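(* Let $\mathbf V$ be a model of GCH and let $\mathbf V[G]$ be the extension obtained by the finite support iteration of length $\omega_2$ of the forcing adding one Cohen real (so $2^{\aleph_0}=\aleph_2$ in $\mathbf V[G]$). Then in $\mathbf V[G]$ there is a family $\mathcal F$ of $\aleph_2$ many UG Banach spaces of density $\aleph_1$ such that there is no family of fewer than $\aleph_2$ Banach spaces of density $\aleph_1$ into whose members every element of $\mathcal F$ isomorphically embeds.
   Context: A Banach space is UG if it admits a uniformly Gâteaux differentiable renorming. An isomorphic embedding is a linear map $T$ with $\frac1c\|x\|\le\|Tx\|\le c\|x\|$ for some $c>0$. The Cohen forcing is the poset of finite partial functions from $\omega$ to $2$ ordered by extension. *)

theory Defs
  imports Complex_Main "HOL-Algebra.Module"
begin

section \<open>Structures for the language of set theory\<close>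

datatype fm = Mem nat nat | Eql nat nat | Neg fm | Conj fm fm | All nat fm

text \<open>
  A structure is a type together with a binary relation; its universe is the whole type.
  Quantifiers over the type are therefore quantifiers over the structure: every definition
  below is the relativization of the usual set-theoretic one, except that statements which
  only speak about the elements of a given set (algebraic laws, inequalities between reals)
  are written with ordinary HOL notions on the extension of that set.
\<close>

locale set_struct =
  fixes mem :: "'v \<Rightarrow> 'v \<Rightarrow> bool" (infix \<open>\<epsilon>\<close> 50)
begin

definition ext :: "'v \<Rightarrow> 'v set" where
  "ext a = {x. x \<epsilon> a}"

text \<open>The element with a given extension. It is only meaningful when there is a unique one,
  as the axioms of ZFC guarantee in all uses below.\<close>

definition coll :: "'v set \<Rightarrow> 'v" where
  "coll S = (THE a. ext a = S)"

definition pair :: "'v \<Rightarrow> 'v \<Rightarrow> 'v" where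
  "pair a b = coll {coll {a}, coll {a, b}}"

definition pfst :: "'v \<Rightarrow> 'v" where
  "pfst z = (THE x. \<exists>y. z = pair x y)"

definition psnd :: "'v \<Rightarrow> 'v" where
  "psnd z = (THE y. \<exists>x. z = pair x y)"

definition empty :: 'v where
  "empty = coll {}"

definition succ :: "'v \<Rightarrow> 'v" where
  "succ a = coll (insert a (ext a))"

definition powset :: "'v \<Rightarrow> 'v" where
  "powset a = coll {b. ext b \<subseteq> ext a}"

definition cprod :: "'v \<Rightarrow> 'v \<Rightarrow> 'v" where
  "cprod a b = coll {pair x y | x y. x \<epsilon> a \<and> y \<epsilon> b}"

definition func_on :: "'v \<Rightarrow> 'v \<Rightarrow> bool" where
  "func_on f a \<longleftrightarrow>
     (\<forall>z. z \<epsilon> f \<longrightarrow> (\<exists>x y. z = pair x y \<and> x \<epsilon> a)) \<and>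
     (\<forall>x. x \<epsilon> a \<longrightarrow> (\<exists>!y. pair x y \<epsilon> f))"

definition app :: "'v \<Rightarrow> 'v \<Rightarrow> 'v" where
  "app f x = (THE y. pair x y \<epsilon> f)"

definition fn :: "'v \<Rightarrow> 'v \<Rightarrow> 'v \<Rightarrow> bool" where
  "fn f a b \<longleftrightarrow> func_on f a \<and> (\<forall>x. x \<epsilon> a \<longrightarrow> app f x \<epsilon> b)"

definition restr :: "'v \<Rightarrow> 'v \<Rightarrow> 'v" where
  "restr f a = coll {z. z \<epsilon> f \<and> (\<exists>x y. z = pair x y \<and> x \<epsilon> a)}"

subsection \<open>ZFC\<close>

fun sat :: "(nat \<Rightarrow> 'v) \<Rightarrow> fm \<Rightarrow> bool" where
  "sat e (Mem i j) \<longleftrightarrow> e i \<epsilon> e j"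
| "sat e (Eql i j) \<longleftrightarrow> e i = e j"
| "sat e (Neg \<phi>) \<longleftrightarrow> \<not> sat e \<phi>"
| "sat e (Conj \<phi> \<psi>) \<longleftrightarrow> sat e \<phi> \<and> sat e \<psi>"
| "sat e (All i \<phi>) \<longleftrightarrow> (\<forall>x. sat (e(i := x)) \<phi>)"

definition extensional :: bool where
  "extensional \<longleftrightarrow> (\<forall>a b. ext a = ext b \<longrightarrow> a = b)"

text \<open>In the two schemes the environment supplies the parameters.\<close>

definition ZFC :: bool where
  "ZFC \<longleftrightarrow>
     extensional \<and>
     (\<forall>a. ext a \<noteq> {} \<longrightarrow> (\<exists>x. x \<epsilon> a \<and> ext x \<inter> ext a = {})) \<and>
     (\<forall>a b. \<exists>c. ext c = {a, b}) \<and>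
     (\<forall>a. \<exists>u. ext u = {x. \<exists>y. x \<epsilon> y \<and> y \<epsilon> a}) \<and>
     (\<forall>a. \<exists>b. ext b = {x. ext x \<subseteq> ext a}) \<and>
     (\<exists>w. empty \<epsilon> w \<and> (\<forall>x. x \<epsilon> w \<longrightarrow> succ x \<epsilon> w)) \<and>
     (\<forall>\<phi> e a. \<exists>b. ext b = {x. x \<epsilon> a \<and> sat (e(0 := x)) \<phi>}) \<and>
     (\<forall>\<phi> e a. (\<forall>x. x \<epsilon> a \<longrightarrow> (\<exists>!y. sat (e(0 := x, 1 := y)) \<phi>)) \<longrightarrow>
        (\<exists>b. ext b = {y. \<exists>x. x \<epsilon> a \<and> sat (e(0 := x, 1 := y)) \<phi>})) \<and>
     (\<forall>a. (\<forall>x. x \<epsilon> a \<longrightarrow> ext x \<noteq> {}) \<and>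
          (\<forall>x y. x \<epsilon> a \<and> y \<epsilon> a \<and> x \<noteq> y \<longrightarrow> ext x \<inter> ext y = {}) \<longrightarrow>
        (\<exists>c. \<forall>x. x \<epsilon> a \<longrightarrow> (\<exists>!z. z \<epsilon> x \<and> z \<epsilon> c)))"

subsection \<open>Ordinals, cardinals, GCH\<close>

definition ordinal :: "'v \<Rightarrow> bool" where
  "ordinal a \<longleftrightarrow> (\<forall>x. x \<epsilon> a \<longrightarrow> ext x \<subseteq> ext a) \<and>
     (\<forall>x y. x \<epsilon> a \<and> y \<epsilon> x \<longrightarrow> ext y \<subseteq> ext x)"

primrec num :: "nat \<Rightarrow> 'v" where
  "num 0 = empty"
| "num (Suc n) = succ (num n)"

text \<open>All structures considered are well-founded, so that their set of natural numbers consists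
  of the standard numerals, and a set is finite in the structure iff its extension is finite.\<close>

definition omega :: 'v where
  "omega = coll (range num)"

definition equinum :: "'v \<Rightarrow> 'v \<Rightarrow> bool" where
  "equinum a b \<longleftrightarrow> (\<exists>f. fn f a b \<and> bij_betw (app f) (ext a) (ext b))"

definition cardinal :: "'v \<Rightarrow> bool" where
  "cardinal k \<longleftrightarrow> ordinal k \<and> (\<forall>a. a \<epsilon> k \<longrightarrow> \<not> equinum a k)"

definition csucc :: "'v \<Rightarrow> 'v" where
  "csucc k = (THE l. cardinal l \<and> k \<epsilon> l \<and>
     (\<forall>m. cardinal m \<and> k \<epsilon> m \<longrightarrow> ext l \<subseteq> ext m))"

definition aleph1 :: 'v where
  "aleph1 = csucc omega"

definition aleph2 :: 'v where
  "aleph2 = csucc aleph1"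

definition GCH :: bool where
  "GCH \<longleftrightarrow> (\<forall>k. cardinal k \<and> ext omega \<subseteq> ext k \<longrightarrow> equinum (powset k) (csucc k))"

subsection \<open>Forcing\<close>

text \<open>
  A poset is given by its extension and its order. The next two definitions are the usual
  forcing relation for atomic formulas, by recursion on names; as the membership relation is
  well-founded, the inductive definition is that recursion. Elements of a set other than pairs
  with second component in the poset are ignored, so every set may serve as a name.
\<close>

inductive forces_eq :: "'v set \<Rightarrow> ('v \<Rightarrow> 'v \<Rightarrow> bool) \<Rightarrow> 'v \<Rightarrow> 'v \<Rightarrow> 'v \<Rightarrow> bool"
  for P :: "'v set" and leP :: "'v \<Rightarrow> 'v \<Rightarrow> bool" where
  "\<lbrakk> p \<in> P;
     \<forall>\<pi> s. \<forall>q\<in>P. pair \<pi> s \<epsilon> \<tau> \<and> s \<in> P \<and> leP q p \<and> leP q s \<longrightarrow>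
       (\<exists>r\<in>P. leP r q \<and> (\<exists>\<rho> t. pair \<rho> t \<epsilon> \<sigma> \<and> t \<in> P \<and> leP r t \<and> forces_eq P leP r \<pi> \<rho>));
     \<forall>\<rho> t. \<forall>q\<in>P. pair \<rho> t \<epsilon> \<sigma> \<and> t \<in> P \<and> leP q p \<and> leP q t \<longrightarrow>
       (\<exists>r\<in>P. leP r q \<and> (\<exists>\<pi> s. pair \<pi> s \<epsilon> \<tau> \<and> s \<in> P \<and> leP r s \<and> forces_eq P leP r \<pi> \<rho>)) \<rbrakk>
   \<Longrightarrow> forces_eq P leP p \<tau> \<sigma>"

definition forces_mem :: "'v set \<Rightarrow> ('v \<Rightarrow> 'v \<Rightarrow> bool) \<Rightarrow> 'v \<Rightarrow> 'v \<Rightarrow> 'v \<Rightarrow> bool" where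
  "forces_mem P leP p \<tau> \<sigma> \<longleftrightarrow> (\<forall>q\<in>P. leP q p \<longrightarrow>
     (\<exists>r\<in>P. leP r q \<and> (\<exists>\<rho> t. pair \<rho> t \<epsilon> \<sigma> \<and> t \<in> P \<and> leP r t \<and> forces_eq P leP r \<tau> \<rho>)))"

definition forces_subset :: "'v set \<Rightarrow> ('v \<Rightarrow> 'v \<Rightarrow> bool) \<Rightarrow> 'v \<Rightarrow> 'v \<Rightarrow> 'v \<Rightarrow> bool" where
  "forces_subset P leP p \<tau> \<sigma> \<longleftrightarrow> (\<forall>\<pi> s. \<forall>q\<in>P. pair \<pi> s \<epsilon> \<tau> \<and> s \<in> P \<and> leP q p \<and> leP q s \<longrightarrow>
     forces_mem P leP q \<pi> \<sigma>)"

text \<open>The canonical name of a set, for a poset with largest element \<open>top1\<close>.\<close>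

definition check :: "'v \<Rightarrow> 'v \<Rightarrow> 'v" where
  "check top1 = wfrec {(y, x). y \<epsilon> x} (\<lambda>f x. coll ((\<lambda>y. pair (f y) top1) ` ext x))"

text \<open>Finite partial functions from \<open>omega\<close> to \<open>2\<close>; the order is reverse inclusion and the largest
  element is the empty function.\<close>

definition cohen :: 'v where
  "cohen = coll {p. \<exists>d. finite (ext d) \<and> ext d \<subseteq> ext omega \<and> fn p d (num 2)}"

text \<open>
  \<open>fs_iteration \<delta> Q P leP\<close>: \<open>P \<alpha>\<close> with the order \<open>leP \<alpha>\<close>, for \<open>\<alpha> \<le> \<delta>\<close>, are the stages of the finite
  support iteration of the posets named by \<open>Q \<xi>\<close>, for \<open>\<xi> < \<delta>\<close>. The iterands are sets ordered
  by reverse inclusion, with the empty set (named by itself) as largest element.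
  Conditions in \<open>P \<alpha>\<close> are functions on \<open>\<alpha>\<close> whose \<open>\<xi>\<close>-th value is a name from the domain of
  \<open>Q \<xi>\<close>. The clauses for zero, successor and limit stages are merged into one.
\<close>

definition fs_iteration ::
  "'v \<Rightarrow> ('v \<Rightarrow> 'v) \<Rightarrow> ('v \<Rightarrow> 'v set) \<Rightarrow> ('v \<Rightarrow> 'v \<Rightarrow> 'v \<Rightarrow> bool) \<Rightarrow> bool" where
  "fs_iteration \<delta> Q P leP \<longleftrightarrow> (\<forall>\<alpha>. \<alpha> = \<delta> \<or> \<alpha> \<epsilon> \<delta> \<longrightarrow>
     P \<alpha> = {p. func_on p \<alpha> \<and> finite {\<xi>. \<xi> \<epsilon> \<alpha> \<and> app p \<xi> \<noteq> empty} \<and>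
       (\<forall>\<xi>. \<xi> \<epsilon> \<alpha> \<longrightarrow> restr p \<xi> \<in> P \<xi> \<and> (\<exists>s. pair (app p \<xi>) s \<epsilon> Q \<xi>) \<and>
          forces_mem (P \<xi>) (leP \<xi>) (restr p \<xi>) (app p \<xi>) (Q \<xi>))} \<and>
     (\<forall>p q. leP \<alpha> p q \<longleftrightarrow> p \<in> P \<alpha> \<and> q \<in> P \<alpha> \<and>
       (\<forall>\<xi>. \<xi> \<epsilon> \<alpha> \<longrightarrow> forces_subset (P \<xi>) (leP \<xi>) (restr p \<xi>) (app q \<xi>) (app p \<xi>))))"

text \<open>The largest element of \<open>P \<xi>\<close>.\<close>

definition iter_one :: "'v \<Rightarrow> 'v" where
  "iter_one \<xi> = cprod \<xi> (coll {empty})"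

text \<open>The Cohen poset is absolute: as defined in any generic extension it is the one of the
  ground model, so its canonical name is a name for the forcing adding one Cohen real.\<close>

definition fs_cohen_iteration ::
  "'v \<Rightarrow> ('v \<Rightarrow> 'v set) \<Rightarrow> ('v \<Rightarrow> 'v \<Rightarrow> 'v \<Rightarrow> bool) \<Rightarrow> bool" where
  "fs_cohen_iteration \<delta> P leP \<longleftrightarrow> fs_iteration \<delta> (\<lambda>\<xi>. check (iter_one \<xi>) cohen) P leP"

definition generic_filter :: "'v set \<Rightarrow> ('v \<Rightarrow> 'v \<Rightarrow> bool) \<Rightarrow> 'v set \<Rightarrow> bool" where
  "generic_filter P leP G \<longleftrightarrow> G \<subseteq> P \<and> G \<noteq> {} \<and>
     (\<forall>p\<in>G. \<forall>q\<in>P. leP p q \<longrightarrow> q \<in> G) \<and>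
     (\<forall>p\<in>G. \<forall>q\<in>G. \<exists>r\<in>G. leP r p \<and> leP r q) \<and>
     (\<forall>d. ext d \<subseteq> P \<and> (\<forall>p\<in>P. \<exists>q\<in>ext d. leP q p) \<longrightarrow> G \<inter> ext d \<noteq> {})"

subsection \<open>Real numbers\<close>

definition rat_code :: "rat \<Rightarrow> 'v" where
  "rat_code q = (case quotient_of q of (a, b) \<Rightarrow>
     pair (pair (num (nat a)) (num (nat (- a)))) (num (nat b)))"

text \<open>The real numbers of the structure are the left Dedekind cuts of rationals that belong to it.
  Through \<open>is_real\<close> they are identified with real numbers of HOL; \<open>Reals_in\<close> is the subfield of
  the real numbers which occur in the structure.\<close>

definition is_real :: "'v \<Rightarrow> real \<Rightarrow> bool" where
  "is_real c r \<longleftrightarrow> ext c = rat_code ` {q. of_rat q < r}"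

definition Reals_in :: "real set" where
  "Reals_in = {r. \<exists>c. is_real c r}"

definition real_code :: "real \<Rightarrow> 'v" where
  "real_code r = (THE c. is_real c r)"

definition real_val :: "'v \<Rightarrow> real" where
  "real_val c = (THE r. is_real c r)"

definition reals :: 'v where
  "reals = coll {c. \<exists>r. is_real c r}"

definition scalars :: "real ring" where
  "scalars = \<lparr>carrier = Reals_in, monoid.mult = (*), one = 1, zero = 0, add = (+)\<rparr>"

subsection \<open>Banach spaces\<close>

text \<open>A normed space is coded by the quadruple of its underlying set, addition, scalar
  multiplication and norm.\<close>

definition points :: "'v \<Rightarrow> 'v" where
  "points X = pfst (pfst X)"

definition plus_of :: "'v \<Rightarrow> 'v" where
  "plus_of X = psnd (pfst X)"

definition scale_of :: "'v \<Rightarrow> 'v" where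
  "scale_of X = pfst (psnd X)"

definition norm_of :: "'v \<Rightarrow> 'v" where
  "norm_of X = psnd (psnd X)"

text \<open>The fields \<open>mult\<close> and \<open>one\<close> play no role in a module.\<close>

definition vec :: "'v \<Rightarrow> (real, 'v) module" where
  "vec X = \<lparr>carrier = ext (points X), monoid.mult = undefined, one = undefined,
     zero = (THE z. z \<epsilon> points X \<and> (\<forall>x. x \<epsilon> points X \<longrightarrow> app (plus_of X) (pair z x) = x)),
     add = (\<lambda>x y. app (plus_of X) (pair x y)),
     smult = (\<lambda>r x. app (scale_of X) (pair (real_code r) x))\<rparr>"

definition nrm :: "'v \<Rightarrow> 'v \<Rightarrow> real" where
  "nrm m x = real_val (app m x)"

definition vector_space :: "'v \<Rightarrow> bool" where
  "vector_space X \<longleftrightarrow>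
     fn (plus_of X) (cprod (points X) (points X)) (points X) \<and>
     fn (scale_of X) (cprod reals (points X)) (points X) \<and>
     module scalars (vec X)"

definition is_norm :: "'v \<Rightarrow> 'v \<Rightarrow> bool" where
  "is_norm X m \<longleftrightarrow> fn m (points X) reals \<and>
     (\<forall>x\<in>carrier (vec X). 0 \<le> nrm m x \<and> (nrm m x = 0 \<longrightarrow> x = \<zero>\<^bsub>vec X\<^esub>)) \<and>
     (\<forall>x\<in>carrier (vec X). \<forall>r\<in>Reals_in. nrm m (r \<odot>\<^bsub>vec X\<^esub> x) = \<bar>r\<bar> * nrm m x) \<and>
     (\<forall>x\<in>carrier (vec X). \<forall>y\<in>carrier (vec X). nrm m (x \<oplus>\<^bsub>vec X\<^esub> y) \<le> nrm m x + nrm m y)"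

definition is_complete :: "'v \<Rightarrow> 'v \<Rightarrow> bool" where
  "is_complete X m \<longleftrightarrow> (\<forall>s. fn s omega (points X) \<and>
     (\<forall>e>0. \<exists>N. \<forall>i\<ge>N. \<forall>j\<ge>N. nrm m (app s (num i) \<ominus>\<^bsub>vec X\<^esub> app s (num j)) < e) \<longrightarrow>
     (\<exists>x\<in>carrier (vec X). \<forall>e>0. \<exists>N. \<forall>i\<ge>N. nrm m (app s (num i) \<ominus>\<^bsub>vec X\<^esub> x) < e))"

definition banach :: "'v \<Rightarrow> bool" where
  "banach X \<longleftrightarrow>
     X = pair (pair (points X) (plus_of X)) (pair (scale_of X) (norm_of X)) \<and>
     vector_space X \<and> is_norm X (norm_of X) \<and> is_complete X (norm_of X)"

definition dense_in :: "'v \<Rightarrow> 'v \<Rightarrow> bool" where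
  "dense_in X d \<longleftrightarrow> ext d \<subseteq> carrier (vec X) \<and>
     (\<forall>x\<in>carrier (vec X). \<forall>e>0. \<exists>y\<in>ext d. nrm (norm_of X) (x \<ominus>\<^bsub>vec X\<^esub> y) < e)"

definition has_density :: "'v \<Rightarrow> 'v \<Rightarrow> bool" where
  "has_density X k \<longleftrightarrow> (\<exists>d. dense_in X d \<and> equinum d k) \<and>
     (\<forall>d l. dense_in X d \<and> l \<epsilon> k \<longrightarrow> \<not> equinum d l)"

text \<open>For every direction the difference quotients converge uniformly on the unit sphere.\<close>

definition uniformly_Gateaux :: "'v \<Rightarrow> 'v \<Rightarrow> bool" where
  "uniformly_Gateaux X m \<longleftrightarrow> (\<forall>h\<in>carrier (vec X). \<exists>D :: 'v \<Rightarrow> real.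
     \<forall>e>0. \<exists>d>0. \<forall>x\<in>carrier (vec X). \<forall>t\<in>Reals_in.
       nrm m x = 1 \<and> 0 < \<bar>t\<bar> \<and> \<bar>t\<bar> < d \<longrightarrow>
       \<bar>(nrm m (x \<oplus>\<^bsub>vec X\<^esub> t \<odot>\<^bsub>vec X\<^esub> h) - nrm m x) / t - D x\<bar> < e)"

definition equivalent_norms :: "'v \<Rightarrow> 'v \<Rightarrow> 'v \<Rightarrow> bool" where
  "equivalent_norms X m n \<longleftrightarrow> (\<exists>c>0. \<forall>x\<in>carrier (vec X).
     1 / c * nrm m x \<le> nrm n x \<and> nrm n x \<le> c * nrm m x)"

definition UG :: "'v \<Rightarrow> bool" where
  "UG X \<longleftrightarrow> (\<exists>m. is_norm X m \<and> equivalent_norms X (norm_of X) m \<and> uniformly_Gateaux X m)"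

definition embeds :: "'v \<Rightarrow> 'v \<Rightarrow> bool" where
  "embeds X Y \<longleftrightarrow> (\<exists>T. fn T (points X) (points Y) \<and>
     (\<forall>x\<in>carrier (vec X). \<forall>y\<in>carrier (vec X).
        app T (x \<oplus>\<^bsub>vec X\<^esub> y) = app T x \<oplus>\<^bsub>vec Y\<^esub> app T y) \<and>
     (\<forall>r\<in>Reals_in. \<forall>x\<in>carrier (vec X). app T (r \<odot>\<^bsub>vec X\<^esub> x) = r \<odot>\<^bsub>vec Y\<^esub> app T x) \<and>
     (\<exists>c>0. \<forall>x\<in>carrier (vec X).
        1 / c * nrm (norm_of X) x \<le> nrm (norm_of Y) (app T x) \<and>
        nrm (norm_of Y) (app T x) \<le> c * nrm (norm_of X) x))"

end

text \<open>
  \<open>generic_extension memV G memW val\<close>: the structure \<open>memW\<close> is V[G], the set of the values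
  \<open>val \<tau> = {val \<sigma> | \<exists>p\<in>G. (\<sigma>, p) \<in> \<tau>}\<close> of all names \<open>\<tau>\<close> in V. Since \<open>memV\<close> is well-founded, the
  recursion determines \<open>memW\<close> up to isomorphism.
\<close>

definition generic_extension ::
  "('v \<Rightarrow> 'v \<Rightarrow> bool) \<Rightarrow> 'v set \<Rightarrow> ('w \<Rightarrow> 'w \<Rightarrow> bool) \<Rightarrow> ('v \<Rightarrow> 'w) \<Rightarrow> bool" where
  "generic_extension memV G memW val \<longleftrightarrow>
     set_struct.extensional memW \<and> surj val \<and>
     (\<forall>\<tau>. set_struct.ext memW (val \<tau>) =
        {val \<sigma> | \<sigma>. \<exists>p\<in>G. memV (set_struct.pair memV \<sigma> p) \<tau>})"

end

theory Submission
  imports Defs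
begin

text \<open>
  To a graph on an index set \<open>I\<close> we attach the norm \<open>N\<close> whose fourth power is the supremum over finite \<open>F \<subseteq> I\<close> of the
  infimum of \<open>\<Sum>i\<in>F. x i ^ 4 / w i\<close>, taken over the positive weights \<open>w\<close> with mass at most one on every clique. It is
  uniformly smooth, hence uniformly Gateaux differentiable, and the sum of \<open>K\<close> unit vectors has norm at least \<open>K\<close> to the
  power 1/2 on a clique and at most \<open>K\<close> to the power 1/4 on an anticlique. The \<open>\<alpha>\<close>-th space has as index set the power
  set of \<open>\<omega>\<close> in the ground model, and two indices are joined iff the \<open>\<alpha>\<close>-th Cohen real is 1 at the least place where they
  differ.

  If fewer than \<open>\<aleph>\<^sub>2\<close> spaces of density \<open>\<aleph>\<^sub>1\<close> sufficed, unboundedly many of the spaces would embed, with the same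
  constant, into a single \<open>Y\<close>. The norms of finite sums from a dense subset of \<open>Y\<close> are decided by conditions which
  use only boundedly many coordinates, so some \<open>\<alpha>\<close> is not among these. Given \<open>K\<close> jointly compatible conditions that decide
  the (approximate) images of \<open>K\<close> indices, the \<open>\<alpha>\<close>-th real can still be chosen to be 1, or 0, at all places where
  these indices split: the tuple becomes a clique or an anticlique, while the norm of the sum of the images stays the same.

  Instead of the countable chain condition and the Delta-system lemma we use that among infinitely many conditions of bounded size there are
  arbitrarily many jointly compatible ones. In the extension only the axioms of Zermelo set theory are needed.
  \<close>

abbreviation (input) iff_ascii (infixr \<open><->\<close> 25) where "A <-> B \<equiv> (A :: bool) = B"

section \<open>Definability\<close>

primrec fm_vars :: "fm => nat set" where
  "fm_vars (Mem i j) = {i, j}"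
  | "fm_vars (Eql i j) = {i, j}"
  | "fm_vars (Neg ph) = fm_vars ph"
  | "fm_vars (Conj ph ps) = fm_vars ph \<union> fm_vars ps"
  | "fm_vars (All i ph) = insert i (fm_vars ph)"

lemma finite_fm_vars: "finite (fm_vars ph)"
  by (induction ph) auto

primrec rename_fm :: "fm => (nat => nat) => fm" where
  "rename_fm (Mem i j) f = Mem (f i) (f j)"
  | "rename_fm (Eql i j) f = Eql (f i) (f j)"
  | "rename_fm (Neg ph) f = Neg (rename_fm ph f)"
  | "rename_fm (Conj ph ps) f = Conj (rename_fm ph f) (rename_fm ps f)"
  | "rename_fm (All i ph) f = (let k = Suc (Max (insert 0 (f ` fm_vars ph))) in All k (rename_fm ph (f(i := k))))"

definition mix :: "(nat => 'v) => (nat => 'v) => nat => 'v" where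
  "mix e p = (%n. if even n then e (n div 2) else p (n div 2))"

lemma mix_simps [simp]: "mix e p (2 * n) = e n" "mix e p (Suc (2 * n)) = p n"
  by (auto simp: mix_def)

lemma range_mix: "range (mix e p) = range e \<union> range p"
proof -
  have "e n \<in> range (mix e p)" "p n \<in> range (mix e p)" for n
    by (metis mix_simps rangeI)+
  thus ?thesis by (auto simp: mix_def)
qed

named_theorems dpi

context set_struct
begin

lemma sat_cong: "(\<And>i. i \<in> fm_vars ph ==> e i = e' i) ==> sat e ph = sat e' ph"
proof (induction ph arbitrary: e e')
  case (All i ph)
  have "sat (e(i := x)) ph = sat (e'(i := x)) ph" for x
    by (rule All.IH) (use All.prems in auto)
  thus ?case by simp
next
  case (Conj ph ps)
  thus ?case by (metis UnCI sat.simps(4) fm_vars.simps(4))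
next
  case (Neg ph)
  thus ?case by (metis sat.simps(3) fm_vars.simps(3))
qed auto

lemma sat_rename_fm: "sat e (rename_fm ph f) = sat (%i. e (f i)) ph"
proof (induction ph arbitrary: e f)
  case (All i ph)
  define k where "k = Suc (Max (insert 0 (f ` fm_vars ph)))"
  have fresh: "f j \<noteq> k" if "j \<in> fm_vars ph" for j
  proof -
    have "f j <= Max (insert 0 (f ` fm_vars ph))" using that finite_fm_vars by (intro Max_ge) auto
    thus ?thesis by (simp add: k_def)
  qed
  have "sat (e(k := x)) (rename_fm ph (f(i := k))) = sat ((%i. e (f i))(i := x)) ph" for x
    unfolding All.IH by (rule sat_cong) (auto simp: fresh)
  thus ?case by (simp add: k_def[symmetric] Let_def)
qed auto

text \<open>\<open>dp C R\<close>: the predicate \<open>R\<close> on environments is definable with parameters from \<open>C\<close>.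
  Even variables of the defining formula hold the environment, odd ones the parameters.
  \<open>dt C t\<close>: the graph of \<open>t\<close> is definable. Environments are extended de Bruijn style.\<close>

definition dp :: "'v set => ((nat => 'v) => bool) => bool" where
  "dp C R <-> (\<exists>ph p. range p <= insert empty C & (\<forall>e. R e = sat (mix e p) ph))"

lemma dpI: "range p <= insert empty C ==> (\<And>e. R e = sat (mix e p) ph) ==> dp C R"
  unfolding dp_def by auto

lemma dpE:
  assumes "dp C R"
  obtains ph p where "range p <= insert empty C" "\<And>e. R e = sat (mix e p) ph"
  using assms unfolding dp_def by auto

definition dt :: "'v set => ((nat => 'v) => 'v) => bool" where
  "dt C t <-> dp C (%e. e 0 = t (%n. e (Suc n)))"

lemma dp_reindex:
  assumes "dp C R"
  shows "dp C (%e. R (%n. e (f n)))"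
proof -
  obtain ph p where p: "range p <= insert empty C" and ph: "\<And>e. R e = sat (mix e p) ph"
    using assms by (rule dpE) blast
  define g where "g n = (if even n then 2 * f (n div 2) else n)" for n
  have "(%i. mix e p (g i)) = mix (%n. e (f n)) p" for e
    by (auto simp: fun_eq_iff g_def mix_def)
  hence "R (%n. e (f n)) = sat (mix e p) (rename_fm ph g)" for e
    by (simp add: ph sat_rename_fm)
  thus ?thesis by (rule dpI[OF p])
qed

lemma dp_var_mem: "dp C (%e. e i \<epsilon> e j)"
  by (rule dpI[of "%_. empty" _ _ "Mem (2*i) (2*j)"]) auto

lemma dp_var_eq: "dp C (%e. e i = e j)"
  by (rule dpI[of "%_. empty" _ _ "Eql (2*i) (2*j)"]) auto

lemma dp_const_eq: "c \<in> C ==> dp C (%e. e i = c)"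
  by (rule dpI[of "%_. c" _ _ "Eql (2*i) 1"]) (auto simp: mix_def)

lemma dp_not [dpi]: "dp C R ==> dp C (%e. \<not> R e)"
  unfolding dp_def by (elim exE conjE, rule_tac x = "Neg ph" in exI) auto

lemma dp_conj [dpi]:
  assumes "dp C R" "dp C S"
  shows "dp C (%e. R e & S e)"
proof -
  obtain ph p where p: "range p <= insert empty C" and ph: "\<And>e. R e = sat (mix e p) ph"
    using assms(1) by (rule dpE) blast
  obtain ps q where q: "range q <= insert empty C" and ps: "\<And>e. S e = sat (mix e q) ps"
    using assms(2) by (rule dpE) blast
  define place where "place b n = (if even n then n else Suc (2 * (2 * (n div 2) + of_bool b)))" for b and n :: nat
  have place: "(%i. mix e (mix p q) (place b i)) = mix e (if b then q else p)" for e b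
    by (auto simp: mix_def place_def fun_eq_iff elim!: oddE)
  have "(R e & S e) = sat (mix e (mix p q)) (Conj (rename_fm ph (place False)) (rename_fm ps (place True)))" for e
    by (simp add: ph ps sat_rename_fm place)
  moreover have "range (mix p q) <= insert empty C" using p q by (simp add: range_mix)
  ultimately show ?thesis by (intro dpI)
qed

lemma dp_all [dpi]:
  assumes "dp C (%e. R (e 0) (%n. e (Suc n)))"
  shows "dp C (%e. \<forall>x. R x e)"
proof -
  obtain ph p where p: "range p <= insert empty C" and ph: "\<And>e. R (e 0) (%n. e (Suc n)) = sat (mix e p) ph"
    using assms by (rule dpE) blast
  define q where "q = case_nat empty p"
  define f where "f n = (if n = 0 then 1 else if even n then n - 2 else n + 2)" for n :: nat
  have f: "(%i. ((mix e q)(Suc 0 := x)) (f i)) = mix (case_nat x e) p" for e x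
  proof
    fix i
    consider (zero) "i = 0" | (even) j where "i = 2 * Suc j" | (odd) j where "i = Suc (2 * j)"
      by (metis evenE oddE Suc_eq_plus1 mult_0_right not0_implies_Suc)
    thus "((mix e q)(Suc 0 := x)) (f i) = mix (case_nat x e) p i"
      by cases (auto simp: f_def mix_def q_def)
  qed
  have "(\<forall>x. R x e) = sat (mix e q) (All (Suc 0) (rename_fm ph f))" for e
    using ph[of "case_nat _ e"] by (simp add: sat_rename_fm f del: fun_upd_apply)
  moreover have "range q <= insert empty C" using p by (auto simp: q_def image_subset_iff split: nat.splits)
  ultimately show ?thesis by (intro dpI)
qed

lemma dp_disj [dpi]: "dp C R ==> dp C S ==> dp C (%e. R e \<or> S e)"
  using dp_not[OF dp_conj[OF dp_not dp_not], of C R S] by simp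
lemma dp_imp [dpi]: "dp C R ==> dp C S ==> dp C (%e. R e --> S e)"
  unfolding imp_conv_disj by (intro dp_disj dp_not)
lemma dp_iff [dpi]: "dp C R ==> dp C S ==> dp C (%e. R e <-> S e)"
  unfolding iff_conv_conj_imp by (intro dp_conj dp_imp)
lemma dp_ex [dpi]: "dp C (%e. R (e 0) (%n. e (Suc n))) ==> dp C (%e. \<exists>x. R x e)"
  using dp_not[OF dp_all[OF dp_not], of C R] unfolding not_all not_not .
lemma dp_True: "dp C (%e. True)" using dp_var_eq[of C 0 0]
  by simp
lemma dp_const [dpi]: "dp C (%e. b)" using dp_True dp_not[OF dp_True]
  by (cases b) simp_all

lemma dt_var [dpi]: "dt C (%e. e i)" unfolding dt_def
  by (rule dp_var_eq)
lemma dt_const: "c \<in> C ==> dt C (%e. c)" unfolding dt_def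
  by (rule dp_const_eq)
lemma dt_const_UNIV [dpi]: "dt UNIV (%e. c)" by (rule dt_const) simp

lemma dt_reindex: "dt C t ==> dt C (%e. t (%n. e (f n)))"
  unfolding dt_def by (drule dp_reindex[where f = "case_nat 0 (%n. Suc (f n))"]) simp

lemma dp_subst:
  assumes "dp C (%e. R (e 0) (%n. e (Suc n)))" "dt C t"
  shows "dp C (%e. R (t e) e)"
proof -
  have "dp C (%e. \<exists>x. x = t e & R x e)"
    by (rule dp_ex) (rule dp_conj[OF assms(2)[unfolded dt_def] assms(1)])
  thus ?thesis by simp
qed

lemma dp_upd:
  assumes "dp C S" "dt C t"
  shows "dp C (%e. S (e(k := t e)))"
proof (rule dp_subst[where R = "%x e. S (e(k := x))", OF _ assms(2)])
  show "dp C (%e. S ((%n. e (Suc n))(k := e 0)))"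
    using dp_reindex[OF assms(1), of "%n. if n = k then 0 else Suc n"] by (simp add: fun_upd_def if_distrib)
qed

text \<open>The environment is replaced one variable at a time; the old one is kept beyond the variables of the formula.\<close>

lemma dp_env:
  assumes "dp C R" "\<And>n. dt C (ts n)"
  shows "dp C (%e. R (%n. ts n e))"
proof -
  obtain ph p where ph: "\<And>e. R e = sat (mix e p) ph" using assms(1) by (rule dpE) blast
  obtain N where N: "\<And>i. i \<in> fm_vars ph ==> i < N" using finite_fm_vars[of ph] finite_nat_set_iff_bounded
    by auto
  have "dp C (%e. R (%n. if n < k then ts n (%m. e (m + N)) else e n))" if "k <= N" for k
    using that
  proof (induction k)
    case (Suc k)
    let ?upd = "%e. e(k := ts k (%m. e (m + N)))"
    have "dp C (%e. R (%n. if n < k then ts n (%m. ?upd e (m + N)) else ?upd e n))"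
      by (rule dp_upd[OF Suc.IH dt_reindex[OF assms(2)]]) (use Suc in simp)
    moreover have "(%m. ?upd e (m + N)) = (%m. e (m + N))" for e :: "nat => 'v" using Suc by auto
    hence "(%n. if n < k then ts n (%m. ?upd e (m + N)) else ?upd e n)
        = (%n. if n < Suc k then ts n (%m. e (m + N)) else e n)" for e :: "nat => 'v"
      by (auto simp: less_Suc_eq)
    ultimately show ?case by simp
  qed (use assms(1) in simp)
  from dp_reindex[OF this[OF order_refl], of "%n. n - N"]
  have "dp C (%e. R (%n. if n < N then ts n e else e (n - N)))" unfolding add_diff_cancel_right' .
  moreover have "R (%n. if n < N then ts n e else e (n - N)) = R (%n. ts n e)" for e
    unfolding ph by (rule sat_cong)
    (auto simp: mix_def dest: N intro!: less_le_trans[OF div_le_dividend[THEN le_less_trans] order_refl])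
  ultimately show ?thesis by simp
qed

lemma dp_lift1: "dp C (%e. Q (e 0)) ==> dt C t ==> dp C (%e. Q (t e))"
  by (rule dp_subst)

lemma dp_lift2: "dp C (%e. Q (e 0) (e 1)) ==> dt C t ==> dt C u ==> dp C (%e. Q (t e) (u e))"
  using dp_env[of C "%e. Q (e 0) (e 1)" "case_nat t (%_. u)"] by (simp split: nat.split)

lemma dp_lift3: "dp C (%e. Q (e 0) (e 1) (e 2)) ==> dt C t ==> dt C u ==> dt C v ==> dp C (%e. Q (t e) (u e) (v e))"
  using dp_env[of C "%e. Q (e 0) (e 1) (e 2)" "case_nat t (case_nat u (%_. v))"]
  by (simp add: numeral_2_eq_2 split: nat.split)

lemma dp_lift4: "dp C (%e. Q (e 0) (e 1) (e 2) (e 3)) ==> dt C t ==> dt C u ==> dt C v ==> dt C w ==>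
  dp C (%e. Q (t e) (u e) (v e) (w e))"
  using dp_env[of C "%e. Q (e 0) (e 1) (e 2) (e 3)" "case_nat t (case_nat u (case_nat v (%_. w)))"]
  by (simp add: eval_nat_numeral split: nat.split)

lemma dt_lift1: "dp C (%e. e 0 = F (e 1)) ==> dt C t ==> dt C (%e. F (t e))"
  unfolding dt_def[of C "%e. F (t e)"]
  by (rule dp_lift2[where Q = "%x y. x = F y"], assumption, rule dt_var, erule dt_reindex)
lemma dt_lift2: "dp C (%e. e 0 = F (e 1) (e 2)) ==> dt C t ==> dt C u ==> dt C (%e. F (t e) (u e))"
  unfolding dt_def[of C "%e. F (t e) (u e)"]
  by (rule dp_lift3[where Q = "%x y z. x = F y z"], assumption, rule dt_var; erule dt_reindex)
lemma dp_mem [dpi]: "dt C t ==> dt C u ==> dp C (%e. t e \<epsilon> u e)"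
  by (rule dp_lift2[where Q = "(\<epsilon>)", OF dp_var_mem])
lemma dp_eq [dpi]: "dt C t ==> dt C u ==> dp C (%e. t e = u e)"
  by (rule dp_lift2[where Q = "(=)", OF dp_var_eq])
lemma dp_ex1 [dpi]:
  assumes "dp C (%e. R (e 0) (%n. e (Suc n)))"
  shows "dp C (%e. \<exists>!x. R x e)"
proof -
  have "dp C (%e. R (e 0) (%n. e (Suc (Suc n))))" using dp_reindex[OF assms, of "case_nat 0 (%n. Suc (Suc n))"] by simp
  thus ?thesis unfolding Ex1_def by (intro dpi assms)
qed

lemma dt_if [dpi]:
  assumes "dp C R" "dt C t" "dt C u"
  shows "dt C (%e. if R e then t e else u e)"
proof -
  have "dp C (%e. (R (%n. e (Suc n)) & e 0 = t (%n. e (Suc n))) \<or>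
      (\<not> R (%n. e (Suc n)) & e 0 = u (%n. e (Suc n))))"
    by (intro dpi dp_reindex[OF assms(1)] dt_reindex[OF assms(2)] dt_reindex[OF assms(3)])
  thus ?thesis unfolding dt_def by (rule back_subst[where P = "dp C"]) auto
qed

end

section \<open>Zermelo set theory in a well-founded structure\<close>

context set_struct
begin

definition is_set :: "'v set => bool" where "is_set S <-> (\<exists>a. ext a = S)"

definition lam :: "'v => ('v => 'v) => 'v" where "lam a f = coll ((%x. pair x (f x)) ` ext a)"

definition bigunion :: "'v => 'v" where "bigunion a = coll {x. \<exists>y. x \<epsilon> y & y \<epsilon> a}"

text \<open>Unlike \<open>app\<close>, this application is definable everywhere.\<close>

definition ap :: "'v => 'v => 'v" where "ap f x = (if \<exists>!y. pair x y \<epsilon> f then app f x else empty)"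

lemma mem_ext [simp]: "x \<in> ext a <-> x \<epsilon> a" by (simp add: ext_def)

end

locale zermelo = set_struct mem for mem :: "'v => 'v => bool" (infix \<open><:\<close> 50) +
  assumes wf: "wfp mem"
  and ext_inj: "ext a = ext b ==> a = b"
  and pairing: "\<exists>c. ext c = {a, b}"
  and union: "\<exists>u. ext u = {x. \<exists>y. x <: y & y <: a}"
  and power: "\<exists>b. ext b = {x. ext x <= ext a}"
  and infinity: "\<exists>w. empty <: w & (\<forall>x. x <: w --> succ x <: w)"
  and sep0: "\<exists>b. ext b = {x. x <: a & sat (e(0 := x)) ph}"
begin

lemma mem_induct [case_names step]:
  assumes "\<And>x. (\<And>y. y <: x ==> P y) ==> P x"
  shows "P x"
  by (rule wfp_induct_rule[OF wf]) (rule assms)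

lemma mem_irrefl: "\<not> x <: x"
proof (induction x rule: mem_induct)
  case (step x) thus ?case by auto
qed

lemma mem_asym: "x <: y ==> \<not> y <: x"
proof (induction x arbitrary: y rule: mem_induct)
  case (step x) thus ?case by auto
qed

lemma coll_eq: "ext a = S ==> coll S = a" unfolding coll_def
  by (rule the_equality) (simp_all add: ext_inj)
lemma coll_ext [simp]: "coll (ext a) = a" by (rule coll_eq) simp
lemma ext_coll: "is_set S ==> ext (coll S) = S" unfolding is_set_def
  by (auto simp: coll_eq)
lemma mem_coll: "is_set S ==> x <: coll S <-> x \<in> S" using ext_coll mem_ext
  by blast
lemma eq_coll: "is_set S ==> a = coll S <-> (\<forall>x. x <: a <-> x \<in> S)"
  by (metis coll_eq ext_coll mem_ext subset_antisym subsetI)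
lemma set_eqI: "(\<And>x. x <: a <-> x <: b) ==> a = b" by (rule ext_inj) auto

lemma is_set_ext [simp]: "is_set (ext a)" by (auto simp: is_set_def)
lemma sep:
  assumes "dp UNIV (%e. Q (e 0))"
  shows "is_set {x. x <: a & Q x}"
proof -
  obtain ph p where ph: "\<And>e. Q (e 0) = sat (mix e p) ph" using assms by (rule dpE) blast
  have "(mix (%_. undefined) p)(0 := x) = mix ((%_. undefined)(0 := x)) p" for x
    by (auto simp: mix_def fun_eq_iff)
  hence "sat ((mix (%_. undefined) p)(0 := x)) ph = Q x" for x
    using ph[of "(%_. undefined)(0 := x)"] by simp
  thus ?thesis using sep0[of a "mix (%_. undefined) p" ph] unfolding is_set_def by simp
qed

lemma sepE:
  assumes "\<And>b. (\<And>x. x <: b <-> x <: a & Q x) ==> thesis" "dp UNIV (%e. Q (e 0))"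
  shows thesis
  using assms(1)[of "coll {x. x <: a & Q x}"] mem_coll[OF sep[OF assms(2)]] by blast

lemma is_set_sub:
  assumes "is_set T" "S <= T" "dp UNIV (%e. e 0 \<in> S)"
  shows "is_set S"
proof -
  obtain a where "ext a = T" using assms by (auto simp: is_set_def)
  hence "S = {x. x <: a & x \<in> S}" using assms(2) by auto
  thus ?thesis using sep[where Q = "%x. x \<in> S", OF assms(3)] by metis
qed

lemma is_set_upair: "is_set {a, b}" unfolding is_set_def
  by (rule pairing)
lemma is_set_Un:
  assumes "is_set S" "is_set T"
  shows "is_set (S \<union> T)"
proof -
  obtain a b c u where "ext a = S" "ext b = T" "ext c = {a, b}" "ext u = {x. \<exists>y. x <: y & y <: c}"
    using assms pairing union unfolding is_set_def by metis
  hence "ext u = S \<union> T" by (auto simp: set_eq_iff)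
  thus ?thesis by (auto simp: is_set_def)
qed

lemma is_set_insert: "is_set S ==> is_set (insert a S)" using is_set_Un[OF is_set_upair[of a a]]
  by simp
lemma is_set_empty: "is_set {}" using sep[where Q = "%x. False", OF dp_const]
  by simp

lemma is_set_finite: "finite S ==> is_set S"
  by (induction S rule: finite_induct) (auto intro: is_set_empty is_set_insert)
lemma is_set_UN: "is_set {x. \<exists>y. x <: y & y <: a}" unfolding is_set_def
  by (rule union)
lemma is_set_Pow: "is_set {x. ext x <= ext a}" unfolding is_set_def
  by (rule power)
lemma finite_subset_is_set: "finite S ==> \<exists>a. ext a = S" using is_set_finite
  by (auto simp: is_set_def)

lemma mem_bigunion [simp]: "x <: bigunion a <-> (\<exists>y. x <: y & y <: a)"
  unfolding bigunion_def by (simp add: mem_coll is_set_UN)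

lemma mem_powset [simp]: "x <: powset a <-> ext x <= ext a"
  unfolding powset_def by (simp add: mem_coll is_set_Pow)
lemma mem_empty [simp]: "\<not> x <: empty" unfolding empty_def
  by (simp add: mem_coll is_set_empty)
lemma ext_empty [simp]: "ext empty = {}" by auto
lemma ext_eq_empty: "ext a = {} <-> a = empty" by (metis ext_empty ext_inj)
lemma ext_succ: "ext (succ a) = insert a (ext a)"
  unfolding succ_def by (simp add: ext_coll is_set_insert)
lemma mem_succ [simp]: "x <: succ a <-> x = a \<or> x <: a" using ext_succ mem_ext
  by blast
lemma succ_inject [simp]: "succ a = succ b <-> a = b" by (metis mem_asym mem_succ)
lemma succ_ne_empty [simp]: "succ a \<noteq> empty" "empty \<noteq> succ a" by (metis mem_empty mem_succ)+
lemma mem_coll_upair: "x <: coll {a, b} <-> x = a \<or> x = b" by (simp add: mem_coll is_set_upair)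
lemma mem_coll_sing: "x <: coll {a} <-> x = a" using mem_coll_upair[of x a a]
  by simp
lemma ext_pair: "ext (pair a b) = {coll {a}, coll {a, b}}" unfolding pair_def
  by (simp add: ext_coll is_set_upair)

lemma pair_inject [simp]: "pair a b = pair c d <-> a = c & b = d"
proof
  have upair_eq: "coll {x, y} = coll {z, w} <-> (x = z & y = w) \<or> (x = w & y = z)" for x y z w
    by (smt (verit) insert_commute mem_coll_upair)
  have sing_eq: "coll {x} = coll {z, w} <-> x = z & x = w" for x z w using upair_eq[of x x z w] by auto
  assume "pair a b = pair c d"
  hence eq: "{coll {a}, coll {a, b}} = {coll {c}, coll {c, d}}" by (metis ext_pair)
  hence "a = c" using sing_eq[of _ c c] sing_eq[of c] by (metis doubleton_eq_iff insert_absorb2)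
  thus "a = c & b = d" using eq upair_eq sing_eq by (metis doubleton_eq_iff)
qed auto

lemma pfst_pair [simp]: "pfst (pair a b) = a" unfolding pfst_def
  by auto
lemma psnd_pair [simp]: "psnd (pair a b) = b" unfolding psnd_def
  by auto

lemma dt_fun1: "dt C (%e. f (e 0)) ==> dt C t ==> dt C (%e. f (t e))"
  by (rule dt_lift1[where F = f]) (simp_all add: dt_def)
lemma dt_fun2: "dt C (%e. f (e 0) (e 1)) ==> dt C t ==> dt C u ==> dt C (%e. f (t e) (u e))"
  by (rule dt_lift2[where F = f]) (simp_all add: dt_def numeral_2_eq_2)

lemma dt_coll:
  assumes "\<And>e. is_set {x. R x e}" "dp C (%e. R (e 0) (%n. e (Suc n)))"
  shows "dt C (%e. coll {x. R x e})"
proof -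
  have "dp C (%e. \<forall>x. x <: e 0 <-> R x (%n. e (Suc n)))"
    by (intro dp_all dp_iff dp_mem dt_var)
    (use dp_reindex[OF assms(2), of "case_nat 0 (%n. Suc (Suc n))"] in simp)
  thus ?thesis unfolding dt_def eq_coll[OF assms(1)] by simp
qed

lemma dt_empty [dpi]: "dt C (%e. empty)"
  using dt_coll[of "%x e. False" C] is_set_empty dp_const unfolding empty_def by simp

lemma dt_sing [dpi]: "dt C t ==> dt C (%e. coll {t e})"
  by (rule dt_lift1[where F = "%x. coll {x}"]) (use dt_coll[of "%x e. x = e 0" C] is_set_finite in
  \<open>simp_all add: dt_def dp_var_eq\<close>)
lemma dt_upair [dpi]: "dt C t ==> dt C u ==> dt C (%e. coll {t e, u e})"
proof (rule dt_lift2[where F = "%x y. coll {x, y}"])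
  have "dt C (%e. coll {x. x = e 0 \<or> x = e 1})"
    by (rule dt_coll) (intro is_set_finite, simp, intro dpi)
  moreover have "{x. x = a \<or> x = b} = {a, b}" for a b :: 'v by auto
  ultimately show "dp C (%e. e 0 = coll {e 1, e 2})" by (simp add: dt_def numeral_2_eq_2)
qed

lemma dt_pair [dpi]: "dt C t ==> dt C u ==> dt C (%e. pair (t e) (u e))"
  unfolding pair_def by (intro dpi)
lemma dp_subset [dpi]: "dt C t ==> dt C u ==> dp C (%e. ext (t e) <= ext (u e))"
  by (rule dp_lift2[where Q = "%x y. ext x <= ext y"]) (simp only: subset_iff mem_ext, intro dpi)
lemma dt_coll_lift1:
  assumes "\<And>a. is_set {x. R x a}" "dp C (%e. R (e 0) (e 1))" "dt C t"
  shows "dt C (%e. coll {x. R x (t e)})"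
  by (rule dt_lift1[where F = "%a. coll {x. R x a}", OF _ assms(3)])
  (use dt_coll[of "%x e. R x (e 0)" C] assms in \<open>simp add: dt_def\<close>)
lemma dt_bigunion [dpi]: "dt C t ==> dt C (%e. bigunion (t e))"
  unfolding bigunion_def by (rule dt_coll_lift1) (rule is_set_UN, (intro dpi)+)

lemma dt_powset [dpi]: "dt C t ==> dt C (%e. powset (t e))"
  unfolding powset_def by (rule dt_coll_lift1) (rule is_set_Pow, (intro dpi)+)
lemma dt_succ [dpi]: "dt C t ==> dt C (%e. succ (t e))"
proof -
  have "succ a = coll {x. x = a \<or> x <: a}" for a
    unfolding succ_def by (rule arg_cong[where f = coll]) auto
  moreover have "is_set {x. x = a \<or> x <: a}" for a using is_set_ext[of "succ a"] unfolding ext_def by simp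
  moreover assume "dt C t"
  ultimately show ?thesis by (simp only:) (rule dt_coll_lift1, assumption, intro dpi)
qed

lemma mem_bigunion_upair: "x <: bigunion (coll {a, b}) <-> x <: a \<or> x <: b" by (auto simp: mem_coll_upair)

lemma is_set_prod: "is_set {pair x y | x y. x <: a & y <: b}"
proof (rule is_set_sub[OF is_set_ext[of "powset (powset (bigunion (coll {a, b})))"]])
  show "{pair x y | x y. x <: a & y <: b} <= ext (powset (powset (bigunion (coll {a, b}))))"
    using mem_bigunion_upair by (auto simp: ext_pair mem_coll_upair mem_coll_sing)
  show "dp UNIV (%e. e 0 \<in> {pair x y | x y. x <: a & y <: b})"
    by (simp only: mem_Collect_eq) (intro dpi)
qed

lemma mem_cprod: "z <: cprod a b <-> (\<exists>x y. z = pair x y & x <: a & y <: b)"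
  unfolding cprod_def by (auto simp: mem_coll is_set_prod)
lemma pair_mem_cprod [simp]: "pair x y <: cprod a b <-> x <: a & y <: b" by (auto simp: mem_cprod)
lemma dt_cprod [dpi]: "dt C t ==> dt C u ==> dt C (%e. cprod (t e) (u e))"
  by (rule dt_lift2[where F = cprod])
  (simp_all only: eq_coll[OF is_set_prod] cprod_def mem_Collect_eq, intro dpi)

subsection \<open>Functions\<close>

lemma ap_eq: "func_on f a ==> x <: a ==> ap f x = app f x" by (simp add: ap_def func_on_def)
lemma func_app:
  assumes "func_on f a" "x <: a"
  shows "pair x y <: f <-> y = app f x"
proof -
  have u: "\<exists>!y. pair x y <: f" using assms by (simp add: func_on_def)
  show ?thesis unfolding app_def using theI'[OF u] the1_equality[OF u] by metis
qed

lemma func_ap: "func_on f a ==> x <: a ==> pair x y <: f <-> y = ap f x"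
  using func_app ap_eq by simp

lemma ap_graph: "y = ap f x <-> (if \<exists>!y. pair x y <: f then pair x y <: f else y = empty)"
proof (cases "\<exists>!y. pair x y <: f")
  case True
  hence "pair x (ap f x) <: f" using theI'[OF True] by (simp add: ap_def app_def)
  thus ?thesis using True by metis
qed (simp add: ap_def)
lemma dt_ap [dpi]: "dt C t ==> dt C u ==> dt C (%e. ap (t e) (u e))"
  by (rule dt_lift2[where F = ap], unfold ap_graph if_bool_eq_conj, intro dpi)

lemma dp_func_on [dpi]: "dt C t ==> dt C u ==> dp C (%e. func_on (t e) (u e))"
  by (rule dp_lift2[where Q = func_on]) (unfold func_on_def, intro dpi)
lemma fn_ap: "fn f a b <-> func_on f a & (\<forall>x. x <: a --> ap f x <: b)"
  unfolding fn_def using ap_eq by auto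
lemma dp_fn [dpi]: "dt C t ==> dt C u ==> dt C v ==> dp C (%e. fn (t e) (u e) (v e))"
  by (rule dp_lift3[where Q = fn]) (unfold fn_ap, intro dpi)

lemma is_set_lam:
  assumes "dt UNIV (%e. f (e 0))" "\<And>x. x <: a ==> f x <: b"
  shows "is_set ((%x. pair x (f x)) ` ext a)"
proof (rule is_set_sub[OF is_set_ext[of "cprod a b"]])
  show "(%x. pair x (f x)) ` ext a <= ext (cprod a b)" using assms by auto
  have "e 0 \<in> (%x. pair x (f x)) ` ext a <-> (\<exists>x. x <: a & e 0 = pair x (f x))" for e :: "nat => 'v" by auto
  thus "dp UNIV (%e. e 0 \<in> (%x. pair x (f x)) ` ext a)"
    by (simp only:) (intro dpi dt_fun1[OF assms(1)])
qed

lemma func_lam: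
  assumes "is_set ((%x. pair x (f x)) ` ext a)"
  shows "func_on (lam a f) a" "x <: a ==> ap (lam a f) x = f x"
proof -
  have lam: "z <: lam a f <-> (\<exists>x. x <: a & z = pair x (f x))" for z
    unfolding lam_def using mem_coll[OF assms] by auto
  thus "func_on (lam a f) a" unfolding func_on_def by auto
  thus "x <: a ==> ap (lam a f) x = f x" using func_ap[of "lam a f" a x "f x"] lam by auto
qed

lemmas lam_fn = func_lam[OF is_set_lam]

lemma fn_lam: "dt UNIV (%e. f (e 0)) ==> (\<And>x. x <: a ==> f x <: b) ==> fn (lam a f) a b"
  unfolding fn_ap using lam_fn[of f a b] by simp

lemma func_eqI:
  assumes "func_on f a" "func_on g a" "\<And>x. x <: a ==> ap f x = ap g x"
  shows "f = g"
proof (rule set_eqI)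
  fix z show "z <: f <-> z <: g"
    using assms(1, 2)[unfolded func_on_def] func_ap[OF assms(1)] func_ap[OF assms(2)] assms(3) by metis
qed

lemma fn_eqI: "fn f a b ==> fn g a c ==> (\<And>x. x <: a ==> ap f x = ap g x) ==> f = g"
  unfolding fn_ap by (rule func_eqI[of f a g]) auto

lemma fn_finite:
  assumes "finite (ext a)" "\<And>x. x <: a ==> f x <: b"
  shows "fn (lam a f) a b"
  "x <: a ==> ap (lam a f) x = f x"
  using func_lam[OF is_set_finite[of "(%x. pair x (f x)) ` ext a"]] assms by (auto simp: fn_ap)

lemma fn_mem_pow:
  assumes "fn f a b"
  shows "f <: powset (cprod a b)"
proof -
  have "z <: cprod a b" if "z <: f" for z
    using that assms func_ap[of f a] unfolding fn_ap func_on_def by (metis pair_mem_cprod)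
  thus ?thesis by auto
qed

subsection \<open>Natural numbers\<close>

lemma ext_num: "ext (num n) = num ` {..<n}"
  by (induction n) (auto simp: ext_succ lessThan_Suc)
lemma num_mem: "num m <: num n <-> m < n"
proof
  show "m < n ==> num m <: num n" using ext_num[of n] mem_ext by blast
  assume a: "num m <: num n"
  then obtain k where k: "k < n" "num m = num k" using ext_num[of n] mem_ext by blast
  have "\<not> num i <: num i" for i using mem_irrefl by blast
  moreover have "num i <: num j" if "i < j" for i j using that ext_num[of j] mem_ext by blast
  ultimately have "m = k" using k(2) by (metis linorder_neqE_nat)
  thus "m < n" using k by simp
qed

lemma mem_num: "x <: num n <-> (\<exists>k<n. x = num k)" using ext_num[of n]
  by (auto simp flip: mem_ext)
lemma num_inj [simp]: "num m = num n <-> m = n" by (metis linorder_neqE_nat mem_irrefl num_mem)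
lemma inj_num: "inj num" by (simp add: inj_def)
lemma dt_num [dpi]: "dt C (%e. num n)" by (induction n) (auto intro: dpi)

lemma range_num: "x \<in> range num <-> (\<forall>y. y = x \<or> y <: x -->
    y = empty \<or> (\<exists>z. y = succ z))" (is "_ <-> ?nat x")
proof
  assume "x \<in> range num"
  then obtain n where n: "x = num n" by blast
  have "num k = empty \<or> (\<exists>z. num k = succ z)" for k by (cases k) auto
  moreover have "\<exists>k. y = num k" if "y = x \<or> y <: x" for y using that unfolding n mem_num by auto
  ultimately show "?nat x" by metis
next
  assume "?nat x" thus "x \<in> range num"
  proof (induction x rule: mem_induct)
    case (step x)
    consider "x = empty" | z where "x = succ z" using step.prems by blast
    thus ?case
    proof cases
      case 1 thus ?thesis using num.simps(1) by (metis rangeI)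
    next
      case 2
      then obtain n where "z = num n" using step.IH[of z] step.prems by auto
      thus ?thesis using 2 num.simps(2) by (metis rangeI)
    qed
  qed
qed

lemma is_set_omega: "is_set (range num)"
proof -
  obtain w where w: "empty <: w" "\<And>x. x <: w ==> succ x <: w" using infinity by blast
  have "num n <: w" for n by (induction n) (simp_all add: w)
  moreover have "dp UNIV (%e. e 0 \<in> range num)" unfolding range_num by (intro dpi)
  ultimately show ?thesis by (intro is_set_sub[OF is_set_ext[of w]]) auto
qed

lemma ext_omega: "ext omega = range num" unfolding omega_def
  by (rule ext_coll[OF is_set_omega])
lemma mem_omega: "x <: omega <-> (\<exists>n. x = num n)" using ext_omega mem_ext
  by blast
lemma num_omega [simp]: "num n <: omega" by (auto simp: mem_omega)
lemma dt_omega [dpi]: "dt C (%e. omega)"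
  unfolding dt_def omega_def eq_coll[OF is_set_omega] range_num by (intro dpi)

primrec iterate :: "'v => ('v => 'v => 'v) => nat => 'v" where
  "iterate z g 0 = z" | "iterate z g (Suc n) = g (num n) (iterate z g n)"

definition num_val :: "'v => nat" where "num_val x = (THE n. x = num n)"
lemma num_val_num [simp]: "num_val (num n) = n" by (simp add: num_val_def)
definition nat_rec :: "'v => ('v => 'v => 'v) => 'v => 'v" where
  "nat_rec z g n = (if n <: omega then iterate z g (num_val n) else empty)"

lemma nat_rec_num [simp]: "nat_rec z g (num n) = iterate z g n" by (simp add: nat_rec_def)

definition approximates :: "'v => ('v => 'v => 'v) => 'v => 'v => bool" where
  "approximates z g n s <-> pair empty z <: s &
  (\<forall>l. l <: n --> (\<exists>v. pair l v <: s & pair (succ l) (g l v) <: s)) &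
  (\<forall>l v v'. pair l v <: s & pair l v' <: s --> v = v')"

lemma approximates_unique:
  assumes "approximates z g (num k) s"
  shows "l <= k ==> pair (num l) v <: s ==> v = iterate z g l"
proof (induction l arbitrary: v)
  case 0 thus ?case using assms unfolding approximates_def by fastforce
next
  case (Suc l)
  then obtain u where "pair (num l) u <: s" "pair (num (Suc l)) (g (num l) u) <: s"
    using assms unfolding approximates_def by (metis Suc_le_lessD num.simps(2) num_mem)
  thus ?case using Suc assms unfolding approximates_def by (metis Suc_leD iterate.simps(2))
qed

lemma ex_approximates: "\<exists>s. approximates z g (num k) s & pair (num k) (iterate z g k) <: s"
proof -
  obtain s where "ext s = (%l. pair (num l) (iterate z g l)) ` {..k}" using finite_subset_is_set by blast
  hence s: "x <: s <-> (\<exists>l\<le>k. x = pair (num l) (iterate z g l))" for x by (auto simp flip: mem_ext)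
  have "\<exists>v. pair (num l) v <: s & pair (num (Suc l)) (g (num l) v) <: s" if "l < k" for l
    unfolding s using that by (metis Suc_leI iterate.simps(2) less_imp_le_nat)
  hence "\<forall>l. l <: num k --> (\<exists>v. pair l v <: s & pair (succ l) (g l v) <: s)" unfolding mem_num by auto
  moreover have "pair empty z <: s" unfolding s by (intro exI[of _ 0]) simp
  moreover have "\<forall>l v v'. pair l v <: s & pair l v' <: s --> v = v'" unfolding s by auto
  ultimately have "approximates z g (num k) s" unfolding approximates_def by (intro conjI)
  moreover have "pair (num k) (iterate z g k) <: s" unfolding s by (intro exI[of _ k]) simp
  ultimately show ?thesis by blast
qed

lemma nat_rec_graph: "y = nat_rec z g n <->
  (n <: omega & (\<exists>s. approximates z g n s & pair n y <: s)) \<or> (\<not> n <: omega & y = empty)"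
proof (cases "n <: omega")
  case True
  then obtain k where "n = num k" by (auto simp: mem_omega)
  thus ?thesis using True ex_approximates[of z g k] approximates_unique[of z g k _ k] by auto
qed (simp add: nat_rec_def)

lemma dt_nat_rec [dpi]:
  assumes "dt C z" "dt C (%e. g (%n. e (Suc (Suc n))) (e 0) (e 1))" "dt C n"
  shows "dt C (%e. nat_rec (z e) (g e) (n e))"
proof -
  have "dt C (%e. g (%n. e (Suc (Suc (Suc (Suc n))))) (e (Suc 0)) (e 0))"
    using dt_reindex[OF assms(2), of "case_nat (Suc 0) (case_nat 0 (%n. Suc (Suc (Suc (Suc n)))))"] by simp
  note this dt_reindex[OF assms(1), of "%n. Suc n"] dt_reindex[OF assms(3), of "%n. Suc n"]
    dt_reindex[OF assms(1), of "%n. Suc (Suc n)"] dt_reindex[OF assms(3), of "%n. Suc (Suc n)"]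
    dt_reindex[OF assms(3), of "%n. Suc (Suc (Suc n))"]
  thus ?thesis unfolding dt_def[of C "%e. nat_rec (z e) (g e) (n e)"] nat_rec_graph approximates_def by (intro dpi)
qed

end

subsection \<open>Ordinals and cardinality\<close>

context set_struct
begin
definition inj_fn :: "'v => 'v => 'v => bool" where
  "inj_fn f a b <-> fn f a b & (\<forall>x y. x \<epsilon> a & y \<epsilon> a & ap f x = ap f y --> x = y)"
definition lepoll :: "'v => 'v => bool" where "lepoll a b <-> (\<exists>f. inj_fn f a b)"

definition funs :: "'v => 'v => 'v" where "funs a b = coll {f. fn f a b}"
definition covered :: "'v set => 'v => bool" where
  "covered S n <-> (\<exists>f. (\<forall>l x y. pair l x \<epsilon> f & pair l y \<epsilon> f --> x = y) &
      (\<forall>x. x \<in> S --> (\<exists>l. l \<epsilon> n & pair l x \<epsilon> f)))"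
definition Fin :: "'v => 'v" where "Fin b = coll {x. ext x <= ext b & finite {y. y \<epsilon> x}}"

end

context zermelo
begin

lemma dp_ordinal [dpi]: "dt C t ==> dp C (%e. ordinal (t e))"
  by (rule dp_lift1[where Q = ordinal]) (unfold ordinal_def, intro dpi)

lemma ordinal_mem: "ordinal a ==> x <: a ==> ordinal x"
  unfolding ordinal_def by (meson mem_ext subset_iff)
lemma ordinal_trans: "ordinal a ==> x <: a ==> y <: x ==> y <: a"
  unfolding ordinal_def by (meson mem_ext subset_iff)

lemma ordinal_linear: "ordinal a ==> ordinal b ==> a <: b \<or> a = b \<or> b <: a"
proof (induction a arbitrary: b rule: mem_induct)
  case (step a)
  note IH = step.IH and a = step.prems(1)
  show ?case using step.prems(2)
  proof (induction b rule: mem_induct)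
    case (step b)
    show ?case
    proof (rule ccontr)
      assume n: "\<not> (a <: b \<or> a = b \<or> b <: a)"
      have "x <: b" if "x <: a" for x
        using IH[OF that ordinal_mem[OF a that] step.prems] n that ordinal_trans[OF a that] by auto
      moreover have "x <: a" if "x <: b" for x
        using step.IH[OF that ordinal_mem[OF step.prems that]] n that ordinal_trans[OF step.prems that] by auto
      ultimately have "a = b" by (intro set_eqI) blast
      thus False using n by blast
    qed
  qed
qed

lemma ordinal_subset: "ordinal a ==> ordinal b ==> ext a <= ext b <-> a <: b \<or> a = b"
proof
  assume a: "ordinal a" "ordinal b" and "ext a <= ext b"
  hence "\<not> b <: a" using mem_irrefl by auto
  thus "a <: b \<or> a = b" using ordinal_linear a by blast
next
  assume "ordinal a" "ordinal b" "a <: b \<or> a = b" thus "ext a <= ext b" by (auto intro: ordinal_trans)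
qed

lemma ordinal_omega: "ordinal omega"
  unfolding ordinal_def by (auto simp: ext_num ext_omega mem_omega simp flip: mem_ext)

lemma least_ordinal:
  assumes "ordinal a" "Q a"
  obtains b where "ordinal b" "Q b" "\<And>c. c <: b ==> \<not> Q c" "b = a \<or> b <: a"
proof -
  have "\<exists>b. ordinal b & Q b & (\<forall>c. c <: b --> \<not> Q c) & (b = a \<or> b <: a)"
    using assms by (induction a rule: mem_induct) (metis ordinal_mem ordinal_trans)
  thus ?thesis using that by blast
qed

lemma fn_rel:
  assumes "dp UNIV (%e. R (e 0) (e 1))" "\<And>x. x <: a ==> \<exists>y. y <: b & R x y"
  "\<And>x y y'. x <: a ==> y <: b ==> y' <: b ==> R x y ==> R x y' ==> y = y'"
  obtains f where "fn f a b" "\<And>x. x <: a ==> R x (ap f x)"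
proof -
  obtain f where f: "\<And>z. z <: f <-> z <: cprod a b & (\<exists>x y. z = pair x y & R x y)"
    by (rule sepE, erule that, intro dpi dp_lift2[OF assms(1)])
  have fo: "func_on f a" unfolding func_on_def f using assms(2, 3) by (auto simp: mem_cprod)
  have "ap f x <: b & R x (ap f x)" if "x <: a" for x using f that func_ap[OF fo that] by auto
  thus ?thesis using that[of f] fo unfolding fn_ap by blast
qed

lemma inj_fnD: "inj_fn f a b ==> fn f a b" "inj_fn f a b ==> func_on f a" "inj_fn f a b ==> x <: a ==> ap f x <: b"
  "inj_fn f a b ==> x <: a ==> y <: a ==> ap f x = ap f y ==> x = y"
  unfolding inj_fn_def fn_ap by auto
lemma dp_inj_fn [dpi]: "dt C t ==> dt C u ==> dt C v ==> dp C (%e. inj_fn (t e) (u e) (v e))"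
  by (rule dp_lift3[where Q = inj_fn]) (unfold inj_fn_def, intro dpi)
lemma dp_lepoll [dpi]: "dt C t ==> dt C u ==> dp C (%e. lepoll (t e) (u e))"
  by (rule dp_lift2[where Q = lepoll]) (unfold lepoll_def, intro dpi)
lemma lepollE:
  assumes "lepoll a b"
  obtains f where "inj_fn f a b" using assms lepoll_def
  by blast

lemma lepollI:
  assumes "dt UNIV (%e. f (e 0))" "\<And>x. x <: a ==> f x <: b" "inj_on f (ext a)"
  shows "lepoll a b"
proof -
  have "inj_fn (lam a f) a b"
    using fn_lam[OF assms(1, 2)] assms(3) lam_fn(2)[OF assms(1, 2), of a]
      unfolding inj_fn_def by (auto simp: inj_on_def)
  thus ?thesis unfolding lepoll_def by blast
qed

lemma lepoll_rel:
  assumes "dp UNIV (%e. R (e 0) (e 1))" "\<And>x. x <: a ==> \<exists>y. y <: b & R x y"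
  "\<And>x y y'. x <: a ==> y <: b ==> y' <: b ==> R x y ==> R x y' ==> y = y'"
  "\<And>x x' y. x <: a ==> x' <: a ==> y <: b ==> R x y ==> R x' y ==> x = x'"
  shows "lepoll a b"
proof -
  obtain f where f: "fn f a b" "\<And>x. x <: a ==> R x (ap f x)"
    by (rule fn_rel[OF assms(1), of a b]) (use assms(2, 3) in auto)
  hence "inj_fn f a b" using assms(4) unfolding inj_fn_def fn_ap by metis
  thus ?thesis unfolding lepoll_def by blast
qed

text \<open>Least values replace the axiom of choice, which is not derived for the extension.\<close>

lemma fn_least:
  assumes R: "dp UNIV (%e. R (e 0) (e 1))" and l: "ordinal l" and ex: "\<And>x. x <: a ==> \<exists>y. y <: l & R x y"
  obtains f where "fn f a l" "\<And>x. x <: a ==> R x (ap f x)"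
proof (rule fn_rel[of "%x y. R x y & (\<forall>z. z <: y --> \<not> R x z)" a l])
  show "dp UNIV (%e. R (e 0) (e 1) & (\<forall>z. z <: e 1 --> \<not> R (e 0) z))" by (intro dpi dp_lift2[OF R])
  fix x assume "x <: a"
  then obtain y where y: "y <: l" "R x y" using ex by blast
  obtain z where "R x z" "\<And>w. w <: z ==> \<not> R x w" "z = y \<or> z <: y"
    using least_ordinal[of y "R x", OF ordinal_mem[OF l y(1)] y(2)] by metis
  thus "\<exists>y. y <: l & R x y & (\<forall>z. z <: y --> \<not> R x z)" using y(1) ordinal_trans[OF l] by blast
next
  fix x y z assume "y <: l" "z <: l" "R x y & (\<forall>w. w <: y --> \<not> R x w)" "R x z & (\<forall>w. w <: z -->
      \<not> R x w)"
  thus "y = z" using ordinal_linear[OF ordinal_mem[OF l] ordinal_mem[OF l], of y z] by blast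
next
  fix f assume "fn f a l" "\<And>x. x <: a ==> R x (ap f x) & (\<forall>z. z <: ap f x --> \<not> R x z)"
  thus thesis using that by blast
qed

lemma lepoll_least:
  assumes "dp UNIV (%e. R (e 0) (e 1))" "ordinal l" "\<And>x. x <: a ==> \<exists>y. y <: l & R x y"
  "\<And>x x' y. x <: a ==> x' <: a ==> R x y ==> R x' y ==> x = x'" shows "lepoll a l"
proof -
  obtain f where "fn f a l" "\<And>x. x <: a ==> R x (ap f x)"
    by (rule fn_least[OF assms(1, 2), of a]) (rule assms(3), assumption, rule that, assumption, blast)
  hence "inj_fn f a l" using assms(4) unfolding inj_fn_def by metis
  thus ?thesis unfolding lepoll_def by blast
qed

lemma lepoll_subset: "ext a <= ext b ==> lepoll a b" by (rule lepollI[of "%x. x"]) (auto intro: dpi)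

lemma lepoll_refl: "lepoll a a" by (rule lepoll_subset) simp
lemma lepoll_trans:
  assumes "lepoll a b" "lepoll b c"
  shows "lepoll a c"
proof -
  obtain f where f: "inj_fn f a b" using assms(1) by (rule lepollE)
  obtain g where g: "inj_fn g b c" using assms(2) by (rule lepollE)
  show ?thesis
    by (rule lepollI[of "%x. ap g (ap f x)"]) (intro dpi, use inj_fnD(3, 4)[OF f] inj_fnD(3, 4)[OF g] in
      \<open>auto simp: inj_on_def\<close>)
qed

lemma lepoll_ordinal: "ordinal b ==> a <: b ==> lepoll a b"
  by (rule lepoll_subset) (auto intro: ordinal_trans)

lemma equinumE:
  assumes "equinum a b"
  obtains f where "inj_fn f a b" "\<And>y. y <: b ==> \<exists>x. x <: a & ap f x = y"
proof -
  obtain f where f: "fn f a b" "bij_betw (app f) (ext a) (ext b)" using assms equinum_def by blast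
  have ap: "ap f x = app f x" if "x <: a" for x using ap_eq f that unfolding fn_def by blast
  have "x = y" if "x <: a" "y <: a" "ap f x = ap f y" for x y
    using f(2) that ap unfolding bij_betw_def inj_on_def by auto
  moreover have "\<exists>x. x <: a & ap f x = y" if "y <: b" for y
    using f(2) that ap unfolding bij_betw_def by (metis imageE mem_ext)
  ultimately show ?thesis using that f(1) unfolding inj_fn_def by blast
qed

lemma equinum_lepoll: "equinum a b ==> lepoll a b" using equinumE lepoll_def
  by metis
lemma equinum_lepoll2:
  assumes "equinum a b"
  shows "lepoll b a"
proof -
  obtain f where f: "inj_fn f a b" "\<And>y. y <: b ==> \<exists>x. x <: a & ap f x = y" using equinumE[OF assms]
    by metis
  show ?thesis
    by (rule lepoll_rel[of "%y x. x <: a & y = ap f x"]) (intro dpi, use f(2) inj_fnD(4)[OF f(1)] in auto)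
qed

lemma equinum_rel:
  assumes "dp UNIV (%e. R (e 0) (e 1))" "\<And>x. x <: a ==> \<exists>y. y <: b & R x y"
  "\<And>x y y'. x <: a ==> y <: b ==> y' <: b ==> R x y ==> R x y' ==> y = y'"
  "\<And>x x' y. x <: a ==> x' <: a ==> y <: b ==> R x y ==> R x' y ==> x = x'" "\<And>y. y <: b ==>
      \<exists>x. x <: a & R x y"
  shows "equinum a b"
proof -
  obtain f where f: "fn f a b" "\<And>x. x <: a ==> R x (ap f x)"
    by (rule fn_rel[OF assms(1), of a b]) (use assms(2, 3) in auto)
  have ap: "app f x = ap f x" if "x <: a" for x using ap_eq[of f a] f(1) that unfolding fn_def by simp
  have fb: "ap f x <: b" if "x <: a" for x using f(1) that unfolding fn_ap by blast
  have "inj_on (app f) (ext a)" by (rule inj_onI) (metis ap assms(4) f(2) fb mem_ext)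
  moreover have "y \<in> app f ` ext a" if y: "y <: b" for y
  proof -
    obtain x where "x <: a" "R x y" using assms(5)[OF y] by blast
    thus ?thesis using assms(3)[of x "ap f x" y] f(2) fb ap y by (intro image_eqI[of _ _ x]) auto
  qed
  ultimately show ?thesis unfolding equinum_def bij_betw_def using f(1) fb ap by (intro exI[of _ f]) auto
qed

lemma ex_fixpoint:
  assumes that: "\<And>X. (\<And>x. x <: X <-> x <: a & F X x) ==> thesis"
  and F: "dp UNIV (%e. F (e 0) (e 1))" and mono: "\<And>c c' x. ext c <= ext c' ==> F c x ==> F c' x"
  shows thesis
proof -
  define closed where "closed c <-> (\<forall>x. x <: a & F c x --> x <: c)" for c
  obtain X where X: "\<And>x. x <: X <-> x <: a & (\<forall>c. closed c --> x <: c)"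
    by (rule sepE, erule that, unfold closed_def, intro dpi dp_lift2[OF F])
  have closed_X: "closed X" unfolding closed_def
  proof (intro allI impI)
    fix x assume x: "x <: a & F X x"
    have "x <: c" if c: "closed c" for c
    proof -
      have "ext X <= ext c" using X c by auto
      thus ?thesis using mono x c unfolding closed_def by blast
    qed
    thus "x <: X" using X x by blast
  qed
  obtain c where c: "\<And>x. x <: c <-> x <: a & F X x" by (rule sepE, erule that, intro dpi dp_lift2[OF F])
  have "ext c <= ext X" using c closed_X unfolding closed_def by auto
  hence "closed c" unfolding closed_def using mono c by blast
  hence "x <: X <-> x <: a & F X x" for x using c closed_X X unfolding closed_def by blast
  thus ?thesis using that by blast
qed

theorem cantor_bernstein:
  assumes "lepoll a b" "lepoll b a"
  shows "equinum a b"
proof -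
  obtain f where f: "inj_fn f a b" using assms(1) by (rule lepollE)
  obtain g where g: "inj_fn g b a" using assms(2) by (rule lepollE)
  obtain X where X: "\<And>x. x <: X <-> x <: a & ((\<forall>z. z <: b --> x \<noteq> ap g z) \<or>
      (\<exists>y. y <: X & x = ap g (ap f y)))"
    by (rule ex_fixpoint, erule that, intro dpi, auto simp: subset_iff)
  have fX: "ap f x <: b" "ap g (ap f x) <: X" if "x <: X" for x
    using inj_fnD(3)[OF f] inj_fnD(3)[OF g] X that by blast+
  show ?thesis
  proof (rule equinum_rel[of "%x y. (x <: X & y = ap f x) \<or> (\<not> x <: X & y <: b & x = ap g y)"])
    fix x assume "x <: a"
    thus "\<exists>y. y <: b & (x <: X & y = ap f x \<or> \<not> x <: X & y <: b & x = ap g y)" using X fX by blast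
  next
    fix y assume y: "y <: b"
    show "\<exists>x. x <: a & (x <: X & y = ap f x \<or> \<not> x <: X & y <: b & x = ap g y)"
    proof (cases "ap g y <: X")
      case True
      then obtain x where "x <: X" "ap g y = ap g (ap f x)" using X[of "ap g y"] y by blast
      thus ?thesis using inj_fnD(4)[OF g y] fX X by blast
    qed (use inj_fnD(3)[OF g] y in blast)
  next
    fix x y y' assume "x <: X & y = ap f x \<or> \<not> x <: X & y <: b & x = ap g y" "x <: X & y' = ap f x \<or>
        \<not> x <: X & y' <: b & x = ap g y'"
    thus "y = y'" using inj_fnD(4)[OF g] by blast
  next
    fix x x' y assume "x <: X & y = ap f x \<or> \<not> x <: X & y <: b & x = ap g y" "x' <: X & y = ap f x' \<or>
        \<not> x' <: X & y <: b & x' = ap g y"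
    thus "x = x'" using inj_fnD(4)[OF f, of x x'] fX X by blast
  qed (intro dpi)
qed

lemma equinum_iff: "equinum a b <-> lepoll a b & lepoll b a"
  using equinum_lepoll equinum_lepoll2 cantor_bernstein by blast

lemma cardinal_not_lepoll: "cardinal k ==> a <: k ==> \<not> lepoll k a"
  unfolding cardinal_def using lepoll_ordinal equinum_iff by blast

lemma csuccI:
  assumes "cardinal l" "k <: l" "\<And>b. b <: l ==> lepoll b k"
  shows "csucc k = l"
  unfolding csucc_def
proof (rule the_equality)
  have "ext l <= ext m" if m: "cardinal m" "k <: m" for m
  proof -
    have "\<not> m <: l" using cardinal_not_lepoll[OF m] assms(3) by blast
    thus ?thesis using m(1) assms(1) ordinal_linear[of l m] ordinal_subset[of l m] unfolding cardinal_def by blast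
  qed
  thus least: "cardinal l & k <: l & (\<forall>m. cardinal m & k <: m --> ext l <= ext m)" using assms by blast
  fix m assume "cardinal m & k <: m & (\<forall>n. cardinal n & k <: n --> ext m <= ext n)"
  hence "ext m = ext l" using least by blast
  thus "m = l" by (rule ext_inj)
qed

lemma lepoll_prod:
  assumes "lepoll a a'" "lepoll b b'"
  shows "lepoll (cprod a b) (cprod a' b')"
proof -
  obtain f where f: "inj_fn f a a'" using assms(1) by (rule lepollE)
  obtain g where g: "inj_fn g b b'" using assms(2) by (rule lepollE)
  show ?thesis
    by (rule lepoll_rel[of "%z w. \<exists>x y. z = pair x y & w = pair (ap f x) (ap g y)"])
    ((intro dpi)?, use inj_fnD(3, 4)[OF f] inj_fnD(3, 4)[OF g] in \<open>auto simp: mem_cprod\<close>)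
qed

lemma is_set_funs: "is_set {f. fn f a b}"
proof (rule is_set_sub[OF is_set_ext[of "powset (cprod a b)"]])
  show "{f. fn f a b} <= ext (powset (cprod a b))" using fn_mem_pow mem_ext by blast
  show "dp UNIV (%e. e 0 \<in> {f. fn f a b})" unfolding mem_Collect_eq by (intro dpi)
qed

lemma mem_funs [simp]: "f <: funs a b <-> fn f a b" unfolding funs_def
  by (simp add: mem_coll is_set_funs)
lemma dt_funs [dpi]: "dt C t ==> dt C u ==> dt C (%e. funs (t e) (u e))"
  by (rule dt_lift2[where F = funs]) (simp_all only: eq_coll[OF is_set_funs] funs_def mem_Collect_eq, intro dpi)

lemma lepoll_funs:
  assumes "lepoll b b'"
  shows "lepoll (funs a b) (funs a b')"
proof -
  obtain h where h: "inj_fn h b b'" using assms by (rule lepollE)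
  show ?thesis
  proof (rule lepoll_rel[of "%f g. \<forall>x. x <: a --> ap g x = ap h (ap f x)"])
    fix f assume "f <: funs a b"
    hence hf: "ap h (ap f x) <: b'" if "x <: a" for x using that inj_fnD(3)[OF h] by (auto simp: fn_ap)
    have "dt UNIV (%e. ap h (ap f (e 0)))" by (intro dpi)
    from fn_lam[OF this, of a b'] lam_fn(2)[OF this, of a b'] hf
    show "\<exists>g. g <: funs a b' & (\<forall>x. x <: a --> ap g x = ap h (ap f x))"
      by (intro exI[of _ "lam a (%x. ap h (ap f x))"]) auto
  next
    fix f f' g assume f: "f <: funs a b" "f' <: funs a b" and "\<forall>x. x <: a --> ap g x = ap h (ap f x)"
      "\<forall>x. x <: a --> ap g x = ap h (ap f' x)"
    thus "f = f'" using f inj_fnD(4)[OF h] by (intro fn_eqI[of f a b]) (auto simp: fn_ap)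
  qed (intro dpi, auto intro: fn_eqI)
qed

lemma covered_num: "covered S (num n) <-> finite S & card S <= n"
proof
  assume "covered S (num n)"
  then obtain f where f: "\<And>l x y. pair l x <: f ==> pair l y <: f ==> x = y" "\<And>x. x \<in> S ==>
      \<exists>l. l <: num n & pair l x <: f"
    unfolding covered_def by blast
  have "\<exists>l<n. pair (num l) x <: f" if "x \<in> S" for x
    using f(2)[OF that] by (auto simp: ext_num simp flip: mem_ext)
  then obtain k where k: "\<And>x. x \<in> S ==> k x < n & pair (num (k x)) x <: f" by metis
  hence "inj_on k S" "k ` S <= {..<n}" using f(1) by (auto simp: inj_on_def) metis
  thus "finite S & card S <= n" by (metis card_inj_on_le card_lessThan finite_lessThan inj_on_finite)
next
  assume "finite S & card S <= n"
  then obtain k where k: "inj_on k S" "k ` S <= {..<n}" by (metis card_le_inj card_lessThan finite_lessThan)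
  obtain f where "ext f = (%x. pair (num (k x)) x) ` S"
    using finite_subset_is_set \<open>finite S & card S <= n\<close> by (metis finite_imageI)
  hence f: "pair l x <: f <-> x \<in> S & l = num (k x)" for l x by (auto simp: image_iff simp flip: mem_ext)
  show "covered S (num n)" unfolding covered_def
    by (rule exI[of _ f]) (use k in \<open>auto simp: f num_mem inj_on_def\<close>)
qed

lemma dp_covered [dpi]:
  assumes "dp C (%e. R (e 0) (%n. e (Suc n)))" "dt C n"
  shows "dp C (%e. covered {x. R x e} (n e))"
proof -
  have "dp C (%e. R (e 0) (%n. e (Suc (Suc n))))"
    using dp_reindex[OF assms(1), of "case_nat 0 (%n. Suc (Suc n))"] by simp
  thus ?thesis unfolding covered_def mem_Collect_eq
    by (intro dpi dt_reindex[OF assms(2), of "%n. Suc (Suc (Suc n))"])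
qed

lemma finite_covered: "finite S <-> (\<exists>n. n <: omega & covered S n)"
  by (auto simp: mem_omega covered_num)
lemma dp_finite [dpi]:
  assumes "dp C (%e. R (e 0) (%n. e (Suc n)))"
  shows "dp C (%e. finite {x. R x e})"
  unfolding finite_covered
  by (intro dpi) (use dp_reindex[OF assms(1), of "case_nat 0 (%n. Suc (Suc n))"] in simp)

lemma dp_finite_ext [dpi]: "dt C t ==> dp C (%e. finite (ext (t e)))"
  by (rule dp_lift1[where Q = "%x. finite (ext x)"]) (unfold ext_def, intro dpi)

lemma mem_Fin: "x <: Fin b <-> ext x <= ext b & finite (ext x)"
proof -
  have "is_set {x. ext x <= ext b & finite {y. y <: x}}"
    using sep[of "%x. finite {y. y <: x}" "powset b"] by (simp, elim meta_mp) (intro dpi)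
  thus ?thesis unfolding Fin_def by (simp add: mem_coll) (simp add: ext_def)
qed

lemma finite_lepoll_omega:
  assumes "finite (ext x)"
  shows "lepoll x omega"
proof -
  obtain k :: "'v => nat" where k: "inj_on k (ext x)" using finite_imp_inj_to_nat_seg[OF assms] by blast
  have "inj_fn (lam x (%y. num (k y))) x omega"
    using fn_finite[OF assms, of "%y. num (k y)" omega] k unfolding inj_fn_def inj_on_def
      by (metis mem_ext num_inj num_omega)
  thus ?thesis unfolding lepoll_def by blast
qed

lemma lepoll_Fin_mono:
  assumes "lepoll a b"
  shows "lepoll (Fin a) (Fin b)"
proof -
  obtain f where f: "inj_fn f a b" using assms by (rule lepollE)
  show ?thesis
  proof (rule lepoll_rel[of "%x y. \<forall>z. z <: y <-> (\<exists>w. w <: x & z = ap f w)"])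
    fix x assume x: "x <: Fin a"
    then obtain y where "ext y = ap f ` ext x" using mem_Fin finite_subset_is_set by (meson finite_imageI)
    hence y: "z <: y <-> (\<exists>w. w <: x & z = ap f w)" for z by (auto simp: image_iff Bex_def simp flip: mem_ext)
    hence "y <: Fin b" using x inj_fnD(3)[OF f] \<open>ext y = _\<close> unfolding mem_Fin by (auto simp: subset_iff)
    thus "\<exists>y. y <: Fin b & (\<forall>z. z <: y <-> (\<exists>w. w <: x & z = ap f w))" using y by blast
  next
    fix x x' y assume "x <: Fin a" "x' <: Fin a" and y: "\<forall>z. z <: y <-> (\<exists>w. w <: x & z = ap f w)"
      "\<forall>z. z <: y <-> (\<exists>w. w <: x' & z = ap f w)"
    hence "w <: a" if "w <: x \<or> w <: x'" for w using that unfolding mem_Fin by auto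
    thus "x = x'" using y inj_fnD(4)[OF f] by (intro set_eqI) metis
  qed (intro dpi, auto intro: set_eqI)
qed

subsection \<open>Arithmetic of the numerals\<close>

definition num_add :: "'v => 'v => 'v" where "num_add m n = nat_rec m (%l v. succ v) n"
definition num_mult :: "'v => 'v => 'v" where "num_mult m n = nat_rec empty (%l v. num_add v m) n"
lemma num_add_num [simp]: "num_add (num m) (num n) = num (m + n)"
  unfolding num_add_def nat_rec_num by (induction n) simp_all
lemma num_mult_num [simp]: "num_mult (num m) (num n) = num (m * n)"
  unfolding num_mult_def nat_rec_num by (induction n) (simp_all add: add.commute)
lemma dt_num_add [dpi]: "dt C t ==> dt C u ==> dt C (%e. num_add (t e) (u e))"
  unfolding num_add_def by (intro dpi)
lemma dt_num_mult [dpi]: "dt C t ==> dt C u ==> dt C (%e. num_mult (t e) (u e))"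
proof (rule dt_lift2[where F = num_mult])
  have "dt C (%e. num_mult (e 0) (e 1))" unfolding num_mult_def by (intro dpi)
  thus "dp C (%e. e 0 = num_mult (e 1) (e 2))" by (simp add: dt_def numeral_2_eq_2)
qed

lemma square_pairing_inj:
  fixes m n m' n' :: nat
  assumes "(m + n) * (m + n) + m = (m' + n') * (m' + n') + m'" shows "m = m' & n = n'"
proof -
  have not_less: "\<not> s < s'" if "s * s + a = s' * s' + b" "a <= s" for s s' a b :: nat
  proof
    assume "s < s'"
    hence "Suc s * Suc s <= s' * s'" by (intro mult_le_mono) auto
    thus False using that by simp
  qed
  have "m + n = m' + n'" using not_less[OF assms] not_less[OF assms[symmetric]] by (meson le_add1 linorder_neqE_nat)
  thus ?thesis using assms by simp
qed

lemma lepoll_omega_square: "lepoll (cprod omega omega) omega"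
proof (rule lepoll_rel[of "%z w. \<exists>x y. z = pair x y & w = num_add (num_mult (num_add x y) (num_add x y)) x"])
  show "\<exists>w. w <: omega & (\<exists>x y. z = pair x y & w = num_add (num_mult (num_add x y) (num_add x y)) x)"
    if "z <: cprod omega omega" for z using that by (auto simp: mem_cprod mem_omega)
  show "z = z'" if "z <: cprod omega omega" "z' <: cprod omega omega"
    "\<exists>x y. z = pair x y & w = num_add (num_mult (num_add x y) (num_add x y)) x"
    "\<exists>x y. z' = pair x y & w = num_add (num_mult (num_add x y) (num_add x y)) x" for z z' w
    using that by (auto simp: mem_cprod mem_omega) (use square_pairing_inj in blast)+
qed (intro dpi, auto)

end

section \<open>Replacement and choice\<close>

locale zfc = zermelo mem for mem :: "'v => 'v => bool" (infix \<open><:\<close> 50) +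
  assumes rep0: "(\<forall>x. x <: a --> (\<exists>!y. sat (e(0 := x, 1 := y)) ph)) ==>
  \<exists>b. ext b = {y. \<exists>x. x <: a & sat (e(0 := x, 1 := y)) ph}"
  and choice0: "(\<forall>x. x <: a --> ext x \<noteq> {}) &
  (\<forall>x y. x <: a & y <: a & x \<noteq> y --> ext x \<inter> ext y = {}) ==>
  \<exists>c. \<forall>x. x <: a --> (\<exists>!z. z <: x & z <: c)"

lemma zfcI:
  assumes "wfp mem" "set_struct.ZFC mem"
  shows "zfc mem"
proof -
  note axioms = assms(2)[unfolded set_struct.ZFC_def set_struct.extensional_def]
  note pairing_etc = axioms[THEN conjunct2, THEN conjunct2]
  note infinity_etc = pairing_etc[THEN conjunct2, THEN conjunct2, THEN conjunct2]
  show ?thesis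
    by (intro_locales; unfold_locales)
    (use assms(1) axioms[THEN conjunct1] in blast, use assms(1) axioms[THEN conjunct1] in blast,
    rule pairing_etc[THEN conjunct1, THEN spec, THEN spec], rule pairing_etc[THEN conjunct2, THEN conjunct1, THEN spec],
    rule pairing_etc[THEN conjunct2, THEN conjunct2, THEN conjunct1, THEN spec], rule infinity_etc[THEN conjunct1],
    rule infinity_etc[THEN conjunct2, THEN conjunct1, THEN spec, THEN spec, THEN spec],
    rule infinity_etc[THEN conjunct2, THEN conjunct2, THEN conjunct1, THEN spec, THEN spec, THEN spec, THEN mp],
    assumption, rule infinity_etc[THEN conjunct2, THEN conjunct2, THEN conjunct2, THEN spec, THEN mp])
qed

context zfc
begin

lemma rep:
  assumes R: "dp UNIV (%e. R (e 0) (e 1))" and unique: "\<And>x y y'. x <: a ==> R x y ==> R x y' ==> y = y'"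
  shows "is_set {y. \<exists>x. x <: a & R x y}"
proof -
  obtain ph p where p: "\<And>e. R (e 0) (e 1) = sat (mix e p) ph" using R by (rule dpE) blast
  define f where "f n = (if n = 0 then 0 else if n = 2 then 1 else n + 2)" for n :: nat
  define E where "E n = (if odd n then p ((n - 3) div 2) else empty)" for n
  have "(%i. (E(0 := x, 1 := y)) (f i)) = mix (%n. if n = 0 then x else if n = 1 then y else empty) p" for x y
    by (auto simp: fun_eq_iff f_def E_def mix_def elim!: evenE oddE)
  hence sat_R: "sat (E(0 := x, 1 := y)) (rename_fm ph f) = R x y" for x y
    using p[of "%n. if n = 0 then x else if n = 1 then y else empty"] by (simp add: sat_rename_fm)
  obtain a' where a': "\<And>x. x <: a' <-> x <: a & (\<exists>y. R x y)"
    by (rule sepE, erule that, intro dpi dp_lift2[OF R])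
  have "\<forall>x. x <: a' --> (\<exists>!y. R x y)" using a' unique by blast
  from rep0[of a' E "rename_fm ph f", unfolded sat_R, OF this]
  have "is_set {y. \<exists>x. x <: a' & R x y}" unfolding is_set_def .
  moreover have "{y. \<exists>x. x <: a' & R x y} = {y. \<exists>x. x <: a & R x y}" using a' by blast
  ultimately show ?thesis by simp
qed

lemma rep_image:
  assumes "dt UNIV (%e. f (e 0))"
  shows "is_set (f ` ext a)"
proof -
  have "dp UNIV (%e. e 1 = f (e 0))" by (intro dpi dt_fun1[OF assms])
  hence "is_set {y. \<exists>x. x <: a & y = f x}" by (rule rep[where R = "%x y. y = f x"]) auto
  moreover have "{y. \<exists>x. x <: a & y = f x} = f ` ext a" by auto
  ultimately show ?thesis by simp
qed

lemma is_set_graph: "dt UNIV (%e. f (e 0)) ==> is_set ((%x. pair x (f x)) ` ext a)"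
  by (rule rep_image[where f = "%x. pair x (f x)"]) (intro dpi)

lemma disjoint_choice:
  assumes g: "dt UNIV (%e. g (e 0))" and ne: "\<And>x. x <: a ==> g x \<noteq> empty"
  and disj: "\<And>x y. x <: a ==> y <: a ==> x \<noteq> y ==> ext (g x) \<inter> ext (g y) = {}"
  obtains c where "\<And>x. x <: a ==> \<exists>!z. z <: g x & z <: c"
proof -
  obtain A where "ext A = g ` ext a" using rep_image[OF g] unfolding is_set_def by blast
  hence A: "w <: A <-> (\<exists>x. x <: a & w = g x)" for w by (auto simp: image_iff Bex_def simp flip: mem_ext)
  have "\<exists>c. \<forall>w. w <: A --> (\<exists>!z. z <: w & z <: c)"
    by (rule choice0) (use A ne disj ext_eq_empty in metis)
  thus ?thesis using that A by metis
qed

lemma choice: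
  assumes R: "dp UNIV (%e. R (e 0) (e 1))" and ex: "\<And>x. x <: a ==> \<exists>y. y <: b & R x y"
  obtains f where "fn f a b" "\<And>x. x <: a ==> R x (ap f x)"
proof -
  have fiber_set: "is_set {z. z <: cprod (coll {x}) b & (\<exists>y. z = pair x y & R x y)}" for x
    by (rule sep) (intro dpi dp_lift2[OF R])
  define g where "g x = coll {z. z <: cprod (coll {x}) b & (\<exists>y. z = pair x y & R x y)}" for x
  have g: "z <: g x <-> (\<exists>y. z = pair x y & y <: b & R x y)" for z x
    unfolding g_def mem_coll[OF fiber_set] by (auto simp: mem_coll_sing)
  have "dt UNIV (%e. g (e 0))" unfolding g_def by (rule dt_coll[OF fiber_set]) (intro dpi dp_lift2[OF R])
  moreover have "g x \<noteq> empty" if "x <: a" for x using ex[OF that] g mem_empty by metis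
  moreover have "ext (g x) \<inter> ext (g y) = {}" if "x \<noteq> y" for x y using g that by auto
  ultimately obtain c where c: "\<And>x. x <: a ==> \<exists>!z. z <: g x & z <: c" using disjoint_choice[of g a]
    by metis
  show ?thesis
  proof (rule fn_rel[of "%x y. R x y & pair x y <: c" a b])
    show "dp UNIV (%e. R (e 0) (e 1) & pair (e 0) (e 1) <: c)" by (intro dpi R)
    fix x assume x: "x <: a"
    thus "\<exists>y. y <: b & R x y & pair x y <: c" using c[OF x] g by metis
    fix y y' assume "y <: b" "y' <: b" "R x y & pair x y <: c" "R x y' & pair x y' <: c"
    thus "y = y'" using c[OF x] g by (metis pair_inject)
  qed (use that in blast)
qed

lemma lepoll_choice:
  assumes "dp UNIV (%e. R (e 0) (e 1))" "\<And>x. x <: a ==> \<exists>y. y <: b & R x y"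
  "\<And>x x' y. x <: a ==> x' <: a ==> y <: b ==> R x y ==> R x' y ==> x = x'"
  shows "lepoll a b"
proof -
  obtain f where "fn f a b" "\<And>x. x <: a ==> R x (ap f x)" using choice[OF assms(1, 2)] by metis
  hence "inj_fn f a b" using assms(3) unfolding inj_fn_def fn_ap by metis
  thus ?thesis unfolding lepoll_def by blast
qed

lemma finite_cover:
  assumes Q: "dp UNIV (%e. Q (e 0) (e 1))" and cover: "\<And>y. y <: b ==> \<exists>i. i <: L & Q i y"
  and fin: "\<And>i. i <: L ==> finite {y. y <: b & Q i y}"
  shows "lepoll b (cprod L omega)"
proof -
  define R where "R i f <-> (\<forall>l x y. pair l x <: f & pair l y <: f --> x = y) &
      (\<forall>x. x <: b & Q i x --> (\<exists>l. l <: omega & pair l x <: f))" for i f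
  have "\<exists>f. f <: powset (cprod omega b) & R i f" if i: "i <: L" for i
  proof -
    obtain n where "n <: omega" "covered {y. y <: b & Q i y} n" using fin[OF i] finite_covered by blast
    then obtain f where f: "\<And>l x y. pair l x <: f ==> pair l y <: f ==> x = y"
      "\<And>x. x <: b ==> Q i x ==> \<exists>l. l <: n & pair l x <: f" unfolding covered_def by blast
    obtain f' where f': "\<And>z. z <: f' <-> z <: f & z <: cprod omega b" by (rule sepE, erule that, intro dpi)
    have "R i f'" unfolding R_def f' using f ordinal_trans[OF ordinal_omega \<open>n <: omega\<close>] by fastforce
    thus ?thesis using f' by (intro exI[of _ f']) auto
  qed
  moreover have "dp UNIV (%e. R (e 0) (e 1))" unfolding R_def by (intro dpi dp_lift2[OF Q])
  ultimately obtain g where g: "\<And>i. i <: L ==> R i (ap g i)" using choice[of R L] by metis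
  show ?thesis
  proof (rule lepoll_choice[of "%y z. \<exists>i l. z = pair i l & i <: L & pair l y <: ap g i"])
    show "\<exists>z. z <: cprod L omega & (\<exists>i l. z = pair i l & i <: L & pair l y <: ap g i)" if "y <: b" for y
      using cover[OF that] g that unfolding R_def by (metis pair_mem_cprod)
    show "y = y'" if "\<exists>i l. z = pair i l & i <: L & pair l y <: ap g i" "\<exists>i l. z = pair i l & i <: L &
        pair l y' <: ap g i" for y y' z
      using that g unfolding R_def by auto
  qed (intro dpi)
qed

end

subsection \<open>Recursion on the membership relation\<close>

context set_struct
begin
definition transitive :: "'v => bool" where "transitive t <-> (\<forall>x y. x \<epsilon> t & y \<epsilon> x -->
    y \<epsilon> t)"
definition is_tc :: "'v => 'v => bool" where
  "is_tc x t <-> transitive t & ext x <= ext t & (\<forall>u. transitive u & ext x <= ext u --> ext t <= ext u)"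
definition tc :: "'v => 'v" where "tc x = (THE t. is_tc x t)"
end

context zfc
begin

lemma dp_is_tc [dpi]: "dt C t ==> dt C u ==> dp C (%e. is_tc (t e) (u e))"
  by (rule dp_lift2[where Q = is_tc]) (unfold is_tc_def transitive_def, intro dpi)

lemma is_tc_unique: "is_tc x t ==> is_tc x u ==> t = u"
  unfolding is_tc_def by (rule ext_inj) blast

lemma ex_tc: "\<exists>t. is_tc x t"
proof (induction x rule: mem_induct)
  case (step x)
  have "is_set {t. \<exists>y. y <: x & is_tc y t}"
    by (rule rep) (intro dpi, rule is_tc_unique)
  then obtain s where s: "\<And>t. t <: s <-> (\<exists>y. y <: x & is_tc y t)" using mem_coll by blast
  define T where "T = bigunion (coll {x, bigunion s})"
  have T: "z <: T <-> z <: x \<or> (\<exists>y t. y <: x & is_tc y t & z <: t)" for z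
    by (subst T_def, subst mem_bigunion_upair) (auto simp: s)
  have "w <: T" if zT: "z <: T" and wz: "w <: z" for z w
  proof -
    consider "z <: x" | y t where "y <: x" "is_tc y t" "z <: t" using zT T by blast
    thus ?thesis
    proof cases
      case 1
      then obtain t where "is_tc z t" using step by blast
      thus ?thesis using T wz 1 unfolding is_tc_def by (meson mem_ext subset_iff)
    qed (use T wz in \<open>unfold is_tc_def transitive_def, blast\<close>)
  qed
  moreover have "z <: u" if u: "transitive u" "ext x <= ext u" and z: "z <: T" for u z
  proof -
    consider "z <: x" | y t where "y <: x" "is_tc y t" "z <: t" using z T by blast
    thus ?thesis
    proof cases
      case 2
      have "ext y <= ext u" using u 2(1) unfolding transitive_def by auto
      hence "ext t <= ext u" using 2(2) u unfolding is_tc_def by blast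
      thus ?thesis using 2(3) by (auto simp: subset_iff)
    qed (use u in auto)
  qed
  ultimately have "is_tc x T" unfolding is_tc_def transitive_def subset_iff mem_ext using T by blast
  thus ?case by blast
qed

lemma is_tc_tc: "is_tc x (tc x)"
  unfolding tc_def using ex_tc is_tc_unique by (metis theI')
lemma tc_eq: "is_tc x t <-> t = tc x" using is_tc_tc is_tc_unique
  by blast
lemma dt_tc [dpi]: "dt C t ==> dt C (%e. tc (t e))"
  by (rule dt_lift1[where F = tc]) (simp_all only: tc_eq[symmetric], intro dpi)
lemma transitive_tc: "transitive (tc x)" using is_tc_tc is_tc_def
  by blast
lemma tc_trans: "y <: tc x ==> z <: y ==> z <: tc x" using transitive_tc
  unfolding transitive_def by blast
lemma tc_self: "y <: x ==> y <: tc x" using is_tc_tc[of x]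
  unfolding is_tc_def by auto
lemma tc_mono:
  assumes "y <: tc x" "z <: tc y"
  shows "z <: tc x"
proof -
  have "ext y <= ext (tc x)" using assms(1) tc_trans by auto
  hence "ext (tc y) <= ext (tc x)" using is_tc_tc[of y] transitive_tc[of x] unfolding is_tc_def by blast
  thus ?thesis using assms(2) by (auto simp: subset_iff)
qed

lemma tc_cases:
  assumes "z <: tc x"
  shows "z <: x \<or> (\<exists>y. y <: x & z <: tc y)"
proof -
  obtain u where u: "\<And>z. z <: u <-> z <: tc x & (z <: x \<or> (\<exists>y. y <: x & z <: tc y))"
    by (rule sepE, erule that, intro dpi)
  have "transitive u" unfolding transitive_def u using tc_trans tc_self by blast
  moreover have "ext x <= ext u" using u tc_self by auto
  ultimately have "ext (tc x) <= ext u" using is_tc_tc is_tc_def by blast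
  thus ?thesis using assms u by (auto simp: subset_iff)
qed

lemma tc_induct [case_names step]:
  assumes "\<And>x. (\<And>y. y <: tc x ==> P y) ==> P x"
  shows "P x"
proof -
  have "P x & (\<forall>y. y <: tc x --> P y)"
  proof (induction x rule: mem_induct)
    case (step x)
    hence "\<forall>y. y <: tc x --> P y" using tc_cases by blast
    thus ?case using assms by blast
  qed
  thus ?thesis by blast
qed

lemma pair_tc:
  assumes "pair x y <: a"
  shows "x <: tc a" "y <: tc a"
proof -
  have "coll {x, y} <: pair x y" using ext_pair by (metis insertCI mem_ext)
  hence "coll {x, y} <: tc a" using assms tc_self tc_trans by blast
  thus "x <: tc a" "y <: tc a" using tc_trans mem_coll_upair by blast+
qed

text \<open>\<open>attempt T u f\<close>: \<open>f\<close> is a piece of the function \<open>H u\<close> with \<open>H u x = T u (H u) x\<close>, where \<open>T u h x\<close> only uses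
  the values of \<open>h\<close> on the transitive closure of \<open>x\<close>.\<close>

definition attempt :: "('v => ('v => 'v) => 'v => 'v) => 'v => 'v => bool" where
  "attempt T u f <-> (\<forall>x v w. pair x v <: f & pair x w <: f --> v = w) &
  (\<forall>x v. pair x v <: f --> (\<exists>g. ext g <= ext f & func_on g (tc x) & v = T u (ap g) x))"

context
  fixes T :: "'v => ('v => 'v) => 'v => 'v" and H :: "'v => 'v => 'v"
  assumes dt_T: "dt UNIV (%e. T (e 0) (ap (e 1)) (e 2))"
  and T_cong: "\<And>u h h' x. (\<And>y. y <: tc x ==> h y = h' y) ==> T u h x = T u h' x"
  and H_rec: "\<And>u x. H u x = T u (H u) x"
begin

lemma dp_attempt: "dt UNIV t ==> dt UNIV f ==> dp UNIV (%e. attempt T (t e) (f e))"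
proof (rule dp_lift2[where Q = "attempt T"])
  have "dp UNIV (%e. e 0 = T (e 1) (ap (e 2)) (e 3))" using dt_T unfolding dt_def by (simp add: eval_nat_numeral)
  note lift = dp_lift4[where Q = "%v u g x. v = T u (ap g) x", OF this]
  show "dp UNIV (%e. attempt T (e 0) (e 1))" unfolding attempt_def by (intro dpi lift)
qed

lemma attempt_correct:
  assumes f: "attempt T u f"
  shows "pair x v <: f ==> v = H u x"
proof (induction x arbitrary: v rule: tc_induct)
  case (step x)
  then obtain g where g: "ext g <= ext f" "func_on g (tc x)" "v = T u (ap g) x" using f unfolding attempt_def by blast
  have "ap g y = H u y" if "y <: tc x" for y
  proof -
    have "pair y (ap g y) <: g" using func_ap[OF g(2) that] by simp
    thus ?thesis using step.IH[OF that] g(1) by auto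
  qed
  thus ?case using T_cong[of x "ap g" "H u" u] H_rec[of u x] g(3) by simp
qed

lemma graph_rec:
  assumes g: "\<And>z. z <: g <-> (\<exists>y. y <: tc x & z = pair y (H u y))"
  shows "func_on g (tc x)" "H u x = T u (ap g) x"
proof -
  show g_fun: "func_on g (tc x)" unfolding func_on_def g by auto
  have "ap g y = H u y" if "y <: tc x" for y using func_ap[OF g_fun that, of "H u y"] g that by simp
  thus "H u x = T u (ap g) x" using T_cong[of x "ap g" "H u" u] H_rec[of u x] by simp
qed

lemma ex_attempt: "\<exists>f. attempt T u f & (\<forall>z. z <: f <->
    (\<exists>y. (y = x \<or> y <: tc x) & z = pair y (H u y)))"
proof (induction x rule: tc_induct)
  case (step x)
  have "is_set {v. \<exists>y. y <: tc x & (\<exists>f w. attempt T u f & pair y w <: f & v = pair y w)}"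
    by (rule rep) (intro dpi dp_attempt, use attempt_correct in blast)
  then obtain g where "\<And>z. z <: g <->
      (\<exists>y. y <: tc x & (\<exists>f w. attempt T u f & pair y w <: f & z = pair y w))"
    using mem_coll by blast
  hence g: "z <: g <-> (\<exists>y. y <: tc x & z = pair y (H u y))" for z using step attempt_correct by metis
  obtain f where "ext f = insert (pair x (H u x)) (ext g)" using is_set_insert[OF is_set_ext]
    unfolding is_set_def by blast
  hence f: "z <: f <-> (\<exists>y. (y = x \<or> y <: tc x) & z = pair y (H u y))" for z
    using g by (auto simp flip: mem_ext)
  have "\<exists>h. ext h <= ext f & func_on h (tc y) & H u y = T u (ap h) y" if y: "y = x \<or> y <: tc x" for y
  proof -
    obtain h where h: "\<And>z. z <: h <-> z <: f & (\<exists>a b. z = pair a b & a <: tc y)"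
      by (rule sepE, erule that, intro dpi)
    have "a = x \<or> a <: tc x" if "a <: tc y" for a using y tc_mono that by blast
    hence "z <: h <-> (\<exists>a. a <: tc y & z = pair a (H u a))" for z unfolding h f by auto
    note graph_rec[OF this]
    moreover have "ext h <= ext f" using h by auto
    ultimately show ?thesis by blast
  qed
  hence "attempt T u f" unfolding attempt_def using f by auto
  thus ?case using f by blast
qed

theorem dt_recursion: "dt UNIV (%e. H (e 0) (e 1))"
proof -
  have "v = H u x <-> (\<exists>f. attempt T u f & pair x v <: f)" for v u x
    using ex_attempt[of u x] attempt_correct by blast
  thus ?thesis unfolding dt_def by (simp only:) (intro dpi dp_attempt)
qed

end

lemma wf_mem: "wf {(y, x). y <: x}" using wf
  unfolding wfp_def by simp
lemma wf_tc: "wf {(y, x). y <: tc x}" unfolding wf_def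
proof (intro allI impI)
  fix Q x assume "\<forall>x. (\<forall>y. (y, x) \<in> {(y, x). y <: tc x} --> Q y) --> Q x"
  thus "Q x" by (intro tc_induct[of Q x]) auto
qed

lemma check_rec: "check u x = coll {z. \<exists>y. y <: x & z = pair (check u y) u}"
proof -
  have "check u x = coll ((%y. pair (check u y) u) ` ext x)"
    unfolding check_def by (subst wfrec[OF wf_mem]) (auto simp: cut_apply intro!: arg_cong[where f = coll] image_cong)
  thus ?thesis by (simp add: image_def Bex_def)
qed

lemma dt_check0: "dt UNIV (%e. check (e 0) (e 1))"
proof (rule dt_recursion[where T = "%u h x. coll {z. \<exists>y. y <: x & z = pair (h y) u}", OF _ _ check_rec])
  have "is_set {z. \<exists>y. y <: x & z = pair (ap g y) u}" for u x g by (rule rep) (intro dpi, simp)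
  thus "dt UNIV (%e. coll {z. \<exists>y. y <: e 2 & z = pair (ap (e 1) y) (e 0)})" by (intro dt_coll dpi)
qed (use tc_self in \<open>simp cong: conj_cong\<close>)

lemma dt_check [dpi]: "dt UNIV t ==> dt UNIV u ==> dt UNIV (%e. check (t e) (u e))"
  by (rule dt_fun2[where f = check, OF dt_check0])

lemma mem_check: "z <: check u x <-> (\<exists>y. y <: x & z = pair (check u y) u)"
proof -
  have "is_set {z. \<exists>y. y <: x & z = pair (check u y) u}" by (rule rep) (intro dpi, simp)
  thus ?thesis unfolding check_rec[of u x] by (simp add: mem_coll)
qed

lemma check_empty [simp]: "check u empty = empty" by (rule set_eqI) (simp add: mem_check)

subsection \<open>Hartogs numbers and successor cardinals\<close>

definition exhaust :: "'v => 'v => 'v => 'v" where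
  "exhaust c a = wfrec {(y, x). y <: x} (%f x. ap c (coll {z. z <: a & (\<forall>y. y <: x --> z \<noteq> f y)}))"

lemma exhaust_rec: "exhaust c a x = ap c (coll {z. z <: a & (\<forall>y. y <: x --> z \<noteq> exhaust c a y)})"
  unfolding exhaust_def by (subst wfrec[OF wf_mem]) (simp add: cut_apply cong: imp_cong)

lemma dt_exhaust: "dt UNIV (%e. exhaust c (e 0) (e 1))"
proof (rule dt_recursion[where T = "%a h x. ap c (coll {z. z <: a & (\<forall>y. y <: x -->
    z \<noteq> h y)})", OF _ _ exhaust_rec])
  have "is_set {z. z <: a & (\<forall>y. y <: x --> z \<noteq> ap g y)}" for a x g by (rule sep) (intro dpi)
  thus "dt UNIV (%e. ap c (coll {z. z <: e 0 & (\<forall>y. y <: e 2 --> z \<noteq> ap (e 1) y)}))"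
    by (intro dpi dt_coll)
qed (use tc_self in \<open>simp cong: imp_cong\<close>)

text \<open>Otherwise an injection of the ordinals into \<open>a\<close> makes the ordinals a set, which is then an ordinal itself.\<close>

lemma exhaust_stops:
  assumes "\<And>x. ordinal x ==> exhaust c a x <: succ a"
  and new: "\<And>x y. exhaust c a x <: a ==> y <: x ==> exhaust c a x \<noteq> exhaust c a y"
  shows "\<exists>al. ordinal al & exhaust c a al = a"
proof (rule ccontr)
  assume "\<not> ?thesis"
  hence F: "exhaust c a x <: a" if "ordinal x" for x using that assms(1)[OF that] by auto
  have "is_set {x. \<exists>z. z <: a & ordinal x & exhaust c a x = z}"
  proof (rule rep)
    show "dp UNIV (%e. ordinal (e 1) & exhaust c a (e 1) = e 0)" by (intro dpi dt_fun2[OF dt_exhaust])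
    fix z x y assume "ordinal x & exhaust c a x = z" "ordinal y & exhaust c a y = z"
    thus "x = y" using new F ordinal_linear by metis
  qed
  then obtain On where On: "\<And>x. x <: On <-> ordinal x" using mem_coll F by blast
  have "ordinal On" unfolding ordinal_def using On by (auto intro: ordinal_mem ordinal_trans)
  thus False using On mem_irrefl by blast
qed

theorem wellorder: "\<exists>al. ordinal al & lepoll a al"
proof -
  obtain c where c: "\<And>s. s <: powset a ==> ap c s <: succ a & (ap c s <: s \<or> (s = empty & ap c s = a))"
  proof (rule choice[of "%s y. y <: succ a & (y <: s \<or> (s = empty & y = a))" "powset a" "succ a"])
    show "dp UNIV (%e. e 1 <: succ a & (e 1 <: e 0 \<or> (e 0 = empty & e 1 = a)))" by (intro dpi)
    fix s assume s: "s <: powset a"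
    consider "s = empty" | z where "z <: s" using ext_eq_empty[of s] mem_ext by blast
    thus "\<exists>y. y <: succ a & y <: succ a & (y <: s \<or> (s = empty & y = a))"
      by cases (use s in \<open>auto simp: subset_iff\<close>)
  qed (use that in blast)
  let ?F = "exhaust c a"
  define rest where "rest x = coll {z. z <: a & (\<forall>y. y <: x --> z \<noteq> ?F y)}" for x
  have "is_set {z. z <: a & (\<forall>y. y <: x --> z \<noteq> ?F y)}" for x
    by (rule sep) (intro dpi dt_fun2[OF dt_exhaust])
  hence rest: "z <: rest x <-> z <: a & (\<forall>y. y <: x --> z \<noteq> ?F y)" for z x
    unfolding rest_def by (simp add: mem_coll)
  have F: "?F x <: succ a & (?F x <: rest x \<or> (rest x = empty & ?F x = a))" for x
  proof -
    have "rest x <: powset a" using rest by auto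
    moreover have "?F x = ap c (rest x)" unfolding rest_def by (rule exhaust_rec)
    ultimately show ?thesis using c by simp
  qed
  have "?F x \<noteq> ?F y" if "?F x <: a" "y <: x" for x y using F[of x] rest that mem_irrefl by metis
  then obtain al where al: "ordinal al" "?F al = a" using exhaust_stops[of c a] F by metis
  hence "rest al = empty" using F[of al] rest mem_irrefl by metis
  hence "\<exists>y. y <: al & ?F y = z" if "z <: a" for z using rest[of z al] that by auto
  hence "lepoll a al" by (intro lepoll_least[of "%z y. ?F y = z", OF _ al(1)]) (intro dpi dt_fun2[OF dt_exhaust], auto)
  thus ?thesis using al(1) by blast
qed

lemma not_lepoll_powset: "\<not> lepoll (powset k) k"
proof
  assume "lepoll (powset k) k"
  then obtain f where f: "inj_fn f (powset k) k" by (rule lepollE)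
  obtain D where D: "\<And>x. x <: D <-> x <: k & (\<forall>s. s <: powset k & ap f s = x --> \<not> x <: s)"
    by (rule sepE, erule that, intro dpi)
  have "D <: powset k" using D by auto
  thus False using D[of "ap f D"] inj_fnD(3, 4)[OF f] by metis
qed

lemma hartogs: "\<exists>h. ordinal h & \<not> lepoll h k"
  using wellorder[of "powset k"] not_lepoll_powset lepoll_trans by blast

lemma csucc_props:
  assumes k: "ordinal k"
  shows "cardinal (csucc k)" "k <: csucc k" "b <: csucc k ==> lepoll b k" "\<not> lepoll (csucc k) k"
proof -
  obtain l where "ordinal l" "\<not> lepoll l k" using hartogs by blast
  then obtain h where h: "ordinal h" "\<not> lepoll h k" "\<And>c. c <: h ==> lepoll c k"
    using least_ordinal[of l "%h. \<not> lepoll h k"] by metis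
  have card: "cardinal h" unfolding cardinal_def using h equinum_iff lepoll_trans by blast
  have kh: "k <: h" using ordinal_linear[OF k h(1)] h lepoll_ordinal[OF k] lepoll_refl by blast
  have "csucc k = h" by (rule csuccI[OF card kh h(3)])
  thus "cardinal (csucc k)" "k <: csucc k" "b <: csucc k ==> lepoll b k" "\<not> lepoll (csucc k) k"
    using card kh h by auto
qed

subsection \<open>Cardinal arithmetic\<close>

lemma lepoll_pow_seq:
  assumes "lepoll (cprod a omega) a"
  shows "lepoll (funs omega (powset a)) (powset a)"
proof -
  obtain h where h: "inj_fn h (cprod a omega) a" using assms by (rule lepollE)
  define R where "R f s <->
      (\<forall>z. z <: s <-> (\<exists>x n. n <: omega & x <: ap f n & x <: a & z = ap h (pair x n)))" for f s
  have sub: "x <: ap f' n" if f: "f <: funs omega (powset a)" "R f s" "R f' s" and x: "x <: ap f n" "n <: omega"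
    for f f' s n x
  proof -
    have xa: "x <: a" using f(1) x by (auto simp: fn_ap subset_iff)
    hence "ap h (pair x n) <: s" using f(2) x unfolding R_def by blast
    then obtain y m where "m <: omega" "y <: ap f' m" "y <: a" "ap h (pair x n) = ap h (pair y m)"
      using f(3) unfolding R_def by blast
    thus ?thesis using inj_fnD(4)[OF h, of "pair x n" "pair y m"] xa x(2) by auto
  qed
  show ?thesis
  proof (rule lepoll_rel[of R])
    show "dp UNIV (%e. R (e 0) (e 1))" unfolding R_def by (intro dpi)
    fix f
    obtain s where "\<And>z. z <: s <-> z <: a & (\<exists>x n. n <: omega & x <: ap f n & x <: a &
        z = ap h (pair x n))"
      by (rule sepE, erule that, intro dpi)
    thus "\<exists>s. s <: powset a & R f s" unfolding R_def using inj_fnD(3)[OF h] by (intro exI[of _ s]) auto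
  next
    fix f s s' assume "R f s" "R f s'" thus "s = s'" unfolding R_def by (intro set_eqI) blast
  next
    fix f f' s assume f: "f <: funs omega (powset a)" "f' <: funs omega (powset a)" and R: "R f s" "R f' s"
    have "ap f n = ap f' n" if "n <: omega" for n
      by (rule set_eqI) (use sub[OF f(1) R] sub[OF f(2) R(2, 1)] that in blast)
    thus "f = f'" using fn_eqI f unfolding mem_funs by blast
  qed
qed

lemma lepoll_square:
  assumes "lepoll (funs omega b) b"
  shows "lepoll (cprod b b) b"
proof (rule lepoll_trans[OF _ assms])
  let ?R = "%z f. \<exists>x y. z = pair x y & ap f (num 0) = x & (\<forall>n. n <: omega & n \<noteq> num 0 -->
      ap f n = y)"
  show "lepoll (cprod b b) (funs omega b)"
  proof (rule lepoll_rel[of ?R])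
    fix z assume "z <: cprod b b"
    then obtain x y where z: "z = pair x y" "x <: b" "y <: b" by (auto simp: mem_cprod)
    let ?f = "lam omega (%n. if n = num 0 then x else y)"
    have d: "dt UNIV (%e. if e 0 = num 0 then x else y)" by (intro dpi)
    have val: "(if n = num 0 then x else y) <: b" for n using z by auto
    from fn_lam[OF d val] lam_fn(2)[OF d val] show "\<exists>f. f <: funs omega b & ?R z f"
      using z num_omega[of 0] by (intro exI[of _ ?f]) auto
  next
    fix z f f' assume h: "f <: funs omega b" "f' <: funs omega b" "?R z f" "?R z f'"
    show "f = f'" by (rule fn_eqI[of _ omega b _ b]) (use h in \<open>auto, metis\<close>)
  next
    fix z z' f assume "?R z f" "?R z' f"
    thus "z = z'" using num_omega[of 1] num_inj[of 1 0] by (metis zero_neq_one)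
  qed (intro dpi)
qed

definition Ctb :: "'v => 'v" where "Ctb b = coll {x. ext x <= ext b & lepoll x omega}"
lemma mem_Ctb: "x <: Ctb b <-> ext x <= ext b & lepoll x omega"
proof -
  have "is_set {x. x <: powset b & lepoll x omega}" by (rule sep) (intro dpi)
  thus ?thesis unfolding Ctb_def by (simp add: mem_coll)
qed

lemma ex_enumeration:
  assumes x: "x <: Ctb b" "x \<noteq> empty" and c: "c <: b"
  obtains f where "fn f omega b" "ap f empty = c" "\<And>y. y <: x <-> (\<exists>n. n <: omega & ap f (succ n) = y)"
proof -
  obtain h where h: "inj_fn h x omega" using x(1) mem_Ctb lepollE by blast
  obtain y0 where y0: "y0 <: x" using x(2) ext_eq_empty[of x] mem_ext by blast
  define R where "R n y <-> (n = empty & y = c) \<or> (\<exists>m. n = succ m & y <: x &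
      (ap h y = m \<or> (\<not> (\<exists>y'. y' <: x & ap h y' = m) & y = y0)))" for n y
  have xb: "y <: b" if "y <: x" for y using that x(1) mem_Ctb by auto
  obtain f where f: "fn f omega b" "\<And>n. n <: omega ==> R n (ap f n)"
  proof (rule fn_rel[of R omega b])
    show "dp UNIV (%e. R (e 0) (e 1))" unfolding R_def by (intro dpi)
    fix n assume "n <: omega"
    then consider "n = empty" | k where "n = succ k" using mem_omega num.simps by (metis nat.exhaust)
    thus "\<exists>y. y <: b & R n y"
    proof cases
      case 1 thus ?thesis using c R_def by blast
    next
      case 2 thus ?thesis using xb y0 unfolding R_def by (cases "\<exists>y. y <: x & ap h y = k") blast+
    qed
  next
    fix n y y' assume "R n y" "R n y'"
    thus "y = y'" unfolding R_def using inj_fnD(4)[OF h] by (metis succ_ne_empty succ_inject)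
  qed (use that in blast)
  have step: "R (succ n) (ap f (succ n))" if n: "n <: omega" for n
  proof -
    obtain k where "n = num k" using n mem_omega by blast
    thus ?thesis using f(2)[of "num (Suc k)"] num_omega[of "Suc k"] by simp
  qed
  have "\<exists>n. n <: omega & ap f (succ n) = y" if y: "y <: x" for y
  proof -
    have "R (succ (ap h y)) (ap f (succ (ap h y)))" using step inj_fnD(3)[OF h y] by blast
    thus ?thesis using y inj_fnD(3, 4)[OF h] unfolding R_def by (metis mem_empty mem_succ succ_inject)
  qed
  moreover have "ap f (succ n) <: x" if "n <: omega" for n using step[OF that] unfolding R_def by (metis succ_ne_empty)
  moreover have "ap f empty = c" using f(2)[OF num_omega[of 0]] unfolding R_def by auto
  ultimately show ?thesis using that[OF f(1)] by metis
qed

lemma lepoll_Ctb: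
  assumes "c <: b" "c' <: b" "c \<noteq> c'"
  shows "lepoll (Ctb b) (funs omega b)"
proof -
  let ?R = "%x f. (x = empty & ap f empty = c) \<or>
      (x \<noteq> empty & ap f empty = c' & (\<forall>y. y <: x <-> (\<exists>n. n <: omega & ap f (succ n) = y)))"
  show ?thesis
  proof (rule lepoll_choice[of ?R])
    fix x assume x: "x <: Ctb b"
    show "\<exists>f. f <: funs omega b & ?R x f"
    proof (cases "x = empty")
      case True
      have "dt UNIV (%e. c)" by (intro dpi)
      from fn_lam[OF this] lam_fn(2)[OF this, of omega b] assms(1) num_omega[of 0] show ?thesis
        using True by (intro exI[of _ "lam omega (%n. c)"]) simp
    next
      case False
      thus ?thesis using ex_enumeration[OF x False assms(2)] by (metis mem_funs)
    qed
  next
    fix x x' f assume "?R x f" "?R x' f" thus "x = x'" using assms(3) set_eqI by metis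
  qed (intro dpi)
qed

lemma lepoll_Fin:
  assumes "lepoll (funs omega b) b" "c <: b" "c' <: b" "c \<noteq> c'"
  shows "lepoll (Fin b) b"
proof -
  have "ext (Fin b) <= ext (Ctb b)" using mem_Fin mem_Ctb finite_lepoll_omega by auto
  thus ?thesis using lepoll_Ctb[OF assms(2-4)] assms(1) lepoll_subset lepoll_trans by blast
qed

end

section \<open>Forcing\<close>

locale poset = zfc mem for mem :: "'v => 'v => bool" (infix \<open><:\<close> 50) +
  fixes P :: "'v set" and le :: "'v => 'v => bool" and one :: 'v
  assumes le_refl: "p \<in> P ==> le p p" and le_trans: "le p q ==> le q r ==> le p r"
  and le_in: "le p q ==> p \<in> P" "le p q ==> q \<in> P" and one_in: "one \<in> P" and le_one: "p \<in> P ==>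
      le p one"
begin

abbreviation "FE \<equiv> forces_eq P le"
abbreviation "FM \<equiv> forces_mem P le"
abbreviation "FS \<equiv> forces_subset P le"
abbreviation "ck \<equiv> check one"

definition eq_step :: "('v => 'v => 'v => bool) => 'v => 'v => 'v => bool" where
  "eq_step F p ta sg <-> p \<in> P &
  (\<forall>pf s q. pair pf s <: ta & le q p & le q s --> (\<exists>r rh t. le r q & pair rh t <: sg & le r t &
      F r pf rh)) &
  (\<forall>rh t q. pair rh t <: sg & le q p & le q t --> (\<exists>r pf s. le r q & pair pf s <: ta & le r s &
      F r pf rh))"

lemma eq_step_cong:
  assumes "\<And>r pf rh s t. pair pf s <: ta ==> pair rh t <: sg ==> F r pf rh = F' r pf rh"
  shows "eq_step F p ta sg <-> eq_step F' p ta sg"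
proof -
  have imp: "eq_step F p ta sg --> eq_step F' p ta sg"
    if "\<And>r pf rh s t. pair pf s <: ta ==> pair rh t <: sg ==> F r pf rh --> F' r pf rh" for F F'
    using that unfolding eq_step_def by meson
  show ?thesis using imp[of F F'] imp[of F' F] assms by blast
qed

lemma FE_step: "FE p ta sg <-> eq_step FE p ta sg"
proof
  assume "FE p ta sg" thus "eq_step FE p ta sg"
    by cases (unfold eq_step_def, use le_in in meson)
next
  assume step: "eq_step FE p ta sg"
  show "FE p ta sg"
    by (rule forces_eq.intros) (use step le_in in \<open>unfold eq_step_def, meson\<close>)+
qed

definition hits :: "'v => 'v => 'v => bool" where
  "hits r ta sg <-> (\<exists>rh t. pair rh t <: sg & le r t & FE r ta rh)"

lemma FM_iff: "FM p ta sg <-> (\<forall>q. le q p --> (\<exists>r. le r q & hits r ta sg))"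
  unfolding forces_mem_def hits_def using le_in by meson

lemma FS_iff: "FS p ta sg <-> (\<forall>pf s q. pair pf s <: ta & le q p & le q s --> FM q pf sg)"
  unfolding forces_subset_def using le_in by meson

lemma FE_sym: "FE p ta sg ==> FE p sg ta"
proof (induction rule: forces_eq.induct)
  case (1 p ta sg) thus ?case unfolding FE_step[of p sg ta] eq_step_def using le_in by meson
qed

lemma hits_mono: "FE r ta sg ==> le q r ==> FE q ta sg" "hits r ta sg ==> le q r ==> hits q ta sg"
proof -
  show FE: "FE r ta sg ==> le q r ==> FE q ta sg" for ta sg
    unfolding FE_step[of r] FE_step[of q] eq_step_def using le_trans le_in by meson
  show "hits r ta sg ==> le q r ==> hits q ta sg" unfolding hits_def using FE le_trans by meson
qed

lemmas FE_mono = hits_mono(1)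

lemma FM_mono: "FM p ta sg ==> le q p ==> FM q ta sg"
  unfolding FM_iff using le_trans by meson

lemma FE_iff:
  assumes "p \<in> P"
  shows "FE p ta sg <-> FS p ta sg & FS p sg ta"
proof
  assume FE: "FE p ta sg"
  have "FS p ta sg" if FE: "FE p ta sg" for ta sg unfolding FS_iff FM_iff
  proof (intro allI impI)
    fix pf s q q' assume "pair pf s <: ta & le q p & le q s" "le q' q"
    hence "pair pf s <: ta" "le q' p" "le q' s" using le_trans by blast+
    thus "\<exists>r. le r q' & hits r pf sg" using FE[unfolded FE_step[of p] eq_step_def] unfolding hits_def by meson
  qed
  thus "FS p ta sg & FS p sg ta" using FE FE_sym by blast
next
  assume "FS p ta sg & FS p sg ta"
  hence "pair pf s <: ta ==> le q p ==> le q s ==> \<exists>r. le r q & hits r pf sg"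
    "pair pf s <: sg ==> le q p ==> le q s ==> \<exists>r. le r q & hits r pf ta" for pf s q
    unfolding FS_iff FM_iff using le_refl le_in by meson+
  thus "FE p ta sg" unfolding FE_step[of p] eq_step_def hits_def using assms FE_sym by meson
qed

lemma FE_refl: "p \<in> P ==> FE p ta ta"
proof (induction ta arbitrary: p rule: tc_induct)
  case (step ta)
  have "hits q pf ta" if "pair pf s <: ta" "le q s" for pf s q
    unfolding hits_def using that step.IH[OF pair_tc(1)] le_in by blast
  hence "FS p ta ta" unfolding FS_iff FM_iff using le_trans le_refl le_in by meson
  thus ?case using FE_iff[OF step.prems] by blast
qed

lemma FM_check:
  assumes "FM p ta (ck y)" "p \<in> P"
  obtains r w where "le r p" "w <: y" "FE r ta (ck w)"
  using assms le_refl unfolding FM_iff hits_def mem_check by fastforce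

lemma FS_check_mem:
  assumes "FS p (ck x) ta" "p \<in> P" "w <: x"
  shows "FM p (ck w) ta"
  using assms le_refl le_one one_in unfolding FS_iff mem_check by blast

lemma FE_check: "p \<in> P ==> FE p (ck x) (ck y) <-> x = y"
proof (induction x arbitrary: p y rule: mem_induct)
  case (step x)
  show ?case
  proof
    assume "FE p (ck x) (ck y)"
    hence FS: "FS p (ck x) (ck y)" "FS p (ck y) (ck x)" using FE_iff[OF step.prems] by blast+
    have "z <: y" if z: "z <: x" for z
      using FM_check[OF FS_check_mem[OF FS(1) step.prems z] step.prems] step.IH[OF z] le_in by metis
    moreover have "z <: x" if z: "z <: y" for z
      using FM_check[OF FS_check_mem[OF FS(2) step.prems z] step.prems] step.IH FE_sym le_in by metis
    ultimately show "x = y" by (intro set_eqI) blast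
  qed (use FE_refl step in blast)
qed

lemma FM_check_iff:
  assumes "p \<in> P"
  shows "FM p (ck x) (ck y) <-> x <: y"
proof
  assume "FM p (ck x) (ck y)"
  thus "x <: y" using FM_check[OF _ assms] FE_check le_in by metis
next
  assume "x <: y"
  hence "hits q (ck x) (ck y)" if "q \<in> P" for q
    unfolding hits_def mem_check using that FE_refl le_one by blast
  thus "FM p (ck x) (ck y)" unfolding FM_iff using le_refl le_in by blast
qed

lemma FS_check_iff:
  assumes "p \<in> P"
  shows "FS p (ck x) (ck y) <-> ext x <= ext y"
proof
  assume "FS p (ck x) (ck y)"
  thus "ext x <= ext y" unfolding subset_iff mem_ext using FS_check_mem[OF _ assms] FM_check_iff[OF assms] by blast
next
  assume "ext x <= ext y"
  thus "FS p (ck x) (ck y)" unfolding FS_iff mem_check using FM_check_iff le_in by (auto simp: subset_iff)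
qed

lemma FM_dense:
  assumes "\<And>q. le q p ==> \<exists>r. le r q & FM r ta sg"
  shows "FM p ta sg"
  unfolding FM_iff
proof (intro allI impI)
  fix q assume "le q p"
  then obtain r where "le r q" "FM r ta sg" using assms by blast
  thus "\<exists>r. le r q & hits r ta sg" using le_refl le_in le_trans unfolding FM_iff by meson
qed

lemma FE_dense:
  assumes "p \<in> P" "\<And>q. le q p ==> \<exists>r. le r q & FE r ta sg"
  shows "FE p ta sg"
proof -
  have FS: "FS p ta sg" if dense: "\<And>q. le q p ==> \<exists>r. le r q & FE r ta sg" for ta sg unfolding FS_iff
  proof (intro allI impI FM_dense)
    fix pf s q q' assume h: "pair pf s <: ta & le q p & le q s" "le q' q"
    then obtain r where r: "le r q'" "FE r ta sg" using dense le_trans by meson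
    hence "FS r ta sg" "le r r" "le r s" using FE_iff le_in le_refl le_trans h by meson+
    thus "\<exists>r. le r q' & FM r pf sg" using r(1) h unfolding FS_iff by blast
  qed
  show ?thesis using FS[OF assms(2)] FS[of sg ta] assms FE_sym FE_iff by meson
qed

primrec forces :: "fm => 'v => (nat => 'v) => bool" where
  "forces (Mem i j) p e = FM p (e i) (e j)"
  | "forces (Eql i j) p e = FE p (e i) (e j)"
  | "forces (Neg ph) p e = (\<forall>q. le q p --> \<not> forces ph q e)"
  | "forces (Conj ph ps) p e = (forces ph p e & forces ps p e)"
  | "forces (All i ph) p e = (\<forall>x. forces ph p (e(i := x)))"

lemma forces_mono: "forces ph p e ==> le q p ==> forces ph q e"
proof (induction ph arbitrary: p q e)
  case (Neg ph) thus ?case by (metis forces.simps(3) le_trans)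
next
  case (All i ph) thus ?case by (metis forces.simps(5))
next
  case (Conj ph ps) thus ?case by (metis forces.simps(4))
next
  case (Mem i j) thus ?case using FM_mono by simp
next
  case (Eql i j) thus ?case using FE_mono by simp
qed

lemma forces_dense: "p \<in> P ==> (\<And>q. le q p ==> \<exists>r. le r q & forces ph r e) ==> forces ph p e"
proof (induction ph arbitrary: p e)
  case (Mem i j) thus ?case using FM_dense by auto
next
  case (Eql i j) thus ?case using FE_dense by auto
next
  case (Neg ph)
  show ?case unfolding forces.simps
  proof (intro allI impI notI)
    fix q assume q: "le q p" "forces ph q e"
    then obtain r where r: "le r q" "\<forall>s. le s r --> \<not> forces ph s e" using Neg.prems(2) by auto
    thus False using forces_mono[OF q(2) r(1)] le_refl le_in by blast
  qed
next
  case (Conj ph ps) thus ?case by (metis forces.simps(4))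
next
  case (All i ph)
  show ?case unfolding forces.simps
  proof
    fix x show "forces ph p (e(i := x))" by (rule All.IH[OF All.prems(1)]) (metis All.prems(2) forces.simps(5))
  qed
qed

end

locale forcing = poset mem P le one for mem :: "'v => 'v => bool" (infix \<open><:\<close> 50) and P le one +
  assumes is_set_P: "is_set P" and dp_le0: "dp UNIV (%e. le (e 0) (e 1))"
begin

lemma dp_le [dpi]: "dt UNIV t ==> dt UNIV u ==> dp UNIV (%e. le (t e) (u e))"
  by (rule dp_lift2[where Q = le, OF dp_le0])
lemma mem_coll_P [simp]: "p <: coll P <-> p \<in> P" using mem_coll[OF is_set_P] .
lemma dp_P [dpi]: "dt UNIV t ==> dp UNIV (%e. t e \<in> P)"
  using dp_mem[OF _ dt_const_UNIV[of "coll P"], of t] by simp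

definition eq_conds :: "'v => 'v => 'v" where
  "eq_conds u = wfrec {(y, x). y <: tc x} (%f x. coll {z. z <: cprod (coll P) (tc u) &
  (\<exists>p sg. z = pair p sg & eq_step (%r pf rh. pair r rh <: f pf) p x sg)})"

lemma eq_conds_rec: "eq_conds u x = coll {z. z <: cprod (coll P) (tc u) &
  (\<exists>p sg. z = pair p sg & eq_step (%r pf rh. pair r rh <: eq_conds u pf) p x sg)}"
proof -
  have "eq_step (%r pf rh. pair r rh <: cut (eq_conds u) {(y, x). y <: tc x} x pf) p x sg <->
      eq_step (%r pf rh. pair r rh <: eq_conds u pf) p x sg" for p sg
    by (rule eq_step_cong) (simp add: cut_apply pair_tc(1))
  thus ?thesis unfolding eq_conds_def by (subst wfrec[OF wf_tc]) simp
qed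

lemma dt_eq_conds: "dt UNIV (%e. eq_conds (e 0) (e 1))"
proof (rule dt_recursion[where T = "%u h x. coll {z. z <: cprod (coll P) (tc u) &
  (\<exists>p sg. z = pair p sg & eq_step (%r pf rh. pair r rh <: h pf) p x sg)}", OF _ _ eq_conds_rec])
  have sep: "is_set {z. z <: cprod (coll P) (tc u) & (\<exists>p sg. z = pair p sg &
      eq_step (%r pf rh. pair r rh <: ap g pf) p x sg)}" for u g x
    by (rule sep) (unfold eq_step_def, intro dpi)
  show "dt UNIV (%e. coll {z. z <: cprod (coll P) (tc (e 0)) &
      (\<exists>p sg. z = pair p sg & eq_step (%r pf rh. pair r rh <: ap (e 1) pf) p (e 2) sg)})"
    by (rule dt_coll[OF sep]) (unfold eq_step_def, intro dpi)
next
  fix u x and h h' :: "'v => 'v" assume "\<And>y. y <: tc x ==> h y = h' y"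
  hence "eq_step (%r pf rh. pair r rh <: h pf) p x sg <-> eq_step (%r pf rh. pair r rh <: h' pf) p x sg" for p sg
    by (intro eq_step_cong) (use pair_tc(1) in metis)
  thus "coll {z. z <: cprod (coll P) (tc u) & (\<exists>p sg. z = pair p sg &
      eq_step (%r pf rh. pair r rh <: h pf) p x sg)} =
      coll {z. z <: cprod (coll P) (tc u) & (\<exists>p sg. z = pair p sg &
          eq_step (%r pf rh. pair r rh <: h' pf) p x sg)}" by simp
qed

lemma mem_eq_conds: "pair p sg <: eq_conds u x <-> p \<in> P & sg <: tc u &
    eq_step (%r pf rh. pair r rh <: eq_conds u pf) p x sg"
proof -
  have "is_set {z. z <: cprod (coll P) (tc u) & (\<exists>p sg. z = pair p sg &
      eq_step (%r pf rh. pair r rh <: eq_conds u pf) p x sg)}"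
    by (rule sep) (unfold eq_step_def, intro dpi dt_fun2[OF dt_eq_conds])
  from mem_coll[OF this] show ?thesis by (subst eq_conds_rec) auto
qed

lemma FE_eq_conds: "sg <: tc u ==> FE p ta sg <-> pair p sg <: eq_conds u ta"
proof (induction ta arbitrary: p sg rule: tc_induct)
  case (step ta)
  have "eq_step FE p ta sg <-> eq_step (%r pf rh. pair r rh <: eq_conds u pf) p ta sg"
    by (rule eq_step_cong) (use step pair_tc(1) tc_mono in blast)
  thus ?case using FE_step[of p ta sg] mem_eq_conds[of p sg u ta] step.prems by (auto simp: eq_step_def)
qed

lemma dp_FE [dpi]: "dt UNIV t ==> dt UNIV u ==> dt UNIV v ==> dp UNIV (%e. FE (t e) (u e) (v e))"
proof (rule dp_lift3[where Q = FE])
  have "FE p ta sg <-> pair p sg <: eq_conds (coll {sg}) ta" for p ta sg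
    by (rule FE_eq_conds) (simp add: tc_self mem_coll_sing)
  thus "dp UNIV (%e. FE (e 0) (e 1) (e 2))" by (simp only:) (intro dpi dt_fun2[OF dt_eq_conds])
qed

lemma dp_hits [dpi]: "dt UNIV t ==> dt UNIV u ==> dt UNIV v ==> dp UNIV (%e. hits (t e) (u e) (v e))"
  by (rule dp_lift3[where Q = hits]) (unfold hits_def, intro dpi)
lemma dp_FM [dpi]: "dt UNIV t ==> dt UNIV u ==> dt UNIV v ==> dp UNIV (%e. FM (t e) (u e) (v e))"
  by (rule dp_lift3[where Q = FM]) (unfold FM_iff, intro dpi)

lemma dp_forces0: "dp UNIV (%e. forces ph (e 0) (%n. e (Suc n)))"
proof (induction ph)
  case (Neg ph)
  have "dp UNIV (%e. forces ph (e 0) (%n. e (Suc (Suc n))))"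
    using dp_reindex[OF Neg, of "case_nat 0 (%n. Suc (Suc n))"] by simp
  thus ?case unfolding forces.simps by (intro dpi)
next
  case (All i ph)
  have "dp UNIV (%e. forces ph (e (Suc 0)) ((%n. e (Suc (Suc n)))(i := e 0)))"
    using dp_reindex[OF All, of "case_nat (Suc 0) (%n. if n = i then 0 else Suc (Suc n))"]
      by (simp add: fun_upd_def if_distrib)
  thus ?case unfolding forces.simps by (intro dpi)
next
  case (Conj ph ps) thus ?case unfolding forces.simps by (intro dp_conj)
next
  case (Eql i j) show ?case unfolding forces.simps by (intro dpi)
next
  case (Mem i j) show ?case unfolding forces.simps by (intro dpi)
qed

lemma dp_forces:
  assumes "dt UNIV t" "\<And>n. dt UNIV (%e. s e n)"
  shows "dp UNIV (%e. forces ph (t e) (s e))"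
proof -
  have "dt UNIV (case_nat t (%n e. s e n) n)" for n using assms by (cases n) auto
  from dp_env[OF dp_forces0, of "case_nat t (%n e. s e n)" ph, OF this] show ?thesis by simp
qed

end

subsection \<open>The generic extension\<close>

locale generic_ext = forcing mem P le one for mem :: "'v => 'v => bool" (infix \<open><:\<close> 50) and P le one +
  fixes G :: "'v set" and memW :: "'w => 'w => bool" and val :: "'v => 'w"
  assumes filter: "generic_filter P le G" and extension: "generic_extension mem G memW val"
begin

interpretation W: set_struct memW .

lemma G_P: "p \<in> G ==> p \<in> P" and G_dir: "p \<in> G ==> q \<in> G ==> \<exists>r\<in>G. le r p & le r q"
  using filter unfolding generic_filter_def by blast+
lemma G_up:
  assumes "p \<in> G" "le p q"
  shows "q \<in> G"
proof -
  have "\<forall>p\<in>G. \<forall>q\<in>P. le p q --> q \<in> G" using filter unfolding generic_filter_def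
    by (elim conjE)
  thus ?thesis using assms le_in(2) by blast
qed

lemma G_one: "one \<in> G"
proof -
  have "G \<noteq> {}" using filter unfolding generic_filter_def by (elim conjE)
  thus ?thesis using G_up le_one G_P by blast
qed

lemma G_meets:
  assumes "dp UNIV (%e. D (e 0))" "\<And>p. p \<in> P ==> \<exists>q. le q p & D q"
  shows "\<exists>p\<in>G. D p"
proof -
  obtain d where d: "\<And>p. p <: d <-> p <: coll P & D p" by (rule sepE, erule that, rule assms(1))
  have "ext d <= P" by (simp add: subset_iff d)
  moreover have "\<forall>p\<in>P. \<exists>q\<in>ext d. le q p"
    unfolding Bex_def mem_ext d mem_coll_P using assms(2) le_in(1) by metis
  moreover have "\<forall>d. ext d <= P & (\<forall>p\<in>P. \<exists>q\<in>ext d. le q p) -->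
      G \<inter> ext d \<noteq> {}"
    using filter unfolding generic_filter_def by (elim conjE)
  ultimately have "G \<inter> ext d \<noteq> {}" by blast
  thus ?thesis using d by auto
qed

lemma G_meets_below:
  assumes D: "dp UNIV (%e. D (e 0))" and p: "p \<in> G" and dense: "\<And>q. le q p ==> \<exists>r. le r q & D r"
  shows "\<exists>r\<in>G. le r p & D r"
proof -
  have "\<exists>r\<in>G. (le r p & D r) \<or> \<not> (\<exists>u. le u r & le u p)"
  proof (rule G_meets)
    show "dp UNIV (%e. (le (e 0) p & D (e 0)) \<or> \<not> (\<exists>u. le u (e 0) & le u p))" by (intro dpi D)
    fix r assume r: "r \<in> P"
    show "\<exists>q. le q r & ((le q p & D q) \<or> \<not> (\<exists>u. le u q & le u p))"
    proof (cases "\<exists>u. le u r & le u p")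
      case True
      then obtain u where u: "le u r" "le u p" by blast
      then obtain q where "le q u" "D q" using dense by blast
      thus ?thesis using u le_trans by blast
    qed (use r le_refl in blast)
  qed
  thus ?thesis using G_dir p by blast
qed

lemma W_ext_inj: "W.ext a = W.ext b ==> a = b" using extension
  unfolding generic_extension_def W.extensional_def by blast
lemma val_surj: "\<exists>ta. x = val ta" using extension
  unfolding generic_extension_def by (metis surj_def)
lemma ext_val: "W.ext (val ta) = {val sg | sg. \<exists>p\<in>G. pair sg p <: ta}" using extension
  unfolding generic_extension_def by blast
lemma mem_val: "memW x (val ta) <-> (\<exists>sg p. p \<in> G & pair sg p <: ta & x = val sg)"
  using ext_val[of ta] by (auto simp flip: W.mem_ext)

lemma W_wf: "wfp memW"
proof -
  have "Wellfounded.accp memW (val ta)" for ta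
  proof (induction ta rule: tc_induct)
    case (step ta)
    show ?case
    proof (rule accp.intros)
      fix y assume "memW y (val ta)"
      then obtain sg p where "pair sg p <: ta" "y = val sg" unfolding mem_val by auto
      thus "Wellfounded.accp memW y" using step pair_tc(1) by blast
    qed
  qed
  thus ?thesis using val_surj by (metis accp_wfpI)
qed

lemma G_hits:
  assumes "p \<in> G" "FM p ta sg"
  shows "\<exists>r\<in>G. hits r ta sg"
proof -
  have "\<exists>r\<in>G. le r p & hits r ta sg"
  proof (rule G_meets_below[OF _ assms(1)])
    show "dp UNIV (%e. hits (e 0) ta sg)" by (intro dpi)
  qed (use assms(2) FM_iff in blast)
  thus ?thesis by blast
qed

lemma FM_sound:
  assumes sound: "\<And>q rh. q \<in> G ==> FE q pf rh ==> val pf = val rh" and "p \<in> G" "FM p pf sg"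
  shows "memW (val pf) (val sg)"
proof -
  obtain r rh t where r: "r \<in> G" "pair rh t <: sg" "le r t" "FE r pf rh" using G_hits[OF assms(2, 3)] hits_def
    by blast
  thus ?thesis using sound[OF r(1, 4)] G_up mem_val by metis
qed

lemma FE_sound: "p \<in> G ==> FE p ta sg ==> val ta = val sg"
proof (induction ta arbitrary: p sg rule: tc_induct)
  case (step ta)
  have FM: "\<exists>q\<in>G. FM q pf sg'" if "FS p ta' sg'" "s \<in> G" "pair pf s <: ta'" for ta' sg' pf s
    using that G_dir[OF step.prems(1)] unfolding FS_iff by blast
  have FS: "FS p ta sg" "FS p sg ta" using FE_iff step.prems G_P by blast+
  have "memW x (val sg)" if x: "memW x (val ta)" for x
  proof -
    obtain pf s where h: "s \<in> G" "pair pf s <: ta" "x = val pf" using x mem_val by blast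
    show ?thesis unfolding h(3) using FM[OF FS(1) h(1, 2)] FM_sound step.IH[OF pair_tc(1)[OF h(2)]] by blast
  qed
  moreover have "memW x (val ta)" if x: "memW x (val sg)" for x
  proof -
    obtain rh s where h: "s \<in> G" "pair rh s <: sg" "x = val rh" using x mem_val by blast
    obtain q where q: "q \<in> G" "FM q rh ta" using FM[OF FS(2) h(1, 2)] by blast
    obtain r where r: "r \<in> G" "hits r rh ta" using G_hits q by blast
    then obtain pf t where t: "pair pf t <: ta" "le r t" "FE r rh pf" unfolding hits_def by blast
    hence "val pf = val rh" using step.IH[OF pair_tc(1)] FE_sym r(1) by blast
    thus ?thesis unfolding h(3) mem_val using G_up r(1) t by metis
  qed
  ultimately show ?case by (intro W_ext_inj) auto
qed

definition excludes :: "'v => 'v => 'v => bool" where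
  "excludes p ta sg <-> (\<exists>pf s. pair pf s <: ta & le p s & (\<forall>r. le r p --> \<not> hits r pf sg))"

lemma FE_or_excludes: "\<exists>p\<in>G. FE p ta sg \<or> excludes p ta sg \<or> excludes p sg ta"
proof (rule G_meets)
  show "dp UNIV (%e. FE (e 0) ta sg \<or> excludes (e 0) ta sg \<or> excludes (e 0) sg ta)"
    unfolding excludes_def by (intro dpi)
  fix p assume p: "p \<in> P"
  have excl: "\<exists>q. le q p & excludes q ta sg" if not_FS: "\<not> FS p ta sg" for ta sg
  proof -
    obtain pf s q q' where q: "pair pf s <: ta" "le q p" "le q s" "le q' q" "\<forall>r. le r q' -->
        \<not> hits r pf sg"
      using not_FS unfolding FS_iff FM_iff by blast
    thus ?thesis unfolding excludes_def using le_trans by blast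
  qed
  show "\<exists>q. le q p & (FE q ta sg \<or> excludes q ta sg \<or> excludes q sg ta)"
    using excl[of ta sg] excl[of sg ta] FE_iff[OF p] le_refl[OF p] by blast
qed

lemma not_excludes:
  assumes eq: "val ta = val sg" and p: "p \<in> G"
  and complete: "\<And>pf s rh t. pair pf s <: ta ==> pair rh t <: sg ==> val pf = val rh ==>
      \<exists>p\<in>G. FE p pf rh"
  shows "\<not> excludes p ta sg"
proof
  assume "excludes p ta sg"
  then obtain pf s where h: "pair pf s <: ta" "le p s" "\<forall>r. le r p --> \<not> hits r pf sg"
    unfolding excludes_def by blast
  hence "memW (val pf) (val sg)" using p G_up mem_val eq by metis
  then obtain rh t where t: "t \<in> G" "pair rh t <: sg" "val pf = val rh" using mem_val by blast
  then obtain q where q: "q \<in> G" "FE q pf rh" using complete[OF h(1)] by blast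
  obtain u where u: "u \<in> G" "le u p" "le u t" using G_dir p t by blast
  obtain v where "v \<in> G" "le v u" "le v q" using G_dir u q by blast
  thus False using h(3) u t q FE_mono le_trans unfolding hits_def by meson
qed

lemma FE_complete: "val ta = val sg ==> \<exists>p\<in>G. FE p ta sg"
proof (induction ta arbitrary: sg rule: tc_induct)
  case (step ta)
  obtain p where p: "p \<in> G" "FE p ta sg \<or> excludes p ta sg \<or> excludes p sg ta" using FE_or_excludes by blast
  have IH: "\<exists>q\<in>G. FE q pf rh" if "pair pf s <: ta" "val pf = val rh" for pf s rh
    using step.IH that pair_tc(1) by blast
  have "\<not> excludes p ta sg" by (rule not_excludes[OF step.prems p(1)]) (rule IH)
  moreover have "\<not> excludes p sg ta"
    by (rule not_excludes[OF step.prems[symmetric] p(1)]) (use IH FE_sym in metis)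
  ultimately show ?case using p by blast
qed

lemma FM_truth: "memW (val ta) (val sg) <-> (\<exists>p\<in>G. FM p ta sg)"
proof
  assume "memW (val ta) (val sg)"
  then obtain rh t where t: "t \<in> G" "pair rh t <: sg" "val ta = val rh" using mem_val by blast
  then obtain q where q: "q \<in> G" "FE q ta rh" using FE_complete by blast
  obtain u where u: "u \<in> G" "le u q" "le u t" using G_dir q t by blast
  have "hits v ta sg" if "le v u" for v unfolding hits_def using that u t q FE_mono le_trans by meson
  hence "FM u ta sg" unfolding FM_iff using le_refl le_in by meson
  thus "\<exists>p\<in>G. FM p ta sg" using u by blast
qed (use FM_sound FE_sound in blast)

lemma forces_Neg_consistent:
  assumes "p \<in> G" "q \<in> G" "forces ph p e"
  shows "\<not> forces (Neg ph) q e"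
  using G_dir[OF assms(1, 2)] forces_mono assms(3) forces.simps(3) by meson

lemma forces_All_truth: "(\<exists>p\<in>G. forces (All i ph) p e) <->
    (\<forall>sg. \<exists>p\<in>G. forces ph p (e(i := sg)))"
proof
  assume instances: "\<forall>sg. \<exists>p\<in>G. forces ph p (e(i := sg))"
  have "\<exists>p\<in>G. forces (All i ph) p e \<or> (\<exists>sg. forces (Neg ph) p (e(i := sg)))"
  proof (rule G_meets)
    show "dp UNIV (%e'. forces (All i ph) (e' 0) e \<or> (\<exists>sg. forces (Neg ph) (e' 0) (e(i := sg))))"
      by (intro dp_disj dp_ex dp_forces dpi) (unfold fun_upd_def, intro dpi)
    fix p assume p: "p \<in> P"
    show "\<exists>q. le q p & (forces (All i ph) q e \<or> (\<exists>sg. forces (Neg ph) q (e(i := sg))))"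
    proof (cases "forces (All i ph) p e")
      case False
      then obtain sg where "\<not> forces ph p (e(i := sg))" by auto
      then obtain q where "le q p" "\<forall>r. le r q --> \<not> forces ph r (e(i := sg))" using forces_dense[OF p]
        by meson
      thus ?thesis by auto
    qed (use p le_refl in blast)
  qed
  thus "\<exists>p\<in>G. forces (All i ph) p e" using instances forces_Neg_consistent by blast
qed auto

theorem truth: "W.sat (%n. val (e n)) ph <-> (\<exists>p\<in>G. forces ph p e)"
proof (induction ph arbitrary: e)
  case (Mem i j) thus ?case using FM_truth by simp
next
  case (Eql i j) thus ?case using FE_sound FE_complete by auto
next
  case (Neg ph)
  have "\<exists>p\<in>G. forces ph p e \<or> forces (Neg ph) p e"
    by (rule G_meets) (intro dpi dp_forces, metis forces.simps(3) le_in(2) le_refl)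
  thus ?case using Neg forces_Neg_consistent by (auto; blast)
next
  case (Conj ph ps)
  have "\<exists>r\<in>G. forces ph r e & forces ps r e" if "p \<in> G" "q \<in> G" "forces ph p e" "forces ps q e"
    for p q
    using G_dir[OF that(1, 2)] forces_mono that by blast
  thus ?case using Conj by auto
next
  case (All i ph)
  have upd: "(%n. val (e n))(i := val sg) = (%n. val ((e(i := sg)) n))" for sg by auto
  have "W.sat (%n. val (e n)) (All i ph) <-> (\<forall>sg. W.sat (%n. val ((e(i := sg)) n)) ph)"
    unfolding upd[symmetric] using val_surj by (metis W.sat.simps(5))
  thus ?case unfolding All forces_All_truth .
qed

lemma val_env: "\<exists>en. e = (%n. val (en n))" using val_surj
  by (metis fun_eq_iff)

lemma W_sep: "\<exists>b. W.ext b = {x. memW x a & W.sat (e(0 := x)) ph}"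
proof -
  obtain ta where ta: "a = val ta" using val_surj by blast
  obtain en where en: "e = (%n. val (en n))" using val_env by blast
  have upd: "e(0 := val sg) = (%n. val ((en(0 := sg)) n))" for sg using en by auto
  obtain b where b: "\<And>z. z <: b <-> z <: cprod (tc ta) (coll P) &
      (\<exists>sg p. z = pair sg p & FM p sg ta & forces ph p (en(0 := sg)))"
    by (rule sepE, erule that, intro dpi dp_forces, unfold fun_upd_def, intro dpi)
  have "memW x (val b) <-> memW x a & W.sat (e(0 := x)) ph" for x
  proof
    assume "memW x (val b)"
    then obtain sg p where "p \<in> G" "x = val sg" "FM p sg ta" "forces ph p (en(0 := sg))" unfolding mem_val b by auto
    thus "memW x a & W.sat (e(0 := x)) ph" unfolding ta using FM_truth truth upd by metis
  next
    assume h: "memW x a & W.sat (e(0 := x)) ph"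
    then obtain sg s where s: "s \<in> G" "pair sg s <: ta" "x = val sg" unfolding ta mem_val by blast
    obtain p where p: "p \<in> G" "FM p sg ta" using h FM_truth unfolding ta s(3) by blast
    obtain q where q: "q \<in> G" "forces ph q (en(0 := sg))" using h unfolding s(3) upd truth by blast
    obtain r where r: "r \<in> G" "le r p" "le r q" using G_dir p q by blast
    have "pair sg r <: b" unfolding b using r p q FM_mono forces_mono pair_tc(1)[OF s(2)] G_P by auto
    thus "memW x (val b)" unfolding mem_val using r s by blast
  qed
  hence "W.ext (val b) = {x. memW x a & W.sat (e(0 := x)) ph}" unfolding W.ext_def by (rule Collect_cong)
  thus ?thesis by blast
qed

lemma W_bound:
  obtains b where "\<And>x. memW x b <-> (\<exists>ta. ta <: t & x = val ta)"
  using that[of "val (cprod t (coll {one}))"] G_one unfolding mem_val by (auto simp: mem_cprod mem_coll_sing)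

lemma W_pairing: "\<exists>c. W.ext c = {a, b}"
proof -
  obtain ta sg where t: "a = val ta" "b = val sg" using val_surj by meson
  obtain c where "\<And>x. memW x c <-> (\<exists>rh. rh <: coll {ta, sg} & x = val rh)" by (rule W_bound, erule that)
  hence "W.ext c = {a, b}" unfolding t by (auto simp: mem_coll_upair)
  thus ?thesis by blast
qed

lemma W_union: "\<exists>u. W.ext u = {x. \<exists>y. memW x y & memW y a}"
proof -
  obtain ta where t: "a = val ta" using val_surj by blast
  obtain B where B: "\<And>x. memW x B <-> (\<exists>rh. rh <: tc ta & x = val rh)" by (rule W_bound, erule that)
  obtain u where u: "W.ext u = {x. memW x B & W.sat ((%_. a)(0 := x)) (Neg (All 1 (Neg (Conj (Mem 0 1) (Mem 1 2)))))}"
    using W_sep by blast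
  have "memW x B" if xy: "memW x y" "memW y a" for x y
  proof -
    obtain sg p where sg: "pair sg p <: ta" "y = val sg" using xy(2) t mem_val by blast
    then obtain rh q where "pair rh q <: sg" "x = val rh" using xy(1) mem_val by blast
    thus ?thesis unfolding B using pair_tc(1) tc_mono sg(1) by blast
  qed
  hence "W.ext u = {x. \<exists>y. memW x y & memW y a}" unfolding u by auto
  thus ?thesis by blast
qed

lemma W_subset_name:
  assumes "W.ext x <= W.ext (val ta)"
  obtains b where "x = val b" "b <: powset (cprod (tc ta) (coll P))"
proof -
  obtain sg where s: "x = val sg" using val_surj by blast
  obtain b where b: "\<And>z. z <: b <-> z <: cprod (tc ta) (coll P) & (\<exists>rh p. z = pair rh p & FM p rh sg)"
    by (rule sepE, erule that, intro dpi)
  have "memW y (val b) <-> memW y x" for y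
  proof
    assume "memW y (val b)"
    thus "memW y x" unfolding mem_val[of y b] b s using FM_truth by auto
  next
    assume y: "memW y x"
    hence "memW y (val ta)" using assms by auto
    then obtain rh q where r: "pair rh q <: ta" "y = val rh" using mem_val by blast
    obtain p where "p \<in> G" "FM p rh sg" using y FM_truth unfolding s r(2) by blast
    thus "memW y (val b)" unfolding mem_val b using pair_tc(1)[OF r(1)] r(2) G_P by auto
  qed
  hence "x = val b" by (intro W_ext_inj) auto
  moreover have "b <: powset (cprod (tc ta) (coll P))" using b by auto
  ultimately show ?thesis by (rule that)
qed

lemma W_power: "\<exists>b. W.ext b = {x. W.ext x <= W.ext a}"
proof -
  obtain ta where t: "a = val ta" using val_surj by blast
  obtain C where C: "\<And>x. memW x C <-> (\<exists>b. b <: powset (cprod (tc ta) (coll P)) & x = val b)"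
    by (rule W_bound, erule that)
  obtain u where u: "W.ext u = {x. memW x C & W.sat ((%_. a)(0 := x)) (All 1 (Neg (Conj (Mem 1 0) (Neg (Mem 1 2)))))}"
    using W_sep by blast
  have "memW x C" if "W.ext x <= W.ext a" for x using W_subset_name C that t by metis
  hence "W.ext u = {x. W.ext x <= W.ext a}" unfolding u by auto
  thus ?thesis by blast
qed

definition emb :: "'v => 'w" where "emb x = val (ck x)"

lemma mem_emb: "memW y (emb x) <-> (\<exists>z. z <: x & y = emb z)"
  unfolding emb_def mem_val mem_check using G_one by auto
lemma ext_emb: "W.ext (emb x) = emb ` ext x" using mem_emb
  by auto

lemma W_infinity: "\<exists>w. memW W.empty w & (\<forall>x. memW x w --> memW (W.succ x) w)"
proof -
  have coll: "W.coll S = a" if "W.ext a = S" for a S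
    unfolding W.coll_def by (rule the_equality) (use that W_ext_inj in auto)
  have empty: "W.empty = emb empty" unfolding W.empty_def by (rule coll) (simp add: ext_emb)
  have succ: "W.succ (emb x) = emb (succ x)" for x
    unfolding W.succ_def by (rule coll) (simp add: ext_emb ext_succ)
  have "memW W.empty (emb omega)" unfolding empty mem_emb using num_omega[of 0] by auto
  moreover have "memW (W.succ x) (emb omega)" if "memW x (emb omega)" for x
    using that succ unfolding mem_emb mem_omega by (metis num.simps(2))
  ultimately show ?thesis by blast
qed

end

sublocale generic_ext \<subseteq> W: zermelo memW
  using W_wf W_ext_inj W_pairing W_union W_power W_infinity W_sep by (rule zermelo.intro)

subsection \<open>Homogeneity and semantic forcing\<close>

context generic_ext
begin

definition generic :: "'v set => ('v => 'w) => bool" where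
  "generic H v <-> generic_filter P le H & generic_extension mem H memW v"

lemma generic_self: "generic G val" using filter extension
  by (simp add: generic_def)
lemma generic_ext: "generic H v ==> generic_ext mem P le one H memW v"
  using forcing_axioms by (auto simp: generic_def generic_ext_def generic_ext_axioms_def)

lemma val_ck: "generic H v ==> v (ck x) = emb x"
proof (induction x rule: mem_induct)
  case (step x)
  interpret H: generic_ext mem P le one H memW v by (rule generic_ext[OF step.prems])
  have "W.ext (v (ck x)) = W.ext (emb x)"
    unfolding H.emb_def[symmetric] H.ext_emb ext_emb
      by (rule image_cong) (use step in \<open>auto simp: H.emb_def\<close>)
  thus ?case by (rule W_ext_inj)
qed

definition name_image :: "'v => 'v => 'v" where
  "name_image u = wfrec {(y, x). y <: tc x} (%f x. coll {z. \<exists>sg p. pair sg p <: x & p \<in> P &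
      z = pair (f sg) (ap u p)})"

lemma name_image_rec: "name_image u x = coll {z. \<exists>sg p. pair sg p <: x & p \<in> P &
    z = pair (name_image u sg) (ap u p)}"
proof -
  have "{z. \<exists>sg p. pair sg p <: x & p \<in> P &
      z = pair (cut (name_image u) {(y, x). y <: tc x} x sg) (ap u p)} =
      {z. \<exists>sg p. pair sg p <: x & p \<in> P & z = pair (name_image u sg) (ap u p)}"
    using pair_tc(1)[of _ _ x] by (intro Collect_cong ex_cong1) (auto simp: cut_apply)
  thus ?thesis unfolding name_image_def by (subst wfrec[OF wf_tc]) simp
qed

lemma is_set_name_image:
  assumes "dt UNIV (%e. f (e 0))"
  shows "is_set {z. \<exists>sg p. pair sg p <: x & p \<in> P & z = pair (f sg) (ap u p)}"
proof -
  have "is_set {z. \<exists>w. w <: x & (\<exists>sg p. w = pair sg p & p \<in> P & z = pair (f sg) (ap u p))}"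
    by (rule rep) (intro dpi dt_fun1[OF assms], auto)
  moreover have "{z. \<exists>w. w <: x & (\<exists>sg p. w = pair sg p & p \<in> P & z = pair (f sg) (ap u p))} =
      {z. \<exists>sg p. pair sg p <: x & p \<in> P & z = pair (f sg) (ap u p)}" by blast
  ultimately show ?thesis by simp
qed

lemma dt_name_image: "dt UNIV (%e. name_image (e 0) (e 1))"
proof (rule dt_recursion[where T = "%u h x. coll {z. \<exists>sg p. pair sg p <: x & p \<in> P &
    z = pair (h sg) (ap u p)}", OF _ _ name_image_rec])
  have "is_set {z. \<exists>sg p. pair sg p <: x & p \<in> P & z = pair (ap g sg) (ap u p)}" for u x g
    by (rule is_set_name_image) (intro dpi)
  thus "dt UNIV (%e. coll {z. \<exists>sg p. pair sg p <: e 2 & p \<in> P & z = pair (ap (e 1) sg) (ap (e 0) p)})"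
    by (intro dt_coll dpi)
qed (use pair_tc(1) in \<open>simp cong: conj_cong\<close>)

lemma mem_name_image: "z <: name_image u x <->
    (\<exists>sg p. pair sg p <: x & p \<in> P & z = pair (name_image u sg) (ap u p))"
proof -
  have "dt UNIV (%e. name_image u (e 0))" by (rule dt_fun2[OF dt_name_image]) (intro dpi)+
  from mem_coll[OF is_set_name_image[OF this]] show ?thesis by (subst name_image_rec) simp
qed

context
  fixes pf assumes dt_pf: "dt UNIV (%e. pf (e 0))"
  and pf_P: "\<And>p. p \<in> P ==> pf p \<in> P" and pf_pf: "\<And>p. p \<in> P ==> pf (pf p) = p"
  and pf_mono: "\<And>p q. le p q ==> le (pf p) (pf q)"
begin

lemma pf_image: "p \<in> pf ` G <-> p \<in> P & pf p \<in> G" using pf_P pf_pf G_P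
  by (auto simp: image_iff) metis

lemma generic_filter_image: "generic_filter P le (pf ` G)" unfolding generic_filter_def
proof (intro conjI ballI allI impI)
  show "pf ` G <= P" "pf ` G \<noteq> {}" using pf_image G_one by auto
  show "q \<in> pf ` G" if "p \<in> pf ` G" "q \<in> P" "le p q" for p q
    using that pf_image pf_mono[OF that(3)] G_up pf_P by blast
  show "\<exists>r\<in>pf ` G. le r p & le r q" if h: "p \<in> pf ` G" "q \<in> pf ` G" for p q
  proof -
    obtain r where r: "r \<in> G" "le r (pf p)" "le r (pf q)" using G_dir[of "pf p" "pf q"] h pf_image by blast
    hence "le (pf r) p" "le (pf r) q" using pf_mono[OF r(2)] pf_mono[OF r(3)] pf_pf h pf_image by auto
    thus ?thesis using r by blast
  qed
  fix d assume D: "ext d <= P & (\<forall>p\<in>P. \<exists>q\<in>ext d. le q p)"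
  have "\<exists>p\<in>G. p \<in> P & pf p <: d"
  proof (rule G_meets)
    show "dp UNIV (%e. e 0 \<in> P & pf (e 0) <: d)" by (intro dpi dt_fun1[OF dt_pf])
    fix p assume p: "p \<in> P"
    then obtain q where q: "q <: d" "le q (pf p)" using D pf_P by (metis mem_ext)
    have "q \<in> P" using D q by auto
    hence "le (pf q) p" "pf (pf q) <: d" "pf q \<in> P" using pf_mono[OF q(2)] pf_P pf_pf p q by auto
    thus "\<exists>q. le q p & q \<in> P & pf q <: d" by blast
  qed
  thus "pf ` G \<inter> ext d \<noteq> {}" by auto
qed

lemma ap_lam_pf: "p \<in> P ==> ap (lam (coll P) pf) p = pf p"
  using func_lam(2)[OF is_set_graph[OF dt_pf], of p "coll P"] by simp

lemma mem_val_image: "memW x (val (name_image (lam (coll P) pf) ta)) <->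
  (\<exists>sg. \<exists>p\<in>pf ` G. pair sg p <: ta & x = val (name_image (lam (coll P) pf) sg))"
proof -
  have "(\<exists>rh p. p \<in> G & pair rh p <: name_image (lam (coll P) pf) ta & x = val rh) <->
      (\<exists>sg p. p \<in> P & pf p \<in> G & pair sg p <: ta & x = val (name_image (lam (coll P) pf) sg))"
    unfolding mem_name_image using ap_lam_pf by (auto, metis+)
  thus ?thesis unfolding mem_val Bex_def pf_image by blast
qed

lemma val_image_image: "val (name_image (lam (coll P) pf) (name_image (lam (coll P) pf) ta)) = val ta"
proof (induction ta rule: tc_induct)
  case (step ta)
  let ?im = "name_image (lam (coll P) pf)"
  have "memW x (val (?im (?im ta))) <-> memW x (val ta)" for x
  proof
    assume "memW x (val (?im (?im ta)))"
    then obtain sg p where p: "p \<in> P" "pf p \<in> G" "pair sg p <: ?im ta" "x = val (?im sg)"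
      unfolding mem_val_image Bex_def pf_image by blast
    then obtain rh q where "q \<in> P" "pair rh q <: ta" "sg = ?im rh" "p = pf q" using mem_name_image ap_lam_pf by auto
    thus "memW x (val ta)" using step pair_tc(1) pf_pf p(2, 4) mem_val by metis
  next
    assume "memW x (val ta)"
    then obtain sg p where h: "p \<in> G" "pair sg p <: ta" "x = val sg" using mem_val by blast
    hence "pair (?im sg) (pf p) <: ?im ta" using mem_name_image G_P ap_lam_pf by metis
    thus "memW x (val (?im (?im ta)))" unfolding mem_val_image using h step pair_tc(1)[OF h(2)] by (metis imageI)
  qed
  thus ?case by (intro W_ext_inj) auto
qed

lemma generic_image: "\<exists>v. generic (pf ` G) v"
proof -
  define v where "v ta = val (name_image (lam (coll P) pf) ta)" for ta
  have "surj v" unfolding v_def surj_def using val_surj val_image_image by metis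
  moreover have "W.ext (v ta) = {v sg | sg. \<exists>p\<in>pf ` G. pair sg p <: ta}" for ta
    unfolding v_def W.ext_def mem_val_image by (rule Collect_cong) blast
  moreover have "W.extensional" using extension generic_extension_def by blast
  ultimately have "generic_extension mem (pf ` G) memW v" unfolding generic_extension_def by auto
  thus ?thesis unfolding generic_def using generic_filter_image by blast
qed

end

definition forced :: "((nat => 'w) => bool) => 'v => (nat => 'v) => bool" where
  "forced R p e <-> (\<forall>H v. generic H v & p \<in> H --> R (%n. v (e n)))"

end

locale homogeneous = generic_ext mem P le one G memW val
  for mem :: "'v => 'v => bool" (infix \<open><:\<close> 50) and P le one G and memW :: "'w => 'w => bool" and val +
  assumes hom: "p \<in> P ==> \<exists>H v. generic H v & p \<in> H"
begin

lemma generic_facts: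
  assumes "generic H v"
  shows "p \<in> H ==> p \<in> P" "p \<in> H ==> le p q ==> q \<in> H" "p \<in> H ==> q \<in> H ==>
      \<exists>r\<in>H. le r p & le r q"
  "memW x (v ta) <-> (\<exists>sg p. p \<in> H & pair sg p <: ta & x = v sg)" "one \<in> H" "\<exists>ta. x = v ta"
proof -
  interpret H: generic_ext mem P le one H memW v by (rule generic_ext[OF assms])
  show "p \<in> H ==> p \<in> P" "p \<in> H ==> le p q ==> q \<in> H" "p \<in> H ==> q \<in> H ==>
      \<exists>r\<in>H. le r p & le r q"
    "memW x (v ta) <-> (\<exists>sg p. p \<in> H & pair sg p <: ta & x = v sg)" "one \<in> H" "\<exists>ta. x = v ta"
    using H.G_P H.G_up H.G_dir H.mem_val H.G_one H.val_surj by blast+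
qed

lemma generic_truth: "generic H v ==> W.sat (%n. v (e n)) ph <-> (\<exists>p\<in>H. forces ph p e)"
  using generic_ext.truth[OF generic_ext] by blast

lemma val_empty: "generic H v ==> v empty = W.empty"
  by (rule W_ext_inj) (use generic_facts(4)[of H v _ empty] in auto)

lemma forces_sem:
  assumes "p \<in> P"
  shows "forces ph p e <-> (\<forall>H v. generic H v & p \<in> H --> W.sat (%n. v (e n)) ph)"
proof
  assume "forces ph p e" thus "\<forall>H v. generic H v & p \<in> H --> W.sat (%n. v (e n)) ph"
    using generic_truth by blast
next
  assume s: "\<forall>H v. generic H v & p \<in> H --> W.sat (%n. v (e n)) ph"
  show "forces ph p e"
  proof (rule ccontr)
    assume "\<not> forces ph p e"
    then obtain q where q: "le q p" "\<forall>r. le r q --> \<not> forces ph r e" using forces_dense[OF assms] by meson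
    hence "forces (Neg ph) q e" by simp
    obtain H v where H: "generic H v" "q \<in> H" using hom q le_in by blast
    hence "W.sat (%n. v (e n)) (Neg ph)" using generic_truth[OF H(1)] \<open>forces (Neg ph) q e\<close> by blast
    thus False using s H q generic_facts(2) by (metis W.sat.simps(3))
  qed
qed

lemma forced_fm:
  assumes "W.dp {} R"
  obtains ph where "\<And>p e. p \<in> P ==> forced R p e <-> forces ph p (mix e (%_. empty))"
  "\<And>H v e. generic H v ==> R (%n. v (e n)) <-> W.sat (%n. v (mix e (%_. empty) n)) ph"
proof -
  obtain ph p where p: "range p <= {W.empty}" "\<And>e. R e = W.sat (mix e p) ph" using assms by (rule W.dpE) blast
  have "p = (%_. W.empty)" using p(1) by auto
  hence "(%n. v (mix e (%_. empty) n)) = mix (%n. v (e n)) p" if "generic H v" for H v e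
    using val_empty[OF that] by (auto simp: mix_def fun_eq_iff)
  hence sat: "R (%n. v (e n)) <-> W.sat (%n. v (mix e (%_. empty) n)) ph" if "generic H v" for H v e
    using that p(2) by simp
  hence "forced R p e <-> forces ph p (mix e (%_. empty))" if "p \<in> P" for p e
    unfolding forced_def forces_sem[OF that] by metis
  thus ?thesis using that sat by blast
qed

lemma dp_forced:
  assumes R: "W.dp {} R" and d: "dt UNIV t" "\<And>n. dt UNIV (%e. s e n)"
  shows "dp UNIV (%e. t e \<in> P & forced R (t e) (s e))"
proof -
  obtain ph where ph: "\<And>p e. p \<in> P ==> forced R p e <-> forces ph p (mix e (%_. empty))"
    using forced_fm[OF R] by metis
  have "dt UNIV (%e. mix (s e) (%_. empty) n)" for n by (cases "even n") (auto simp: mix_def intro: d dpi)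
  hence "dp UNIV (%e. t e \<in> P & forces ph (t e) (mix (s e) (%_. empty)))" by (intro dpi dp_forces d)
  thus ?thesis using ph by (metis (mono_tags, lifting) dp_def)
qed

lemma forced_truth:
  assumes R: "W.dp {} R" and v: "generic H v" "R (%n. v (e n))"
  shows "\<exists>p\<in>H. forced R p e"
proof -
  obtain ph where ph: "\<And>p e. p \<in> P ==> forced R p e <-> forces ph p (mix e (%_. empty))"
    "\<And>H v e. generic H v ==> R (%n. v (e n)) <-> W.sat (%n. v (mix e (%_. empty) n)) ph"
      using forced_fm[OF R] by blast
  have "\<exists>p\<in>H. forces ph p (mix e (%_. empty))" using generic_truth[OF v(1)] v ph(2)[OF v(1)] by blast
  thus ?thesis using ph(1) generic_facts(1)[OF v(1)] by blast
qed

lemma forcedD: "forced R p e ==> generic H v ==> p \<in> H ==> R (%n. v (e n))" unfolding forced_def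
  by blast

end

section \<open>The finite support iteration of Cohen forcing\<close>

context zfc
begin

definition bit :: "bool => 'v" where "bit b = num (if b then 1 else 0)"
lemma bit_inj [simp]: "bit a = bit b <-> a = b" by (simp add: bit_def)
lemma mem_num2: "y <: num 2 <-> (\<exists>b. y = bit b)"
proof -
  have "y <: num 2 <-> y = num 1 \<or> y = num 0" by (simp add: numeral_2_eq_2)
  also have "... <-> (\<exists>b. y = bit b)" unfolding bit_def by (metis (full_types))
  finally show ?thesis .
qed

definition graph_code :: "(nat => bool option) => 'v" where
  "graph_code g = coll {pair (num n) (bit b) | n b. g n = Some b}"

lemma mem_graph_code:
  assumes "finite (dom g)"
  shows "z <: graph_code g <-> (\<exists>n b. z = pair (num n) (bit b) & g n = Some b)"
proof -
  have "{pair (num n) (bit b) | n b. g n = Some b} = (%n. pair (num n) (bit (the (g n)))) ` dom g"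
    by (auto simp: dom_def image_iff; force)
  thus ?thesis unfolding graph_code_def using assms by (simp add: mem_coll is_set_finite) force
qed

lemma graph_code_empty: "graph_code Map.empty = empty" by (rule set_eqI) (simp add: mem_graph_code)

lemma finite_fn_graph_code:
  assumes "finite (ext d)" "ext d <= ext omega" "fn q d (num 2)"
  shows "\<exists>g. finite (dom g) & q = graph_code g"
proof -
  define g where "g n = (if num n <: d then Some (ap q (num n) = bit True) else None)" for n
  have "dom g = num -` ext d" unfolding g_def by (auto simp: dom_def)
  hence fin: "finite (dom g)" using assms(1) inj_num by (simp add: finite_vimageI)
  have q: "func_on q d" "\<And>x. x <: d ==> \<exists>b. ap q x = bit b" using assms(3) mem_num2 unfolding fn_ap by auto
  have "z <: q <-> z <: graph_code g" for z
  proof -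
    have "z <: q <-> (\<exists>x y. z = pair x y & x <: d & y = ap q x)"
      using q(1) func_ap[OF q(1)] unfolding func_on_def by metis
    also have "... <-> (\<exists>n. num n <: d & z = pair (num n) (ap q (num n)))"
      using assms(2) mem_omega by (auto simp: subset_iff)
    also have "... <-> (\<exists>n b. z = pair (num n) (bit b) & g n = Some b)" unfolding g_def
      using q(2) by (auto, metis+)
    finally show ?thesis unfolding mem_graph_code[OF fin] .
  qed
  thus ?thesis using fin set_eqI by metis
qed

lemma graph_code_fn:
  assumes "finite (dom g)"
  shows "\<exists>d. finite (ext d) & ext d <= ext omega & fn (graph_code g) d (num 2)"
proof -
  obtain d where d: "ext d = num ` dom g" using finite_subset_is_set assms by (metis finite_imageI)
  hence mem_d: "x <: d <-> (\<exists>n b. x = num n & g n = Some b)" for x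
    by (auto simp: image_iff Bex_def dom_def simp flip: mem_ext)
  have f: "func_on (graph_code g) d" unfolding func_on_def mem_graph_code[OF assms] mem_d by auto
  moreover have "ap (graph_code g) x <: num 2" if "x <: d" for x
    using func_ap[OF f that] that mem_graph_code[OF assms] mem_num2 by (metis pair_inject)
  ultimately have "fn (graph_code g) d (num 2)" unfolding fn_ap by blast
  moreover have "finite (ext d)" "ext d <= ext omega" unfolding d using assms by auto
  ultimately show ?thesis by blast
qed

lemma mem_cohen: "q <: cohen <-> (\<exists>g. finite (dom g) & q = graph_code g)"
proof -
  have "is_set {p. \<exists>d. finite (ext d) & ext d <= ext omega & fn p d (num 2)}"
  proof (rule is_set_sub[OF is_set_ext[of "powset (cprod omega (num 2))"]])
    have "z <: cprod omega (num 2)" if "ext d <= ext omega" "fn p d (num 2)" "z <: p" for z p d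
    proof -
      have "z <: cprod d (num 2)" using fn_mem_pow[OF that(2)] that(3) by auto
      thus ?thesis using that(1) by (auto simp: mem_cprod subset_iff)
    qed
    thus "{p. \<exists>d. finite (ext d) & ext d <= ext omega & fn p d (num 2)} <= ext (powset (cprod omega (num 2)))"
      by auto
    show "dp UNIV (%e. e 0 \<in> {p. \<exists>d. finite (ext d) & ext d <= ext omega & fn p d (num 2)})"
      unfolding mem_Collect_eq by (intro dpi)
  qed
  from mem_coll[OF this] have "q <: cohen <-> (\<exists>d. finite (ext d) & ext d <= ext omega & fn q d (num 2))"
    unfolding cohen_def by simp
  thus ?thesis using finite_fn_graph_code graph_code_fn by blast
qed

definition cohen_map :: "'v => nat => bool option" where
  "cohen_map q n = (if pair (num n) (bit True) <: q then Some True else if pair (num n) (bit False) <: q then Some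
      False else None)"

lemma cohen_map_code: "finite (dom g) ==> cohen_map (graph_code g) = g"
proof
  fix n assume "finite (dom g)"
  thus "cohen_map (graph_code g) n = g n" by (cases "g n") (auto simp: cohen_map_def mem_graph_code)
qed

lemma cohenE:
  assumes "q <: cohen"
  obtains "finite (dom (cohen_map q))" "q = graph_code (cohen_map q)"
  using assms cohen_map_code unfolding mem_cohen by metis

lemma cohen_map_mem: "q <: cohen ==> z <: q <-> (\<exists>n b. z = pair (num n) (bit b) & cohen_map q n = Some b)"
  by (erule cohenE) (metis mem_graph_code)

lemma cohen_map_le:
  assumes "q <: cohen" "r <: cohen"
  shows "ext q <= ext r <-> cohen_map q \<subseteq>\<^sub>m cohen_map r"
proof -
  have "ext q <= ext r <-> (\<forall>z. (\<exists>n b. z = pair (num n) (bit b) & cohen_map q n = Some b) --> z <: r)"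
    unfolding subset_iff mem_ext cohen_map_mem[OF assms(1)] ..
  also have "... <-> (\<forall>n b. cohen_map q n = Some b --> pair (num n) (bit b) <: r)" by blast
  also have "... <-> (\<forall>n b. cohen_map q n = Some b --> cohen_map r n = Some b)"
    by (simp add: cohen_map_mem[OF assms(2)])
  finally show ?thesis unfolding map_le_def dom_def by auto
qed

lemma cohen_map_inj: "q <: cohen ==> r <: cohen ==> cohen_map q = cohen_map r ==> q = r" by (metis cohenE)

lemma empty_cohen: "empty <: cohen" unfolding mem_cohen
  using graph_code_empty by (metis dom_empty finite.emptyI)

lemma check_inj: "check u x = check u y <-> x = y"
proof (induction x arbitrary: y rule: mem_induct)
  case (step x)
  have "x = y" if eq: "check u x = check u y"
  proof (rule set_eqI)
    fix z
    have "pair (check u w) u <: check u x <-> pair (check u w) u <: check u y" for w using eq by simp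
    hence "(\<exists>v. v <: x & check u w = check u v) <-> (\<exists>v. v <: y & check u w = check u v)" for w
      by (simp add: mem_check)
    thus "z <: x <-> z <: y" using step by metis
  qed
  thus ?case by auto
qed

definition Cond :: "'v => 'v set" where
  "Cond al = {p. func_on p al & finite {xi. xi <: al & ap p xi \<noteq> empty} &
  (\<forall>xi. xi <: al --> (\<exists>q. q <: cohen & ap p xi = check (iter_one xi) q))}"
definition coord :: "'v => 'v => 'v" where
  "coord p xi = (THE q. q <: cohen & ap p xi = check (iter_one xi) q)"
definition cond_le :: "'v => 'v => 'v => bool" where
  "cond_le al p q <-> p \<in> Cond al & q \<in> Cond al & (\<forall>xi. xi <: al -->
      ext (coord q xi) <= ext (coord p xi))"

lemma Cond_func: "p \<in> Cond al ==> func_on p al" unfolding Cond_def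
  by blast
lemma coord_eq: "q <: cohen ==> ap p xi = check (iter_one xi) q ==> coord p xi = q"
  unfolding coord_def by (rule the_equality) (auto simp: check_inj)
lemma coord:
  assumes "p \<in> Cond al" "xi <: al"
  shows "coord p xi <: cohen" "ap p xi = check (iter_one xi) (coord p xi)"
  using assms coord_eq unfolding Cond_def by auto

lemma iter_one_fn: "func_on (iter_one al) al" "x <: al ==> ap (iter_one al) x = empty"
proof -
  have m: "z <: iter_one al <-> (\<exists>x. x <: al & z = pair x empty)" for z
    unfolding iter_one_def by (auto simp: mem_cprod mem_coll_sing)
  show f: "func_on (iter_one al) al" unfolding func_on_def m by auto
  show "x <: al ==> ap (iter_one al) x = empty" using func_ap[OF f, of x empty] m by auto
qed

lemma coord_one: "x <: al ==> coord (iter_one al) x = empty"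
  by (rule coord_eq) (simp_all add: empty_cohen iter_one_fn)
lemma one_Cond: "iter_one al \<in> Cond al"
proof -
  have "{xi. xi <: al & ap (iter_one al) xi \<noteq> empty} = {}" using iter_one_fn by auto
  hence "finite {xi. xi <: al & ap (iter_one al) xi \<noteq> empty}" by (metis finite.emptyI)
  moreover have "\<exists>q. q <: cohen & ap (iter_one al) xi = check (iter_one xi) q" if "xi <: al" for xi
    by (rule exI[of _ empty]) (simp add: iter_one_fn(2)[OF that] empty_cohen)
  ultimately show ?thesis unfolding Cond_def using iter_one_fn(1) by blast
qed

lemma poset_Cond: "poset mem (Cond al) (cond_le al) (iter_one al)"
  by unfold_locales (auto simp: cond_le_def one_Cond coord_one)

lemma restr_func:
  assumes "func_on p al" "ext xi <= ext al"
  shows "func_on (restr p xi) xi" "et <: xi ==> ap (restr p xi) et = ap p et"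
proof -
  have "is_set {z. z <: p & (\<exists>x y. z = pair x y & x <: xi)}" by (rule sep) (intro dpi)
  hence m: "z <: restr p xi <-> z <: p & (\<exists>x y. z = pair x y & x <: xi)" for z
    unfolding restr_def by (simp add: mem_coll)
  show f: "func_on (restr p xi) xi" unfolding func_on_def m using assms unfolding func_on_def by (auto simp: subset_iff)
  show "ap (restr p xi) et = ap p et" if et: "et <: xi"
  proof -
    have "et <: al" using et assms(2) by auto
    hence "pair et (ap p et) <: restr p xi" unfolding m using func_ap[OF assms(1)] et by auto
    thus ?thesis using func_ap[OF f et] by simp
  qed
qed

lemma restr_Cond:
  assumes "p \<in> Cond al" "ext xi <= ext al"
  shows "restr p xi \<in> Cond xi"
proof -
  have f: "func_on p al" "finite {xi. xi <: al & ap p xi \<noteq> empty}" using assms(1) Cond_def by auto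
  have "{et. et <: xi & ap (restr p xi) et \<noteq> empty} <= {xi. xi <: al & ap p xi \<noteq> empty}"
    using restr_func(2)[OF f(1) assms(2)] assms(2) by (auto simp: subset_iff)
  hence "finite {et. et <: xi & ap (restr p xi) et \<noteq> empty}" using f(2) finite_subset by blast
  moreover have "\<exists>q. q <: cohen & ap (restr p xi) et = check (iter_one et) q" if "et <: xi" for et
    using assms restr_func(2)[OF f(1) assms(2) that] that unfolding Cond_def by (auto simp: subset_iff)
  ultimately show ?thesis unfolding Cond_def using restr_func(1)[OF f(1) assms(2)] by blast
qed

lemma Cond_rec:
  assumes "ordinal al"
  shows "p \<in> Cond al <-> func_on p al & finite {xi. xi <: al & app p xi \<noteq> empty} &
  (\<forall>xi. xi <: al --> restr p xi \<in> Cond xi & (\<exists>s. pair (app p xi) s <: check (iter_one xi) cohen) &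
  forces_mem (Cond xi) (cond_le xi) (restr p xi) (app p xi) (check (iter_one xi) cohen))"
proof -
  have sub: "ext xi <= ext al" if "xi <: al" for xi using assms ordinal_trans that by auto
  have forces: "forces_mem (Cond xi) (cond_le xi) p' (check (iter_one xi) q) (check (iter_one xi) cohen) <-> q <: cohen"
    if "p' \<in> Cond xi" for p' q xi
    using that poset.FM_check_iff[OF poset_Cond] by blast
  have "(\<exists>s. pair y s <: check (iter_one xi) cohen) <-> (\<exists>q. q <: cohen & y = check (iter_one xi) q)"
    for y xi
    unfolding mem_check by auto
  hence iterand: "(\<exists>s. pair y s <: check (iter_one xi) cohen) &
      forces_mem (Cond xi) (cond_le xi) p' y (check (iter_one xi) cohen) <->
      (\<exists>q. q <: cohen & y = check (iter_one xi) q)" if "p' \<in> Cond xi" for p' y xi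
    using forces[OF that] by blast
  have app: "app p xi = ap p xi" if "func_on p al" "xi <: al" for xi using ap_eq that by simp
  hence support: "{xi. xi <: al & app p xi \<noteq> empty} = {xi. xi <: al & ap p xi \<noteq> empty}" if "func_on p al"
    using that by auto
  show ?thesis
  proof (cases "func_on p al")
    case True
    have "p \<in> Cond al --> (\<forall>xi. xi <: al --> restr p xi \<in> Cond xi)" using restr_Cond sub by blast
    thus ?thesis using True iterand unfolding Cond_def mem_Collect_eq support[OF True]
      by (simp add: app[OF True] cong: conj_cong imp_cong) blast
  qed (auto simp: Cond_def)
qed

lemma cond_le_rec:
  assumes "ordinal al"
  shows "cond_le al p q <-> p \<in> Cond al & q \<in> Cond al &
  (\<forall>xi. xi <: al --> forces_subset (Cond xi) (cond_le xi) (restr p xi) (app q xi) (app p xi))"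
proof -
  have "forces_subset (Cond xi) (cond_le xi) (restr p xi) (app q xi) (app p xi) <->
      ext (coord q xi) <= ext (coord p xi)"
    if x: "xi <: al" and p: "p \<in> Cond al" and q: "q \<in> Cond al" for xi
  proof -
    have "ext xi <= ext al" using assms ordinal_trans x by auto
    moreover have "app p xi = check (iter_one xi) (coord p xi)" "app q xi = check (iter_one xi) (coord q xi)"
      using coord(2)[OF p x] coord(2)[OF q x] ap_eq[OF Cond_func[OF p] x] ap_eq[OF Cond_func[OF q] x] by simp_all
    ultimately show ?thesis using poset.FS_check_iff[OF poset_Cond] restr_Cond[OF p] by simp
  qed
  thus ?thesis unfolding cond_le_def by blast
qed

theorem iteration_eq:
  assumes it: "fs_cohen_iteration dl P leP" and dl: "ordinal dl" and "al = dl \<or> al <: dl"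
  shows "P al = Cond al & leP al = cond_le al"
  using assms(3)
proof (induction al rule: mem_induct)
  case (step al)
  have al: "ordinal al" using step.prems dl ordinal_mem by blast
  have "xi = dl \<or> xi <: dl" if "xi <: al" for xi using step.prems that ordinal_trans[OF dl] by blast
  hence IH: "P xi = Cond xi" "leP xi = cond_le xi" if "xi <: al" for xi using step.IH that by auto
  note rec = it[unfolded fs_cohen_iteration_def fs_iteration_def, THEN spec, of al, THEN mp, OF step.prems]
  have "p \<in> P al <-> p \<in> Cond al" for p
    unfolding rec[THEN conjunct1] mem_Collect_eq Cond_rec[OF al] using IH by (simp cong: imp_cong)
  hence P: "P al = Cond al" by blast
  have "leP al p q <-> cond_le al p q" for p q
    unfolding rec[THEN conjunct2, THEN spec, THEN spec] cond_le_rec[OF al] P using IH by (simp cong: imp_cong)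
  thus ?case using P by blast
qed

end

subsection \<open>Conditions as finite partial maps\<close>

definition extends :: "'x set => ('x => bool option) => bool" where
  "extends S f <-> (\<forall>x b. f x = Some b --> b = (x \<in> S))"

lemma card_extends:
  assumes X: "finite X" and f: "dom f <= X"
  shows "2 ^ card X <= card {S \<in> Pow X. extends S f} * 2 ^ card (dom f)"
proof -
  let ?t = "{x. f x = Some True}"
  have inj: "inj_on (%T. T \<union> ?t) (Pow (X - dom f))" unfolding inj_on_def by blast
  have "(%T. T \<union> ?t) ` Pow (X - dom f) <= {S \<in> Pow X. extends S f}"
    using f unfolding extends_def by (auto simp: dom_def)
  hence "card (Pow (X - dom f)) <= card {S \<in> Pow X. extends S f}"
    using card_inj_on_le[OF inj] X by (simp add: image_subset_iff)
  hence "2 ^ (card X - card (dom f)) <= card {S \<in> Pow X. extends S f}"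
    using X finite_subset[OF f X] f by (simp add: card_Pow card_Diff_subset)
  hence "2 ^ (card X - card (dom f)) * 2 ^ card (dom f) <= card {S \<in> Pow X. extends S f} * 2 ^ card (dom f)" by simp
  thus ?thesis using card_mono[OF X f] by (simp flip: power_add)
qed

definition agree :: "('x => bool option) => ('x => bool option) => bool" where
  "agree f g <-> (\<forall>x b c. f x = Some b --> g x = Some c --> b = c)"

text \<open>Averaging over all total extensions: many small partial maps cannot all be far from compatible.\<close>

lemma many_compatible:
  fixes f :: "'i => 'x => bool option"
  assumes A: "finite A" "card A > K * 2 ^ n" and f: "\<And>i. i \<in> A ==> finite (dom (f i)) & card (dom (f i)) <= n"
  shows "\<exists>B\<subseteq>A. card B = Suc K & (\<forall>i\<in>B. \<forall>j\<in>B. agree (f i) (f j))"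
proof -
  define X where "X = (\<Union>i\<in>A. dom (f i))"
  have X: "finite X" using A f unfolding X_def by blast
  have low: "2 ^ card X <= card {S \<in> Pow X. extends S (f i)} * 2 ^ n" if i: "i \<in> A" for i
  proof -
    have "2 ^ card X <= card {S \<in> Pow X. extends S (f i)} * 2 ^ card (dom (f i))"
      by (rule card_extends[OF X]) (use i X_def in auto)
    also have "... <= card {S \<in> Pow X. extends S (f i)} * 2 ^ n" using f[OF i] by (intro mult_le_mono2) simp
    finally show ?thesis .
  qed
  have "\<exists>S\<in>Pow X. card {i \<in> A. extends S (f i)} > K"
  proof (rule ccontr)
    assume "\<not> ?thesis"
    hence few: "card {i \<in> A. extends S (f i)} <= K" if "S \<in> Pow X" for S using that by (meson not_le)
    have "card A * 2 ^ card X = (\<Sum>i\<in>A. 2 ^ card X)" by simp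
    also have "... <= (\<Sum>i\<in>A. card {S \<in> Pow X. extends S (f i)} * 2 ^ n)" by (rule sum_mono) (rule low)
    also have "... = (\<Sum>i\<in>A. card {S \<in> Pow X. extends S (f i)}) * 2 ^ n" by (simp add: sum_distrib_right)
    also have "(\<Sum>i\<in>A. card {S \<in> Pow X. extends S (f i)}) =
        (\<Sum>S\<in>Pow X. card {i \<in> A. extends S (f i)})"
      using A X by (intro sum_multicount_gen[symmetric]) auto
    also have "... <= (\<Sum>S\<in>Pow X. K)" by (rule sum_mono) (rule few)
    also have "... = K * 2 ^ card X" using X by (simp add: card_Pow)
    finally have "card A * 2 ^ card X <= (K * 2 ^ n) * 2 ^ card X" by (simp add: mult_ac)
    hence "card A <= K * 2 ^ n" by simp
    thus False using A by simp
  qed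
  then obtain S where "card {i \<in> A. extends S (f i)} > K" by blast
  then obtain B where B: "B <= {i \<in> A. extends S (f i)}" "card B = Suc K"
    by (metis Suc_leI obtain_subset_with_card_n)
  thus ?thesis unfolding extends_def agree_def by (intro exI[of _ B]) blast
qed

lemma infinite_compatible:
  assumes "infinite A" "\<And>i. i \<in> A ==> finite (dom (f i)) & card (dom (f i)) <= n"
  shows "\<exists>B\<subseteq>A. finite B & card B = Suc K & (\<forall>i\<in>B. \<forall>j\<in>B. agree (f i) (f j))"
proof -
  obtain A' where A': "A' <= A" "finite A'" "card A' = Suc (K * 2 ^ n)" using infinite_arbitrarily_large[OF assms(1)]
    by metis
  have "\<exists>B\<subseteq>A'. card B = Suc K & (\<forall>i\<in>B. \<forall>j\<in>B. agree (f i) (f j))"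
    by (rule many_compatible[where n = n]) (use A' assms(2) in auto)
  then obtain B where B: "B <= A'" "card B = Suc K" "\<forall>i\<in>B. \<forall>j\<in>B. agree (f i) (f j)" by blast
  thus ?thesis using A' finite_subset by (intro exI[of _ B]) auto
qed

lemma finite_predense:
  assumes f: "\<And>i. i \<in> D ==> finite (dom (f i)) & card (dom (f i)) <= n"
  shows "\<exists>E\<subseteq>D. finite E & (\<forall>i\<in>D. \<exists>j\<in>E. agree (f i) (f j))"
proof (rule ccontr)
  assume not_predense: "\<not> ?thesis"
  have ex: "\<exists>E\<subseteq>D. finite E & card E = m & (\<forall>i\<in>E. \<forall>j\<in>E. i \<noteq> j -->
      \<not> agree (f i) (f j))" for m
  proof (induction m)
    case 0 thus ?case by (intro exI[of _ "{}"]) auto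
  next
    case (Suc m)
    then obtain E where E: "E <= D" "finite E" "card E = m" "\<forall>i\<in>E. \<forall>j\<in>E. i \<noteq> j -->
        \<not> agree (f i) (f j)" by blast
    obtain i where i: "i \<in> D" "\<forall>j\<in>E. \<not> agree (f i) (f j)" using not_predense E(1, 2) by meson
    have "agree (f i) (f i)" unfolding agree_def by simp
    hence "i \<notin> E" using i(2) by blast
    moreover have "agree g h" if "agree h g" for g h :: "'b => bool option"
      using that unfolding agree_def by blast
    ultimately show ?case using E i by (intro exI[of _ "insert i E"]) auto
  qed
  obtain E where E: "E <= D" "finite E" "card E = Suc (1 * 2 ^ n)"
    "\<forall>i\<in>E. \<forall>j\<in>E. i \<noteq> j --> \<not> agree (f i) (f j)" using ex by blast
  have "\<exists>B\<subseteq>E. card B = Suc 1 & (\<forall>i\<in>B. \<forall>j\<in>B. agree (f i) (f j))"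
    by (rule many_compatible[where n = n]) (use E f in auto)
  then obtain B where B: "B <= E" "card B = 2" "\<forall>i\<in>B. \<forall>j\<in>B. agree (f i) (f j)" by auto
  then obtain i j where "B = {i, j}" "i \<noteq> j" by (meson card_2_iff)
  thus False using B E by blast
qed

context zfc
begin

definition cond_map :: "'v => 'v => 'v \<times> nat => bool option" where
  "cond_map dl p = (%(xi, n). if xi <: dl then cohen_map (coord p xi) n else None)"
definition has_bit :: "'v => 'v => 'v => bool" where
  "has_bit p xi z <-> (\<exists>q. q <: cohen & ap p xi = check (iter_one xi) q & z <: q)"

lemma dp_has_bit [dpi]: "dt UNIV t ==> dt UNIV u ==> dt UNIV v ==> dp UNIV (%e. has_bit (t e) (u e) (v e))"
  by (rule dp_lift3[where Q = has_bit]) (unfold has_bit_def iter_one_def, intro dpi)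

lemma dp_Cond [dpi]: "dt UNIV t ==> dp UNIV (%e. t e \<in> Cond dl)"
  by (rule dp_lift1[where Q = "%p. p \<in> Cond dl"]) (unfold Cond_def mem_Collect_eq iter_one_def, intro dpi)

lemma has_bit_coord:
  assumes "p \<in> Cond dl" "xi <: dl"
  shows "has_bit p xi z <-> z <: coord p xi"
  unfolding has_bit_def using coord[OF assms] check_inj by auto
lemma has_bit_cond_map:
  assumes "p \<in> Cond dl" "xi <: dl"
  shows "has_bit p xi z <-> (\<exists>n b. z = pair (num n) (bit b) & cond_map dl p (xi, n) = Some b)"
  unfolding has_bit_coord[OF assms] cohen_map_mem[OF coord(1)[OF assms]] cond_map_def using assms by simp
lemma has_bit_pair: "p \<in> Cond dl ==> xi <: dl ==> has_bit p xi (pair (num n) (bit b)) <->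
    cond_map dl p (xi, n) = Some b"
  by (simp add: has_bit_cond_map)

lemma cond_le_iff: "cond_le dl p q <-> p \<in> Cond dl & q \<in> Cond dl &
    cond_map dl q \<subseteq>\<^sub>m cond_map dl p"
proof -
  have "(\<forall>xi. xi <: dl --> ext (coord q xi) <= ext (coord p xi)) <->
      cond_map dl q \<subseteq>\<^sub>m cond_map dl p"
    if pq: "p \<in> Cond dl" "q \<in> Cond dl"
  proof -
    have "(\<forall>xi. xi <: dl --> ext (coord q xi) <= ext (coord p xi)) <->
        (\<forall>xi. xi <: dl --> cohen_map (coord q xi) \<subseteq>\<^sub>m cohen_map (coord p xi))"
      using cohen_map_le coord(1) pq by auto
    also have "... <-> cond_map dl q \<subseteq>\<^sub>m cond_map dl p" unfolding map_le_def cond_map_def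
      by (auto simp: dom_def split: if_splits)
    finally show ?thesis .
  qed
  thus ?thesis unfolding cond_le_def by blast
qed

lemma dom_cond_map:
  assumes "p \<in> Cond dl"
  shows "finite (dom (cond_map dl p))" "dom (cond_map dl p) <= ext dl \<times> UNIV"
proof -
  let ?S = "{xi. xi <: dl & ap p xi \<noteq> empty}"
  have S: "finite ?S" using assms Cond_def by auto
  have "cohen_map (coord p xi) = Map.empty" if "xi <: dl" "ap p xi = empty" for xi
    using coord_eq[of empty p xi] that empty_cohen by (simp add: cohen_map_def fun_eq_iff)
  hence "dom (cond_map dl p) <= Sigma ?S (%xi. dom (cohen_map (coord p xi)))"
    unfolding cond_map_def by (auto split: if_splits)
  moreover have "finite (Sigma ?S (%xi. dom (cohen_map (coord p xi))))"
    using S coord(1)[OF assms] by (intro finite_SigmaI) (auto elim: cohenE)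
  ultimately show "finite (dom (cond_map dl p))" using finite_subset by blast
  show "dom (cond_map dl p) <= ext dl \<times> UNIV" unfolding cond_map_def by (auto split: if_splits)
qed

lemma ap_outside: "func_on f a ==> \<not> x <: a ==> ap f x = empty" unfolding ap_def func_on_def
  by (metis pair_inject)

lemma ex_cond_map:
  assumes g: "finite (dom g)" "dom g <= ext dl \<times> UNIV"
  shows "\<exists>p\<in>Cond dl. cond_map dl p = g"
proof -
  define row where "row xi = graph_code (%n. g (xi, n))" for xi
  have "dom (%n. g (xi, n)) = Pair xi -` dom g" for xi by auto
  hence "finite (dom (%n. g (xi, n)))" for xi using finite_vimageI[OF g(1), of "Pair xi"] by (simp add: inj_def)
  hence row: "row xi <: cohen" "cohen_map (row xi) = (%n. g (xi, n))" for xi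
    unfolding row_def mem_cohen using cohen_map_code by blast+
  obtain F where F: "ext F = fst ` dom g" using finite_subset_is_set g(1) by (metis finite_imageI)
  obtain B where B: "ext B = row ` ext F" using finite_subset_is_set F g(1) by (metis finite_imageI)
  define h where "h = lam F row"
  have h: "func_on h F" "\<And>x. x <: F ==> ap h x = row x"
    unfolding h_def using fn_finite[of F row B] F B g(1) by (auto simp: fn_ap image_iff simp flip: mem_ext)
  have "ap h x = row x" if "\<not> x <: F" for x
  proof -
    have "x \<notin> fst ` dom g" using that F mem_ext by blast
    hence "(%n. g (x, n)) = Map.empty" by (auto simp: fun_eq_iff image_iff dom_def; force)
    thus ?thesis using ap_outside[OF h(1) that] graph_code_empty unfolding row_def by simp
  qed
  hence ap_h: "ap h x = row x" for x using h(2) by blast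
  define p where "p = lam dl (%xi. check (iter_one xi) (ap h xi))"
  have dt_p: "dt UNIV (%e. check (iter_one (e 0)) (ap h (e 0)))" unfolding iter_one_def by (intro dpi)
  have p: "func_on p dl" "\<And>xi. xi <: dl ==> ap p xi = check (iter_one xi) (row xi)"
    unfolding p_def by (simp_all add: func_lam[OF is_set_graph[OF dt_p]] flip: ap_h)
  have "xi <: F" if "xi <: dl" "ap p xi \<noteq> empty" for xi using p(2) that ap_h ap_outside[OF h(1)] check_empty
    by metis
  hence "{xi. xi <: dl & ap p xi \<noteq> empty} <= ext F" by auto
  hence "finite {xi. xi <: dl & ap p xi \<noteq> empty}" by (rule finite_subset) (use F g(1) in simp)
  hence "p \<in> Cond dl" unfolding Cond_def using p row(1) by blast
  moreover have "coord p xi = row xi" if "xi <: dl" for xi using coord_eq[OF row(1) p(2)[OF that]] .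
  hence "cond_map dl p (xi, n) = g (xi, n)" for xi n unfolding cond_map_def
    using row(2) g(2) by (cases "g (xi, n)") auto
  ultimately show ?thesis by (intro bexI[of _ p]) auto
qed

lemma cond_map_inj:
  assumes "p \<in> Cond dl" "q \<in> Cond dl" "cond_map dl p = cond_map dl q"
  shows "p = q"
proof (rule func_eqI[OF Cond_func[OF assms(1)] Cond_func[OF assms(2)]])
  fix xi assume xi: "xi <: dl"
  have "cohen_map (coord p xi) n = cohen_map (coord q xi) n" for n
    using fun_cong[OF assms(3), of "(xi, n)"] xi unfolding cond_map_def by simp
  hence "cohen_map (coord p xi) = cohen_map (coord q xi)" by blast
  thus "ap p xi = ap q xi" using cohen_map_inj coord assms xi by metis
qed

lemma forcing_Cond: "forcing mem (Cond dl) (cond_le dl) (iter_one dl)"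
proof -
  interpret poset mem "Cond dl" "cond_le dl" "iter_one dl" by (rule poset_Cond)
  have "is_set {y. \<exists>z. z <: cprod dl cohen & (\<exists>xi q. z = pair xi q & y = check (iter_one xi) q)}"
    by (rule rep) (unfold iter_one_def, intro dpi, auto)
  then obtain U where U: "\<And>y. y <: U <->
      (\<exists>z. z <: cprod dl cohen & (\<exists>xi q. z = pair xi q & y = check (iter_one xi) q))"
    using mem_coll by blast
  have "p <: funs dl U" if "p \<in> Cond dl" for p
    using that unfolding mem_funs fn_ap U Cond_def mem_Collect_eq by (metis pair_mem_cprod)
  hence "Cond dl <= ext (funs dl U)" by auto
  hence "is_set (Cond dl)" by (rule is_set_sub[OF is_set_ext]) (intro dpi)
  moreover have "cond_le dl p q <-> p \<in> Cond dl & q \<in> Cond dl & (\<forall>xi z. xi <: dl & has_bit q xi z -->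
      has_bit p xi z)" for p q
    unfolding cond_le_def using has_bit_coord by (auto simp: subset_iff)
  hence "dp UNIV (%e. cond_le dl (e 0) (e 1))" by (simp only:) (intro dpi)
  ultimately show ?thesis by unfold_locales
qed

definition size_le :: "'v => 'v => 'v => bool" where
  "size_le dl p n <-> covered {z. \<exists>xi y. z = pair xi y & xi <: dl & has_bit p xi y} n"

lemma dp_size_le [dpi]: "dt UNIV t ==> dt UNIV u ==> dp UNIV (%e. size_le dl (t e) (u e))"
  by (rule dp_lift2[where Q = "size_le dl"]) (unfold size_le_def, intro dpi)

lemma size_le_num:
  assumes "p \<in> Cond dl"
  shows "size_le dl p (num n) <-> card (dom (cond_map dl p)) <= n"
proof -
  let ?f = "%x. pair (fst x) (pair (num (snd x)) (bit (the (cond_map dl p x))))"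
  have "z \<in> {z. \<exists>xi y. z = pair xi y & xi <: dl & has_bit p xi y} <->
      (\<exists>xi n b. cond_map dl p (xi, n) = Some b & z = pair xi (pair (num n) (bit b)))" for z
    using has_bit_cond_map[OF assms] dom_cond_map(2)[OF assms] by auto
  also have "... z <-> z \<in> ?f ` dom (cond_map dl p)" for z by (auto simp: image_iff dom_def; force)
  finally have "{z. \<exists>xi y. z = pair xi y & xi <: dl & has_bit p xi y} = ?f ` dom (cond_map dl p)" by blast
  moreover have "inj_on ?f (dom (cond_map dl p))" by (auto simp: inj_on_def)
  ultimately show ?thesis unfolding size_le_def covered_num using dom_cond_map(1)[OF assms] by (simp add: card_image)
qed

end

subsection \<open>The Cohen extension\<close>

context zfc
begin

definition flip :: "('v \<times> nat) set => ('v \<times> nat => bool option) => 'v \<times> nat => bool option" where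
  "flip D g = (%x. if x \<in> D then map_option Not (g x) else g x)"

lemma flip_flip: "flip D (flip D g) = g" by (auto simp: flip_def fun_eq_iff option.map_comp o_def option.map_ident)
lemma flip_le: "g \<subseteq>\<^sub>m h ==> flip D g \<subseteq>\<^sub>m flip D h"
  unfolding map_le_def flip_def by (auto simp: dom_def split: if_splits; metis domI option.simps(9))
lemma dom_flip: "dom (flip D g) = dom g" by (auto simp: flip_def dom_def split: if_splits)
lemma flip_Some: "flip D g x = Some b <-> g x = Some (b <-> x \<notin> D)" by (cases "g x") (auto simp: flip_def)

lemma ex_flip:
  assumes D: "finite D"
  shows "\<exists>pf. dt UNIV (%e. pf (e 0)) & (\<forall>p\<in>Cond dl. pf p \<in> Cond dl &
      cond_map dl (pf p) = flip D (cond_map dl p))"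
proof -
  obtain d where "ext d = (%x. pair (fst x) (num (snd x))) ` D" using finite_subset_is_set D by blast
  hence d: "pair xi (num n) <: d <-> (xi, n) \<in> D" for xi n by (auto simp: image_iff simp flip: mem_ext) force
  define r where "r p z <-> (\<forall>xi k y y'. xi <: dl & k <: omega & y <: num 2 & y' <: num 2 & (y = y' <->
      \<not> pair xi k <: d) -->
      (has_bit z xi (pair k y) <-> has_bit p xi (pair k y')))" for p z
  have r: "r p z <-> cond_map dl z = flip D (cond_map dl p)" if p: "p \<in> Cond dl" and z: "z \<in> Cond dl" for p z
  proof -
    have bool_eq: "(b = b' <-> c) <-> b' = (b <-> c)" for b b' c :: bool by auto
    have "r p z <-> (\<forall>xi n b b'. xi <: dl & (bit b = bit b' <-> \<not> pair xi (num n) <: d) -->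
        (has_bit z xi (pair (num n) (bit b)) <-> has_bit p xi (pair (num n) (bit b'))))"
      unfolding r_def mem_omega mem_num2 by blast
    also have "... <-> (\<forall>xi n b b'. xi <: dl & b' = (b <-> (xi, n) \<notin> D) -->
        (has_bit z xi (pair (num n) (bit b)) <-> has_bit p xi (pair (num n) (bit b'))))" unfolding bit_inj d bool_eq ..
    also have "... <-> (\<forall>xi n b. xi <: dl --> (cond_map dl z (xi, n) = Some b <->
        flip D (cond_map dl p) (xi, n) = Some b))"
      unfolding flip_Some by (simp add: has_bit_pair[OF p] has_bit_pair[OF z])
    also have "... <-> (\<forall>x b. cond_map dl z x = Some b <-> flip D (cond_map dl p) x = Some b)"
      unfolding flip_Some cond_map_def by auto
    also have "... <-> cond_map dl z = flip D (cond_map dl p)" unfolding fun_eq_iff by (metis not_None_eq)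
    finally show ?thesis .
  qed
  define pf where "pf p = (if p \<in> Cond dl then THE z. z \<in> Cond dl & r p z else empty)" for p
  have ex1: "\<exists>!z. z \<in> Cond dl & r p z" if p: "p \<in> Cond dl" for p
  proof -
    have "\<exists>z\<in>Cond dl. cond_map dl z = flip D (cond_map dl p)" using dom_cond_map[OF p] dom_flip
      by (intro ex_cond_map) simp_all
    thus ?thesis using r[OF p] cond_map_inj by metis
  qed
  have pf: "pf p \<in> Cond dl & r p (pf p)" if "p \<in> Cond dl" for p using theI'[OF ex1[OF that]] that
    by (simp add: pf_def)
  have "z = pf p <-> (p \<in> Cond dl & z \<in> Cond dl & r p z) \<or> (p \<notin> Cond dl & z = empty)" for p z
    using pf[of p] ex1[of p] by (cases "p \<in> Cond dl") (auto simp: pf_def[of p])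
  hence "dt UNIV (%e. pf (e 0))" unfolding dt_def r_def by (simp only:) (intro dpi)
  thus ?thesis using pf r by blast
qed

end

locale cohen_ext = zfc mem for mem :: "'v => 'v => bool" (infix \<open><:\<close> 50) +
  fixes dl :: 'v and G :: "'v set" and memW :: "'w => 'w => bool" and val :: "'v => 'w"
  assumes filter_dl: "generic_filter (Cond dl) (cond_le dl) G" and extension_dl: "generic_extension mem G memW val"

sublocale cohen_ext \<subseteq> generic_ext mem "Cond dl" "cond_le dl" "iter_one dl" G memW val
  using forcing_Cond filter_dl extension_dl by (auto simp: generic_ext_def generic_ext_axioms_def)

context cohen_ext
begin

abbreviation "conds \<equiv> Cond dl"
abbreviation "leq \<equiv> cond_le dl"
abbreviation "bits \<equiv> cond_map dl"

lemma G_meets_dom: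
  assumes r: "r \<in> conds"
  shows "\<exists>g\<in>G. dom (bits r) <= dom (bits g)"
proof -
  define D where "D g <-> g \<in> conds & (\<forall>xi k. xi <: dl & (\<exists>b. has_bit r xi (pair k b)) -->
      (\<exists>b. has_bit g xi (pair k b)))" for g
  have "\<exists>g\<in>G. D g"
  proof (rule G_meets)
    show "dp UNIV (%e. D (e 0))" unfolding D_def by (intro dpi)
    fix p assume p: "p \<in> conds"
    have "\<exists>q\<in>conds. bits q = bits r ++ bits p" using dom_cond_map[OF p] dom_cond_map[OF r]
      by (intro ex_cond_map) auto
    then obtain q where q: "q \<in> conds" "bits q = bits r ++ bits p" by blast
    have "\<exists>b. has_bit q xi (pair k b)" if h: "xi <: dl" "has_bit r xi (pair k b)" for xi k b
    proof -
      obtain n b' where n: "k = num n" "bits r (xi, n) = Some b'" using h has_bit_cond_map[OF r h(1)] by auto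
      hence "bits q (xi, n) \<noteq> None" using q by (auto simp: map_add_def split: option.splits)
      thus ?thesis using has_bit_pair[OF q(1) h(1)] n by auto
    qed
    moreover have "leq q p" unfolding cond_le_iff using p q by simp
    ultimately show "\<exists>q. leq q p & D q" unfolding D_def using q by blast
  qed
  then obtain g where g: "g \<in> G" "g \<in> conds" "\<And>xi k b. xi <: dl ==> has_bit r xi (pair k b) ==>
      \<exists>b. has_bit g xi (pair k b)"
    unfolding D_def by blast
  have "x \<in> dom (bits g)" if xr: "x \<in> dom (bits r)" for x
  proof -
    obtain xi n b where x: "x = (xi, n)" "bits r (xi, n) = Some b" "xi <: dl" using xr dom_cond_map(2)[OF r]
      by (cases x) auto
    thus ?thesis using g(3)[OF x(3), of "num n" "bit b"] has_bit_pair[OF r x(3)] has_bit_cond_map[OF g(2) x(3)] by auto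
  qed
  thus ?thesis using g(1) by blast
qed

lemma ex_generic_above:
  assumes r: "r \<in> conds"
  shows "\<exists>H v. generic H v & r \<in> H"
proof -
  obtain g where g: "g \<in> G" "g \<in> conds" "dom (bits r) <= dom (bits g)" using G_meets_dom[OF r] G_P by blast
  define D where "D = {x \<in> dom (bits r). bits g x \<noteq> bits r x}"
  have finD: "finite D" unfolding D_def using dom_cond_map(1)[OF r] by simp
  obtain pf where pf: "dt UNIV (%e. pf (e 0))" "\<And>p. p \<in> conds ==>
      pf p \<in> conds & bits (pf p) = flip D (bits p)"
    using ex_flip[OF finD, of dl] by (elim exE conjE) simp
  have "pf (pf p) = p" if "p \<in> conds" for p
    by (rule cond_map_inj[of _ dl]) (use pf(2) that flip_flip in auto)
  moreover have "leq (pf p) (pf q)" if "leq p q" for p q using that pf(2) flip_le unfolding cond_le_iff by auto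
  ultimately obtain v where v: "generic (pf ` G) v" using generic_image[OF pf(1)] pf(2) by blast
  have "bits r \<subseteq>\<^sub>m bits (pf g)" unfolding map_le_def
  proof
    fix x assume x: "x \<in> dom (bits r)"
    then obtain b c where "bits r x = Some b" "bits g x = Some c" using g(3) by blast
    thus "bits r x = bits (pf g) x" using pf(2)[OF g(2)] x unfolding flip_def D_def by auto
  qed
  hence "leq (pf g) r" unfolding cond_le_iff using pf(2)[OF g(2)] r by blast
  moreover have "pf g \<in> pf ` G" using g by blast
  ultimately have "r \<in> pf ` G" using generic_ext.G_up[OF generic_ext[OF v]] by blast
  thus ?thesis using v by blast
qed

end

sublocale cohen_ext \<subseteq> homogeneous mem "Cond dl" "cond_le dl" "iter_one dl" G memW val
  by unfold_locales (rule ex_generic_above)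

context cohen_ext
begin

lemma ex_union:
  assumes B: "finite B" "B <= conds" "\<And>p q. p \<in> B ==> q \<in> B ==> agree (bits p) (bits q)"
  shows "\<exists>r\<in>conds. (\<forall>p\<in>B. bits p \<subseteq>\<^sub>m bits r) &
      dom (bits r) = (\<Union>p\<in>B. dom (bits p))"
proof -
  define g where "g x = (if x \<in> (\<Union>p\<in>B. dom (bits p)) then Some (\<exists>p\<in>B. bits p x =
      Some True) else None)" for x
  have d: "dom g = (\<Union>p\<in>B. dom (bits p))" unfolding g_def by (auto simp: dom_def split: if_splits)
  have "\<exists>r\<in>conds. bits r = g"
  proof (rule ex_cond_map)
    show "finite (dom g)" unfolding d using dom_cond_map(1) B(1, 2) by blast
    show "dom g <= ext dl \<times> UNIV" unfolding d using dom_cond_map(2) B(2) by blast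
  qed
  moreover have "bits p \<subseteq>\<^sub>m g" if p: "p \<in> B" for p unfolding map_le_def
  proof
    fix x assume "x \<in> dom (bits p)"
    then obtain b where b: "bits p x = Some b" by blast
    have "(\<exists>q\<in>B. bits q x = Some True) <-> b" using b p B(3)[OF p]
      unfolding agree_def by (metis (full_types))
    thus "bits p x = g x" unfolding g_def using b p by auto
  qed
  ultimately show ?thesis using d by metis
qed

lemma ex_common:
  assumes "p \<in> conds" "q \<in> conds" "agree (bits p) (bits q)"
  shows "\<exists>r. leq r p & leq r q"
proof -
  have "agree (bits x) (bits x)" "agree (bits q) (bits p)" for x using assms(3) unfolding agree_def by auto
  hence "\<exists>r\<in>conds. (\<forall>p\<in>{p, q}. bits p \<subseteq>\<^sub>m bits r) &
      dom (bits r) = (\<Union>p\<in>{p, q}. dom (bits p))"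
    by (intro ex_union) (use assms in auto)
  thus ?thesis unfolding cond_le_iff using assms by blast
qed

subsubsection \<open>Ground model sets in the extension\<close>

lemma emb_inj [simp]: "emb x = emb y <-> x = y"
proof
  assume "emb x = emb y"
  then obtain p where "p \<in> G" "FE p (ck x) (ck y)" using FE_complete unfolding emb_def by blast
  thus "x = y" using FE_check G_P by blast
qed simp
lemma emb_mem [simp]: "memW (emb x) (emb y) <-> x <: y" by (auto simp: mem_emb)
lemma emb_coll: "finite S ==> emb (coll S) = W.coll (emb ` S)"
  by (rule W.coll_eq[symmetric]) (simp add: ext_emb ext_coll is_set_finite)
lemma emb_pair: "emb (pair x y) = W.pair (emb x) (emb y)"
  unfolding pair_def W.pair_def by (simp add: emb_coll)
lemma emb_empty: "emb empty = W.empty" unfolding empty_def W.empty_def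
  by (simp add: emb_coll)
lemma emb_succ: "emb (succ x) = W.succ (emb x)"
  unfolding W.succ_def by (rule W.coll_eq[symmetric]) (simp add: ext_emb ext_succ)
lemma emb_num: "emb (num n) = W.num n" by (induction n) (simp_all add: emb_empty emb_succ)
lemma emb_omega: "emb omega = W.omega"
  by (rule W_ext_inj) (simp add: ext_emb ext_omega W.ext_omega emb_num image_comp o_def)
lemma emb_finite: "finite (W.ext (emb x)) <-> finite (ext x)"
  unfolding ext_emb by (rule finite_image_iff) (simp add: inj_on_def)
lemma emb_cprod: "W.cprod (emb a) (emb b) = emb (cprod a b)"
proof (rule W.set_eqI)
  fix z
  show "memW z (W.cprod (emb a) (emb b)) <-> memW z (emb (cprod a b))"
    unfolding W.mem_cprod mem_emb mem_cprod by (auto simp: emb_pair; metis emb_pair)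
qed

lemma emb_func:
  assumes f: "func_on f a"
  shows "W.func_on (emb f) (emb a)"
proof -
  have graph: "memW (W.pair (emb x) y) (emb f) <-> (\<exists>z. y = emb z & pair x z <: f)" for x y
  proof -
    have "memW (W.pair (emb x) y) (emb f) <-> (\<exists>w. w <: f & W.pair (emb x) y = emb w)" by (rule mem_emb)
    also have "... <-> (\<exists>z. y = emb z & pair x z <: f)" using f
      unfolding func_on_def by (auto simp: emb_pair; metis emb_pair W.pair_inject emb_inj)
    finally show ?thesis .
  qed
  have "\<exists>x y. z = W.pair x y & memW x (emb a)" if "memW z (emb f)" for z
    using that f unfolding mem_emb func_on_def by (metis emb_pair)
  moreover have "\<exists>!y. memW (W.pair x y) (emb f)" if "memW x (emb a)" for x
    using that f unfolding mem_emb[of x] func_on_def by (auto simp: graph) metis+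
  ultimately show ?thesis unfolding W.func_on_def by blast
qed

lemma emb_ap:
  assumes "func_on f a" "x <: a"
  shows "W.ap (emb f) (emb x) = emb (ap f x)"
proof -
  have "memW (W.pair (emb x) (emb (ap f x))) (emb f)" unfolding emb_pair[symmetric] using func_ap[OF assms] by simp
  thus ?thesis using W.func_ap[OF emb_func[OF assms(1)], of "emb x"] assms(2) by simp
qed

lemma emb_fn: "fn f a b ==> W.fn (emb f) (emb a) (emb b)"
  unfolding fn_ap W.fn_ap using emb_func emb_ap by (auto simp: mem_emb)
lemma emb_inj_fn:
  assumes f: "inj_fn f a b"
  shows "W.inj_fn (emb f) (emb a) (emb b)"
  unfolding W.inj_fn_def mem_emb
  using emb_fn[OF inj_fnD(1)[OF f]] emb_ap[OF inj_fnD(2)[OF f]] inj_fnD(4)[OF f] by auto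
lemma emb_lepoll: "lepoll a b ==> W.lepoll (emb a) (emb b)"
  unfolding lepoll_def W.lepoll_def using emb_inj_fn by blast
lemma emb_ordinal:
  assumes a: "ordinal a"
  shows "W.ordinal (emb a)"
proof -
  have "W.ext x <= W.ext (emb a)" if "memW x (emb a)" for x
    using that a unfolding ordinal_def mem_emb by (fastforce simp: ext_emb)
  moreover have "W.ext y <= W.ext x" if xy: "memW x (emb a)" "memW y x" for x y
  proof -
    obtain z where z: "z <: a" "x = emb z" using xy mem_emb by blast
    then obtain w where w: "w <: z" "y = emb w" using xy mem_emb by blast
    hence "ext w <= ext z" using a z unfolding ordinal_def by blast
    thus ?thesis using z w by (auto simp: ext_emb)
  qed
  ultimately show ?thesis unfolding W.ordinal_def by blast
qed

lemma emb_sub: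
  assumes "W.ext x <= W.ext (emb a)" "finite (W.ext x)"
  shows "\<exists>y. x = emb y & ext y <= ext a"
proof -
  have "\<exists>S. finite S & S <= ext a & W.ext x = emb ` S" using assms
    unfolding ext_emb by (metis finite_subset_image)
  then obtain S y where S: "S <= ext a" "W.ext x = emb ` S" "ext y = S" using finite_subset_is_set by metis
  hence "x = emb y" by (intro W_ext_inj) (simp add: ext_emb)
  thus ?thesis using S by blast
qed

subsubsection \<open>Deciding membership in a name\<close>

primrec env_list :: "'v list => nat => 'v" where
  "env_list [] n = empty" | "env_list (x # l) n = (case n of 0 => x | Suc k => env_list l k)"

definition decides :: "'v => 'v => 'v => bool => bool" where
  "decides q b ta c <-> q \<in> conds & forced (%e. memW (e 1) (e 0) <-> c) q (env_list [ta, ck b])"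

lemma dp_decides [dpi]:
  assumes "dt UNIV t" "dt UNIV u" "dt UNIV s"
  shows "dp UNIV (%e. decides (t e) (u e) (s e) c)"
proof -
  have "dt UNIV (%e. env_list [s e, ck (u e)] n)" for n
    by (cases n; cases "n - 1") (auto intro!: dpi assms)
  moreover have "W.dp {} (%e. memW (e 1) (e 0) <-> c)" by (intro dpi)
  ultimately show ?thesis unfolding decides_def using assms(1) by (intro dp_forced)
qed

lemma decides_iff: "decides q b ta c <-> q \<in> conds & (\<forall>H v. generic H v & q \<in> H -->
    (memW (emb b) (v ta) <-> c))"
proof -
  have "memW (v (ck b)) (v ta) <-> memW (emb b) (v ta)" if "generic H v" for H v using val_ck[OF that] by simp
  thus ?thesis unfolding decides_def forced_def by auto
qed

lemma decides_mono: "decides q b ta c ==> leq r q ==> decides r b ta c"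
  unfolding decides_iff using generic_facts(2) le_in(1) by blast

lemma decides_truth:
  assumes H: "generic H v"
  shows "\<exists>q\<in>H. decides q b ta (memW (emb b) (v ta))"
proof -
  have "\<exists>q\<in>H. forced (%e. memW (e 1) (e 0) <-> memW (emb b) (v ta)) q (env_list [ta, ck b])"
    by (rule forced_truth[OF _ H]) (intro dpi, simp add: val_ck[OF H])
  thus ?thesis unfolding decides_def using generic_facts(1)[OF H] by blast
qed

lemma decides_below:
  assumes "p \<in> G" "memW (emb b) (val ta)"
  shows "\<exists>q\<in>G. leq q p & decides q b ta True"
proof -
  obtain q where q: "q \<in> G" "decides q b ta True" using decides_truth[OF generic_self, of b ta] assms(2) by auto
  obtain r where "r \<in> G" "leq r p" "leq r q" using G_dir assms(1) q(1) by blast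
  thus ?thesis using q(2) decides_mono by blast
qed

text \<open>Conditions of bounded size that decide different values of a function at a place are pairwise incompatible.\<close>

lemma finite_decided_values:
  assumes p0: "forced (%e. \<forall>x y y'. memW (W.pair x y) (e 0) & memW (W.pair x y') (e 0) --> y = y') p0 (%_. tf)"
  shows "finite {y. \<exists>q. leq q p0 & card (dom (bits q)) <= n & decides q (pair x y) tf True}" (is "finite ?Y")
proof (rule ccontr)
  assume inf: "infinite ?Y"
  have "\<forall>y\<in>?Y. \<exists>q. leq q p0 & card (dom (bits q)) <= n & decides q (pair x y) tf True" by blast
  from bchoice[OF this] obtain q where q: "\<forall>y\<in>?Y. leq (q y) p0 & card (dom (bits (q y))) <= n &
      decides (q y) (pair x y) tf True"
    by blast
  have "\<exists>B\<subseteq>?Y. finite B & card B = Suc 1 &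
      (\<forall>y\<in>B. \<forall>z\<in>B. agree (bits (q y)) (bits (q z)))"
    by (rule infinite_compatible[OF inf, of "%y. bits (q y)" n 1]) (use q dom_cond_map(1) decides_iff in blast)
  then obtain B where B: "B <= ?Y" "card B = 2" "\<forall>y\<in>B. \<forall>z\<in>B. agree (bits (q y)) (bits (q z))"
    by auto
  then obtain y z where yz: "y \<in> B" "z \<in> B" "y \<noteq> z" by (metis card_2_iff')
  hence Q: "q y \<in> conds" "q z \<in> conds" "leq (q y) p0" "decides (q y) (pair x y) tf True"
    "decides (q z) (pair x z) tf True"
    using q B(1) decides_iff by blast+
  obtain r where r: "leq r (q y)" "leq r (q z)" using ex_common[OF Q(1, 2)] B(3) yz by blast
  obtain H v where H: "generic H v" "r \<in> H" using hom le_in r by blast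
  have inH: "q y \<in> H" "q z \<in> H" "p0 \<in> H" using generic_facts(2)[OF H] r Q(3) le_trans by blast+
  hence "memW (W.pair (emb x) (emb y)) (v tf)" "memW (W.pair (emb x) (emb z)) (v tf)"
    using Q(4, 5) H(1) unfolding decides_iff emb_pair by blast+
  hence "emb y = emb z" using forcedD[OF p0 H(1) inH(3)] by blast
  thus False using yz by simp
qed

lemma covering:
  assumes f: "\<And>x y y'. memW (W.pair x y) f ==> memW (W.pair x y') f ==> y = y'"
  obtains C where "ext C <= ext a" "lepoll C (cprod (cprod b omega) omega)"
  "\<And>x y. x <: b ==> y <: a ==> memW (W.pair (emb x) (emb y)) f ==> y <: C"
proof -
  obtain tf where tf: "f = val tf" using val_surj by blast
  let ?functional = "%e. \<forall>x y y'. memW (W.pair x y) (e (0::nat)) & memW (W.pair x y') (e 0) --> y = y'"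
  have "W.dp {} ?functional" by (intro dpi)
  then obtain p0 where p0: "p0 \<in> G" "forced ?functional p0 (%_. tf)"
    using forced_truth[OF _ generic_self, of ?functional "%_. tf"] f unfolding tf by blast
  define Q where "Q z y <-> (\<exists>x n q. z = pair x n & leq q p0 & size_le dl q n & decides q (pair x y) tf True)"
    for z y
  have dQ: "dp UNIV (%e. Q (e 0) (e 1))" unfolding Q_def by (intro dpi)
  obtain C where C: "\<And>y. y <: C <-> y <: a & (\<exists>z. z <: cprod b omega & Q z y)"
    by (rule sepE, erule that, intro dpi dp_lift2[OF dQ])
  have "ext C <= ext a" using C by auto
  moreover have "lepoll C (cprod (cprod b omega) omega)"
  proof (rule finite_cover[OF dQ])
    show "\<exists>z. z <: cprod b omega & Q z y" if "y <: C" for y using that C by blast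
    fix z assume "z <: cprod b omega"
    then obtain x n where z: "z = pair x (num n)" by (auto simp: mem_cprod mem_omega)
    have "{y. y <: C & Q z y} <= {y. \<exists>q. leq q p0 & card (dom (bits q)) <= n & decides q (pair x y) tf True}"
      unfolding Q_def z using size_le_num decides_iff by auto
    thus "finite {y. y <: C & Q z y}" using finite_decided_values[OF p0(2)] finite_subset by blast
  qed
  moreover have "y <: C" if xy: "x <: b" "y <: a" "memW (W.pair (emb x) (emb y)) f" for x y
  proof -
    obtain q where q: "leq q p0" "decides q (pair x y) tf True"
      using decides_below[OF p0(1), of "pair x y" tf] xy(3) unfolding tf emb_pair by blast
    hence "Q (pair x (num (card (dom (bits q))))) y" unfolding Q_def using size_le_num decides_iff by blast
    thus ?thesis unfolding C using xy(1, 2) by (intro conjI exI) auto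
  qed
  ultimately show ?thesis by (rule that)
qed

lemma lepoll_reflect:
  assumes "W.lepoll (emb a) (emb b)"
  shows "lepoll a (cprod (cprod b omega) omega)"
proof -
  obtain g where g: "W.inj_fn g (emb a) (emb b)" using assms by (rule W.lepollE)
  obtain f where f: "\<And>z. memW z f <-> memW z (W.cprod (emb b) (emb a)) & (\<exists>x. memW x (emb a) &
      z = W.pair (W.ap g x) x)"
    by (rule W.sepE, erule that, intro dpi)
  obtain C where C: "ext C <= ext a" "lepoll C (cprod (cprod b omega) omega)"
    "\<And>x y. x <: b ==> y <: a ==> memW (W.pair (emb x) (emb y)) f ==> y <: C"
  proof (rule covering[of f a b])
    show "y = y'" if "memW (W.pair x y) f" "memW (W.pair x y') f" for x y y' using that W.inj_fnD(4)[OF g]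
      unfolding f by auto
  qed (rule that)
  have "x <: C" if x: "x <: a" for x
  proof -
    have "memW (W.ap g (emb x)) (emb b)" using W.inj_fnD(3)[OF g] x by simp
    then obtain y where y: "y <: b" "W.ap g (emb x) = emb y" using mem_emb by blast
    hence "memW (W.pair (emb y) (emb x)) f" unfolding f using x by (metis W.pair_mem_cprod emb_mem)
    thus ?thesis using C(3) x y(1) by blast
  qed
  hence "lepoll a C" by (intro lepoll_subset) auto
  thus ?thesis using C(2) lepoll_trans by blast
qed

lemma csucc_W:
  assumes k: "ordinal k" "lepoll (cprod (cprod k omega) omega) k"
  shows "W.cardinal (emb (csucc k))" "W.csucc (emb k) = emb (csucc k)"
proof -
  note csucc = csucc_props[OF k(1)]
  have "\<not> W.equinum b (emb (csucc k))" if b: "memW b (emb (csucc k))" for b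
  proof
    assume "W.equinum b (emb (csucc k))"
    hence "W.lepoll (emb (csucc k)) b" by (rule W.equinum_lepoll2)
    then obtain a where a: "a <: csucc k" "W.lepoll (emb (csucc k)) (emb a)" using b by (metis mem_emb)
    have "lepoll (csucc k) (cprod (cprod a omega) omega)" by (rule lepoll_reflect[OF a(2)])
    moreover have "lepoll (cprod (cprod a omega) omega) (cprod (cprod k omega) omega)"
      using csucc(3)[OF a(1)] by (intro lepoll_prod lepoll_refl)
    ultimately show False using csucc(4) k(2) lepoll_trans by blast
  qed
  thus card: "W.cardinal (emb (csucc k))" unfolding W.cardinal_def using emb_ordinal csucc(1) cardinal_def by blast
  have "W.lepoll b (emb k)" if "memW b (emb (csucc k))" for b using that csucc(3) emb_lepoll by (metis mem_emb)
  thus "W.csucc (emb k) = emb (csucc k)" using card csucc(2) by (intro W.csuccI) simp_all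
qed

end

subsection \<open>Cardinals and the continuum in the extension\<close>

locale cohen_model = cohen_ext mem dl G memW val
  for mem :: "'v => 'v => bool" (infix \<open><:\<close> 50) and dl G and memW :: "'w => 'w => bool" and val +
  assumes GCH: GCH and dl: "dl = aleph2"
begin

lemmas aleph1_props = csucc_props[OF ordinal_omega, folded aleph1_def]
lemma ordinal_aleph1: "ordinal aleph1" using aleph1_props(1) cardinal_def
  by blast
lemmas dl_props = csucc_props[OF ordinal_aleph1, folded aleph2_def, folded dl]
lemma ordinal_dl: "ordinal dl" using dl_props(1) cardinal_def
  by blast

lemma cardinal_omega: "cardinal omega"
  unfolding cardinal_def
proof (intro conjI allI impI notI)
  fix a assume "a <: omega" "equinum a omega"
  then obtain n f where "a = num n" "bij_betw (app f) (ext (num n)) (ext omega)" unfolding equinum_def mem_omega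
    by blast
  hence "finite (ext omega)" using bij_betw_finite ext_num by (metis finite_imageI finite_lessThan)
  thus False unfolding ext_omega using inj_num by (metis infinite_UNIV_char_0 finite_imageD)
qed (rule ordinal_omega)

lemma equinum_pow_omega: "equinum (powset omega) aleph1"
  using GCH cardinal_omega unfolding GCH_def aleph1_def by blast
lemma omega_subset_aleph1: "ext omega <= ext aleph1" using aleph1_props(2) ordinal_aleph1 ordinal_trans
  by auto
lemma equinum_pow_aleph1: "equinum (powset aleph1) dl"
  using GCH aleph1_props(1) omega_subset_aleph1 unfolding GCH_def dl aleph2_def by blast

lemma lepoll_seq:
  assumes "equinum (powset a) b" "lepoll (cprod a omega) a"
  shows "lepoll (funs omega b) b"
  using lepoll_funs[OF equinum_lepoll2[OF assms(1)]] lepoll_pow_seq[OF assms(2)] equinum_lepoll[OF assms(1)]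
    lepoll_trans
  by meson
lemmas aleph1_seq = lepoll_seq[OF equinum_pow_omega lepoll_omega_square]
lemma aleph1_square: "lepoll (cprod aleph1 aleph1) aleph1" by (rule lepoll_square[OF aleph1_seq])
lemma omega_lepoll_aleph1: "lepoll omega aleph1" by (rule lepoll_ordinal[OF ordinal_aleph1 aleph1_props(2)])
lemma aleph1_omega: "lepoll (cprod aleph1 omega) aleph1"
  by (rule lepoll_trans[OF lepoll_prod[OF lepoll_refl omega_lepoll_aleph1] aleph1_square])
lemmas dl_seq = lepoll_seq[OF equinum_pow_aleph1 aleph1_omega]
lemma dl_square: "lepoll (cprod dl dl) dl" by (rule lepoll_square[OF dl_seq])
lemma omega_lepoll_dl: "lepoll omega dl"
  by (rule lepoll_trans[OF omega_lepoll_aleph1 lepoll_ordinal[OF ordinal_dl dl_props(2)]])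
lemma num_aleph1: "num n <: aleph1" using omega_subset_aleph1 num_omega[of n]
  by (auto simp: subset_iff)
lemma num_dl: "num n <: dl" using num_aleph1 ordinal_trans[OF ordinal_dl dl_props(2)]
  by blast
lemma Fin_aleph1: "lepoll (Fin aleph1) aleph1"
  by (rule lepoll_Fin[OF aleph1_seq num_aleph1[of 0] num_aleph1[of 1]]) (simp del: num.simps)
lemma Fin_dl: "lepoll (Fin dl) dl" by (rule lepoll_Fin[OF dl_seq num_dl[of 0] num_dl[of 1]]) (simp del: num.simps)
lemma lepoll_prod_dl: "lepoll a dl ==> lepoll b dl ==> lepoll (cprod a b) dl"
  using lepoll_prod dl_square lepoll_trans by blast

lemma omega_cube: "lepoll (cprod (cprod omega omega) omega) omega"
  by (rule lepoll_trans[OF lepoll_prod[OF lepoll_omega_square lepoll_refl] lepoll_omega_square])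
lemma lepoll_aleph1_omega: "lepoll b aleph1 ==> lepoll (cprod b omega) aleph1"
  using lepoll_prod[OF _ lepoll_refl] aleph1_omega lepoll_trans by blast
lemmas lepoll_aleph1_omega2 = lepoll_aleph1_omega[OF lepoll_aleph1_omega]

lemmas aleph1_W = csucc_W(2)[OF ordinal_omega omega_cube, folded aleph1_def, unfolded emb_omega, folded W.aleph1_def]
lemmas cardinal_aleph1_W = csucc_W(1)[OF ordinal_omega omega_cube, folded aleph1_def]
lemmas aleph2_W = csucc_W(2)[OF ordinal_aleph1 lepoll_aleph1_omega2[OF lepoll_refl],
  folded aleph2_def aleph1_W W.aleph2_def dl]

lemma bounded_dl:
  assumes C: "ext C <= ext dl" "lepoll C aleph1"
  shows "\<exists>be. be <: dl & ext C <= ext be"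
proof (rule ccontr)
  assume unbounded: "\<not> ?thesis"
  have cof: "\<exists>c. c <: C & (al <: c \<or> al = c)" if al: "al <: dl" for al
  proof -
    obtain c where c: "c <: C" "\<not> c <: al" using unbounded al by (auto simp: subset_iff)
    hence "ordinal c" "ordinal al" using C(1) al ordinal_mem[OF ordinal_dl] by (auto simp: subset_iff)
    thus ?thesis using c ordinal_linear by blast
  qed
  have ex: "\<exists>i. i <: powset (cprod dl aleph1) & inj_fn i c aleph1" if c: "c <: C" for c
  proof -
    have "c <: dl" using c C(1) by auto
    then obtain i where i: "inj_fn i c aleph1" using dl_props(3) lepollE by metis
    have "ext (cprod c aleph1) <= ext (cprod dl aleph1)" using ordinal_trans[OF ordinal_dl \<open>c <: dl\<close>]
      by (auto simp: mem_cprod)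
    thus ?thesis using fn_mem_pow[OF inj_fnD(1)[OF i]] i by auto
  qed
  obtain g where g: "\<And>c. c <: C ==> inj_fn (ap g c) c aleph1"
    by (rule choice[of "%c i. inj_fn i c aleph1" C "powset (cprod dl aleph1)"]) (intro dpi, erule ex, rule that, blast)
  have "lepoll dl (cprod (cprod C aleph1) omega)"
  proof (rule lepoll_choice[of "%al z. \<exists>c. c <: C &
      ((al <: c & z = pair (pair c (ap (ap g c) al)) (num 0)) \<or>
      (al = c & z = pair (pair c (num 0)) (num 1)))"])
    fix al assume "al <: dl"
    then obtain c where c: "c <: C" "al <: c \<or> al = c" using cof by blast
    hence "al <: c ==> ap (ap g c) al <: aleph1" using inj_fnD(3)[OF g] by blast
    thus "\<exists>z. z <: cprod (cprod C aleph1) omega &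
        (\<exists>c. c <: C & ((al <: c & z = pair (pair c (ap (ap g c) al)) (num 0)) \<or>
        (al = c & z = pair (pair c (num 0)) (num 1))))" using c num_aleph1[of 0] num_omega[of 0] num_omega[of 1]
          by (metis pair_mem_cprod)
  next
    fix al al' z assume h: "\<exists>c. c <: C & ((al <: c & z = pair (pair c (ap (ap g c) al)) (num 0)) \<or>
        (al = c & z = pair (pair c (num 0)) (num 1)))"
      "\<exists>c. c <: C & ((al' <: c & z = pair (pair c (ap (ap g c) al')) (num 0)) \<or>
          (al' = c & z = pair (pair c (num 0)) (num 1)))"
    have "num 0 \<noteq> num 1" by (simp only: num_inj)
    thus "al = al'" using h inj_fnD(4)[OF g] by (metis pair_inject)
  qed (intro dpi)
  moreover have "lepoll (cprod (cprod C aleph1) omega) aleph1"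
    using lepoll_aleph1_omega lepoll_prod[OF C(2) lepoll_refl] aleph1_square lepoll_trans by blast
  ultimately show False using dl_props(4) lepoll_trans by blast
qed

text \<open>The least bounds of bounded fibers would be covered by a ground model set of size \<open>\<aleph>\<^sub>1\<close>.\<close>

lemma unbounded_fiber:
  assumes R: "W.dp UNIV (%e. R (e 0) (e 1))" and L: "W.lepoll L (emb aleph1)"
  and ex: "\<And>al. al <: dl ==> \<exists>p. memW p L & R p (emb al)"
  shows "\<exists>p. memW p L & (\<forall>be. be <: dl --> (\<exists>al. al <: dl & \<not> al <: be & R p (emb al)))"
proof (rule ccontr)
  assume bounded: "\<not> ?thesis"
  define bound where "bound p be <-> (\<forall>al. memW al (emb dl) & R p al --> memW al be)" for p be
  have dp_bound: "W.dp UNIV (%e. bound (e 0) (e 1))" unfolding bound_def by (intro dpi W.dp_lift2[OF R])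
  obtain h where h: "W.inj_fn h L (emb aleph1)" using L by (rule W.lepollE)
  obtain f where f: "\<And>z. memW z f <-> memW z (W.cprod (emb aleph1) (emb dl)) &
      (\<exists>p be. z = W.pair (W.ap h p) be & memW p L & bound p be & (\<forall>c. memW c be --> \<not> bound p c))"
    by (rule W.sepE, erule that, intro dpi W.dp_lift2[OF dp_bound])
  have "be = be'" if "memW (W.pair x be) f" "memW (W.pair x be') f" for x be be'
  proof -
    have "W.ordinal be" "W.ordinal be'" using that W.ordinal_mem[OF emb_ordinal[OF ordinal_dl]] unfolding f by auto
    thus ?thesis using that W.inj_fnD(4)[OF h] W.ordinal_linear[of be be'] unfolding f W.pair_inject by metis
  qed
  then obtain C where C: "ext C <= ext dl" "lepoll C (cprod (cprod aleph1 omega) omega)"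
    "\<And>x y. x <: aleph1 ==> y <: dl ==> memW (W.pair (emb x) (emb y)) f ==> y <: C" using covering[of f dl aleph1]
      by metis
  have "\<exists>be. be <: C & al <: be" if al: "al <: dl" for al
  proof -
    obtain p where p: "memW p L" "R p (emb al)" using ex[OF al] by blast
    obtain be0 where be0: "be0 <: dl" "\<And>al. al <: dl ==> R p (emb al) ==> al <: be0" using bounded p(1) by blast
    have "bound p (emb be0)" unfolding bound_def mem_emb[of _ dl] using be0(2) by auto
    then obtain be where be: "bound p be" "\<And>c. memW c be ==> \<not> bound p c" "be = emb be0 \<or>
        memW be (emb be0)"
      using W.least_ordinal[of "emb be0" "bound p"] emb_ordinal ordinal_mem[OF ordinal_dl be0(1)] by metis
    have "memW be (emb dl)" using be(3) be0(1) W.ordinal_trans[OF emb_ordinal[OF ordinal_dl], of "emb be0"] by auto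
    then obtain be1 where be1: "be = emb be1" "be1 <: dl" using mem_emb by blast
    obtain x where x: "W.ap h p = emb x" "x <: aleph1" using W.inj_fnD(3)[OF h p(1)] mem_emb by blast
    have "memW (W.pair (W.ap h p) be) f" unfolding f using x be1 be(1, 2) p(1)
      by (intro conjI exI[of _ p] exI[of _ be]) auto
    hence "be1 <: C" using C(3)[OF x(2) be1(2)] unfolding x(1) be1(1) by simp
    moreover have "al <: be1" using be(1) p(2) al unfolding bound_def be1(1) by (metis emb_mem)
    ultimately show ?thesis by blast
  qed
  moreover have "lepoll C aleph1" using C(2) lepoll_aleph1_omega2[OF lepoll_refl] lepoll_trans by blast
  then obtain be where "be <: dl" "ext C <= ext be" using bounded_dl[OF C(1)] by blast
  ultimately show False using mem_asym by (metis mem_ext subsetD)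
qed

definition cohen_name :: 'v where
  "cohen_name = coll {z. \<exists>w. w <: cprod (cprod dl omega) (coll conds) &
  (\<exists>xi k p. w = pair (pair xi k) p & has_bit p xi (pair k (bit True)) & z = pair (ck (pair xi k)) p)}"

lemma mem_cohen_name: "z <: cohen_name <->
  (\<exists>xi k p. xi <: dl & k <: omega & p \<in> conds & has_bit p xi (pair k (bit True)) &
      z = pair (ck (pair xi k)) p)"
proof -
  have "is_set {z. \<exists>w. w <: cprod (cprod dl omega) (coll conds) &
      (\<exists>xi k p. w = pair (pair xi k) p & has_bit p xi (pair k (bit True)) & z = pair (ck (pair xi k)) p)}"
    by (rule rep) (intro dpi, auto)
  from mem_coll[OF this, of z] have "z <: cohen_name <-> (\<exists>w. w <: cprod (cprod dl omega) (coll conds) &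
      (\<exists>xi k p. w = pair (pair xi k) p & has_bit p xi (pair k (bit True)) & z = pair (ck (pair xi k)) p))"
    unfolding cohen_name_def mem_Collect_eq .
  also have "... <-> (\<exists>xi k p. xi <: dl & k <: omega & p \<in> conds & has_bit p xi (pair k (bit True)) &
      z = pair (ck (pair xi k)) p)"
    using mem_coll_P pair_mem_cprod by blast
  finally show ?thesis .
qed

lemma mem_val_cohen_name:
  assumes "generic H v"
  shows "memW x (v cohen_name) <-> (\<exists>xi n p. p \<in> H & bits p (xi, n) = Some True &
      x = emb (pair xi (num n)))"
proof
  assume "memW x (v cohen_name)"
  then obtain xi k p where "p \<in> H" "xi <: dl" "k <: omega" "p \<in> conds" "has_bit p xi (pair k (bit True))"
    "x = v (ck (pair xi k))"
    unfolding generic_facts(4)[OF assms] mem_cohen_name by auto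
  thus "\<exists>xi n p. p \<in> H & bits p (xi, n) = Some True & x = emb (pair xi (num n))"
    using has_bit_pair val_ck[OF assms] by (metis mem_omega)
next
  assume "\<exists>xi n p. p \<in> H & bits p (xi, n) = Some True & x = emb (pair xi (num n))"
  then obtain xi n p where h: "p \<in> H" "bits p (xi, n) = Some True" "x = emb (pair xi (num n))" by blast
  hence p: "p \<in> conds" "xi <: dl" using generic_facts(1)[OF assms] dom_cond_map(2) by fastforce+
  hence "has_bit p xi (pair (num n) (bit True))" using has_bit_pair h by simp
  hence "pair (ck (pair xi (num n))) p <: cohen_name" unfolding mem_cohen_name using p num_omega by blast
  thus "memW x (v cohen_name)" unfolding generic_facts(4)[OF assms] using h val_ck[OF assms] by metis
qed

lemma bit_decided:
  assumes "generic H v" "p \<in> H" "bits p (xi, n) = Some b"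
  shows "memW (W.pair (emb xi) (W.num n)) (v cohen_name) <-> b"
proof
  assume "memW (W.pair (emb xi) (W.num n)) (v cohen_name)"
  then obtain q where q: "q \<in> H" "bits q (xi, n) = Some True"
    unfolding mem_val_cohen_name[OF assms(1)] by (auto simp flip: emb_num emb_pair)
  obtain r where "r \<in> H" "leq r p" "leq r q" using generic_facts(3)[OF assms(1, 2) q(1)] by blast
  hence "bits r (xi, n) = Some b" "bits r (xi, n) = Some True" using assms(3) q(2) unfolding cond_le_iff map_le_def
    by (metis domI)+
  thus b by simp
next
  assume b thus "memW (W.pair (emb xi) (W.num n)) (v cohen_name)"
    unfolding mem_val_cohen_name[OF assms(1)] using assms by (auto simp flip: emb_num emb_pair)
qed

definition cohen_reals :: 'w where "cohen_reals = val cohen_name"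

lemma bits_differ:
  assumes "al <: dl" "be <: dl" "al \<noteq> be"
  shows "\<exists>n. memW (W.pair (emb al) (W.num n)) cohen_reals & \<not> memW (W.pair (emb be) (W.num n)) cohen_reals"
proof -
  define D where "D p <-> p \<in> conds & (\<exists>k. k <: omega & has_bit p al (pair k (bit True)) &
      has_bit p be (pair k (bit False)))" for p
  have "\<exists>p\<in>G. D p"
  proof (rule G_meets)
    show "dp UNIV (%e. D (e 0))" unfolding D_def by (intro dpi)
    fix p assume p: "p \<in> conds"
    obtain n where n: "n \<notin> snd ` dom (bits p)"
      using dom_cond_map(1)[OF p] by (meson ex_new_if_finite finite_imageI infinite_UNIV_nat)
    hence new: "bits p (al, n) = None" "bits p (be, n) = None" by (force simp: dom_def image_iff)+
    have "\<exists>q\<in>conds. bits q = (bits p)((al, n) \<mapsto> True, (be, n) \<mapsto> False)"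
      using dom_cond_map[OF p] assms by (intro ex_cond_map) auto
    then obtain q where q: "q \<in> conds" "bits q = (bits p)((al, n) \<mapsto> True, (be, n) \<mapsto> False)" by blast
    have "leq q p" unfolding cond_le_iff map_le_def using p q new by auto
    moreover have "has_bit q al (pair (num n) (bit True))" "has_bit q be (pair (num n) (bit False))"
      using q assms by (auto simp: has_bit_pair)
    ultimately show "\<exists>q. leq q p & D q" unfolding D_def using q num_omega by blast
  qed
  then obtain p n where p: "p \<in> G" "bits p (al, n) = Some True" "bits p (be, n) = Some False"
    using has_bit_pair assms unfolding D_def by (auto simp: mem_omega)
  thus ?thesis using bit_decided[OF generic_self p(1)] unfolding cohen_reals_def by blast
qed

lemma lepoll_continuum: "W.lepoll (emb dl) (W.powset W.omega)"
proof (rule W.lepoll_rel[of "%a s. \<forall>n. memW n s <-> memW n W.omega & memW (W.pair a n) cohen_reals"])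
  fix a
  obtain s where "\<And>n. memW n s <-> memW n W.omega & memW (W.pair a n) cohen_reals"
    by (rule W.sepE, erule that, intro dpi)
  thus "\<exists>s. memW s (W.powset W.omega) & (\<forall>n. memW n s <->
      memW n W.omega & memW (W.pair a n) cohen_reals)"
    by (intro exI[of _ s]) auto
next
  fix a a' s assume h: "memW a (emb dl)" "memW a' (emb dl)" "\<forall>n. memW n s <->
      memW n W.omega & memW (W.pair a n) cohen_reals"
    "\<forall>n. memW n s <-> memW n W.omega & memW (W.pair a' n) cohen_reals"
  obtain al be where ab: "al <: dl" "be <: dl" "a = emb al" "a' = emb be" using h(1, 2) mem_emb by blast
  thus "a = a'" using bits_differ[of al be] bits_differ[of be al] h(3, 4) by (metis W.num_omega)
qed (intro dpi, auto intro: W.set_eqI)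

lemma ex_predense_set:
  obtains E where "finite (ext E)" "\<And>q. q <: E ==> q \<in> conds & D q"
  "\<And>q. q \<in> conds ==> D q ==> size_le dl q (num n) ==> \<exists>e r. e <: E & leq r q & leq r e"
proof -
  let ?small = "{q \<in> conds. D q & card (dom (bits q)) <= n}"
  have "\<exists>E\<subseteq>?small. finite E & (\<forall>i\<in>?small. \<exists>j\<in>E. agree (bits i) (bits j))"
    by (rule finite_predense[where n = n]) (use dom_cond_map(1) in auto)
  then obtain E where E: "E <= ?small" "finite E" "\<forall>i\<in>?small. \<exists>j\<in>E. agree (bits i) (bits j)"
    by blast
  obtain F where F: "ext F = E" using finite_subset_is_set E(2) by blast
  have "\<exists>e r. e <: F & leq r q & leq r e" if q: "q \<in> conds" "D q" "size_le dl q (num n)" for q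
  proof -
    obtain e where "e \<in> E" "agree (bits q) (bits e)" using E(3) size_le_num q by blast
    thus ?thesis using ex_common[of q e] q(1) E(1) F mem_ext by blast
  qed
  moreover have "q \<in> conds & D q" if "q <: F" for q using that E(1) F mem_ext by blast
  ultimately show thesis using that E(2) F by blast
qed

lemma predense_cover:
  assumes D: "dp UNIV (%e. D (e 0) (e 1))"
  obtains U where "lepoll U (cprod (cprod B omega) omega)" "\<And>u. u <: U ==> \<exists>b q. u = pair b q & b <: B &
      q \<in> conds & D b q"
  "\<And>b q. b <: B ==> q \<in> conds ==> D b q ==> \<exists>e r. pair b e <: U & leq r q & leq r e"
proof -
  define R where "R z E <-> (\<exists>b n. z = pair b n & finite (ext E) & (\<forall>q. q <: E -->
      q \<in> conds & D b q) &
      (\<forall>q. q \<in> conds & D b q & size_le dl q n --> (\<exists>e r. e <: E & leq r q & leq r e)))" for z E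
  have dR: "dp UNIV (%e. R (e 0) (e 1))" unfolding R_def by (intro dpi dp_lift2[OF D])
  have "\<exists>E. E <: powset (coll conds) & R z E" if z: "z <: cprod B omega" for z
  proof -
    obtain b n where bn: "z = pair b (num n)" using z by (auto simp: mem_cprod mem_omega)
    obtain E where E: "finite (ext E)" "\<And>q. q <: E ==> q \<in> conds & D b q"
      "\<And>q. q \<in> conds ==> D b q ==> size_le dl q (num n) ==> \<exists>e r. e <: E & leq r q & leq r e"
        by (rule ex_predense_set[of "D b" n, OF that])
    have "R z E" unfolding R_def bn using E by (rule_tac exI[of _ b], rule_tac exI[of _ "num n"]) blast
    moreover have "E <: powset (coll conds)" using E(2) by auto
    ultimately show ?thesis by blast
  qed
  then obtain f where f: "\<And>z. z <: cprod B omega ==> R z (ap f z)" using choice[OF dR, of "cprod B omega"] by metis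
  obtain U where U: "\<And>u. u <: U <-> u <: cprod B (coll conds) & (\<exists>b q n. u = pair b q & n <: omega &
      q <: ap f (pair b n))"
    by (rule sepE, erule that, intro dpi)
  have "lepoll U (cprod (cprod B omega) omega)"
  proof (rule finite_cover[of "%i u. \<exists>b n q. i = pair b n & u = pair b q & q <: ap f (pair b n)"])
    show "\<exists>i. i <: cprod B omega & (\<exists>b n q. i = pair b n & u = pair b q & q <: ap f (pair b n))"
      if "u <: U" for u
      using that unfolding U mem_cprod by (metis pair_inject)
    fix i assume i: "i <: cprod B omega"
    then obtain b n where bn: "i = pair b n" by (auto simp: mem_cprod)
    have "{u. u <: U & (\<exists>b n q. i = pair b n & u = pair b q & q <: ap f (pair b n))} <=
        (%q. pair b q) ` ext (ap f i)"
      using bn by auto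
    moreover have "finite (ext (ap f i))" using f[OF i] unfolding R_def by blast
    ultimately show "finite {u. u <: U & (\<exists>b n q. i = pair b n & u = pair b q & q <: ap f (pair b n))}"
      using finite_surj by blast
  qed (intro dpi)
  moreover have "\<exists>b q. u = pair b q & b <: B & q \<in> conds & D b q" if u: "u <: U" for u
  proof -
    obtain b q n where bq: "u = pair b q" "n <: omega" "q <: ap f (pair b n)" "b <: B" "q \<in> conds" using u
      unfolding U by auto
    thus ?thesis using f[of "pair b n"] unfolding R_def by auto
  qed
  moreover have "\<exists>e r. pair b e <: U & leq r q & leq r e" if q: "b <: B" "q \<in> conds" "D b q" for b q
  proof -
    have "size_le dl q (num (card (dom (bits q))))" using size_le_num[OF q(2)] by blast
    then obtain e r where "e <: ap f (pair b (num (card (dom (bits q)))))" "leq r q" "leq r e"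
      using f[of "pair b (num (card (dom (bits q))))"] q unfolding R_def by auto
    moreover from this have "pair b e <: U" unfolding U using q(1) le_in(2) num_omega
      by (metis mem_coll_P pair_mem_cprod)
    ultimately show ?thesis by blast
  qed
  ultimately show ?thesis by (rule that)
qed

definition filter_name :: 'v where "filter_name = coll ((%p. pair (ck p) p) ` conds)"
lemma mem_filter_name: "memW x (val filter_name) <-> (\<exists>p\<in>G. x = emb p)"
proof -
  have "is_set ((%p. pair (ck p) p) ` ext (coll conds))" by (rule rep_image) (intro dpi)
  hence "is_set ((%p. pair (ck p) p) ` conds)" by (simp add: ext_coll is_set_P)
  from mem_coll[OF this] show ?thesis unfolding mem_val filter_name_def emb_def using G_P by (auto simp: image_iff)
qed

lemma lepoll_PP: "lepoll (coll conds) dl"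
proof -
  let ?B = "cprod dl (cprod omega (num 2))"
  let ?bits = "%p s. \<forall>z. z <: s <-> (\<exists>xi y. z = pair xi y & xi <: dl & has_bit p xi y)"
  have "lepoll (coll conds) (Fin ?B)"
  proof (rule lepoll_rel[of ?bits])
    fix p assume "p <: coll conds"
    hence p: "p \<in> conds" by simp
    have "finite {z. \<exists>xi y. z = pair xi y & xi <: dl & has_bit p xi y}"
      using size_le_num[OF p] unfolding size_le_def covered_num by blast
    moreover from this obtain s where "ext s = {z. \<exists>xi y. z = pair xi y & xi <: dl & has_bit p xi y}"
      using finite_subset_is_set by blast
    ultimately have "?bits p s" "finite (ext s)" by (auto simp flip: mem_ext)
    moreover from this have "s <: Fin ?B" unfolding mem_Fin using has_bit_cond_map[OF p] mem_num2
      by (auto simp: subset_iff)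
    ultimately show "\<exists>s. s <: Fin ?B & ?bits p s" by blast
  next
    fix p q s assume h: "p <: coll conds" "q <: coll conds" "?bits p s" "?bits q s"
    have pq: "p \<in> conds" "q \<in> conds" using h by simp_all
    have "has_bit p xi y <-> has_bit q xi y" if "xi <: dl" for xi y
      using h(3)[THEN spec, of "pair xi y"] h(4)[THEN spec, of "pair xi y"] that by auto
    hence "leq p q" "leq q p" unfolding cond_le_def using pq has_bit_coord by (auto simp: subset_iff)
    thus "p = q" using pq cond_map_inj map_le_antisym unfolding cond_le_iff by blast
  qed (intro dpi, auto intro: set_eqI)
  moreover have "lepoll ?B dl"
    by (intro lepoll_prod_dl lepoll_refl omega_lepoll_dl lepoll_ordinal[OF ordinal_dl num_dl])
  ultimately show ?thesis using lepoll_Fin_mono Fin_dl lepoll_trans by meson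
qed

lemma lepoll_Ctb_PP: "lepoll (Ctb (cprod omega (coll conds))) dl"
proof -
  have "lepoll (Ctb (cprod omega (coll conds))) (funs omega (cprod omega (coll conds)))"
    by (rule lepoll_Ctb[of "pair (num 0) (iter_one dl)" _ "pair (num 1) (iter_one dl)"])
      (use one_in in \<open>simp_all del: num.simps\<close>)
  thus ?thesis using lepoll_funs[OF lepoll_prod_dl[OF omega_lepoll_dl lepoll_PP]] dl_seq lepoll_trans by meson
qed

lemma real_name:
  assumes x: "W.ext x <= W.ext W.omega"
  obtains U where "U <: Ctb (cprod omega (coll conds))" "\<And>n. memW (W.num n) x <->
      (\<exists>q\<in>G. pair (num n) q <: U)"
proof -
  obtain ta where ta: "x = val ta" using val_surj by blast
  obtain U where U: "lepoll U (cprod (cprod omega omega) omega)"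
    "\<And>u. u <: U ==> \<exists>b q. u = pair b q & b <: omega & q \<in> conds & decides q b ta True"
    "\<And>b q. b <: omega ==> q \<in> conds ==> decides q b ta True ==> \<exists>e r. pair b e <: U & leq r q &
        leq r e"
    by (rule predense_cover[of "%b q. decides q b ta True" omega]) (intro dpi, rule that)
  have "U <: Ctb (cprod omega (coll conds))" unfolding mem_Ctb using U(1) omega_cube lepoll_trans U(2) by fastforce
  moreover have "memW (W.num n) x <-> (\<exists>q\<in>G. pair (num n) q <: U)" for n
  proof
    assume "memW (W.num n) x"
    then obtain q where q: "q \<in> G" "decides q (num n) ta True" using decides_below[OF G_one, of "num n"]
      unfolding ta emb_num by blast
    have "\<exists>r\<in>G. leq r q & (\<exists>e. pair (num n) e <: U & leq r e)"
    proof (rule G_meets_below[OF _ q(1)])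
      show "dp UNIV (%r. \<exists>e. pair (num n) e <: U & leq (r 0) e)" by (intro dpi)
      fix s assume "leq s q"
      hence "s \<in> conds" "decides s (num n) ta True" using decides_mono q(2) decides_iff by blast+
      thus "\<exists>r. leq r s & (\<exists>e. pair (num n) e <: U & leq r e)" using U(3)[of "num n" s] by auto
    qed
    thus "\<exists>q\<in>G. pair (num n) q <: U" using G_up by blast
  next
    assume "\<exists>q\<in>G. pair (num n) q <: U"
    then obtain q where "q \<in> G" "decides q (num n) ta True" using U(2) by fastforce
    thus "memW (W.num n) x" using generic_self unfolding decides_iff ta emb_num by blast
  qed
  ultimately show ?thesis by (rule that)
qed

theorem continuum: "W.equinum (W.powset W.omega) W.aleph2"
proof -
  obtain g where g: "inj_fn g (Ctb (cprod omega (coll conds))) dl" using lepoll_Ctb_PP by (rule lepollE)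
  define codes where "codes x U <-> (\<forall>n. memW n W.omega -->
      (memW n x <-> (\<exists>q. memW q (val filter_name) & memW (W.pair n q) U)))" for x U
  have "W.lepoll (W.powset W.omega) (emb dl)"
  proof (rule W.lepoll_least[of "%x a. \<exists>U. memW U (emb (Ctb (cprod omega (coll conds)))) & a = W.ap (emb g) U &
      codes x U"])
    show "W.ordinal (emb dl)" by (rule emb_ordinal[OF ordinal_dl])
    fix x assume "memW x (W.powset W.omega)"
    then obtain U where U: "U <: Ctb (cprod omega (coll conds))" "\<And>n. memW (W.num n) x <->
        (\<exists>q\<in>G. pair (num n) q <: U)"
      using real_name[of x] by auto
    have pair_emb: "memW (W.pair (W.num n) (emb q)) (emb U) <-> pair (num n) q <: U" for n q
      by (metis emb_mem emb_num emb_pair)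
    have "memW (W.num n) x <-> (\<exists>q. memW q (val filter_name) & memW (W.pair (W.num n) q) (emb U))" for n
      unfolding mem_filter_name U(2) pair_emb[symmetric] by blast
    hence "codes x (emb U)" unfolding codes_def W.mem_omega by blast
    thus "\<exists>a. memW a (emb dl) & (\<exists>U. memW U (emb (Ctb (cprod omega (coll conds)))) &
        a = W.ap (emb g) U & codes x U)"
      using U(1) emb_ap[OF inj_fnD(2)[OF g]] inj_fnD(3)[OF g] \<open>codes x (emb U)\<close>
      by (intro exI[of _ "emb (ap g U)"] conjI exI[of _ "emb U"]) simp_all
  next
    fix x x' a assume x: "memW x (W.powset W.omega)" "memW x' (W.powset W.omega)"
      and "\<exists>U. memW U (emb (Ctb (cprod omega (coll conds)))) & a = W.ap (emb g) U & codes x U"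
      "\<exists>U. memW U (emb (Ctb (cprod omega (coll conds)))) & a = W.ap (emb g) U & codes x' U"
    then obtain U U' where U: "U <: Ctb (cprod omega (coll conds))" "U' <: Ctb (cprod omega (coll conds))"
      "W.ap (emb g) (emb U) = W.ap (emb g) (emb U')" "codes x (emb U)" "codes x' (emb U')" unfolding mem_emb by metis
    have "U = U'" using U(3) emb_ap[OF inj_fnD(2)[OF g]] inj_fnD(4)[OF g] U(1, 2) by simp
    hence "memW n x <-> memW n x'" if "memW n W.omega" for n using U(4, 5) that unfolding codes_def by blast
    moreover have "memW n W.omega" if "memW n x \<or> memW n x'" for n using x that by auto
    ultimately show "x = x'" by (intro W.set_eqI) blast
  qed (unfold codes_def, intro dpi)
  thus ?thesis unfolding aleph2_W by (rule W.cantor_bernstein[OF _ lepoll_continuum])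
qed

end

section \<open>Real numbers of a structure\<close>

context zermelo
begin

definition num_denom :: "rat => nat \<times> nat \<times> nat" where
  "num_denom q = (case quotient_of q of (a, b) => (nat a, nat (- a), nat b))"
abbreviation "rat_pos q \<equiv> fst (num_denom q)"
abbreviation "rat_neg q \<equiv> fst (snd (num_denom q))"
abbreviation "rat_den q \<equiv> snd (snd (num_denom q))"

lemma num_denom_props: "rat_den q > 0" "q = (of_nat (rat_pos q) - of_nat (rat_neg q)) / of_nat (rat_den q)"
  "rat_pos q = 0 \<or> rat_neg q = 0" "coprime (rat_pos q + rat_neg q) (rat_den q)"
  "rat_code q = pair (pair (num (rat_pos q)) (num (rat_neg q))) (num (rat_den q))"
proof -
  obtain a b where ab: "quotient_of q = (a, b)" by fastforce
  hence b: "b > 0" "q = of_int a / of_int b" "coprime a b"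
    using quotient_of_denom_pos quotient_of_div quotient_of_coprime by auto
  show "rat_den q > 0" using ab b by (simp add: num_denom_def)
  have "(of_nat (nat a) :: rat) - of_nat (nat (- a)) = of_int a" by (cases "a >= 0") (simp_all add: of_nat_nat)
  thus "q = (of_nat (rat_pos q) - of_nat (rat_neg q)) / of_nat (rat_den q)"
    using ab b by (simp add: num_denom_def of_nat_nat)
  show "rat_pos q = 0 \<or> rat_neg q = 0" using ab by (simp add: num_denom_def) linarith
  have "int (nat a + nat (- a)) = \<bar>a\<bar>" by (simp add: abs_if)
  moreover have "coprime \<bar>a\<bar> b" using b by simp
  ultimately have "coprime (int (nat a + nat (- a))) (int (nat b))" using b by simp
  thus "coprime (rat_pos q + rat_neg q) (rat_den q)"
    using ab by (simp only: num_denom_def case_prod_conv fst_conv snd_conv coprime_int_iff)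
  show "rat_code q = pair (pair (num (rat_pos q)) (num (rat_neg q))) (num (rat_den q))"
    using ab by (simp add: rat_code_def num_denom_def)
qed

lemma rat_code_inj [simp]: "rat_code p = rat_code q <-> p = q"
  using num_denom_props(2)[of p] num_denom_props(2)[of q] unfolding num_denom_props(5) by (metis num_inj pair_inject)

lemma ex_rat_code:
  assumes "a = 0 \<or> b = 0" "c > 0" "coprime (a + b) c"
  shows "\<exists>q. rat_code q = pair (pair (num a) (num b)) (num c)"
proof -
  have "coprime (int a - int b) (int c)"
  proof -
    have "\<bar>int a - int b\<bar> = int (a + b)" using assms(1) by auto
    moreover have "coprime (int (a + b)) (int c)" using assms(3) by (simp only: coprime_int_iff)
    ultimately show ?thesis by (metis coprime_abs_left_iff)
  qed
  hence "quotient_of (Fract (int a - int b) (int c)) = (int a - int b, int c)"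
    using assms(2) by (simp add: quotient_of_Fract normalize_stable)
  thus ?thesis using assms(1) by (intro exI[of _ "Fract (int a - int b) (int c)"]) (auto simp: rat_code_def)
qed

definition reduced :: "'v => 'v => 'v => bool" where
  "reduced a b c <-> c \<noteq> empty & (a = empty \<or> b = empty) & (\<forall>d x y. d <: omega & x <: omega &
      y <: omega &
  num_mult d x = num_add a b & num_mult d y = c --> d = num 1)"

lemma reduced_num: "reduced (num a) (num b) (num c) <-> (a = 0 \<or> b = 0) & c > 0 & coprime (a + b) c"
proof -
  have zero: "num k = empty <-> k = 0" for k using num_inj[of k 0] by simp
  have "(\<forall>d x y. d <: omega & x <: omega & y <: omega & num_mult d x = num_add (num a) (num b) &
      num_mult d y = num c --> d = num 1)
      <-> (\<forall>d x y. d * x = a + b & d * y = c --> d = 1)"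
    unfolding mem_omega by (auto simp del: num.simps) (metis num_add_num num_inj num_mult_num)+
  also have "... <-> (\<forall>d. d dvd a + b & d dvd c --> d = 1)" unfolding dvd_def by metis
  also have "... <-> coprime (a + b) c" by (auto simp: coprime_def)
  finally show ?thesis unfolding reduced_def zero by auto
qed

lemma range_rat_code: "z \<in> range rat_code <-> z <: cprod (cprod omega omega) omega &
    (\<exists>a b c. z = pair (pair a b) c & reduced a b c)"
proof
  assume "z \<in> range rat_code"
  then obtain q where "z = pair (pair (num (rat_pos q)) (num (rat_neg q))) (num (rat_den q))" using num_denom_props(5)
    by auto
  thus "z <: cprod (cprod omega omega) omega & (\<exists>a b c. z = pair (pair a b) c & reduced a b c)"
    using num_denom_props(1, 3, 4)[of q] reduced_num by auto
next
  assume "z <: cprod (cprod omega omega) omega & (\<exists>a b c. z = pair (pair a b) c & reduced a b c)"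
  then obtain a b c where "z = pair (pair (num a) (num b)) (num c)" "reduced (num a) (num b) (num c)"
    by (auto simp: mem_omega)
  thus "z \<in> range rat_code" using ex_rat_code[of a b c] reduced_num by (metis rangeI)
qed

lemma is_set_Rat: "is_set (range rat_code)"
proof -
  have "is_set {z. z <: cprod (cprod omega omega) omega & (\<exists>a b c. z = pair (pair a b) c & reduced a b c)}"
    by (rule sep) (unfold reduced_def, intro dpi)
  thus ?thesis unfolding range_rat_code[symmetric] by simp
qed

definition Rat :: 'v where "Rat = coll (range rat_code)"
lemma mem_Rat: "z <: Rat <-> (\<exists>q. z = rat_code q)" unfolding Rat_def
  by (auto simp: mem_coll is_set_Rat)

definition rat_less :: "'v => 'v => bool" where
  "rat_less x y <-> (\<exists>a b c a' b' c'. x = pair (pair a b) c & y = pair (pair a' b') c' &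
  num_add (num_mult a c') (num_mult b' c) <: num_add (num_mult a' c) (num_mult b c'))"

definition rat_add :: "'v => 'v => 'v => bool" where
  "rat_add x y z <-> (\<exists>a b c a' b' c' a'' b'' c''. x = pair (pair a b) c & y = pair (pair a' b') c' &
      z = pair (pair a'' b'') c'' &
  num_add (num_add (num_mult a (num_mult c' c'')) (num_mult a' (num_mult c c''))) (num_mult b'' (num_mult c c')) =
  num_add (num_add (num_mult b (num_mult c' c'')) (num_mult b' (num_mult c c''))) (num_mult a'' (num_mult c c')))"
definition rat_mult :: "'v => 'v => 'v => bool" where
  "rat_mult x y z <-> (\<exists>a b c a' b' c' a'' b'' c''. x = pair (pair a b) c & y = pair (pair a' b') c' &
      z = pair (pair a'' b'') c'' &
  num_add (num_add (num_mult (num_mult a a') c'') (num_mult (num_mult b b') c'')) (num_mult b'' (num_mult c c')) =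
  num_add (num_add (num_mult (num_mult a b') c'') (num_mult (num_mult b a') c'')) (num_mult a'' (num_mult c c')))"

lemma dp_rat_less [dpi]: "dt C t ==> dt C u ==> dp C (%e. rat_less (t e) (u e))"
  by (rule dp_lift2[where Q = rat_less]) (unfold rat_less_def, intro dpi)
lemma dp_rat_add [dpi]: "dt C t ==> dt C u ==> dt C v ==> dp C (%e. rat_add (t e) (u e) (v e))"
  by (rule dp_lift3[where Q = rat_add]) (unfold rat_add_def, intro dpi)
lemma dp_rat_mult [dpi]: "dt C t ==> dt C u ==> dt C v ==> dp C (%e. rat_mult (t e) (u e) (v e))"
  by (rule dp_lift3[where Q = rat_mult]) (unfold rat_mult_def, intro dpi)

context
  fixes a b c a' b' c' a'' b'' c'' :: nat
  assumes pos: "c > 0" "c' > 0" "c'' > 0"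
begin

lemma frac_less: "(of_nat a - of_nat b) / of_nat c < ((of_nat a' - of_nat b') / of_nat c' :: rat) <->
    a * c' + b' * c < a' * c + b * c'"
proof -
  have "a * c' + b' * c < a' * c + b * c' <-> (of_nat (a * c' + b' * c) :: rat) < of_nat (a' * c + b * c')"
    by (simp only: of_nat_less_iff)
  thus ?thesis using pos by (simp add: field_simps)
qed

lemma nat_eq_rat: "x = y <-> (of_nat x :: rat) = of_nat y" by simp

lemma frac_add:
  "(of_nat a - of_nat b) / of_nat c + (of_nat a' - of_nat b') / of_nat c' =
      ((of_nat a'' - of_nat b'') / of_nat c'' :: rat) <->
  a * (c' * c'') + a' * (c * c'') + b'' * (c * c') = b * (c' * c'') + b' * (c * c'') + a'' * (c * c')"
  unfolding nat_eq_rat[of "_ + _"] using pos by (simp add: divide_simps) (simp add: algebra_simps; linarith?)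

lemma frac_mult:
  "(of_nat a - of_nat b) / of_nat c * ((of_nat a' - of_nat b') / of_nat c') =
      ((of_nat a'' - of_nat b'') / of_nat c'' :: rat) <->
  a * a' * c'' + b * b' * c'' + b'' * (c * c') = a * b' * c'' + b * a' * c'' + a'' * (c * c')"
  unfolding nat_eq_rat[of "_ + _"] using pos by (simp add: divide_simps) (simp add: algebra_simps; linarith?)

end

lemma rat_less_iff: "rat_less (rat_code p) (rat_code q) <-> p < q"
proof -
  have "rat_less (rat_code p) (rat_code q) <->
      rat_pos p * rat_den q + rat_neg q * rat_den p < rat_pos q * rat_den p + rat_neg p * rat_den q"
    unfolding rat_less_def num_denom_props(5) by (simp add: num_mem del: num.simps)
  also have "... <-> p < q"
    by (rule frac_less[OF num_denom_props(1)[of p] num_denom_props(1)[of q] zero_less_one, of "rat_pos p" "rat_neg p"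
      "rat_pos q" "rat_neg q",
    folded num_denom_props(2)[of p] num_denom_props(2)[of q], symmetric])
  finally show ?thesis .
qed

lemma rat_add_iff: "rat_add (rat_code p) (rat_code q) (rat_code r) <-> p + q = r"
proof -
  have "rat_add (rat_code p) (rat_code q) (rat_code r) <->
      rat_pos p * (rat_den q * rat_den r) + rat_pos q * (rat_den p * rat_den r) + rat_neg r * (rat_den p * rat_den q) =
      rat_neg p * (rat_den q * rat_den r) + rat_neg q * (rat_den p * rat_den r) + rat_pos r * (rat_den p * rat_den q)"
    unfolding rat_add_def num_denom_props(5) by (simp del: num.simps)
  also have "... <-> p + q = r"
    by (rule frac_add[OF num_denom_props(1)[of p] num_denom_props(1)[of q] num_denom_props(1)[of r],
    of "rat_pos p" "rat_neg p" "rat_pos q" "rat_neg q" "rat_pos r" "rat_neg r",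
    folded num_denom_props(2)[of p] num_denom_props(2)[of q] num_denom_props(2)[of r], symmetric])
  finally show ?thesis .
qed

lemma rat_mult_iff: "rat_mult (rat_code p) (rat_code q) (rat_code r) <-> p * q = r"
proof -
  have "rat_mult (rat_code p) (rat_code q) (rat_code r) <->
      rat_pos p * rat_pos q * rat_den r + rat_neg p * rat_neg q * rat_den r + rat_neg r * (rat_den p * rat_den q) =
      rat_pos p * rat_neg q * rat_den r + rat_neg p * rat_pos q * rat_den r + rat_pos r * (rat_den p * rat_den q)"
    unfolding rat_mult_def num_denom_props(5) by (simp del: num.simps)
  also have "... <-> p * q = r"
    by (rule frac_mult[OF num_denom_props(1)[of p] num_denom_props(1)[of q] num_denom_props(1)[of r],
    of "rat_pos p" "rat_neg p" "rat_pos q" "rat_neg q" "rat_pos r" "rat_neg r",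
    folded num_denom_props(2)[of p] num_denom_props(2)[of q] num_denom_props(2)[of r], symmetric])
  finally show ?thesis .
qed

subsection \<open>Cuts\<close>

abbreviation "real_cut c \<equiv> (\<exists>r. is_real c r)"

lemma mem_real: "is_real c r ==> z <: c <-> (\<exists>q. z = rat_code q & of_rat q < r)"
  unfolding is_real_def by (auto simp: image_iff simp flip: mem_ext)
lemma rat_mem_real: "is_real c r ==> rat_code q <: c <-> of_rat q < r" by (simp add: mem_real)

lemma is_real_unique:
  assumes "is_real c r" "is_real c s"
  shows "r = s"
proof -
  have "\<not> x < y" if x: "is_real c x" and y: "is_real c y" for x y
  proof
    assume "x < y"
    then obtain q where "x < of_rat q" "of_rat q < y" using of_rat_dense by blast
    thus False using rat_mem_real[OF x, of q] rat_mem_real[OF y, of q] by simp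
  qed
  thus ?thesis using assms by (meson linorder_neqE_linordered_idom)
qed

lemma is_real_inj: "is_real c r ==> is_real d r ==> c = d" unfolding is_real_def
  by (intro ext_inj) simp
lemma real_val_eq: "is_real c r ==> real_val c = r" unfolding real_val_def
  using is_real_unique by blast
lemma real_code_eq: "is_real c r ==> real_code r = c" unfolding real_code_def
  using is_real_inj by blast
lemma is_real_code: "r \<in> Reals_in ==> is_real (real_code r) r" unfolding Reals_in_def
  using real_code_eq by auto
lemma real_val_code [simp]: "r \<in> Reals_in ==> real_val (real_code r) = r" using real_val_eq is_real_code
  by blast
lemma real_code_inj: "r \<in> Reals_in ==> s \<in> Reals_in ==> real_code r = real_code s <-> r = s"
  by (metis real_val_code)
lemma Reals_inI:
  assumes "is_set {z. \<exists>q. z = rat_code q & of_rat q < r}"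
  shows "r \<in> Reals_in"
proof -
  have "{z. \<exists>q. z = rat_code q & of_rat q < r} = rat_code ` {q. of_rat q < r}" by auto
  thus ?thesis using assms unfolding is_set_def Reals_in_def is_real_def by simp
qed

lemma real_cut_val: "real_cut c ==> real_val c \<in> Reals_in & real_code (real_val c) = c & is_real c (real_val c)"
  using real_val_eq real_code_eq unfolding Reals_in_def by auto

lemma Reals_sep:
  assumes "dp UNIV (%e. Q (e 0))" "\<And>q. Q (rat_code q) <-> of_rat q < r"
  shows "r \<in> Reals_in"
proof (rule Reals_inI)
  have "is_set {z. z <: Rat & Q z}" by (rule sep[OF assms(1)])
  moreover have "{z. z <: Rat & Q z} = {z. \<exists>q. z = rat_code q & of_rat q < r}"
    using assms(2) by (auto simp: mem_Rat)
  ultimately show "is_set {z. \<exists>q. z = rat_code q & of_rat q < r}" by simp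
qed

definition dedekind_cut :: "'v => bool" where
  "dedekind_cut c <-> (\<forall>z. z <: c --> z <: Rat) & (\<exists>z. z <: c) &
      (\<exists>z. z <: Rat & \<not> z <: c) &
  (\<forall>z y. z <: c & y <: Rat & rat_less y z --> y <: c) & (\<forall>z. z <: c -->
      (\<exists>y. y <: c & rat_less z y))"

lemma dedekind_cut_real:
  assumes r: "is_real c r"
  shows "dedekind_cut c"
  unfolding dedekind_cut_def
proof (intro conjI allI impI)
  note mem_c = mem_real[OF r]
  obtain q where "of_rat q < r" using of_rat_dense[of "r - 1" r] by auto
  thus "\<exists>z. z <: c" using mem_c by blast
  obtain q where "\<not> of_rat q < r" using of_rat_dense[of r "r + 1"] by (meson less_add_one not_less_iff_gr_or_eq)
  thus "\<exists>z. z <: Rat & \<not> z <: c" using rat_mem_real[OF r] mem_Rat by blast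
  show "z <: Rat" if "z <: c" for z using that mem_c mem_Rat by blast
  show "y <: c" if h: "z <: c & y <: Rat & rat_less y z" for z y
  proof -
    obtain q where q: "z = rat_code q" "of_rat q < r" using h mem_c by blast
    obtain p where p: "y = rat_code p" using h mem_Rat by blast
    have "p < q" using h unfolding p q(1) by (simp add: rat_less_iff)
    hence "of_rat p < r" using q(2) of_rat_less[of p q, where ?'a = real] by linarith
    thus ?thesis using p rat_mem_real[OF r] by simp
  qed
  show "\<exists>y. y <: c & rat_less z y" if "z <: c" for z
  proof -
    obtain q where q: "z = rat_code q" "of_rat q < r" using \<open>z <: c\<close> mem_c by blast
    obtain q' where "of_rat q' < r" "q < q'" using of_rat_dense[OF q(2)] by (auto simp: of_rat_less)
    thus ?thesis using q rat_mem_real[OF r] rat_less_iff by blast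
  qed
qed

lemma real_dedekind_cut:
  assumes c: "dedekind_cut c"
  shows "\<exists>r. is_real c r"
proof -
  define S where "S = {of_rat q :: real | q. rat_code q <: c}"
  have down: "rat_code p <: c" if "rat_code q <: c" "p < q" for p q using c that rat_less_iff mem_Rat
    unfolding dedekind_cut_def by metis
  obtain q0 q1 where q01: "rat_code q0 <: c" "\<not> rat_code q1 <: c" using c mem_Rat unfolding dedekind_cut_def
    by metis
  have "x <= of_rat q1" if "x \<in> S" for x
    using that q01(2) down unfolding S_def by (auto simp: of_rat_less_eq) (metis linorder_not_le)
  hence S: "S \<noteq> {}" "bdd_above S" using q01(1) unfolding S_def bdd_above_def by blast+
  have "rat_code q <: c <-> of_rat q < Sup S" for q
  proof
    assume "rat_code q <: c"
    then obtain q' where q': "rat_code q' <: c" "q < q'" using c mem_Rat rat_less_iff unfolding dedekind_cut_def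
      by metis
    hence "of_rat q' <= Sup S" using S cSup_upper[of "of_rat q'" S] unfolding S_def by blast
    thus "of_rat q < Sup S" using q'(2) by (simp add: of_rat_less order.strict_trans2[of "of_rat q" "of_rat q'"])
  next
    assume "of_rat q < Sup S"
    then obtain q' where "rat_code q' <: c" "of_rat q < (of_rat q' :: real)" using less_cSup_iff[OF S]
      unfolding S_def by auto
    thus "rat_code q <: c" using down by (simp add: of_rat_less)
  qed
  moreover have "\<exists>q. z = rat_code q" if "z <: c" for z using c that mem_Rat unfolding dedekind_cut_def by blast
  ultimately have "is_real c (Sup S)" unfolding is_real_def by (auto simp: image_iff; metis)
  thus ?thesis by blast
qed

lemma dt_Rat [dpi]: "dt UNIV (%e. Rat)" by (rule dt_const_UNIV)
lemma dp_real_cut [dpi]: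
  assumes "dt UNIV t"
  shows "dp UNIV (%e. real_cut (t e))"
proof -
  have "real_cut c <-> dedekind_cut c" for c using dedekind_cut_real real_dedekind_cut by blast
  thus ?thesis by (simp only:) (rule dp_lift1[OF _ assms], unfold dedekind_cut_def, intro dpi)
qed

lemma is_set_reals: "is_set {c. real_cut c}"
proof (rule is_set_sub[OF is_set_ext[of "powset Rat"]])
  have "z <: Rat" if "is_real c r" "z <: c" for z c r using mem_real[OF that(1)] that(2) mem_Rat by blast
  thus "{c. real_cut c} <= ext (powset Rat)" by auto
  show "dp UNIV (%e. e 0 \<in> {c. real_cut c})" unfolding mem_Collect_eq by (intro dpi)
qed

lemma mem_reals: "c <: reals <-> real_cut c" unfolding reals_def
  by (simp add: mem_coll is_set_reals)
lemma mem_reals_code: "c <: reals <-> (\<exists>r\<in>Reals_in. c = real_code r)"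
  unfolding mem_reals by (metis real_cut_val is_real_code)
lemma real_code_reals [simp]: "r \<in> Reals_in ==> real_code r <: reals" using mem_reals_code
  by blast

lemma rat_Reals: "of_rat p \<in> Reals_in"
  by (rule Reals_sep[of "%z. rat_less z (rat_code p)"]) (intro dpi, simp add: rat_less_iff of_rat_less)

lemma add_cut:
  assumes "is_real c r" "is_real d s"
  shows "(\<exists>x y. x <: c & y <: d & rat_add x y (rat_code q)) <-> of_rat q < r + s"
proof
  assume "\<exists>x y. x <: c & y <: d & rat_add x y (rat_code q)"
  thus "of_rat q < r + s" using mem_real[OF assms(1)] mem_real[OF assms(2)] by (auto simp: rat_add_iff of_rat_add)
next
  assume "of_rat q < r + s"
  then obtain p where p: "of_rat q - s < of_rat p" "of_rat p < r" using of_rat_dense[of "of_rat q - s" r] by auto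
  hence "rat_code p <: c" "rat_code (q - p) <: d" using rat_mem_real[OF assms(1)] rat_mem_real[OF assms(2)]
    by (auto simp: of_rat_diff)
  moreover have "rat_add (rat_code p) (rat_code (q - p)) (rat_code q)" by (simp add: rat_add_iff)
  ultimately show "\<exists>x y. x <: c & y <: d & rat_add x y (rat_code q)" by blast
qed

lemma mult_corners:
  fixes r s q :: real
  assumes "a <= r" "r <= b" "a' <= s" "s <= b'" "q < a * a'" "q < a * b'" "q < b * a'" "q < b * b'" shows "q < r * s"
proof -
  have "q < x * s" if "q < x * a'" "q < x * b'" for x
  proof (cases "x >= 0")
    case True thus ?thesis using that mult_left_mono[OF assms(3) True] by linarith
  next
    case False thus ?thesis using that mult_left_mono_neg[OF assms(4), of x] by linarith
  qed
  hence edges: "q < a * s" "q < b * s" using assms by auto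
  show ?thesis
  proof (cases "s >= 0")
    case True thus ?thesis using edges mult_right_mono[OF assms(1) True] by linarith
  next
    case False thus ?thesis using edges mult_right_mono_neg[OF assms(2), of s] by linarith
  qed
qed

lemma ex_product_near:
  fixes r s q :: real
  assumes q: "q < r * s"
  obtains e where "0 < e" "\<And>x y. \<bar>x - r\<bar> < e ==> \<bar>y - s\<bar> < e ==> q < x * y"
proof -
  define e where "e = min 1 ((r * s - q) / (\<bar>r\<bar> + \<bar>s\<bar> + 2))"
  have pos: "0 < \<bar>r\<bar> + \<bar>s\<bar> + 2" by (simp add: add_nonneg_pos)
  hence e: "0 < e" "e <= 1" using q unfolding e_def by simp_all
  have "e <= (r * s - q) / (\<bar>r\<bar> + \<bar>s\<bar> + 2)" unfolding e_def by simp
  hence small: "e * (\<bar>r\<bar> + \<bar>s\<bar> + 2) <= r * s - q" using pos by (simp only: pos_le_divide_eq)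
  have "q < x * y" if xy: "\<bar>x - r\<bar> < e" "\<bar>y - s\<bar> < e" for x y
  proof -
    have "\<bar>x * y - r * s\<bar> = \<bar>(x - r) * s + r * (y - s) + (x - r) * (y - s)\<bar>"
      by (simp add: algebra_simps)
    also have "... <= \<bar>x - r\<bar> * \<bar>s\<bar> + \<bar>r\<bar> * \<bar>y - s\<bar> + \<bar>x - r\<bar> *
        \<bar>y - s\<bar>" by (simp only: abs_mult[symmetric]; linarith)
    also have "... <= e * \<bar>s\<bar> + \<bar>r\<bar> * e + e * 1" using xy e by (intro add_mono mult_mono) auto
    also have "... < e * (\<bar>r\<bar> + \<bar>s\<bar> + 2)" using e by (simp add: algebra_simps)
    finally show ?thesis using small by linarith
  qed
  thus ?thesis using that e(1) by blast
qed

definition product_cut :: "'v => 'v => 'v => bool" where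
  "product_cut c d z <-> (\<exists>a b a' b' p1 p2 p3 p4. a <: c & b <: Rat & \<not> b <: c & a' <: d & b' <: Rat &
      \<not> b' <: d &
  p1 <: Rat & p2 <: Rat & p3 <: Rat & p4 <: Rat & rat_mult a a' p1 & rat_mult a b' p2 & rat_mult b a' p3 &
      rat_mult b b' p4 &
  rat_less z p1 & rat_less z p2 & rat_less z p3 & rat_less z p4)"

lemma mult_cut:
  assumes "is_real c r" "is_real d s"
  shows "product_cut c d (rat_code q) <-> of_rat q < r * s"
proof
  assume "product_cut c d (rat_code q)"
  then obtain a b a' b' where "of_rat a < r" "\<not> of_rat b < r" "of_rat a' < s" "\<not> of_rat b' < s"
    "q < a * a'" "q < a * b'" "q < b * a'" "q < b * b'"
    using mem_real[OF assms(1)] mem_real[OF assms(2)] unfolding product_cut_def mem_Rat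
      by (auto simp: rat_mult_iff rat_less_iff)
  thus "of_rat q < r * s"
    by (intro mult_corners[of "of_rat a" r "of_rat b" "of_rat a'" s "of_rat b'"]) (auto simp: of_rat_less simp flip:
      of_rat_mult)
next
  assume "of_rat q < r * s"
  then obtain e where e: "0 < e" "\<And>x y. \<bar>x - r\<bar> < e ==> \<bar>y - s\<bar> < e ==> of_rat q < x * y"
    using ex_product_near by metis
  obtain a b where ab: "r - e < of_rat a" "of_rat a < r" "r < of_rat b" "of_rat b < r + e"
    using of_rat_dense[of "r - e" r] of_rat_dense[of r "r + e"] e(1) by auto
  obtain a' b' where ab': "s - e < of_rat a'" "of_rat a' < s" "s < of_rat b'" "of_rat b' < s + e"
    using of_rat_dense[of "s - e" s] of_rat_dense[of s "s + e"] e(1) by auto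
  have "q < x * y" if "\<bar>of_rat x - r\<bar> < e" "\<bar>of_rat y - s\<bar> < e" for x y
    using e(2)[OF that] by (simp add: of_rat_less flip: of_rat_mult)
  hence corners: "q < a * a'" "q < a * b'" "q < b * a'" "q < b * b'" using ab ab' by auto
  have sides: "rat_code a <: c" "\<not> rat_code b <: c" "rat_code a' <: d" "\<not> rat_code b' <: d"
    using ab ab' rat_mem_real[OF assms(1)] rat_mem_real[OF assms(2)] by auto
  have Rat: "rat_code x <: Rat" for x using mem_Rat by blast
  show "product_cut c d (rat_code q)" unfolding product_cut_def
    by (rule exI[of _ "rat_code a"], rule exI[of _ "rat_code b"], rule exI[of _ "rat_code a'"], rule
      exI[of _ "rat_code b'"],
    rule exI[of _ "rat_code (a * a')"], rule exI[of _ "rat_code (a * b')"], rule exI[of _ "rat_code (b * a')"], rule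
      exI[of _ "rat_code (b * b')"])
    (simp add: rat_mult_iff rat_less_iff corners sides Rat)
qed

lemma dp_product_cut [dpi]: "dt UNIV t ==> dt UNIV u ==> dt UNIV v ==> dp UNIV (%e. product_cut (t e) (u e) (v e))"
  by (rule dp_lift3[where Q = product_cut]) (unfold product_cut_def, intro dpi)

lemma Reals_add:
  assumes "r \<in> Reals_in" "s \<in> Reals_in"
  shows "r + s \<in> Reals_in"
  by (rule Reals_sep[OF _ add_cut[OF is_real_code[OF assms(1)] is_real_code[OF assms(2)]]]) (intro dpi)
lemma Reals_mult:
  assumes "r \<in> Reals_in" "s \<in> Reals_in"
  shows "r * s \<in> Reals_in"
  by (rule Reals_sep[OF _ mult_cut[OF is_real_code[OF assms(1)] is_real_code[OF assms(2)]]]) (intro dpi)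
lemma Reals_of_int: "of_int n \<in> Reals_in" using rat_Reals[of "of_int n"]
  by simp
lemma Reals_const: "0 \<in> Reals_in" "1 \<in> Reals_in" "of_nat n \<in> Reals_in"
  using Reals_of_int[of 0] Reals_of_int[of 1] Reals_of_int[of "int n"] by auto

lemma Reals_minus: "r \<in> Reals_in ==> - r \<in> Reals_in" using Reals_mult[OF Reals_of_int[of "-1"]]
  by simp
definition real_plus :: "'v => 'v => 'v" where
  "real_plus c d = (if real_cut c & real_cut d then real_code (real_val c + real_val d) else empty)"

definition real_times :: "'v => 'v => 'v" where
  "real_times c d = (if real_cut c & real_cut d then real_code (real_val c * real_val d) else empty)"

lemma real_cut_code: "r \<in> Reals_in ==> real_cut (real_code r)" using is_real_code
  by blast
lemma real_plus_code [simp]: "r \<in> Reals_in ==> s \<in> Reals_in ==>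
    real_plus (real_code r) (real_code s) = real_code (r + s)"
  by (simp add: real_plus_def real_cut_code)
lemma real_times_code [simp]: "r \<in> Reals_in ==> s \<in> Reals_in ==>
    real_times (real_code r) (real_code s) = real_code (r * s)"
  by (simp add: real_times_def real_cut_code)

lemma real_code_cut:
  assumes "r \<in> Reals_in" "\<And>q. Q (rat_code q) <-> of_rat q < r"
  shows "y = real_code r <-> (\<forall>z. z <: y <-> z <: Rat & Q z)"
proof -
  have "z <: real_code r <-> z <: Rat & Q z" for z using mem_real[OF is_real_code[OF assms(1)]] assms(2)
    by (auto simp: mem_Rat)
  thus ?thesis using set_eqI[of y "real_code r"] by auto
qed

lemma dt_real_plus [dpi]: "dt UNIV t ==> dt UNIV u ==> dt UNIV (%e. real_plus (t e) (u e))"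
proof (rule dt_lift2[where F = real_plus])
  have "y = real_plus c d <->
      (real_cut c & real_cut d & (\<forall>z. z <: y <->
      z <: Rat & (\<exists>x x'. x <: c & x' <: d & rat_add x x' z))) \<or> (\<not> (real_cut c & real_cut d) &
      y = empty)" for y c d
  proof (cases "real_cut c & real_cut d")
    case True
    hence "is_real c (real_val c)" "is_real d (real_val d)" "real_val c + real_val d \<in> Reals_in"
      using real_cut_val Reals_add by blast+
    thus ?thesis using real_code_cut[OF _ add_cut[of c _ d], of "real_val c" "real_val d" y] True
      by (simp add: real_plus_def)
  next
    case False thus ?thesis by (simp only: real_plus_def if_False) blast
  qed
  thus "dp UNIV (%e. e 0 = real_plus (e 1) (e 2))" by (simp only:) (intro dpi)
qed

lemma dt_real_times [dpi]: "dt UNIV t ==> dt UNIV u ==> dt UNIV (%e. real_times (t e) (u e))"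
proof (rule dt_lift2[where F = real_times])
  have "y = real_times c d <-> (real_cut c & real_cut d & (\<forall>z. z <: y <-> z <: Rat & product_cut c d z)) \<or>
      (\<not> (real_cut c & real_cut d) & y = empty)" for y c d
  proof (cases "real_cut c & real_cut d")
    case True
    hence "is_real c (real_val c)" "is_real d (real_val d)" "real_val c * real_val d \<in> Reals_in"
      using real_cut_val Reals_mult by blast+
    thus ?thesis using real_code_cut[OF _ mult_cut[of c _ d], of "real_val c" "real_val d" y] True
      by (simp add: real_times_def)
  next
    case False thus ?thesis by (simp only: real_times_def if_False) blast
  qed
  thus "dp UNIV (%e. e 0 = real_times (e 1) (e 2))" by (simp only:) (intro dpi)
qed

definition real_less :: "'v => 'v => bool" where "real_less c d <-> (\<exists>z. z <: Rat & z <: d & \<not> z <: c)"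
lemma dp_real_less [dpi]: "dt UNIV t ==> dt UNIV u ==> dp UNIV (%e. real_less (t e) (u e))"
  by (rule dp_lift2[where Q = real_less]) (unfold real_less_def, intro dpi)
lemma real_less_code:
  assumes "r \<in> Reals_in" "s \<in> Reals_in"
  shows "real_less (real_code r) (real_code s) <-> r < s"
proof -
  have "real_less (real_code r) (real_code s) <-> (\<exists>q. of_rat q < s & \<not> of_rat q < r)"
    unfolding real_less_def mem_Rat
      using rat_mem_real[OF is_real_code[OF assms(1)]] rat_mem_real[OF is_real_code[OF assms(2)]] by auto
  also have "... <-> r < s" using of_rat_dense[of r s]
    by (meson dual_order.strict_trans linorder_not_less order.strict_trans1 less_imp_le)
  finally show ?thesis .
qed

definition rat_real :: "'v => 'v" where "rat_real z = coll {y. y <: Rat & rat_less y z}"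
lemma rat_real_code: "rat_real (rat_code q) = real_code (of_rat q)"
proof -
  have "\<forall>z. z <: rat_real (rat_code q) <-> z <: Rat & rat_less z (rat_code q)" unfolding rat_real_def
    using mem_coll[OF sep[of "%y. rat_less y (rat_code q)" Rat]] dp_rat_less[OF dt_var dt_const_UNIV] by blast
  thus ?thesis using real_code_cut[OF rat_Reals, of "%z. rat_less z (rat_code q)" q "rat_real (rat_code q)"]
    by (simp add: rat_less_iff of_rat_less)
qed

lemma dt_rat_real [dpi]: "dt UNIV t ==> dt UNIV (%e. rat_real (t e))"
  unfolding rat_real_def by (rule dt_coll_lift1) (rule sep, (intro dpi)+)

lemma cring_scalars: "cring scalars"
  unfolding scalars_def
  by (intro cringI abelian_groupI comm_monoidI)
  (auto simp: Reals_add Reals_mult Reals_const algebra_simps intro!: bexI[of _ "- _"] Reals_minus)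

end

section \<open>A smooth norm from a graph\<close>

text \<open>Weights \<open>w\<close> of total mass at most one on every clique define a lattice norm through
  \<open>inf (\<Sum> x\<^sup>4 / w)\<close>: it is the \<open>\<ell>\<^sub>2\<close> norm on cliques and the \<open>\<ell>\<^sub>4\<close> norm on anticliques.\<close>

definition feasible :: "('i => 'i => bool) => 'i set => ('i => real) => bool" where
  "feasible Q F w <-> (\<forall>i\<in>F. 0 < w i) & (\<forall>K\<subseteq>F. pairwise Q K -->
      (\<Sum>i\<in>K. w i) <= 1)"
definition fin_norm4 :: "('i => 'i => bool) => 'i set => ('i => real) => real" where
  "fin_norm4 Q F x = Inf {\<Sum>i\<in>F. x i ^ 4 / w i | w. feasible Q F w}"
definition fin_norm :: "('i => 'i => bool) => 'i set => ('i => real) => real" where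
  "fin_norm Q F x = root 4 (fin_norm4 Q F x)"

lemma feasible_mono:
  assumes "feasible Q F w" "E <= F"
  shows "feasible Q E w"
  unfolding feasible_def
proof (intro conjI ballI allI impI)
  show "0 < w i" if "i \<in> E" for i using assms that unfolding feasible_def by auto
  show "(\<Sum>i\<in>K. w i) <= 1" if "K <= E" "pairwise Q K" for K
    by (rule assms(1)[unfolded feasible_def, THEN conjunct2, rule_format]) (use assms(2) that in auto)
qed

lemma feasible_le_1:
  assumes w: "feasible Q F w" and i: "i \<in> F"
  shows "w i <= 1"
proof -
  have "(\<Sum>i\<in>{i}. w i) <= 1"
    by (rule w[unfolded feasible_def, THEN conjunct2, rule_format]) (use i in \<open>auto simp: pairwise_def\<close>)
  thus ?thesis by simp
qed

lemma feasible_convex: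
  assumes "feasible Q F w" "feasible Q F w'" "0 < a" "0 < (b::real)"
  shows "feasible Q F (%i. (a * w i + b * w' i) / (a + b))"
  unfolding feasible_def
proof (intro conjI ballI allI impI)
  show "0 < (a * w i + b * w' i) / (a + b)" if "i \<in> F" for i
    using assms that unfolding feasible_def by (auto intro!: divide_pos_pos add_pos_pos mult_pos_pos)
  fix K assume K: "K <= F" "pairwise Q K"
  hence s: "(\<Sum>i\<in>K. w i) <= 1" "(\<Sum>i\<in>K. w' i) <= 1" using assms unfolding feasible_def by auto
  have "(\<Sum>i\<in>K. (a * w i + b * w' i) / (a + b)) =
      (a * (\<Sum>i\<in>K. w i) + b * (\<Sum>i\<in>K. w' i)) / (a + b)"
    by (simp add: sum_divide_distrib[symmetric] sum.distrib sum_distrib_left)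
  also have "... <= (a * 1 + b * 1) / (a + b)"
    using assms s by (intro divide_right_mono add_mono mult_left_mono) auto
  finally show "(\<Sum>i\<in>K. (a * w i + b * w' i) / (a + b)) <= 1" using assms by simp
qed

lemma feasible_const:
  assumes "finite F"
  shows "feasible Q F (%i. 1 / (real (card F) + 1))"
  unfolding feasible_def
proof (intro conjI ballI allI impI)
  fix K assume "K <= F"
  hence "card K <= card F" using assms card_mono by blast
  thus "(\<Sum>i\<in>K. 1 / (real (card F) + 1)) <= 1" by simp
qed simp

lemma feasible_sum_nonneg: "feasible Q F w ==> 0 <= (\<Sum>i\<in>F. x i ^ 4 / w i)"
  unfolding feasible_def by (intro sum_nonneg divide_nonneg_pos) auto

lemma fin_norm4_lower: "feasible Q F w ==> fin_norm4 Q F x <= (\<Sum>i\<in>F. x i ^ 4 / w i)"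
  unfolding fin_norm4_def by (rule cInf_lower) (auto intro: bdd_belowI[of _ 0] feasible_sum_nonneg)
lemma fin_norm4_greatest: "finite F ==> (\<And>w. feasible Q F w ==> c <= (\<Sum>i\<in>F. x i ^ 4 / w i)) ==>
    c <= fin_norm4 Q F x"
  unfolding fin_norm4_def by (rule cInf_greatest) (use feasible_const in blast)+
lemma fin_norm4_nonneg: "finite F ==> 0 <= fin_norm4 Q F x"
  by (rule fin_norm4_greatest) (auto intro: feasible_sum_nonneg)
lemma fin_norm4_approx:
  assumes "finite F" "fin_norm4 Q F x < c"
  shows "\<exists>w. feasible Q F w & (\<Sum>i\<in>F. x i ^ 4 / w i) < c"
  using fin_norm4_greatest[OF assms(1), of Q c x] assms(2) by (meson linorder_not_le)

lemma fin_norm_nonneg: "finite F ==> 0 <= fin_norm Q F x" unfolding fin_norm_def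
  by (simp add: fin_norm4_nonneg)
lemma fin_norm_pow4: "finite F ==> fin_norm Q F x ^ 4 = fin_norm4 Q F x" unfolding fin_norm_def
  by (simp add: fin_norm4_nonneg)
lemma fin_norm_leI:
  assumes "finite F" "feasible Q F w" "(\<Sum>i\<in>F. x i ^ 4 / w i) <= a ^ 4" "0 <= a"
  shows "fin_norm Q F x <= a"
proof -
  have "fin_norm Q F x ^ 4 <= a ^ 4" using fin_norm4_lower[OF assms(2)] assms fin_norm_pow4 by (metis order_trans)
  thus ?thesis using power_mono_iff[of "fin_norm Q F x" a 4] fin_norm_nonneg[OF assms(1)] assms(4) by simp
qed

lemma fin_norm_lessE:
  assumes "finite F" "fin_norm Q F x < a"
  obtains w where "feasible Q F w" "(\<Sum>i\<in>F. x i ^ 4 / w i) <= a ^ 4"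
proof -
  have "fin_norm4 Q F x < a ^ 4"
    using assms power_strict_mono[of "fin_norm Q F x" a 4] fin_norm_nonneg[OF assms(1)] fin_norm_pow4[OF assms(1)]
    by auto
  thus ?thesis using fin_norm4_approx[OF assms(1)] that by (meson less_imp_le)
qed

lemma fin_norm_geI:
  assumes "finite F" "\<And>w. feasible Q F w ==> a ^ 4 <= (\<Sum>i\<in>F. x i ^ 4 / w i)"
  shows "a <= fin_norm Q F x"
proof -
  have "a ^ 4 <= fin_norm Q F x ^ 4" unfolding fin_norm_pow4[OF assms(1)] by (rule fin_norm4_greatest[OF assms])
  thus ?thesis using power_mono_iff[of a "fin_norm Q F x" 4] fin_norm_nonneg[OF assms(1), of Q x]
    by (cases "0 <= a") auto
qed

lemma fin_norm_mono:
  assumes "finite F" "E <= F"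
  shows "fin_norm Q E x <= fin_norm Q F x"
proof (rule fin_norm_geI[OF assms(1)])
  fix w assume w: "feasible Q F w"
  have fE: "finite E" using assms finite_subset by blast
  have "fin_norm Q E x ^ 4 <= (\<Sum>i\<in>E. x i ^ 4 / w i)" unfolding fin_norm_pow4[OF fE]
    by (rule fin_norm4_lower[OF feasible_mono[OF w assms(2)]])
  also have "... <= (\<Sum>i\<in>F. x i ^ 4 / w i)" using assms w
    unfolding feasible_def by (intro sum_mono2 divide_nonneg_pos) auto
  finally show "fin_norm Q E x ^ 4 <= (\<Sum>i\<in>F. x i ^ 4 / w i)" .
qed

lemma fin_norm_cong: "(\<And>i. i \<in> F ==> x i = y i) ==> fin_norm Q F x = fin_norm Q F y"
  unfolding fin_norm_def fin_norm4_def by (auto intro!: arg_cong[where f = Inf] cong: sum.cong)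

lemma titu:
  fixes u v a b w w' :: real
  assumes "0 < w" "0 < w'" "0 < a" "0 < b"
  shows "(u + v)\<^sup>2 / (a * w + b * w') <= u\<^sup>2 / (a * w) + v\<^sup>2 / (b * w')"
proof -
  define p q where "p = a * w" and "q = b * w'"
  have pq: "0 < p" "0 < q" using assms by (auto simp: p_def q_def)
  have "(u\<^sup>2 / p + v\<^sup>2 / q) * (p + q) - (u + v)\<^sup>2 = (u * q - v * p)\<^sup>2 / (p * q)"
    using pq by (simp add: field_simps power2_eq_square)
  moreover have "0 <= (u * q - v * p)\<^sup>2 / (p * q)" using pq by simp
  ultimately have "(u + v)\<^sup>2 <= (u\<^sup>2 / p + v\<^sup>2 / q) * (p + q)" by linarith
  thus ?thesis unfolding p_def[symmetric] q_def[symmetric] using pq by (simp add: pos_divide_le_eq)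
qed

text \<open>Both the triangle inequality and smoothness come from mixing the weights of the two vectors.\<close>

lemma mixed_weight_triangle:
  fixes a b x y w w' :: real
  assumes ab: "0 < a" "0 < b" and w: "0 < w" "0 < w'"
  shows "(x + y) ^ 4 / ((a * w + b * w') / (a + b)) <= (a + b) ^ 3 * (x ^ 4 / w / a ^ 3 + y ^ 4 / w' / b ^ 3)"
proof -
  have "(x + y)\<^sup>2 / (a * 1 + b * 1) <= x\<^sup>2 / (a * 1) + y\<^sup>2 / (b * 1)" by (rule titu) (use ab in auto)
  hence "(x + y)\<^sup>2 <= (a + b) * (x\<^sup>2 / a + y\<^sup>2 / b)"
    using ab by (simp add: pos_divide_le_eq mult.commute)
  hence "((x + y)\<^sup>2)\<^sup>2 <= ((a + b) * (x\<^sup>2 / a + y\<^sup>2 / b))\<^sup>2" by (intro power_mono) auto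
  hence "(x + y) ^ 4 / (a * w + b * w') <=
      (a + b)\<^sup>2 * ((x\<^sup>2 / a + y\<^sup>2 / b)\<^sup>2 / (a * w + b * w'))"
    using w ab by (simp add: power_mult_distrib divide_right_mono add_nonneg_nonneg flip: power_mult)
  also have "... <= (a + b)\<^sup>2 * ((x\<^sup>2 / a)\<^sup>2 / (a * w) + (y\<^sup>2 / b)\<^sup>2 / (b * w'))"
    by (intro mult_left_mono titu) (use w ab in auto)
  also have "... = (a + b)\<^sup>2 * (x ^ 4 / w / a ^ 3 + y ^ 4 / w' / b ^ 3)"
    by (simp add: power_divide power3_eq_cube power2_eq_square power4_eq_xxxx mult_ac)
  finally have "(x + y) ^ 4 / (a * w + b * w') * (a + b) <=
      (a + b)\<^sup>2 * (x ^ 4 / w / a ^ 3 + y ^ 4 / w' / b ^ 3) * (a + b)"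
    using ab by (intro mult_right_mono) auto
  thus ?thesis using ab by (simp add: power3_eq_cube power2_eq_square mult_ac)
qed

lemma fin_norm_triangle:
  assumes F: "finite F"
  shows "fin_norm Q F (%i. x i + y i) <= fin_norm Q F x + fin_norm Q F y"
proof (rule field_le_epsilon)
  fix e :: real assume e: "0 < e"
  define a b where "a = fin_norm Q F x + e / 2" and "b = fin_norm Q F y + e / 2"
  have ab: "0 < a" "0 < b" using fin_norm_nonneg[OF F, of Q] e unfolding a_def b_def by (auto intro: add_nonneg_pos)
  obtain w where w: "feasible Q F w" "(\<Sum>i\<in>F. x i ^ 4 / w i) <= a ^ 4" using fin_norm_lessE[OF F, of Q x a] e
    unfolding a_def by auto
  obtain w' where w': "feasible Q F w'" "(\<Sum>i\<in>F. y i ^ 4 / w' i) <= b ^ 4"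
    using fin_norm_lessE[OF F, of Q y b] e unfolding b_def by auto
  have "fin_norm Q F (%i. x i + y i) <= a + b"
  proof (rule fin_norm_leI[OF F feasible_convex[OF w(1) w'(1) ab]])
    have "(\<Sum>i\<in>F. (x i + y i) ^ 4 / ((a * w i + b * w' i) / (a + b))) <=
        (\<Sum>i\<in>F. (a + b) ^ 3 * (x i ^ 4 / w i / a ^ 3 + y i ^ 4 / w' i / b ^ 3))"
      using w(1) w'(1) unfolding feasible_def by (intro sum_mono mixed_weight_triangle ab) auto
    also have "... = (a + b) ^ 3 * ((\<Sum>i\<in>F. x i ^ 4 / w i) / a ^ 3 + (\<Sum>i\<in>F. y i ^ 4 / w' i) / b ^ 3)"
      by (simp add: sum_distrib_left sum.distrib sum_divide_distrib distrib_left)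
    also have "... <= (a + b) ^ 3 * (a ^ 4 / a ^ 3 + b ^ 4 / b ^ 3)"
      using ab w(2) w'(2) by (intro mult_left_mono add_mono divide_right_mono) auto
    also have "... = (a + b) ^ 4"
      using ab by (simp add: power_diff[symmetric] flip: power_Suc2; simp add: power4_eq_xxxx power3_eq_cube)
    finally show "(\<Sum>i\<in>F. (x i + y i) ^ 4 / ((a * w i + b * w' i) / (a + b))) <= (a + b) ^ 4" .
  qed (use ab in auto)
  thus "fin_norm Q F (%i. x i + y i) <= fin_norm Q F x + fin_norm Q F y + e" unfolding a_def b_def by simp
qed

lemma mixed_weight_smooth:
  fixes A B x h w w' :: real
  assumes AB: "0 < A" "0 < B" and w: "0 < w" "0 < w'"
  shows "((x + h) ^ 4 + (x - h) ^ 4) / ((A * w + B * w') / (A + B)) <=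
      2 * ((A + B) * (x ^ 4 / w / A + 9 * (h ^ 4 / w') / B))"
proof -
  have "(x + h) ^ 4 + (x - h) ^ 4 = 2 * (x\<^sup>2 + 3 * h\<^sup>2)\<^sup>2 - 16 * h ^ 4"
    by (simp add: power4_eq_xxxx power2_eq_square algebra_simps)
  also have "... <= 2 * (x\<^sup>2 + 3 * h\<^sup>2)\<^sup>2" by simp
  finally have "((x + h) ^ 4 + (x - h) ^ 4) / (A * w + B * w') <=
      2 * ((x\<^sup>2 + 3 * h\<^sup>2)\<^sup>2 / (A * w + B * w'))"
    using w AB by (simp add: divide_right_mono add_nonneg_nonneg)
  also have "... <= 2 * ((x\<^sup>2)\<^sup>2 / (A * w) + (3 * h\<^sup>2)\<^sup>2 / (B * w'))"
    by (intro mult_left_mono titu) (use w AB in auto)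
  also have "... = 2 * (x ^ 4 / w / A + 9 * (h ^ 4 / w') / B)" by (simp add: power2_eq_square power4_eq_xxxx mult_ac)
  finally have "((x + h) ^ 4 + (x - h) ^ 4) / (A * w + B * w') * (A + B) <=
      2 * (x ^ 4 / w / A + 9 * (h ^ 4 / w') / B) * (A + B)"
    using AB by (intro mult_right_mono) auto
  thus ?thesis by (simp add: mult_ac)
qed

lemma fin_norm_smooth:
  assumes F: "finite F" and a: "fin_norm Q F x < a" and b: "fin_norm Q F h < b"
  shows "fin_norm Q F (%i. x i + h i) ^ 4 + fin_norm Q F (%i. x i - h i) ^ 4 <= 2 * (a\<^sup>2 + 3 * b\<^sup>2)\<^sup>2"
proof -
  have ab: "0 < a" "0 < b" using fin_norm_nonneg[OF F, of Q] a b by (meson le_less_trans)+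
  obtain w where w: "feasible Q F w" "(\<Sum>i\<in>F. x i ^ 4 / w i) <= a ^ 4" using fin_norm_lessE[OF F a] by blast
  obtain w' where w': "feasible Q F w'" "(\<Sum>i\<in>F. h i ^ 4 / w' i) <= b ^ 4" using fin_norm_lessE[OF F b] by blast
  define A B where "A = a\<^sup>2" and "B = 3 * b\<^sup>2"
  have AB: "0 < A" "0 < B" using ab unfolding A_def B_def by auto
  let ?v = "%i. (A * w i + B * w' i) / (A + B)"
  have "fin_norm Q F (%i. x i + h i) ^ 4 + fin_norm Q F (%i. x i - h i) ^ 4 <=
      (\<Sum>i\<in>F. (x i + h i) ^ 4 / ?v i) + (\<Sum>i\<in>F. (x i - h i) ^ 4 / ?v i)"
    unfolding fin_norm_pow4[OF F] by (intro add_mono fin_norm4_lower feasible_convex[OF w(1) w'(1) AB])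
  also have "... = (\<Sum>i\<in>F. ((x i + h i) ^ 4 + (x i - h i) ^ 4) / ?v i)"
    by (simp add: sum.distrib add_divide_distrib)
  also have "... <= (\<Sum>i\<in>F. 2 * ((A + B) * (x i ^ 4 / w i / A + 9 * (h i ^ 4 / w' i) / B)))"
    using w(1) w'(1) unfolding feasible_def by (intro sum_mono mixed_weight_smooth AB) auto
  also have "... = 2 * ((A + B) * ((\<Sum>i\<in>F. x i ^ 4 / w i) / A + 9 * (\<Sum>i\<in>F. h i ^ 4 / w' i) / B))"
    by (simp add: sum_distrib_left sum.distrib sum_divide_distrib distrib_left)
  also have "... <= 2 * ((A + B) * (a ^ 4 / A + 9 * b ^ 4 / B))"
    using AB w(2) w'(2) by (intro mult_left_mono add_mono divide_right_mono) auto
  also have "a ^ 4 / A + 9 * b ^ 4 / B = A + B"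
    using ab unfolding A_def B_def by (simp add: power4_eq_xxxx power2_eq_square)
  finally show ?thesis unfolding A_def B_def by (simp add: power2_eq_square)
qed

lemma fin_norm4_scale:
  assumes F: "finite F"
  shows "fin_norm4 Q F (%i. c * x i) = c ^ 4 * fin_norm4 Q F x"
proof (cases "c = 0")
  case True
  have "fin_norm4 Q F (%i. c * x i) <= (\<Sum>i\<in>F. (c * x i) ^ 4 / (1 / (real (card F) + 1)))"
    by (intro fin_norm4_lower feasible_const F)
  thus ?thesis using True fin_norm4_nonneg[OF F, of Q "%i. c * x i"] by simp
next
  case False
  have scale_le: "fin_norm4 Q F (%i. d * y i) <= d ^ 4 * fin_norm4 Q F y" if d: "d \<noteq> 0" for d y
  proof -
    have "fin_norm4 Q F (%i. d * y i) / d ^ 4 <= fin_norm4 Q F y"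
    proof (rule fin_norm4_greatest[OF F])
      fix w assume "feasible Q F w"
      hence "fin_norm4 Q F (%i. d * y i) <= (\<Sum>i\<in>F. (d * y i) ^ 4 / w i)" by (rule fin_norm4_lower)
      also have "... = d ^ 4 * (\<Sum>i\<in>F. y i ^ 4 / w i)" by (simp add: sum_distrib_left power_mult_distrib)
      finally show "fin_norm4 Q F (%i. d * y i) / d ^ 4 <= (\<Sum>i\<in>F. y i ^ 4 / w i)"
        using d by (simp add: pos_divide_le_eq zero_less_power_eq mult.commute)
    qed
    thus ?thesis using d by (simp add: pos_divide_le_eq zero_less_power_eq mult.commute)
  qed
  have "(%i. inverse c * (c * x i)) = x" using False by (simp add: fun_eq_iff)
  hence "fin_norm4 Q F x <= inverse c ^ 4 * fin_norm4 Q F (%i. c * x i)"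
    using scale_le[of "inverse c" "%i. c * x i"] False by simp
  hence "c ^ 4 * fin_norm4 Q F x <= c ^ 4 * (inverse c ^ 4 * fin_norm4 Q F (%i. c * x i))"
    by (intro mult_left_mono) auto
  also have "... = fin_norm4 Q F (%i. c * x i)" using False by (simp add: power_inverse)
  finally show ?thesis using scale_le[OF False] by (intro antisym)
qed

lemma fin_norm_scale:
  assumes "finite F"
  shows "fin_norm Q F (%i. c * x i) = \<bar>c\<bar> * fin_norm Q F x"
proof -
  have "root 4 (c ^ 4) = \<bar>c\<bar>" using real_root_power_cancel[of 4 "\<bar>c\<bar>"] by (simp add: power_even_abs)
  thus ?thesis unfolding fin_norm_def fin_norm4_scale[OF assms] by (simp add: real_root_mult)
qed

lemma fin_norm_coord:
  assumes "finite F" "i \<in> F"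
  shows "\<bar>x i\<bar> <= fin_norm Q F x"
proof (rule fin_norm_geI[OF assms(1)])
  fix w assume w: "feasible Q F w"
  have wi: "0 < w i" using w[unfolded feasible_def, THEN conjunct1] assms(2) by blast
  have wi1: "w i <= 1" by (rule feasible_le_1[OF w assms(2)])
  have "x i ^ 4 * w i <= x i ^ 4 * 1" using wi1 by (intro mult_left_mono) auto
  moreover have "\<bar>x i\<bar> ^ 4 = x i ^ 4" by (rule power_even_abs) simp
  ultimately have "\<bar>x i\<bar> ^ 4 <= x i ^ 4 / w i" using wi by (simp add: pos_le_divide_eq)
  also have "... <= (\<Sum>i\<in>F. x i ^ 4 / w i)" using assms w unfolding feasible_def by (intro member_le_sum) auto
  finally show "\<bar>x i\<bar> ^ 4 <= (\<Sum>i\<in>F. x i ^ 4 / w i)" .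
qed

lemma fin_norm_lower4:
  assumes "finite E" "finite F" "E \<inter> F = {}"
  shows "fin_norm Q E x ^ 4 + fin_norm Q F x ^ 4 <= fin_norm Q (E \<union> F) x ^ 4"
proof -
  have "fin_norm4 Q E x + fin_norm4 Q F x <= fin_norm4 Q (E \<union> F) x"
  proof (rule fin_norm4_greatest)
    fix w assume w: "feasible Q (E \<union> F) w"
    have "fin_norm4 Q E x <= (\<Sum>i\<in>E. x i ^ 4 / w i)" "fin_norm4 Q F x <= (\<Sum>i\<in>F. x i ^ 4 / w i)"
      by (intro fin_norm4_lower feasible_mono[OF w] Un_upper1 Un_upper2)+
    thus "fin_norm4 Q E x + fin_norm4 Q F x <= (\<Sum>i\<in>E \<union> F. x i ^ 4 / w i)"
      using assms by (simp add: sum.union_disjoint)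
  qed (use assms in simp)
  thus ?thesis using assms by (simp add: fin_norm_pow4)
qed

lemma fin_norm4_le:
  assumes "finite F"
  shows "fin_norm4 Q F x <= (real (card F) + 1) * (\<Sum>i\<in>F. x i ^ 4)"
  using fin_norm4_lower[OF feasible_const[OF assms], of Q x] by (simp add: sum_distrib_left mult.commute)

lemma fin_norm_clique:
  assumes "finite F" "pairwise Q F"
  shows "sqrt (card F) <= fin_norm Q F (%i. 1)"
proof (rule fin_norm_geI[OF assms(1)])
  fix w assume w: "feasible Q F w"
  have mass: "(\<Sum>i\<in>F. w i) <= 1" using w assms unfolding feasible_def by auto
  have "(\<Sum>i\<in>F. 2 * real (card F) - (real (card F))\<^sup>2 * w i) <= (\<Sum>i\<in>F. 1 ^ 4 / w i)"
  proof (rule sum_mono)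
    fix i assume "i \<in> F"
    hence pos: "0 < w i" using w unfolding feasible_def by auto
    hence "0 <= (1 - real (card F) * w i)\<^sup>2 / w i" by simp
    also have "... = 1 / w i - (2 * real (card F) - (real (card F))\<^sup>2 * w i)"
      using pos by (simp add: field_simps power2_eq_square)
    finally show "2 * real (card F) - (real (card F))\<^sup>2 * w i <= 1 ^ 4 / w i" by simp
  qed
  moreover have "(\<Sum>i\<in>F. 2 * real (card F) - (real (card F))\<^sup>2 * w i) =
      2 * (real (card F))\<^sup>2 - (real (card F))\<^sup>2 * (\<Sum>i\<in>F. w i)"
    by (simp add: sum_subtractf sum_distrib_left power2_eq_square)
  moreover have "(real (card F))\<^sup>2 * (\<Sum>i\<in>F. w i) <= (real (card F))\<^sup>2 * 1"
    using mass by (intro mult_left_mono) auto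
  ultimately have "(real (card F))\<^sup>2 <= (\<Sum>i\<in>F. 1 ^ 4 / w i)" by linarith
  moreover have "sqrt (card F) ^ 4 = (real (card F))\<^sup>2" by (simp add: power4_eq_xxxx power2_eq_square)
  ultimately show "sqrt (card F) ^ 4 <= (\<Sum>i\<in>F. 1 ^ 4 / w i)" by simp
qed

lemma fin_norm_anticlique:
  assumes "finite F" "pairwise (%i j. \<not> Q i j) F"
  shows "fin_norm Q F (%i. 1) <= sqrt (sqrt (card F))"
proof (rule fin_norm_leI[OF assms(1), where w = "%i. 1"])
  show "feasible Q F (%i. 1)" unfolding feasible_def
  proof (intro conjI ballI allI impI)
    fix K assume K: "K <= F" "pairwise Q K"
    hence "card K <= 1" using assms
      unfolding pairwise_def by (metis card_le_Suc0_iff_eq finite_subset subsetD One_nat_def)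
    thus "(\<Sum>i\<in>K. 1) <= (1::real)" by simp
  qed simp
  have "sqrt (sqrt (card F)) ^ 4 = (sqrt (sqrt (card F)) ^ 2) ^ 2"
    using power_mult[of "sqrt (sqrt (card F))" 2 2] by simp
  thus "(\<Sum>i\<in>F. 1 ^ 4 / 1) <= sqrt (sqrt (card F)) ^ 4" by simp
qed simp

lemma convex_smooth_differentiable:
  fixes ph :: "real => real"
  assumes conv: "\<And>s t u. 0 <= u ==> u <= 1 ==> ph (u * s + (1 - u) * t) <= u * ph s + (1 - u) * ph t"
  and smooth: "\<And>t. ph t + ph (- t) - 2 * ph 0 <= c * t\<^sup>2"
  shows "\<exists>D. \<forall>t. t \<noteq> 0 --> \<bar>(ph t - ph 0) / t - D\<bar> <= c * \<bar>t\<bar>"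
proof -
  define q where "q t = (ph t - ph 0) / t" for t
  have slopes: "q (- s) <= q t" if "0 < s" "0 < t" for s t
  proof -
    have "ph ((t / (s + t)) * (- s) + (1 - t / (s + t)) * t) <= (t / (s + t)) * ph (- s) + (1 - t / (s + t)) * ph t"
      using that by (intro conv) auto
    moreover have "(t / (s + t)) * (- s) + (1 - t / (s + t)) * t = 0" using that by (simp add: field_simps)
    moreover have "1 - t / (s + t) = s / (s + t)" using that by (simp add: field_simps)
    ultimately have "ph 0 <= (t * ph (- s) + s * ph t) / (s + t)" by (simp add: add_divide_distrib)
    hence "ph 0 * (s + t) <= t * ph (- s) + s * ph t" using that by (simp add: pos_le_divide_eq)
    thus ?thesis using that unfolding q_def by (simp add: field_simps)
  qed
  define D where "D = Inf (q ` {0<..})"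
  have "bdd_below (q ` {0<..})" using slopes[of 1] by (auto intro!: bdd_belowI[of _ "q (- 1)"])
  hence right: "D <= q t" if "0 < t" for t unfolding D_def using that by (intro cInf_lower) auto
  have left: "q (- t) <= D" if "0 < t" for t unfolding D_def using that slopes by (intro cInf_greatest) auto
  have gap: "q t - q (- t) <= c * t" if "0 < t" for t
  proof -
    have "q t - q (- t) = (ph t + ph (- t) - 2 * ph 0) / t" using that unfolding q_def by (simp add: field_simps)
    also have "... <= c * t\<^sup>2 / t" using smooth[of t] that by (intro divide_right_mono) auto
    finally show ?thesis using that by (simp add: power2_eq_square)
  qed
  have "\<bar>q t - D\<bar> <= c * \<bar>t\<bar>" if "t \<noteq> 0" for t
  proof (cases "0 < t")
    case True thus ?thesis using right[of t] left[of t] gap[of t] by auto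
  next
    case False
    hence "0 < - t" using that by auto
    thus ?thesis using right[of "- t"] left[of "- t"] gap[of "- t"] by auto
  qed
  thus ?thesis unfolding q_def by blast
qed

definition norm_bdd :: "('i => 'i => bool) => 'i set => ('i => real) => bool" where
  "norm_bdd Q I x <-> (\<exists>M. \<forall>F. finite F & F <= I --> fin_norm Q F x <= M)"
definition graph_norm :: "('i => 'i => bool) => 'i set => ('i => real) => real" where
  "graph_norm Q I x = Sup {fin_norm Q F x | F. finite F & F <= I}"

lemma graph_norm_ge: "norm_bdd Q I x ==> finite F ==> F <= I ==> fin_norm Q F x <= graph_norm Q I x"
  unfolding graph_norm_def norm_bdd_def by (rule cSup_upper) (auto simp: bdd_above_def)
lemma graph_norm_le: "(\<And>F. finite F ==> F <= I ==> fin_norm Q F x <= M) ==> graph_norm Q I x <= M"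
  unfolding graph_norm_def by (rule cSup_least) auto
lemma norm_bddI: "(\<And>F. finite F ==> F <= I ==> fin_norm Q F x <= M) ==> norm_bdd Q I x" unfolding norm_bdd_def
  by blast
lemma graph_norm_nonneg: "norm_bdd Q I x ==> 0 <= graph_norm Q I x"
  using graph_norm_ge[of Q I x "{}"] fin_norm_nonneg[of "{}" Q x] by simp
lemma graph_norm_approx:
  assumes "c < graph_norm Q I x"
  shows "\<exists>F. finite F & F <= I & c < fin_norm Q F x"
  using assms graph_norm_le[of I Q x c] by (meson linorder_not_le)
lemma graph_norm_cong:
  assumes "\<And>i. i \<in> I ==> x i = y i"
  shows "graph_norm Q I x = graph_norm Q I y" "norm_bdd Q I x = norm_bdd Q I y"
proof -
  have eq: "fin_norm Q F x = fin_norm Q F y" if "F <= I" for F using assms that by (intro fin_norm_cong) auto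
  show "norm_bdd Q I x = norm_bdd Q I y" unfolding norm_bdd_def using eq by auto
  have "{fin_norm Q F x | F. finite F & F <= I} = {fin_norm Q F y | F. finite F & F <= I}"
    by (intro Collect_cong ex_cong1) (auto simp: eq)
  thus "graph_norm Q I x = graph_norm Q I y" unfolding graph_norm_def by simp
qed

lemma graph_norm_add:
  assumes "norm_bdd Q I x" "norm_bdd Q I y"
  shows "norm_bdd Q I (%i. x i + y i)" "graph_norm Q I (%i. x i + y i) <= graph_norm Q I x + graph_norm Q I y"
proof -
  have fin: "fin_norm Q F (%i. x i + y i) <= graph_norm Q I x + graph_norm Q I y" if "finite F" "F <= I" for F
    using fin_norm_triangle[OF that(1), of Q x y] graph_norm_ge[OF assms(1) that] graph_norm_ge[OF assms(2) that]
      by linarith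
  show "norm_bdd Q I (%i. x i + y i)" by (rule norm_bddI[OF fin])
  show "graph_norm Q I (%i. x i + y i) <= graph_norm Q I x + graph_norm Q I y" by (rule graph_norm_le[OF fin])
qed

lemma graph_norm_scale:
  assumes "norm_bdd Q I x"
  shows "norm_bdd Q I (%i. c * x i)" "graph_norm Q I (%i. c * x i) = \<bar>c\<bar> * graph_norm Q I x"
proof -
  have fin: "fin_norm Q F (%i. c * x i) <= \<bar>c\<bar> * graph_norm Q I x" if "finite F" "F <= I" for F c
    using fin_norm_scale[OF that(1), of Q c x] graph_norm_ge[OF assms that] by (simp add: mult_left_mono)
  show bdd: "norm_bdd Q I (%i. c * x i)" by (rule norm_bddI[OF fin])
  have "\<bar>c\<bar> * graph_norm Q I x <= graph_norm Q I (%i. c * x i)"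
  proof (cases "c = 0")
    case True thus ?thesis using graph_norm_nonneg[OF bdd] by simp
  next
    case False
    have "graph_norm Q I x <= graph_norm Q I (%i. c * x i) / \<bar>c\<bar>"
    proof (rule graph_norm_le)
      fix F assume F: "finite F" "F <= I"
      have "\<bar>c\<bar> * fin_norm Q F x <= graph_norm Q I (%i. c * x i)"
        using graph_norm_ge[OF bdd F] fin_norm_scale[OF F(1), of Q c x] by simp
      thus "fin_norm Q F x <= graph_norm Q I (%i. c * x i) / \<bar>c\<bar>"
        using False by (simp add: pos_le_divide_eq mult.commute)
    qed
    thus ?thesis using False by (simp add: pos_le_divide_eq mult.commute)
  qed
  thus "graph_norm Q I (%i. c * x i) = \<bar>c\<bar> * graph_norm Q I x" using graph_norm_le[OF fin, of I c] by simp
qed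

lemma graph_norm_diff:
  assumes "norm_bdd Q I x" "norm_bdd Q I y"
  shows "norm_bdd Q I (%i. x i - y i)" "graph_norm Q I (%i. x i - y i) <= graph_norm Q I x + graph_norm Q I y"
  using graph_norm_add[OF assms(1) graph_norm_scale(1)[OF assms(2), of "- 1"]] graph_norm_scale(2)[OF assms(2), of
    "- 1"] by simp_all

lemma graph_norm_coord: "norm_bdd Q I x ==> i \<in> I ==> \<bar>x i\<bar> <= graph_norm Q I x"
  using fin_norm_coord[of "{i}" i x Q] graph_norm_ge[of Q I x "{i}"] by simp

lemma graph_norm_smooth:
  assumes x: "norm_bdd Q I x" and h: "norm_bdd Q I h"
  shows "graph_norm Q I (%i. x i + h i) ^ 4 + graph_norm Q I (%i. x i - h i) ^ 4 <=
      2 * ((graph_norm Q I x)\<^sup>2 + 3 * (graph_norm Q I h)\<^sup>2)\<^sup>2"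
proof -
  define A B a b where "A = graph_norm Q I (%i. x i + h i)" and "B = graph_norm Q I (%i. x i - h i)"
    and "a = graph_norm Q I x" and "b = graph_norm Q I h"
  have AB: "0 <= A" "0 <= B" unfolding A_def B_def
    using graph_norm_nonneg graph_norm_add(1)[OF x h] graph_norm_diff(1)[OF x h] by blast+
  have approx: "(max 0 (A - e)) ^ 4 + (max 0 (B - e)) ^ 4 <= 2 * ((a + e)\<^sup>2 + 3 * (b + e)\<^sup>2)\<^sup>2"
    if e: "0 < e" for e
  proof -
    obtain F where F: "finite F" "F <= I" "A - e < fin_norm Q F (%i. x i + h i)"
      using graph_norm_approx[of "A - e" Q I "%i. x i + h i"] e unfolding A_def by auto
    obtain E where E: "finite E" "E <= I" "B - e < fin_norm Q E (%i. x i - h i)"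
      using graph_norm_approx[of "B - e" Q I "%i. x i - h i"] e unfolding B_def by auto
    have FE: "finite (F \<union> E)" "F \<union> E <= I" using F E by auto
    have "max 0 (A - e) <= fin_norm Q (F \<union> E) (%i. x i + h i)"
      "max 0 (B - e) <= fin_norm Q (F \<union> E) (%i. x i - h i)"
      using F(3) E(3) fin_norm_mono[OF FE(1), of F Q "%i. x i + h i"] fin_norm_mono[OF FE(1), of E Q "%i. x i - h i"]
      fin_norm_nonneg[OF FE(1), of Q] by auto
    hence "(max 0 (A - e)) ^ 4 + (max 0 (B - e)) ^ 4 <=
        fin_norm Q (F \<union> E) (%i. x i + h i) ^ 4 + fin_norm Q (F \<union> E) (%i. x i - h i) ^ 4"
      by (intro add_mono power_mono) auto
    also have "... <= 2 * ((a + e)\<^sup>2 + 3 * (b + e)\<^sup>2)\<^sup>2"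
      using graph_norm_ge[OF x FE] graph_norm_ge[OF h FE] e
        unfolding a_def b_def by (intro fin_norm_smooth[OF FE(1)]) auto
    finally show ?thesis .
  qed
  have lhs: "((%e. (max 0 (A - e)) ^ 4 + (max 0 (B - e)) ^ 4) \<longlongrightarrow> (max 0 (A - 0)) ^ 4 +
      (max 0 (B - 0)) ^ 4) (at_right 0)"
    by (intro tendsto_intros)
  have rhs: "((%e. 2 * ((a + e)\<^sup>2 + 3 * (b + e)\<^sup>2)\<^sup>2) \<longlongrightarrow> 2 *
      ((a + 0)\<^sup>2 + 3 * (b + 0)\<^sup>2)\<^sup>2) (at_right 0)"
    by (intro tendsto_intros)
  have "(max 0 (A - 0)) ^ 4 + (max 0 (B - 0)) ^ 4 <= 2 * ((a + 0)\<^sup>2 + 3 * (b + 0)\<^sup>2)\<^sup>2"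
    by (rule tendsto_le[OF trivial_limit_at_right_real rhs lhs], rule eventually_mono[OF eventually_at_right_less])
      (rule approx)
  thus ?thesis using AB unfolding A_def[symmetric] B_def[symmetric] a_def[symmetric] b_def[symmetric]
    by (simp add: max_def)
qed

lemma sum_le_of_fourth_powers:
  fixes p q z :: real
  assumes pow: "p ^ 4 + q ^ 4 <= 2 * (1 + 3 * z)\<^sup>2" and z: "0 <= z"
  shows "p + q <= 2 + 3 * z"
proof -
  have square_mean: "((r + s) / 2)\<^sup>2 <= (r\<^sup>2 + s\<^sup>2) / 2" for r s :: real
    using sum_squares_bound[of r s] by (simp add: power2_eq_square field_simps)
  have "(((p + q) / 2)\<^sup>2)\<^sup>2 <= ((p\<^sup>2 + q\<^sup>2) / 2)\<^sup>2" by (intro power_mono square_mean) auto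
  also have "... <= ((p\<^sup>2)\<^sup>2 + (q\<^sup>2)\<^sup>2) / 2" by (rule square_mean)
  also have "... <= (1 + 3 * z)\<^sup>2" using pow by (simp flip: power_mult)
  finally have "((p + q) / 2)\<^sup>2 <= 1 + 3 * z" by (rule power2_le_imp_le) (use z in simp)
  also have "... <= (1 + 3 / 2 * z)\<^sup>2" using z by (simp add: power2_eq_square algebra_simps)
  finally have "(p + q) / 2 <= 1 + 3 / 2 * z" by (rule power2_le_imp_le) (use z in simp)
  thus ?thesis by simp
qed

lemma graph_norm_UG:
  assumes x: "norm_bdd Q I x" "graph_norm Q I x = 1" and h: "norm_bdd Q I h"
  shows "\<exists>D. \<forall>t. t \<noteq> 0 --> \<bar>(graph_norm Q I (%i. x i + t * h i) - 1) / t - D\<bar> <=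
      3 * (graph_norm Q I h)\<^sup>2 * \<bar>t\<bar>"
proof -
  define ph where "ph t = graph_norm Q I (%i. x i + t * h i)" for t
  have bdd: "norm_bdd Q I (%i. x i + t * h i)" for t by (rule graph_norm_add(1)[OF x(1) graph_norm_scale(1)[OF h]])
  have "\<exists>D. \<forall>t. t \<noteq> 0 -->
      \<bar>(ph t - ph 0) / t - D\<bar> <= 3 * (graph_norm Q I h)\<^sup>2 * \<bar>t\<bar>"
  proof (rule convex_smooth_differentiable)
    fix s t u :: real assume u: "0 <= u" "u <= 1"
    have "ph (u * s + (1 - u) * t) = graph_norm Q I (%i. u * (x i + s * h i) + (1 - u) * (x i + t * h i))"
      unfolding ph_def by (rule arg_cong[where f = "graph_norm Q I"]) (auto simp: algebra_simps)
    also have "... <= graph_norm Q I (%i. u * (x i + s * h i)) + graph_norm Q I (%i. (1 - u) * (x i + t * h i))"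
      by (rule graph_norm_add(2)[OF graph_norm_scale(1)[OF bdd] graph_norm_scale(1)[OF bdd]])
    also have "... = u * ph s + (1 - u) * ph t"
      using graph_norm_scale(2)[OF bdd, of u s] graph_norm_scale(2)[OF bdd, of "1 - u" t] u unfolding ph_def by simp
    finally show "ph (u * s + (1 - u) * t) <= u * ph s + (1 - u) * ph t" .
  next
    fix t :: real
    have "ph t ^ 4 + ph (- t) ^ 4 <= 2 * (1\<^sup>2 + 3 * (graph_norm Q I (%i. t * h i))\<^sup>2)\<^sup>2"
      using graph_norm_smooth[OF x(1) graph_norm_scale(1)[OF h, of t]] x(2) unfolding ph_def by simp
    also have "... = 2 * (1 + 3 * (t\<^sup>2 * (graph_norm Q I h)\<^sup>2))\<^sup>2"
      unfolding graph_norm_scale(2)[OF h] by (simp add: power_mult_distrib)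
    finally have "ph t + ph (- t) <= 2 + 3 * (t\<^sup>2 * (graph_norm Q I h)\<^sup>2)"
      by (rule sum_le_of_fourth_powers) simp
    thus "ph t + ph (- t) - 2 * ph 0 <= 3 * (graph_norm Q I h)\<^sup>2 * t\<^sup>2"
      using x(2) by (simp add: ph_def[of 0] mult_ac)
  qed
  thus ?thesis unfolding ph_def using x(2) by simp
qed

lemma feasible_extend:
  assumes F: "finite F" and w: "feasible Q E w" and s: "0 < (s::real)" "s < 1"
  shows "feasible Q F (%i. if i \<in> E then s * w i else (1 - s) / (real (card F) + 1))" (is "feasible Q F ?w")
  unfolding feasible_def
proof (intro conjI ballI allI impI)
  show "0 < ?w i" if "i \<in> F" for i using w s unfolding feasible_def by (auto intro!: divide_pos_pos add_nonneg_pos)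
  fix K assume K: "K <= F" "pairwise Q K"
  have fK: "finite K" using K(1) F finite_subset by blast
  have "(\<Sum>i\<in>K. ?w i) = (\<Sum>i\<in>K \<inter> E. ?w i) + (\<Sum>i\<in>K - E. ?w i)"
    by (subst sum.union_disjoint[symmetric]) (use fK in \<open>auto intro!: arg_cong2[where f = sum]\<close>)
  also have "(\<Sum>i\<in>K \<inter> E. ?w i) = s * (\<Sum>i\<in>K \<inter> E. w i)" by (simp add: sum_distrib_left)
  also have "(\<Sum>i\<in>K - E. ?w i) = real (card (K - E)) * ((1 - s) / (real (card F) + 1))" by simp
  also have "s * (\<Sum>i\<in>K \<inter> E. w i) <= s * 1"
    using w pairwise_subset[OF K(2)] s unfolding feasible_def by (intro mult_left_mono) auto
  also have "real (card (K - E)) * ((1 - s) / (real (card F) + 1)) <= 1 - s"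
  proof -
    have "card (K - E) <= card F" using K(1) F by (meson Diff_subset card_mono subset_trans)
    hence "real (card (K - E)) / (real (card F) + 1) <= 1" by simp
    hence "(1 - s) * (real (card (K - E)) / (real (card F) + 1)) <= (1 - s) * 1" using s by (intro mult_left_mono) auto
    thus ?thesis by (simp add: mult_ac)
  qed
  finally show "(\<Sum>i\<in>K. ?w i) <= 1" by simp
qed

lemma fin_norm_zero:
  assumes F: "finite F" "E <= F" and zero: "\<And>i. i \<in> F ==> i \<notin> E ==> y i = 0"
  shows "fin_norm Q F y <= fin_norm Q E y"
proof -
  have fE: "finite E" using F finite_subset by blast
  have "fin_norm4 Q F y <= fin_norm4 Q E y"
  proof (rule fin_norm4_greatest[OF fE], rule field_le_mult_one_interval)
    fix w and s :: real assume w: "feasible Q E w" and s: "0 < s" "s < 1"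
    let ?w = "%i. if i \<in> E then s * w i else (1 - s) / (real (card F) + 1)"
    have "fin_norm4 Q F y <= (\<Sum>i\<in>F. y i ^ 4 / ?w i)" by (rule fin_norm4_lower[OF feasible_extend[OF F(1) w s]])
    also have "... = (\<Sum>i\<in>E. y i ^ 4 / ?w i)" using F zero by (intro sum.mono_neutral_right) auto
    also have "... = (\<Sum>i\<in>E. y i ^ 4 / w i) / s" by (simp add: sum_divide_distrib mult.commute)
    finally show "s * fin_norm4 Q F y <= (\<Sum>i\<in>E. y i ^ 4 / w i)"
      using s by (simp add: pos_le_divide_eq mult.commute)
  qed
  thus ?thesis unfolding fin_norm_def by simp
qed

lemma graph_norm_fin:
  assumes "finite K" "K <= I" "\<And>i. i \<in> I ==> i \<notin> K ==> y i = 0"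
  shows "norm_bdd Q I y" "graph_norm Q I y = fin_norm Q K y"
proof -
  have fin: "fin_norm Q F y <= fin_norm Q K y" if "finite F" "F <= I" for F
    using fin_norm_mono[of "F \<union> K" F Q y] fin_norm_zero[of "F \<union> K" K y Q] assms that by fastforce
  show bdd: "norm_bdd Q I y" by (rule norm_bddI[OF fin])
  show "graph_norm Q I y = fin_norm Q K y" by (rule antisym[OF graph_norm_le[OF fin] graph_norm_ge[OF bdd assms(1, 2)]])
qed

lemma graph_norm_tail:
  assumes x: "norm_bdd Q I x" and e: "0 < e"
  shows "\<exists>F. finite F & F <= I & norm_bdd Q I (%i. if i \<in> F then 0 else x i) &
      graph_norm Q I (%i. if i \<in> F then 0 else x i) <= e"
proof -
  define M where "M = graph_norm Q I x"
  have M: "0 <= M" unfolding M_def using graph_norm_nonneg[OF x] .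
  have "\<exists>F. finite F & F <= I & M ^ 4 - e ^ 4 < fin_norm Q F x ^ 4"
  proof (cases "M ^ 4 < e ^ 4")
    case True
    hence "M ^ 4 - e ^ 4 < fin_norm Q {} x ^ 4" using fin_norm_nonneg[of "{}" Q x]
      by (smt (verit) finite.emptyI zero_le_power)
    thus ?thesis by blast
  next
    case False
    define c where "c = root 4 (M ^ 4 - e ^ 4)"
    have c: "c ^ 4 = M ^ 4 - e ^ 4" "0 <= c" using False unfolding c_def by auto
    hence "c ^ 4 < M ^ 4" using e by simp
    hence "c < M" using M power_less_imp_less_base by blast
    then obtain F where "finite F" "F <= I" "c < fin_norm Q F x" using graph_norm_approx[of c Q I x]
      unfolding M_def by auto
    thus ?thesis using c power_strict_mono[of c "fin_norm Q F x" 4] by auto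
  qed
  then obtain F where F: "finite F" "F <= I" "M ^ 4 - e ^ 4 < fin_norm Q F x ^ 4" by blast
  let ?y = "%i. if i \<in> F then 0 else x i"
  have tail: "fin_norm Q E ?y <= e" if E: "finite E" "E <= I" for E
  proof -
    have "fin_norm Q F x ^ 4 + fin_norm Q (E - F) x ^ 4 <= fin_norm Q (F \<union> (E - F)) x ^ 4"
      by (rule fin_norm_lower4) (use E F in auto)
    also have "... <= M ^ 4" unfolding M_def
      using graph_norm_ge[OF x, of "F \<union> (E - F)"] E F fin_norm_nonneg[of "F \<union> (E - F)" Q x]
        by (intro power_mono) auto
    finally have "fin_norm Q (E - F) x ^ 4 < e ^ 4" using F by linarith
    hence "fin_norm Q (E - F) x < e" using e power_less_imp_less_base[of _ 4 e] by auto
    moreover have "fin_norm Q E ?y <= fin_norm Q (E - F) ?y" by (rule fin_norm_zero) (use E in auto)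
    moreover have "fin_norm Q (E - F) ?y = fin_norm Q (E - F) x" by (rule fin_norm_cong) auto
    ultimately show ?thesis by linarith
  qed
  show ?thesis using F(1, 2) norm_bddI[OF tail] graph_norm_le[OF tail] by blast
qed

lemma graph_norm_limit:
  assumes xs: "\<And>n. norm_bdd Q I (xs n)"
  and cauchy: "\<And>e. 0 < e ==>
      \<exists>N. \<forall>n\<ge>N. \<forall>k\<ge>N. graph_norm Q I (%i. xs n i - xs k i) < e"
  and lim: "\<And>i. i \<in> I ==> (%n. xs n i) \<longlonglongrightarrow> x i"
  shows "norm_bdd Q I x" "\<And>e. 0 < e ==> \<exists>N. \<forall>n\<ge>N. graph_norm Q I (%i. xs n i - x i) < e"
proof -
  have fin: "fin_norm Q F (%i. xs n i - x i) <= e"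
    if N: "\<forall>n\<ge>N. \<forall>k\<ge>N. graph_norm Q I (%i. xs n i - xs k i) < e" and n: "n >= N" and F:
      "finite F" "F <= I" for N n F e
  proof (rule field_le_epsilon)
    fix d :: real assume d: "0 < d"
    have "(%k. (real (card F) + 1) * (\<Sum>i\<in>F. (xs k i - x i) ^ 4)) \<longlonglongrightarrow> (real (card F) + 1)
        * (\<Sum>i\<in>F. (x i - x i) ^ 4)"
      using F(2) by (intro tendsto_intros lim) auto
    hence "\<forall>\<^sub>F k in sequentially. (real (card F) + 1) * (\<Sum>i\<in>F. (xs k i - x i) ^ 4) < d ^ 4"
      by (rule order_tendstoD(2)) (use d in simp)
    then obtain k where k: "k >= N" "(real (card F) + 1) * (\<Sum>i\<in>F. (xs k i - x i) ^ 4) < d ^ 4"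
      unfolding eventually_sequentially by (metis nat_le_linear)
    have "fin_norm Q F (%i. xs k i - x i) ^ 4 < d ^ 4"
      using fin_norm4_le[OF F(1), of Q "%i. xs k i - x i"] k fin_norm_pow4[OF F(1)] by (metis le_less_trans)
    hence "fin_norm Q F (%i. xs k i - x i) < d" using d power_less_imp_less_base[of _ 4 d] by auto
    moreover have "fin_norm Q F (%i. xs n i - xs k i) < e"
      using graph_norm_ge[OF graph_norm_diff(1)[OF xs xs] F] N n k(1) le_less_trans by blast
    moreover have "fin_norm Q F (%i. (xs n i - xs k i) + (xs k i - x i)) <=
        fin_norm Q F (%i. xs n i - xs k i) + fin_norm Q F (%i. xs k i - x i)"
      by (rule fin_norm_triangle[OF F(1)])
    ultimately show "fin_norm Q F (%i. xs n i - x i) <= e + d" by simp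
  qed
  obtain N where N: "\<forall>n\<ge>N. \<forall>k\<ge>N. graph_norm Q I (%i. xs n i - xs k i) < 1"
    using cauchy[of 1] by auto
  have "norm_bdd Q I (%i. xs N i - x i)" by (rule norm_bddI) (rule fin[OF N order_refl])
  from graph_norm_diff(1)[OF xs[of N] this] show "norm_bdd Q I x" by simp
  fix e :: real assume e: "0 < e"
  obtain N where N: "\<forall>n\<ge>N. \<forall>k\<ge>N. graph_norm Q I (%i. xs n i - xs k i) < e / 2"
    using cauchy[of "e / 2"] e by auto
  show "\<exists>N. \<forall>n\<ge>N. graph_norm Q I (%i. xs n i - x i) < e"
  proof (intro exI[of _ N] allI impI)
    fix n assume "N <= n"
    hence "graph_norm Q I (%i. xs n i - x i) <= e / 2" by (intro graph_norm_le fin[OF N])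
    thus "graph_norm Q I (%i. xs n i - x i) < e" using e by linarith
  qed
qed

lemma feasible_smaller:
  assumes w: "feasible Q F w" and v: "\<And>i. i \<in> F ==> 0 < v i & v i <= w i"
  shows "feasible Q F v"
  unfolding feasible_def
proof (intro conjI ballI allI impI)
  fix K assume K: "K <= F" "pairwise Q K"
  have "(\<Sum>i\<in>K. v i) <= (\<Sum>i\<in>K. w i)" using v K(1) by (intro sum_mono) auto
  also have "... <= 1" by (rule w[unfolded feasible_def, THEN conjunct2, rule_format]) (use K in auto)
  finally show "(\<Sum>i\<in>K. v i) <= 1" .
qed (use v in auto)

lemma fin_norm_geI_rational:
  assumes F: "finite F" and c: "0 <= c"
  and bound: "\<And>v. feasible Q F (%i. of_rat (v i)) ==> c ^ 4 <= (\<Sum>i\<in>F. x i ^ 4 / of_rat (v i))"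
  shows "c <= fin_norm Q F x"
proof (rule fin_norm_geI[OF F], rule field_le_mult_one_interval)
  fix w and z :: real assume w: "feasible Q F w" and z: "0 < z" "z < 1"
  have pos: "0 < w i" if "i \<in> F" for i using w[unfolded feasible_def, THEN conjunct1] that by blast
  have "\<exists>t. z * w i < of_rat t & of_rat t < w i" if "i \<in> F" for i
    using of_rat_dense[of "z * w i" "w i"] pos[OF that] z by (auto simp: mult_less_cancel_right1)
  then obtain v where v: "\<And>i. i \<in> F ==> z * w i < of_rat (v i) & of_rat (v i) < w i" by metis
  have v0: "0 < (of_rat (v i) :: real)" if "i \<in> F" for i using v[OF that] pos[OF that] z
    by (meson less_trans mult_pos_pos)
  have "c ^ 4 <= (\<Sum>i\<in>F. x i ^ 4 / of_rat (v i))"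
    by (rule bound[OF feasible_smaller[OF w]]) (use v v0 less_imp_le in blast)
  also have "... <= (\<Sum>i\<in>F. x i ^ 4 / (z * w i))"
  proof (rule sum_mono)
    fix i assume i: "i \<in> F"
    show "x i ^ 4 / of_rat (v i) <= x i ^ 4 / (z * w i)"
      using v[OF i] v0[OF i] z(1) pos[OF i] by (intro divide_left_mono mult_pos_pos) auto
  qed
  also have "... = (\<Sum>i\<in>F. x i ^ 4 / w i) / z" by (simp add: sum_divide_distrib mult.commute)
  finally show "z * c ^ 4 <= (\<Sum>i\<in>F. x i ^ 4 / w i)" using z by (simp add: pos_le_divide_eq mult.commute)
qed

lemma graph_norm_cut:
  assumes x: "norm_bdd Q I x" and V: "\<And>q. of_rat q \<in> V"
  shows "of_rat q < graph_norm Q I x <-> q < 0 \<or> (\<exists>F r. finite F & F <= I & q < r & 0 <= r &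
  (\<forall>w. (\<forall>i\<in>F. w i \<in> V) & feasible Q F w -->
      of_rat (r ^ 4) <= (\<Sum>i\<in>F. x i ^ 4 / w i)))" (is "_ <-> _ \<or> ?R")
proof
  assume less: "of_rat q < graph_norm Q I x"
  show "q < 0 \<or> ?R"
  proof (cases "q < 0")
    case False
    obtain F where F: "finite F" "F <= I" "of_rat q < fin_norm Q F x" using graph_norm_approx[OF less] by blast
    obtain r where r: "of_rat q < (of_rat r :: real)" "of_rat r < fin_norm Q F x" using of_rat_dense[OF F(3)] by blast
    hence qr: "q < r" by (simp add: of_rat_less)
    hence "of_rat r ^ 4 <= fin_norm Q F x ^ 4" using r False by (intro power_mono) (auto simp: zero_le_of_rat_iff)
    hence "of_rat (r ^ 4) <= (\<Sum>i\<in>F. x i ^ 4 / w i)" if "feasible Q F w" for w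
      using fin_norm4_lower[OF that, of x] fin_norm_pow4[OF F(1), of Q x] by (simp add: of_rat_power)
    thus ?thesis using F qr False by (intro disjI2 exI[of _ F] exI[of _ r]) auto
  qed simp
next
  assume "q < 0 \<or> ?R"
  thus "of_rat q < graph_norm Q I x"
  proof
    assume "q < 0"
    hence "of_rat q < (0::real)" by simp
    thus ?thesis using graph_norm_nonneg[OF x] by linarith
  next
    assume ?R
    then obtain F r where F: "finite F" "F <= I" "q < r" "0 <= r"
      and w: "\<And>w. (\<forall>i\<in>F. w i \<in> V) ==> feasible Q F w ==>
          of_rat (r ^ 4) <= (\<Sum>i\<in>F. x i ^ 4 / w i)" by blast
    have "of_rat r <= fin_norm Q F x"
      by (rule fin_norm_geI_rational[OF F(1)]) (use F(4) w V in \<open>simp_all add: of_rat_power\<close>)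
    also have "... <= graph_norm Q I x" by (rule graph_norm_ge[OF x F(1, 2)])
    finally show ?thesis using F(3) by (metis of_rat_less order.strict_trans2)
  qed
qed

section \<open>The Banach spaces\<close>

lemma fin_norm_bound:
  assumes F: "finite F" and x: "\<And>i. i \<in> F ==> \<bar>x i\<bar> <= d" "0 <= d"
  shows "fin_norm Q F x <= (real (card F) + 1) * d"
proof (rule fin_norm_leI[OF F feasible_const[OF F]])
  let ?n = "real (card F) + 1"
  have "(\<Sum>i\<in>F. x i ^ 4 / (1 / ?n)) <= (\<Sum>i\<in>F. ?n * d ^ 4)"
  proof (rule sum_mono)
    fix i assume "i \<in> F"
    hence "\<bar>x i\<bar> ^ 4 <= d ^ 4" using x by (intro power_mono) auto
    thus "x i ^ 4 / (1 / ?n) <= ?n * d ^ 4" by (simp add: power_even_abs mult.commute)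
  qed
  also have "... = (real (card F) * ?n) * d ^ 4" by simp
  also have "... <= ?n ^ 4 * d ^ 4"
  proof (rule mult_right_mono)
    have "real (card F) * ?n <= ?n ^ 2" by (simp add: power2_eq_square)
    also have "... <= ?n ^ 4" by (rule power_increasing) auto
    finally show "real (card F) * ?n <= ?n ^ 4" .
  qed (use x(2) in simp)
  finally show "(\<Sum>i\<in>F. x i ^ 4 / (1 / ?n)) <= (?n * d) ^ 4" by (simp add: power_mult_distrib)
qed (use x(2) in simp)

lemma rational_approximation:
  assumes x: "norm_bdd Q I x" and e: "0 < e"
  obtains F q where "finite F" "F <= I" "graph_norm Q I (%i. x i - (if i \<in> F then of_rat (q i) else 0)) < e"
proof -
  obtain F where F: "finite F" "F <= I" and tail: "norm_bdd Q I (%i. if i \<in> F then 0 else x i)"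
    "graph_norm Q I (%i. if i \<in> F then 0 else x i) <= e / 4" using graph_norm_tail[OF x, of "e / 4"] e by auto
  define d where "d = e / 4 / (real (card F) + 1)"
  have "0 < real (card F) + 1" by simp
  hence d: "0 < d" "(real (card F) + 1) * d = e / 4"
    using e nonzero_mult_div_cancel_left[of "real (card F) + 1" "e / 4"] unfolding d_def times_divide_eq_right by auto
  have "\<exists>q. \<bar>x i - of_rat q\<bar> < d" for i
  proof -
    obtain q where "x i < of_rat q" "of_rat q < x i + d" using of_rat_dense[of "x i" "x i + d"] d(1) by auto
    hence "\<bar>x i - of_rat q\<bar> < d" by linarith
    thus ?thesis by blast
  qed
  then obtain q where q: "\<And>i. \<bar>x i - of_rat (q i)\<bar> < d" by metis
  let ?z = "%i. if i \<in> F then x i - of_rat (q i) else 0"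
  have "fin_norm Q F ?z <= e / 4"
    using fin_norm_bound[OF F(1), of ?z d Q] q d less_imp_le[OF q] by simp
  hence near: "norm_bdd Q I ?z" "graph_norm Q I ?z <= e / 4" using graph_norm_fin[OF F, of ?z Q] by simp_all
  have "graph_norm Q I (%i. x i - (if i \<in> F then of_rat (q i) else 0)) =
      graph_norm Q I (%i. (if i \<in> F then 0 else x i) + ?z i)"
    by (rule graph_norm_cong(1)) simp
  also have "... < e" using graph_norm_add(2)[OF tail(1) near(1)] tail(2) near(2) e by linarith
  finally show thesis using that F by blast
qed

lemma norm_Cauchy_convergent:
  assumes xs: "\<And>n. norm_bdd Q I (xs n)" and i: "i \<in> I"
  and cauchy: "\<And>e. 0 < e ==>
      \<exists>N. \<forall>n\<ge>N. \<forall>k\<ge>N. graph_norm Q I (%i. xs n i - xs k i) < e"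
  shows "(%n. xs n i) \<longlonglongrightarrow> lim (%n. xs n i)"
proof -
  have "Cauchy (%n. xs n i)"
  proof (rule CauchyI)
    fix e :: real assume "0 < e"
    then obtain N where "\<forall>n\<ge>N. \<forall>k\<ge>N. graph_norm Q I (%i. xs n i - xs k i) < e"
      using cauchy by blast
    moreover have "norm (xs n i - xs k i) <= graph_norm Q I (%i. xs n i - xs k i)" for n k
      using graph_norm_coord[OF graph_norm_diff(1)[OF xs[of n] xs[of k]] i] by simp
    ultimately show "\<exists>N. \<forall>n\<ge>N. \<forall>k\<ge>N. norm (xs n i - xs k i) < e"
      by (meson order.strict_trans1)
  qed
  thus ?thesis by (simp add: Cauchy_convergent_iff convergent_LIMSEQ_iff)
qed

definition norm_exceeds :: "('i => 'i => bool) => 'i set => ('i => real) => rat => bool" where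
  "norm_exceeds Q I x q <-> q < 0 \<or> (\<exists>F r. finite F & F <= I & q < r & 0 <= r &
  (\<forall>w. (\<forall>i\<in>F. w i \<in> range of_rat) & feasible Q F w -->
      of_rat (r ^ 4) <= (\<Sum>i\<in>F. x i ^ 4 / w i)))"

lemma norm_exceeds_iff: "norm_bdd Q I x ==> norm_exceeds Q I x q <-> of_rat q < graph_norm Q I x"
  unfolding norm_exceeds_def using graph_norm_cut[of Q I x "range of_rat" q] by simp

lemma norm_bdd_iff: "norm_bdd Q I x <-> (\<exists>q. \<not> norm_exceeds Q I x q)"
proof
  assume bdd: "norm_bdd Q I x"
  obtain q where "graph_norm Q I x < of_rat q" using of_rat_dense[of "graph_norm Q I x" "graph_norm Q I x + 1"] by auto
  thus "\<exists>q. \<not> norm_exceeds Q I x q" using norm_exceeds_iff[OF bdd, of q] by (intro exI[of _ q]) simp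
next
  assume "\<exists>q. \<not> norm_exceeds Q I x q"
  then obtain q where q: "\<not> norm_exceeds Q I x q" by blast
  show "norm_bdd Q I x"
  proof (rule norm_bddI, rule ccontr)
    fix F assume F: "finite F" "F <= I" "\<not> fin_norm Q F x <= of_rat q"
    have "norm_bdd Q F x" "graph_norm Q F x = fin_norm Q F x" using graph_norm_fin[of F F x Q] F by auto
    hence "norm_exceeds Q F x q" using norm_exceeds_iff F(3) by (metis linorder_not_le)
    hence "norm_exceeds Q I x q" unfolding norm_exceeds_def using F(2) by (meson subset_trans)
    thus False using q by blast
  qed
qed

lemma feasible_cong:
  assumes "\<And>i. i \<in> F ==> w i = w' i"
  shows "feasible Q F w = feasible Q F w'"
proof -
  have "sum w K = sum w' K" if "K <= F" for K using assms that by (intro sum.cong) auto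
  thus ?thesis unfolding feasible_def using assms by auto
qed

context zermelo
begin

definition real_pow4 :: "'v => 'v" where "real_pow4 c = real_times (real_times c c) (real_times c c)"
lemma dt_real_pow4 [dpi]: "dt UNIV t ==> dt UNIV (%e. real_pow4 (t e))" unfolding real_pow4_def
  by (intro dpi)
lemma real_pow4_code [simp]: "r \<in> Reals_in ==> real_pow4 (real_code r) = real_code (r ^ 4)" "r \<in> Reals_in ==>
    r ^ 4 \<in> Reals_in"
  using Reals_mult[of r r] Reals_mult[of "r * r" "r * r"] by (simp_all add: real_pow4_def power4_eq_xxxx mult.assoc)

text \<open>A finite sum is read off a function on the subsets that changes by \<open>g x\<close> when \<open>x\<close> is added.\<close>

definition sum_is :: "'v => ('v => 'v) => 'v => bool" where
  "sum_is F g c <-> (\<exists>s. ap s empty = real_code 0 & c = ap s F & (\<forall>T U x. ext U <= ext F & x <: F &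
      \<not> x <: T &
  ext U = insert x (ext T) --> ap s U = real_plus (ap s T) (g x)))"

lemma sum_is_iff:
  assumes fin: "finite (ext F)" and g: "\<And>x. x <: F ==> h x \<in> Reals_in & g x = real_code (h x)"
  shows "(\<Sum>x\<in>ext F. h x) \<in> Reals_in" "sum_is F g c <-> c = real_code (\<Sum>x\<in>ext F. h x)"
proof -
  have Reals: "(\<Sum>x\<in>K. h x) \<in> Reals_in" if "K <= ext F" for K
    using finite_subset[OF that fin] that
    by (induction K rule: finite_induct) (use g in \<open>auto simp: Reals_const Reals_add\<close>)
  show "(\<Sum>x\<in>ext F. h x) \<in> Reals_in" by (rule Reals) simp
  have step: "(\<Sum>x\<in>ext U. h x) = (\<Sum>x\<in>ext T. h x) + h x"
    if "ext U <= ext F" "\<not> x <: T" "ext U = insert x (ext T)" for T U x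
    using that finite_subset[OF _ fin, of "ext T"] by (simp add: add.commute)
  have unique: "ap s U = real_code (\<Sum>x\<in>K. h x)"
    if s: "ap s empty = real_code 0" "\<forall>T U x. ext U <= ext F & x <: F & \<not> x <: T &
      ext U = insert x (ext T) --> ap s U = real_plus (ap s T) (g x)" and K: "K <= ext F" "ext U = K" for s K U
    using finite_subset[OF K(1) fin] K
  proof (induction K arbitrary: U rule: finite_induct)
    case empty thus ?case using s(1) ext_eq_empty by simp
  next
    case (insert x K)
    obtain T where T: "ext T = K" using finite_subset_is_set[OF insert.hyps(1)] by blast
    hence "ap s U = real_plus (ap s T) (g x)" using s(2) insert.prems insert.hyps(2) by (metis insert_subset mem_ext)
    moreover have "ap s T = real_code (\<Sum>x\<in>K. h x)" using insert.IH[OF _ T] insert.prems by blast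
    ultimately show ?case using g[of x] Reals[of K] insert by (simp add: add.commute)
  qed
  define s where "s = lam (powset F) (%T. real_code (\<Sum>x\<in>ext T. h x))"
  have "ext ` ext (powset F) <= Pow (ext F)" by (auto simp: subset_iff)
  hence "finite (ext (powset F))" using fin by (meson finite_Pow_iff finite_subset finite_imageD inj_onI ext_inj)
  hence s: "ap s T = real_code (\<Sum>x\<in>ext T. h x)" if "ext T <= ext F" for T
    unfolding s_def using fn_finite(2)[of "powset F" "%T. real_code (\<Sum>x\<in>ext T. h x)" reals T] Reals that
      by simp
  have "ap s U = real_plus (ap s T) (g x)" if "ext U <= ext F" "x <: F" "\<not> x <: T" "ext U = insert x (ext T)"
    for T U x
    using s[of U] s[of T] step[OF that(1, 3, 4)] g[OF that(2)] Reals[of "ext T"] that by simp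
  moreover have "ap s empty = real_code 0" "ap s F = real_code (\<Sum>x\<in>ext F. h x)" using s[of empty] s[of F]
    by simp_all
  ultimately have "sum_is F g (real_code (\<Sum>x\<in>ext F. h x))" unfolding sum_is_def by metis
  thus "sum_is F g c <-> c = real_code (\<Sum>x\<in>ext F. h x)" using unique[of _ "ext F" F]
    unfolding sum_is_def by blast
qed

definition fn_graph :: "'v => 'v => ('v => 'v => bool) => 'v" where
  "fn_graph A B R = coll {z. z <: cprod A B & (\<exists>x y. z = pair x y & R x y)}"
lemma fn_graph:
  assumes d: "dp UNIV (%e. R (e 0) (e 1))"
  and f: "\<And>x. x <: A ==> f x <: B" "\<And>x y. x <: A ==> y <: B ==> R x y <-> y = f x"
  shows "fn (fn_graph A B R) A B" "\<And>x. x <: A ==> app (fn_graph A B R) x = f x"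
proof -
  have "is_set {z. z <: cprod A B & (\<exists>x y. z = pair x y & R x y)}" by (rule sep) (intro dpi dp_lift2[OF d])
  hence "z <: fn_graph A B R <-> (\<exists>x y. z = pair x y & x <: A & y <: B & R x y)" for z
    unfolding fn_graph_def by (auto simp: mem_coll mem_cprod)
  hence graph: "z <: fn_graph A B R <-> (\<exists>x. x <: A & z = pair x (f x))" for z using f by auto
  have func: "func_on (fn_graph A B R) A" unfolding func_on_def graph by auto
  show val: "app (fn_graph A B R) x = f x" if "x <: A" for x using func_app[OF func that, of "f x"] graph that by simp
  show "fn (fn_graph A B R) A B" using func f(1) val by (simp add: fn_def)
qed

lemma dt_fn_graph:
  assumes "dt UNIV (%e. A (e 0))" "dt UNIV (%e. B (e 0))" "dp UNIV (%e. R (e 0) (e 1) (e 2))" "dt UNIV t"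
  shows "dt UNIV (%e. fn_graph (A (t e)) (B (t e)) (R (t e)))"
  unfolding fn_graph_def by (rule dt_coll_lift1[OF _ _ assms(4)])
  (rule sep, (intro dpi dp_lift3[OF assms(3)] dt_fun1[OF assms(1)] dt_fun1[OF assms(2)])+)

definition entry :: "'v => 'v => real" where "entry x i = real_val (ap x i)"
lemma entry:
  assumes "fn x I reals" "i <: I"
  shows "ap x i = real_code (entry x i)" "entry x i \<in> Reals_in"
proof -
  have "real_cut (ap x i)" using assms by (simp add: fn_ap flip: mem_reals)
  thus "ap x i = real_code (entry x i)" "entry x i \<in> Reals_in" using real_cut_val by (simp_all add: entry_def)
qed

lemma entry_eqI: "fn x I reals ==> fn y I reals ==> (\<And>i. i <: I ==> entry x i = entry y i) ==> x = y"
  by (rule fn_eqI[of x I reals y reals]) (simp_all add: entry)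
lemma real_lam:
  assumes "dt UNIV (%e. g (e 0))" "\<And>i. i <: I ==> h i \<in> Reals_in & g i = real_code (h i)"
  shows "fn (lam I g) I reals" "i <: I ==> ap (lam I g) i = g i" "i <: I ==> entry (lam I g) i = h i"
proof -
  have reals: "g i <: reals" if "i <: I" for i using assms(2)[OF that] by simp
  show "fn (lam I g) I reals" by (rule fn_lam[OF assms(1) reals])
  show val: "ap (lam I g) i = g i" if "i <: I" by (rule lam_fn(2)[OF assms(1) reals that])
  show "entry (lam I g) i = h i" if "i <: I" using val[OF that] assms(2)[OF that] by (simp add: entry_def)
qed

definition limit_cut :: "'v => 'v => 'v"
  where "limit_cut s i = coll {z. z <: Rat & (\<exists>r N. r <: Rat & rat_less z r & N <: omega &
  (\<forall>n. n <: omega & N <: n --> r <: ap (ap s n) i))}"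
lemma limit_cut:
  assumes u: "\<And>n. u n \<in> Reals_in & ap (ap s (num n)) i = real_code (u n)" and lim:
    "u \<longlonglongrightarrow> L"
  shows "L \<in> Reals_in & limit_cut s i = real_code L"
proof -
  let ?Z = "%z. \<exists>r N. r <: Rat & rat_less z r & N <: omega & (\<forall>n. n <: omega & N <: n -->
      r <: ap (ap s n) i)"
  have term_cut: "rat_code r <: ap (ap s (num n)) i <-> of_rat r < u n" for r n
    using u[of n] rat_mem_real[OF is_real_code] by simp
  have cut: "?Z (rat_code q) <-> of_rat q < L" for q
  proof
    assume "?Z (rat_code q)"
    then obtain r N where r: "q < r" "\<forall>n. n <: omega & num N <: n --> rat_code r <: ap (ap s n) i"
      unfolding mem_Rat mem_omega[of "_::'v"] by (auto simp: rat_less_iff)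
    have "of_rat r <= u n" if "n >= Suc N" for n
      using r(2)[THEN spec, of "num n"] that term_cut[of r n] by (simp add: num_mem)
    hence "of_rat r <= L" using LIMSEQ_le_const[OF lim] by blast
    thus "of_rat q < L" using r(1) of_rat_less[of q r, where ?'a = real] by linarith
  next
    assume "of_rat q < L"
    then obtain r where r: "of_rat q < (of_rat r :: real)" "of_rat r < L" using of_rat_dense by blast
    obtain N where N: "\<forall>n\<ge>N. of_rat r < u n" using order_tendstoD(1)[OF lim r(2)]
      unfolding eventually_sequentially by blast
    have "rat_code r <: ap (ap s n) i" if "n <: omega & num N <: n" for n
      using that N term_cut by (auto simp: mem_omega num_mem)
    moreover have "rat_code r <: Rat" "rat_less (rat_code q) (rat_code r)"
      using mem_Rat r(1) by (auto simp: rat_less_iff of_rat_less)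
    ultimately show "?Z (rat_code q)" using num_omega by blast
  qed
  have "is_set {z. z <: Rat & ?Z z}" by (rule sep) (intro dpi)
  moreover have L: "L \<in> Reals_in" by (rule Reals_sep[OF _ cut]) (intro dpi)
  ultimately show ?thesis using real_code_cut[OF L cut, of "limit_cut s i"] unfolding limit_cut_def
    by (simp add: mem_coll)
qed

lemma dt_limit_cut: "dt UNIV (%e. limit_cut s (e 0))"
  unfolding limit_cut_def by (rule dt_coll_lift1[where t = "%e. e 0"]) (rule sep, (intro dpi)+)

lemma lepoll_Rat: "lepoll Rat omega"
proof -
  have "ext Rat <= ext (cprod (cprod omega omega) omega)"
    by (auto simp: mem_Rat num_denom_props(5) simp del: num.simps)
  hence "lepoll Rat (cprod (cprod omega omega) omega)" by (rule lepoll_subset)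
  thus ?thesis by (rule lepoll_trans[OF lepoll_trans lepoll_omega_square])
    (rule lepoll_prod[OF lepoll_omega_square lepoll_refl])
qed

end

locale graph_spaces = zermelo mem for mem :: "'v => 'v => bool" (infix \<open><:\<close> 50) +
  fixes I :: 'v and Q :: "'v => 'v => 'v => bool"
  assumes dp_Q0: "dp UNIV (%e. Q (e 0) (e 1) (e 2))"
begin

lemma dp_Q: "dt UNIV t ==> dt UNIV u ==> dt UNIV v ==> dp UNIV (%e. Q (t e) (u e) (v e))"
  by (rule dp_lift3[OF dp_Q0])

definition weights :: "'v => 'v => 'v => bool" where
  "weights a F w <-> fn w F Rat & (\<forall>i. i <: F --> rat_less (rat_code 0) (ap w i)) &
  (\<forall>K c. ext K <= ext F & pairwise (Q a) (ext K) & sum_is K (%i. rat_real (ap w i)) c -->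
      \<not> real_less (real_code 1) c)"
definition weighted_sum_is :: "'v => 'v => 'v => 'v => bool" where
  "weighted_sum_is F w x c <-> (\<exists>y. fn y F reals &
  (\<forall>i. i <: F --> real_times (ap y i) (rat_real (ap w i)) = real_pow4 (ap x i)) & sum_is F (ap y) c)"
definition exceeds :: "'v => 'v => 'v => bool" where
  "exceeds a x z <-> rat_less z (rat_code 0) \<or> (\<exists>F r. ext F <= ext I & finite (ext F) & r <: Rat &
      rat_less z r & \<not> rat_less r (rat_code 0) &
  (\<forall>w c. weights a F w & weighted_sum_is F w x c --> \<not> real_less c (real_pow4 (rat_real r))))"

lemma dp_exceeds: "dt UNIV t ==> dt UNIV u ==> dt UNIV v ==> dp UNIV (%e. exceeds (t e) (u e) (v e))"
  by (rule dp_lift3[where Q = exceeds]) (unfold exceeds_def weights_def weighted_sum_is_def sum_is_def pairwise_def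
    Ball_def mem_ext set_eq_iff insert_iff, intro dpi dp_Q)

lemma weights_iff:
  assumes F: "finite (ext F)" and w: "fn w F Rat" "\<And>i. i <: F ==> ap w i = rat_code (om i)"
  shows "weights a F w <-> feasible (Q a) (ext F) (%i. of_rat (om i))"
proof -
  let ?mass = "%K. \<forall>c. sum_is K (%i. rat_real (ap w i)) c --> \<not> real_less (real_code 1) c"
  have mass: "?mass K <-> (\<Sum>i\<in>ext K. of_rat (om i)) <= (1::real)" if K: "ext K <= ext F" for K
  proof -
    have "of_rat (om i) \<in> Reals_in & rat_real (ap w i) = real_code (of_rat (om i))" if "i <: K" for i
      using w(2)[of i] that K by (auto simp: rat_Reals rat_real_code)
    note sum = sum_is_iff[OF finite_subset[OF K F] this]
    show ?thesis using real_less_code[OF Reals_const(2) sum(1)] by (simp add: sum(2) linorder_not_less)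
  qed
  have "weights a F w <-> (\<forall>i\<in>ext F. 0 < om i) & (\<forall>K. ext K <= ext F --> pairwise (Q a) (ext K) -->
      ?mass K)"
    unfolding weights_def using w by (auto simp: rat_less_iff)
  also have "... <-> (\<forall>i\<in>ext F. 0 < om i) & (\<forall>K. ext K <= ext F --> pairwise (Q a) (ext K) -->
      (\<Sum>i\<in>ext K. of_rat (om i)) <= (1::real))"
    using mass by simp
  also have "... <-> feasible (Q a) (ext F) (%i. of_rat (om i))"
    unfolding feasible_def using finite_subset_is_set[OF finite_subset[OF _ F]] by (simp, metis)
  finally show ?thesis .
qed

lemma weighted_sum_iff:
  assumes F: "finite (ext F)" "ext F <= ext I" and x: "fn x I reals"
  and w: "\<And>i. i <: F ==> 0 < om i & ap w i = rat_code (om i)"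
  shows "(\<Sum>i\<in>ext F. entry x i ^ 4 / of_rat (om i)) \<in> Reals_in"
  "weighted_sum_is F w x c <-> c = real_code (\<Sum>i\<in>ext F. entry x i ^ 4 / of_rat (om i))"
proof -
  let ?h = "%i. entry x i ^ 4 / of_rat (om i)"
  have x4: "entry x i ^ 4 \<in> Reals_in" "real_pow4 (ap x i) = real_code (entry x i ^ 4)" if "i <: F" for i
    using entry[OF x, of i] that F(2) by (auto simp: subset_iff)
  have "?h i = entry x i ^ 4 * of_rat (1 / om i)" for i by (simp add: of_rat_divide)
  hence h: "?h i \<in> Reals_in" if "i <: F" for i using Reals_mult[OF x4(1)[OF that] rat_Reals] by metis
  have quotient: "c = real_code (?h i) <-> real_times c (rat_real (ap w i)) = real_pow4 (ap x i)"
    if i: "i <: F" and c: "c <: reals" for i c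
  proof -
    obtain s where s: "s \<in> Reals_in" "c = real_code s" using c mem_reals_code by blast
    have "s = ?h i <-> s * of_rat (om i) = entry x i ^ 4" using w[OF i] by (auto simp: field_simps)
    thus ?thesis using s w[OF i] h[OF i] x4[OF i] Reals_mult[OF s(1) rat_Reals] rat_Reals
      by (simp add: rat_real_code real_code_inj)
  qed
  define y where "y = lam F (%i. real_code (?h i))"
  have quotient_reals: "real_code (?h i) <: reals" if "i <: F" for i using h[OF that] by simp
  have y: "fn y F reals" "\<And>i. i <: F ==> ap y i = real_code (?h i)"
    unfolding y_def by (rule fn_finite(1)[OF F(1) quotient_reals], assumption, rule
      fn_finite(2)[OF F(1) quotient_reals])
  have unique: "(fn y' F reals & (\<forall>i. i <: F -->
      real_times (ap y' i) (rat_real (ap w i)) = real_pow4 (ap x i))) <-> y' = y" for y'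
    using y quotient fn_eqI[of y' F reals y reals] unfolding fn_ap by (metis (no_types, lifting))
  have "?h i \<in> Reals_in & ap y i = real_code (?h i)" if "i <: F" for i using h[OF that] y(2)[OF that]
    by (rule conjI)
  note sum = sum_is_iff[OF F(1) this]
  show "(\<Sum>i\<in>ext F. ?h i) \<in> Reals_in" by (rule sum(1))
  have "weighted_sum_is F w x c <-> (\<exists>y'. y' = y & sum_is F (ap y') c)"
    unfolding weighted_sum_is_def unique[symmetric] conj_assoc by (rule refl)
  thus "weighted_sum_is F w x c <-> c = real_code (\<Sum>i\<in>ext F. ?h i)" by (simp add: sum(2))
qed

lemma exceeds_bound_iff:
  assumes F: "finite (ext F)" "ext F <= ext I" and x: "fn x I reals"
  shows "(\<forall>w c. weights a F w & weighted_sum_is F w x c -->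
      \<not> real_less c (real_pow4 (rat_real (rat_code r)))) <->
  (\<forall>w. (\<forall>i\<in>ext F. w i \<in> range of_rat) & feasible (Q a) (ext F) w -->
      of_rat (r ^ 4) <= (\<Sum>i\<in>ext F. entry x i ^ 4 / w i))"
  (is "?L <-> ?R")
proof -
  have real_less: "\<not> real_less (real_code s) (real_pow4 (rat_real (rat_code r))) <-> of_rat (r ^ 4) <= s"
    if "s \<in> Reals_in" for s
    using that rat_Reals[of r] by (simp add: rat_real_code real_less_code linorder_not_less of_rat_power)
  note bound_iff = weighted_sum_iff(2)[OF F x] real_less[OF weighted_sum_iff(1)[OF F x]]
  show ?thesis
  proof
    assume L: ?L
    show ?R
    proof (intro allI impI, elim conjE)
      fix W assume W: "\<forall>i\<in>ext F. W i \<in> range of_rat" "feasible (Q a) (ext F) W"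
      then obtain om where om: "\<forall>i\<in>ext F. W i = of_rat (om i)"
        using bchoice[of "ext F" "%i c. W i = of_rat c"] by auto
      define w where "w = lam F (%i. rat_code (om i))"
      have "rat_code (om i) <: Rat" for i using mem_Rat by blast
      hence w: "fn w F Rat" "\<And>i. i <: F ==> ap w i = rat_code (om i)" unfolding w_def by (rule fn_finite[OF F(1)])+
      have "feasible (Q a) (ext F) (%i. of_rat (om i))" using W(2) om feasible_cong[of "ext F" W "%i. of_rat (om i)"]
        by blast
      hence "weights a F w" "\<And>i. i <: F ==> 0 < om i" using weights_iff[OF F(1) w] unfolding feasible_def by auto
      hence "of_rat (r ^ 4) <= (\<Sum>i\<in>ext F. entry x i ^ 4 / of_rat (om i))"
        using L bound_iff[of om w] w(2) by blast
      also have "... = (\<Sum>i\<in>ext F. entry x i ^ 4 / W i)" using om by (intro sum.cong) auto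
      finally show "of_rat (r ^ 4) <= (\<Sum>i\<in>ext F. entry x i ^ 4 / W i)" .
    qed
  next
    assume R: ?R
    show ?L
    proof (intro allI impI, elim conjE)
      fix w c assume w: "weights a F w" and c: "weighted_sum_is F w x c"
      have w_fn: "fn w F Rat" and pos: "\<And>i. i <: F ==> rat_less (rat_code 0) (ap w i)" using w
        unfolding weights_def by blast+
      hence "\<exists>q. ap w i = rat_code q" if "i <: F" for i using that unfolding fn_ap mem_Rat by blast
      then obtain om where om: "\<And>i. i <: F ==> ap w i = rat_code (om i)" by metis
      hence "of_rat (r ^ 4) <= (\<Sum>i\<in>ext F. entry x i ^ 4 / of_rat (om i))"
        using R[THEN spec, of "%i. of_rat (om i)"] w weights_iff[OF F(1) w_fn om] by simp
      moreover have "0 < om i & ap w i = rat_code (om i)" if "i <: F" for i using pos om that rat_less_iff by metis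
      note bound = bound_iff[OF this]
      ultimately show "\<not> real_less c (real_pow4 (rat_real (rat_code r)))" using c
        unfolding bound(1) by (simp only: bound(2))
    qed
  qed
qed

lemma exceeds_iff:
  assumes x: "fn x I reals"
  shows "exceeds a x (rat_code q) <-> norm_exceeds (Q a) (ext I) (entry x) q"
proof -
  define B where "B F r <-> (\<forall>w c. weights a F w & weighted_sum_is F w x c -->
      \<not> real_less c (real_pow4 (rat_real r)))" for F r
  define R where "R F r <-> (\<forall>w. (\<forall>i\<in>F. w i \<in> range of_rat) & feasible (Q a) F w -->
      of_rat (r ^ 4) <= (\<Sum>i\<in>F. entry x i ^ 4 / w i))" for F r
  have "exceeds a x (rat_code q) <-> q < 0 \<or> (\<exists>F r. ext F <= ext I & finite (ext F) & q < r & 0 <= r &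
      B F (rat_code r))"
    unfolding exceeds_def B_def[symmetric] rat_less_iff by (metis mem_Rat rat_less_iff linorder_not_less)
  also have "... <-> q < 0 \<or> (\<exists>F r. ext F <= ext I & finite (ext F) & q < r & 0 <= r & R (ext F) r)"
    unfolding B_def R_def by (intro disj_cong refl ex_cong1 conj_cong exceeds_bound_iff[OF _ _ x])
  also have "... <-> q < 0 \<or> (\<exists>F r. finite F & F <= ext I & q < r & 0 <= r & R F r)"
    using finite_subset_is_set by metis
  finally show ?thesis unfolding norm_exceeds_def R_def .
qed

definition bounded_fns :: "'v => 'v"
  where "bounded_fns a = coll {x. x <: funs I reals & (\<exists>q. q <: Rat & \<not> exceeds a x q)}"
lemma is_set_bounded_fns: "is_set {x. x <: funs I reals & (\<exists>q. q <: Rat & \<not> exceeds a x q)}"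
  by (rule sep) (intro dpi dp_exceeds)
lemma dt_bounded_fns: "dt UNIV t ==> dt UNIV (%e. bounded_fns (t e))"
  unfolding bounded_fns_def by (rule dt_coll_lift1[OF is_set_bounded_fns]) (intro dpi dp_exceeds)
lemma mem_bounded_fns: "x <: bounded_fns a <-> fn x I reals & norm_bdd (Q a) (ext I) (entry x)"
proof -
  have "(\<exists>q. q <: Rat & \<not> exceeds a x q) <-> norm_bdd (Q a) (ext I) (entry x)" if "fn x I reals"
    unfolding norm_bdd_iff exceeds_iff[OF that, symmetric] mem_Rat by blast
  thus ?thesis unfolding bounded_fns_def mem_coll[OF is_set_bounded_fns] by auto
qed

lemma bounded_fnD: "x <: bounded_fns a ==> fn x I reals" "x <: bounded_fns a ==> norm_bdd (Q a) (ext I) (entry x)"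
  using mem_bounded_fns by auto
lemma bounded_fn_eqI: "x <: bounded_fns a ==> y <: bounded_fns b ==> (\<And>i. i <: I ==> entry x i = entry y i) ==>
    x = y"
  by (rule entry_eqI[OF bounded_fnD(1) bounded_fnD(1)])
lemma bounded_lam:
  assumes "dt UNIV (%e. g (e 0))" "\<And>i. i <: I ==> h i \<in> Reals_in & g i = real_code (h i)"
    "norm_bdd (Q a) (ext I) h"
  shows "lam I g <: bounded_fns a"
  using real_lam(1, 3)[OF assms(1, 2)] assms(3) graph_norm_cong(2)[of "ext I" "entry (lam I g)" h]
    unfolding mem_bounded_fns by simp

definition vec_add :: "'v => 'v => 'v" where "vec_add x y = lam I (%i. real_plus (ap x i) (ap y i))"
definition vec_scale :: "'v => 'v => 'v" where "vec_scale c x = lam I (%i. real_times c (ap x i))"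
definition vec_zero :: 'v where "vec_zero = lam I (%i. real_code 0)"
definition unit_vec :: "'v => 'v" where "unit_vec i = lam I (%j. if j = i then real_code 1 else real_code 0)"

lemma vec_add:
  assumes x: "x <: bounded_fns a" and y: "y <: bounded_fns a"
  shows "vec_add x y <: bounded_fns a" "i <: I ==> entry (vec_add x y) i = entry x i + entry y i"
  "i <: I ==> ap (vec_add x y) i = real_plus (ap x i) (ap y i)"
proof -
  have dt: "dt UNIV (%e. real_plus (ap x (e 0)) (ap y (e 0)))" by (intro dpi)
  have code: "entry x i + entry y i \<in> Reals_in & real_plus (ap x i) (ap y i) = real_code (entry x i + entry y i)"
    if "i <: I" for i
    using entry[OF bounded_fnD(1)[OF x] that] entry[OF bounded_fnD(1)[OF y] that] Reals_add by simp
  show "vec_add x y <: bounded_fns a" unfolding vec_add_def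
    by (rule bounded_lam[OF dt code graph_norm_add(1)[OF bounded_fnD(2)[OF x] bounded_fnD(2)[OF y]]])
  show "i <: I ==> entry (vec_add x y) i = entry x i + entry y i"
    unfolding vec_add_def by (rule real_lam(3)[OF dt code])
  show "i <: I ==> ap (vec_add x y) i = real_plus (ap x i) (ap y i)"
    unfolding vec_add_def by (rule real_lam(2)[OF dt code])
qed

lemma vec_scale:
  assumes r: "r \<in> Reals_in" and x: "x <: bounded_fns a"
  shows "vec_scale (real_code r) x <: bounded_fns a" "i <: I ==> entry (vec_scale (real_code r) x) i = r * entry x i"
  "i <: I ==> ap (vec_scale (real_code r) x) i = real_times (real_code r) (ap x i)"
proof -
  have dt: "dt UNIV (%e. real_times (real_code r) (ap x (e 0)))" by (intro dpi)
  have code: "r * entry x i \<in> Reals_in & real_times (real_code r) (ap x i) = real_code (r * entry x i)" if "i <: I"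
    for i
    using entry[OF bounded_fnD(1)[OF x] that] r Reals_mult by simp
  show "vec_scale (real_code r) x <: bounded_fns a" unfolding vec_scale_def
    by (rule bounded_lam[OF dt code graph_norm_scale(1)[OF bounded_fnD(2)[OF x]]])
  show "i <: I ==> entry (vec_scale (real_code r) x) i = r * entry x i" unfolding vec_scale_def
    by (rule real_lam(3)[OF dt code])
  show "i <: I ==> ap (vec_scale (real_code r) x) i = real_times (real_code r) (ap x i)" unfolding vec_scale_def
    by (rule real_lam(2)[OF dt code])
qed

lemma vec_zero: "vec_zero <: bounded_fns a" "i <: I ==> entry vec_zero i = 0"
proof -
  have dt: "dt UNIV (%e. real_code 0)" by (intro dpi)
  have code: "0 \<in> Reals_in & real_code 0 = real_code 0" by (simp add: Reals_const)
  show "vec_zero <: bounded_fns a"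
    unfolding vec_zero_def by (rule bounded_lam[OF dt code graph_norm_fin(1)[of "{}"]]) simp_all
  show "i <: I ==> entry vec_zero i = 0" unfolding vec_zero_def by (rule real_lam(3)[OF dt code])
qed

lemma unit_vec:
  assumes i: "i <: I"
  shows "unit_vec i <: bounded_fns a" "j <: I ==> entry (unit_vec i) j = (if j = i then 1 else 0)"
  "j <: I ==> ap (unit_vec i) j = (if j = i then real_code 1 else real_code 0)"
proof -
  have dt: "dt UNIV (%e. if e 0 = i then real_code 1 else real_code 0)" by (intro dpi)
  have code: "(if j = i then 1 else 0) \<in> Reals_in & (if j = i then real_code 1 else real_code 0) =
      real_code (if j = i then 1 else 0)" for j
    by (simp add: Reals_const)
  show "unit_vec i <: bounded_fns a" unfolding unit_vec_def
    by (rule bounded_lam[OF dt code graph_norm_fin(1)[of "{i}"]]) (use i in simp_all)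
  show "j <: I ==> entry (unit_vec i) j = (if j = i then 1 else 0)"
    unfolding unit_vec_def by (rule real_lam(3)[OF dt code])
  show "j <: I ==> ap (unit_vec i) j = (if j = i then real_code 1 else real_code 0)"
    unfolding unit_vec_def by (rule real_lam(2)[OF dt code])
qed

lemma dt_unit_vec: "dt UNIV t ==> dt UNIV (%e. unit_vec (t e))"
proof (rule dt_lift1[where F = unit_vec])
  have "y = unit_vec i <->
      (\<forall>z. z <: y <-> (\<exists>j. j <: I & z = pair j (if j = i then real_code 1 else real_code 0)))" for y i
  proof -
    have "is_set ((%j. pair j (if j = i then real_code 1 else real_code 0)) ` ext I)"
      by (rule is_set_lam[where b = reals]) (intro dpi, simp add: Reals_const)
    from eq_coll[OF this, of y] show ?thesis unfolding unit_vec_def lam_def by (simp only: image_iff Bex_def mem_ext)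
  qed
  thus "dp UNIV (%e. e 0 = unit_vec (e 1))" by (simp only:) (intro dpi)
qed

definition pointwise :: "'v => 'v => ('v => 'v => 'v => 'v) => 'v" where
  "pointwise a A op = fn_graph (cprod A (bounded_fns a)) (bounded_fns a) (%u w. \<exists>x y. u = pair x y &
      (\<forall>i. i <: I --> ap w i = op x y i))"

lemma pointwise:
  assumes dp: "dp UNIV (%e. \<exists>x y. e 0 = pair x y & (\<forall>i. i <: I --> ap (e 1) i = op x y i))"
  and v: "\<And>x y. x <: A ==> y <: bounded_fns a ==> v x y <: bounded_fns a & (\<forall>i. i <: I -->
      ap (v x y) i = op x y i)"
  shows "fn (pointwise a A op) (cprod A (bounded_fns a)) (bounded_fns a)"
  "x <: A ==> y <: bounded_fns a ==> app (pointwise a A op) (pair x y) = v x y"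
proof -
  let ?R = "%u w. \<exists>x y. u = pair x y & (\<forall>i. i <: I --> ap w i = op x y i)" and ?f =
    "%u. v (pfst u) (psnd u)"
  have closed: "?f u <: bounded_fns a" if "u <: cprod A (bounded_fns a)" for u using that v by (auto simp: mem_cprod)
  have graph: "?R u w <-> w = ?f u" if u: "u <: cprod A (bounded_fns a)" and w: "w <: bounded_fns a" for u w
  proof -
    obtain x y where xy: "u = pair x y" "x <: A" "y <: bounded_fns a" using u mem_cprod by blast
    have "w = v x y" if "\<forall>i. i <: I --> ap w i = op x y i"
      using that v[OF xy(2, 3)] w by (intro fn_eqI[of w I reals _ reals]) (auto intro: bounded_fnD)
    thus ?thesis using xy v[OF xy(2, 3)] by auto
  qed
  show "fn (pointwise a A op) (cprod A (bounded_fns a)) (bounded_fns a)"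
    unfolding pointwise_def by (rule fn_graph(1)[of ?R, OF dp closed graph])
  show "app (pointwise a A op) (pair x y) = v x y" if "x <: A" "y <: bounded_fns a"
    unfolding pointwise_def
      using fn_graph(2)[of ?R "cprod A (bounded_fns a)" ?f, OF dp closed graph, of "pair x y"] that by simp
qed

definition add_fn :: "'v => 'v" where "add_fn a = pointwise a (bounded_fns a) (%x y i. real_plus (ap x i) (ap y i))"
definition scale_fn :: "'v => 'v" where "scale_fn a = pointwise a reals (%c x i. real_times c (ap x i))"
definition norm_fn :: "'v => 'v" where
  "norm_fn a = fn_graph (bounded_fns a) reals ((%a x c. \<forall>z. z <: c <-> z <: Rat & exceeds a x z) a)"
definition space :: "'v => 'v" where "space a = pair (pair (bounded_fns a) (add_fn a)) (pair (scale_fn a) (norm_fn a))"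
definition gnorm :: "'v => 'v => real" where "gnorm a x = graph_norm (Q a) (ext I) (entry x)"

lemma dt_space: "dt UNIV t ==> dt UNIV (%e. space (t e))"
proof (rule dt_fun1[of _ space])
  show "dt UNIV (%e. space (e 0))" unfolding space_def add_fn_def scale_fn_def norm_fn_def pointwise_def
    by (intro dpi dt_bounded_fns dt_fn_graph dp_exceeds)
qed

lemma space_parts: "points (space a) = bounded_fns a" "plus_of (space a) = add_fn a" "scale_of (space a) = scale_fn a"
  "norm_of (space a) = norm_fn a"
  by (simp_all add: space_def points_def plus_of_def scale_of_def norm_of_def)

lemma add_fn: "fn (add_fn a) (cprod (bounded_fns a) (bounded_fns a)) (bounded_fns a)"
  "x <: bounded_fns a ==> y <: bounded_fns a ==> app (add_fn a) (pair x y) = vec_add x y"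
proof -
  have dp: "dp UNIV (%e. \<exists>x y. e 0 = pair x y & (\<forall>i. i <: I -->
      ap (e 1) i = real_plus (ap x i) (ap y i)))" by (intro dpi)
  note pointwise_add = pointwise[OF dp, of "bounded_fns a" a vec_add, folded add_fn_def]
  show "fn (add_fn a) (cprod (bounded_fns a) (bounded_fns a)) (bounded_fns a)"
    "x <: bounded_fns a ==> y <: bounded_fns a ==> app (add_fn a) (pair x y) = vec_add x y"
    using pointwise_add vec_add by blast+
qed

lemma scale_fn: "fn (scale_fn a) (cprod reals (bounded_fns a)) (bounded_fns a)"
  "r \<in> Reals_in ==> x <: bounded_fns a ==> app (scale_fn a) (pair (real_code r) x) = vec_scale (real_code r) x"
proof -
  have dp: "dp UNIV (%e. \<exists>c x. e 0 = pair c x & (\<forall>i. i <: I --> ap (e 1) i = real_times c (ap x i)))"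
    by (intro dpi)
  have "vec_scale c x <: bounded_fns a & (\<forall>i. i <: I --> ap (vec_scale c x) i = real_times c (ap x i))"
    if "c <: reals" "x <: bounded_fns a" for c x using that vec_scale by (auto simp: mem_reals_code)
  note pointwise_scale = pointwise[OF dp, of reals a vec_scale, folded scale_fn_def, OF this]
  show "fn (scale_fn a) (cprod reals (bounded_fns a)) (bounded_fns a)"
    "r \<in> Reals_in ==> x <: bounded_fns a ==> app (scale_fn a) (pair (real_code r) x) = vec_scale (real_code r) x"
    using pointwise_scale by simp_all
qed

lemma norm_fn: "fn (norm_fn a) (bounded_fns a) reals" "x <: bounded_fns a ==> nrm (norm_fn a) x = gnorm a x"
proof -
  let ?R = "%x c. \<forall>z. z <: c <-> z <: Rat & exceeds a x z"
  have cut: "exceeds a x (rat_code q) <-> of_rat q < gnorm a x" if "x <: bounded_fns a" for x q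
    unfolding gnorm_def using exceeds_iff[OF bounded_fnD(1)[OF that]] norm_exceeds_iff[OF bounded_fnD(2)[OF that]]
      by simp
  have Reals: "gnorm a x \<in> Reals_in" if "x <: bounded_fns a" for x
    by (rule Reals_sep[OF _ cut[OF that]]) (intro dpi dp_exceeds)
  have dp: "dp UNIV (%e. ?R (e 0) (e 1))" by (intro dpi dp_exceeds)
  have closed: "real_code (gnorm a x) <: reals" if "x <: bounded_fns a" for x using Reals[OF that] by simp
  have graph: "?R x y <-> y = real_code (gnorm a x)" if "x <: bounded_fns a" for x y
    using real_code_cut[OF Reals[OF that] cut[OF that], of y] by blast
  show "fn (norm_fn a) (bounded_fns a) reals" unfolding norm_fn_def by (rule fn_graph(1)[of ?R, OF dp closed graph])
  show "nrm (norm_fn a) x = gnorm a x" if x: "x <: bounded_fns a"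
  proof -
    have "app (norm_fn a) x = real_code (gnorm a x)"
      unfolding norm_fn_def by (rule fn_graph(2)[of ?R, OF dp closed graph x])
    thus ?thesis by (simp add: nrm_def Reals[OF x])
  qed
qed

lemma gnorm_cong: "(\<And>i. i <: I ==> entry x i = g i) ==> gnorm a x = graph_norm (Q a) (ext I) g"
  unfolding gnorm_def by (rule graph_norm_cong(1)) simp

context
  fixes a :: 'v
begin

abbreviation "E \<equiv> bounded_fns a"
abbreviation "V \<equiv> vec (space a)"

lemma space_vec: "carrier V = ext E" "x <: E ==> y <: E ==> x \<oplus>\<^bsub>V\<^esub> y = vec_add x y"
  "r \<in> Reals_in ==> x <: E ==> r \<odot>\<^bsub>V\<^esub> x = vec_scale (real_code r) x"
    "\<zero>\<^bsub>V\<^esub> = vec_zero"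
proof -
  show "carrier V = ext E" by (simp add: vec_def space_parts)
  show "x <: E ==> y <: E ==> x \<oplus>\<^bsub>V\<^esub> y = vec_add x y" by (simp add: vec_def space_parts add_fn)
  show "r \<in> Reals_in ==> x <: E ==> r \<odot>\<^bsub>V\<^esub> x = vec_scale (real_code r) x"
    by (simp add: vec_def space_parts scale_fn)
  note zero = vec_zero(1)[of a]
  have "(THE z. z <: E & (\<forall>x. x <: E --> app (add_fn a) (pair z x) = x)) = vec_zero"
  proof (rule the_equality)
    have "vec_add vec_zero x = x" if x: "x <: E" for x
      by (rule bounded_fn_eqI[OF vec_add(1)[OF zero x] x]) (simp add: vec_add(2)[OF zero x] vec_zero(2))
    thus "vec_zero <: E & (\<forall>x. x <: E --> app (add_fn a) (pair vec_zero x) = x)" using zero add_fn(2) by simp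
  next
    fix z assume z: "z <: E & (\<forall>x. x <: E --> app (add_fn a) (pair z x) = x)"
    hence "vec_add z vec_zero = vec_zero" using zero add_fn(2)[of z a vec_zero] by metis
    hence "entry z i = entry vec_zero i" if "i <: I" for i
      using vec_add(2)[OF conjunct1[OF z] zero that] vec_zero(2)[OF that] by simp
    thus "z = vec_zero" using z zero bounded_fn_eqI by blast
  qed
  thus "\<zero>\<^bsub>V\<^esub> = vec_zero" by (simp add: vec_def space_parts)
qed

lemmas vector_simps = space_vec vec_add[where a = a] vec_scale[where a = a] vec_zero(1)[where a = a] vec_zero(2)

lemma space_abelian: "abelian_group V"
proof (rule abelian_groupI)
  fix x assume x: "x \<in> carrier V"
  show "\<exists>y\<in>carrier V. y \<oplus>\<^bsub>V\<^esub> x = \<zero>\<^bsub>V\<^esub>"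
  proof (rule bexI[of _ "vec_scale (real_code (- 1)) x"])
    have "- 1 \<in> Reals_in" using Reals_minus[OF Reals_const(2)] by simp
    thus "vec_scale (real_code (- 1)) x \<oplus>\<^bsub>V\<^esub> x = \<zero>\<^bsub>V\<^esub>"
      "vec_scale (real_code (- 1)) x \<in> carrier V"
      using x by (simp_all add: vector_simps) (rule bounded_fn_eqI[of _ a _ a], simp_all add: vector_simps)
  qed
qed (simp_all add: vector_simps, (rule bounded_fn_eqI[of _ a _ a], simp_all add: vector_simps)+)

lemma space_module: "module scalars V"
proof (rule moduleI[OF cring_scalars space_abelian])
qed (simp_all add: scalars_def vector_simps Reals_add Reals_mult Reals_const,
  (rule bounded_fn_eqI[of _ a _ a], simp_all add: vector_simps Reals_add Reals_mult Reals_const algebra_simps)+)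

lemma space_minus:
  assumes x: "x <: E" and y: "y <: E"
  shows "x \<ominus>\<^bsub>V\<^esub> y <: E" "i <: I ==>
      entry (x \<ominus>\<^bsub>V\<^esub> y) i = entry x i - entry y i"
  "nrm (norm_fn a) (x \<ominus>\<^bsub>V\<^esub> y) = graph_norm (Q a) (ext I) (%i. entry x i - entry y i)"
proof -
  have yV: "y \<in> carrier V" using y by (simp add: space_vec)
  have n: "\<ominus>\<^bsub>V\<^esub> y <: E" using abelian_group.a_inv_closed[OF space_abelian yV]
    by (simp add: space_vec)
  have "vec_add y (\<ominus>\<^bsub>V\<^esub> y) = vec_zero" using abelian_group.r_neg[OF space_abelian yV] y n
    by (simp add: space_vec)
  hence neg: "entry y i + entry (\<ominus>\<^bsub>V\<^esub> y) i = 0" if "i <: I" for i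
    using vec_add(2)[OF y n that] vec_zero(2)[OF that] by simp
  have diff: "x \<ominus>\<^bsub>V\<^esub> y = vec_add x (\<ominus>\<^bsub>V\<^esub> y)"
    using x n by (simp add: a_minus_def space_vec)
  show closed: "x \<ominus>\<^bsub>V\<^esub> y <: E" unfolding diff by (rule vec_add(1)[OF x n])
  show val: "entry (x \<ominus>\<^bsub>V\<^esub> y) i = entry x i - entry y i" if "i <: I" for i
    unfolding diff using vec_add(2)[OF x n that] neg[OF that] by simp
  show "nrm (norm_fn a) (x \<ominus>\<^bsub>V\<^esub> y) = graph_norm (Q a) (ext I) (%i. entry x i - entry y i)"
    unfolding norm_fn(2)[OF closed] by (rule gnorm_cong[OF val])
qed

lemma space_norm: "is_norm (space a) (norm_fn a)"
  unfolding is_norm_def space_parts space_vec(1, 4)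
proof (intro conjI ballI)
  show "fn (norm_fn a) E reals" by (rule norm_fn)
next
  fix x assume "x \<in> ext E"
  hence x: "x <: E" by simp
  note bdd = bounded_fnD(2)[OF x]
  show "0 <= nrm (norm_fn a) x" using graph_norm_nonneg[OF bdd] by (simp add: norm_fn(2)[OF x] gnorm_def)
  show "nrm (norm_fn a) x = 0 --> x = vec_zero"
  proof
    assume "nrm (norm_fn a) x = 0"
    hence "entry x i = 0" if "i <: I" for i using graph_norm_coord[OF bdd, of i] that
      by (simp add: norm_fn(2)[OF x] gnorm_def)
    thus "x = vec_zero" by (intro bounded_fn_eqI[OF x vec_zero(1)]) (simp add: vec_zero)
  qed
  show "nrm (norm_fn a) (r \<odot>\<^bsub>V\<^esub> x) = \<bar>r\<bar> * nrm (norm_fn a) x" if r: "r \<in> Reals_in"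
    for r
    using gnorm_cong[OF vec_scale(2)[OF r x], of a] graph_norm_scale(2)[OF bdd, of r]
    by (simp add: space_vec r x norm_fn(2) vec_scale(1) gnorm_def)
  show "nrm (norm_fn a) (x \<oplus>\<^bsub>V\<^esub> y) <= nrm (norm_fn a) x + nrm (norm_fn a) y" if "y \<in> ext E"
    for y
  proof -
    have y: "y <: E" using that by simp
    show ?thesis using gnorm_cong[OF vec_add(2)[OF x y], of a] graph_norm_add(2)[OF bdd bounded_fnD(2)[OF y]]
      by (simp add: space_vec x y norm_fn(2) vec_add(1) gnorm_def)
  qed
qed

lemma space_complete: "is_complete (space a) (norm_fn a)"
  unfolding is_complete_def space_parts space_vec(1)
proof (intro allI impI, elim conjE)
  fix s assume s_fn: "fn s omega E"
    and cauchy: "\<forall>e>0. \<exists>N. \<forall>i\<ge>N. \<forall>j\<ge>N. nrm (norm_fn a)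
        (app s (num i) \<ominus>\<^bsub>V\<^esub> app s (num j)) < e"
  define xs where "xs n = entry (app s (num n))" for n
  have s: "app s (num n) <: E" "ap s (num n) = app s (num n)" for n using s_fn ap_eq unfolding fn_def by auto
  have bdd: "norm_bdd (Q a) (ext I) (xs n)" for n unfolding xs_def by (rule bounded_fnD(2)[OF s(1)])
  have cauchy_xs: "\<exists>N. \<forall>i\<ge>N. \<forall>j\<ge>N. graph_norm (Q a) (ext I) (%k. xs i k - xs j k) < e"
    if "0 < e" for e
    using cauchy that unfolding xs_def space_minus(3)[OF s(1) s(1)] by blast
  have lim: "(%n. xs n i) \<longlonglongrightarrow> lim (%n. xs n i)" if "i <: I" for i
    by (rule norm_Cauchy_convergent[OF bdd _ cauchy_xs]) (use that in simp)
  have "xs n i \<in> Reals_in & ap (ap s (num n)) i = real_code (xs n i)" if "i <: I" for n i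
    unfolding s(2) xs_def using entry[OF bounded_fnD(1)[OF s(1)] that] by simp
  note code = limit_cut[OF this lim]
  define x where "x = lam I (limit_cut s)"
  have "fn x I reals" unfolding x_def by (rule real_lam(1)[OF dt_limit_cut code])
  moreover have entry_x: "entry x i = lim (%n. xs n i)" if "i <: I" for i
    unfolding x_def by (rule real_lam(3)[OF dt_limit_cut code that])
  moreover have "(%n. xs n i) \<longlonglongrightarrow> entry x i" if "i \<in> ext I" for i
    using lim entry_x that by simp
  note limit = graph_norm_limit[OF bdd cauchy_xs this]
  ultimately have x: "x <: E" unfolding mem_bounded_fns by blast
  have "nrm (norm_fn a) (app s (num i) \<ominus>\<^bsub>V\<^esub> x) =
      graph_norm (Q a) (ext I) (%k. xs i k - entry x k)" for i
    unfolding xs_def by (rule space_minus(3)[OF s(1) x])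
  thus "\<exists>x\<in>ext E. \<forall>e>0. \<exists>N. \<forall>i\<ge>N. nrm (norm_fn a)
      (app s (num i) \<ominus>\<^bsub>V\<^esub> x) < e"
    using limit(2) x by (intro bexI[of _ x]) auto
qed

theorem space_banach: "banach (space a)"
  unfolding banach_def vector_space_def space_parts
  using space_norm space_complete space_module add_fn(1) scale_fn(1) by (simp add: space_def)

lemma space_Gateaux:
  assumes h: "h <: E" and x: "x <: E" "gnorm a x = 1"
  shows "\<exists>D. \<forall>t\<in>Reals_in. t \<noteq> 0 -->
      \<bar>(nrm (norm_fn a) (x \<oplus>\<^bsub>V\<^esub> t \<odot>\<^bsub>V\<^esub> h) - nrm (norm_fn a) x) / t -
      D\<bar> <= 3 * (gnorm a h)\<^sup>2 * \<bar>t\<bar>"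
proof -
  obtain D where D: "\<And>t. t \<noteq> 0 ==>
      \<bar>(graph_norm (Q a) (ext I) (%i. entry x i + t * entry h i) - 1) / t - D\<bar> <=
      3 * (gnorm a h)\<^sup>2 * \<bar>t\<bar>"
    using graph_norm_UG[OF bounded_fnD(2)[OF x(1)] x(2)[unfolded gnorm_def] bounded_fnD(2)[OF h]]
      unfolding gnorm_def by blast
  have "nrm (norm_fn a) (x \<oplus>\<^bsub>V\<^esub> t \<odot>\<^bsub>V\<^esub> h) =
      graph_norm (Q a) (ext I) (%i. entry x i + t * entry h i)" if t: "t \<in> Reals_in" for t
    using gnorm_cong[of "vec_add x (vec_scale (real_code t) h)" "%i. entry x i + t * entry h i" a] h x t
      by (simp add: vector_simps norm_fn(2))
  thus ?thesis using D x by (intro exI[of _ D] ballI impI) (simp add: norm_fn(2))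
qed

theorem space_UG: "UG (space a)"
  unfolding UG_def
proof (intro exI[of _ "norm_fn a"] conjI space_norm)
  show "equivalent_norms (space a) (norm_of (space a)) (norm_fn a)"
    unfolding equivalent_norms_def space_parts by (intro exI[of _ 1]) simp
  show "uniformly_Gateaux (space a) (norm_fn a)" unfolding uniformly_Gateaux_def space_vec(1)
  proof (rule ballI)
    fix h assume "h \<in> ext E"
    hence h: "h <: E" by simp
    define n where "n = 3 * (gnorm a h)\<^sup>2"
    have n: "0 <= n" by (simp add: n_def)
    let ?quotient = "%x t. (nrm (norm_fn a) (x \<oplus>\<^bsub>V\<^esub> t \<odot>\<^bsub>V\<^esub> h) - nrm
        (norm_fn a) x) / t"
    obtain D where D: "\<And>x t. x <: E ==> gnorm a x = 1 ==> t \<in> Reals_in ==> t \<noteq> 0 ==>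
        \<bar>?quotient x t - D x\<bar> <= n * \<bar>t\<bar>"
      using space_Gateaux[OF h] unfolding n_def by metis
    have "\<bar>?quotient x t - D x\<bar> < e"
      if "0 < e" "x \<in> ext E" "t \<in> Reals_in" "nrm (norm_fn a) x = 1 & 0 < \<bar>t\<bar> &
          \<bar>t\<bar> < e / (n + 1)" for e x t
    proof -
      have "n * \<bar>t\<bar> <= (n + 1) * \<bar>t\<bar>" by (simp add: mult_right_mono)
      also have "... < e" using that n by (simp add: field_simps)
      finally show ?thesis using D[of x t] that norm_fn(2)[of x a] by auto
    qed
    moreover have "0 < e / (n + 1)" if "0 < e" for e using that n by simp
    ultimately show "\<exists>D. \<forall>e>0. \<exists>d>0. \<forall>x\<in>ext E. \<forall>t\<in>Reals_in. nrm
        (norm_fn a) x = 1 & 0 < \<bar>t\<bar> & \<bar>t\<bar> < d --> \<bar>?quotient x t - D x\<bar> < e"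
      by blast
  qed
qed

definition rational_vecs :: 'v where
  "rational_vecs = coll {x. x <: E & finite {i. i <: I & ap x i \<noteq> real_code 0} & (\<forall>i. i <: I -->
      (\<exists>q. q <: Rat & ap x i = rat_real q))}"
lemma mem_rational_vecs: "x <: rational_vecs <-> x <: E & finite {i. i <: I & ap x i \<noteq> real_code 0} &
    (\<forall>i. i <: I --> (\<exists>q. q <: Rat & ap x i = rat_real q))"
proof -
  have "is_set {x. x <: E & finite {i. i <: I & ap x i \<noteq> real_code 0} & (\<forall>i. i <: I -->
      (\<exists>q. q <: Rat & ap x i = rat_real q))}"
    by (rule sep) (intro dpi)
  thus ?thesis unfolding rational_vecs_def by (simp only: mem_coll mem_Collect_eq)
qed

lemma rational_vecD: "x <: rational_vecs ==> x <: E" "x <: rational_vecs ==> fn x I reals"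
  using mem_rational_vecs bounded_fnD(1) by blast+

lemma ex_rational_vec:
  assumes F: "finite F" "F <= ext I"
  obtains y where "y <: rational_vecs" "\<And>i. i <: I ==> entry y i = (if i \<in> F then of_rat (q i) else 0)"
proof -
  let ?h = "%i. if i \<in> F then of_rat (q i) else 0"
  obtain f where f: "ext f = F" using finite_subset_is_set[OF F(1)] by blast
  hence mem_f: "i <: f <-> i \<in> F" for i by auto
  define w where "w = lam f (%i. real_code (of_rat (q i)))"
  have w: "ap w i = real_code (of_rat (q i))" if "i \<in> F" for i
    unfolding w_def by (rule fn_finite(2)[of f _ reals]) (use F(1) f that mem_f rat_Reals in auto)
  have dt: "dt UNIV (%e. if e 0 <: f then ap w (e 0) else real_code 0)" by (intro dpi)
  have code: "?h i \<in> Reals_in & (if i <: f then ap w i else real_code 0) = real_code (?h i)" for i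
    using w mem_f rat_Reals Reals_const by simp
  define y where "y = lam I (%i. if i <: f then ap w i else real_code 0)"
  have y: "y <: E" unfolding y_def by (rule bounded_lam[OF dt code graph_norm_fin(1)[OF F]]) simp
  have entry_y: "entry y i = ?h i" if "i <: I" for i unfolding y_def by (rule real_lam(3)[OF dt code that])
  have ap_y: "ap y i = rat_real (rat_code (if i \<in> F then q i else 0))" if "i <: I" for i
    using entry(1)[OF bounded_fnD(1)[OF y] that] entry_y[OF that] by (simp add: rat_real_code)
  have "{i. i <: I & ap y i \<noteq> real_code 0} <= F" using ap_y by (auto simp: rat_real_code split: if_splits)
  hence "finite {i. i <: I & ap y i \<noteq> real_code 0}" using F(1) by (rule finite_subset)
  hence "y <: rational_vecs" using y ap_y mem_Rat unfolding mem_rational_vecs by blast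
  thus thesis using that entry_y by blast
qed

lemma rational_vecs_dense: "dense_in (space a) rational_vecs"
  unfolding dense_in_def space_parts space_vec(1)
proof (intro conjI ballI allI impI)
  show "ext rational_vecs <= ext E" using mem_rational_vecs by auto
  fix x and e :: real assume "x \<in> ext E" and e: "0 < e"
  hence x: "x <: E" by simp
  obtain F q where F: "finite F" "F <= ext I"
    "graph_norm (Q a) (ext I) (%i. entry x i - (if i \<in> F then of_rat (q i) else 0)) < e"
    using rational_approximation[OF bounded_fnD(2)[OF x] e] by metis
  obtain y where y: "y <: rational_vecs" "\<And>i. i <: I ==> entry y i = (if i \<in> F then of_rat (q i) else 0)"
    using ex_rational_vec[OF F(1, 2)] by metis
  have "nrm (norm_fn a) (x \<ominus>\<^bsub>V\<^esub> y) = graph_norm (Q a) (ext I) (%i. entry x i - entry y i)"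
    by (rule space_minus(3)[OF x rational_vecD(1)[OF y(1)]])
  also have "... = graph_norm (Q a) (ext I) (%i. entry x i - (if i \<in> F then of_rat (q i) else 0))"
    by (rule graph_norm_cong(1)) (simp add: y(2))
  finally show "\<exists>y\<in>ext rational_vecs. nrm (norm_fn a) (x \<ominus>\<^bsub>V\<^esub> y) < e"
    using y(1) F(3) by (intro bexI[of _ y]) auto
qed

lemma lepoll_rational_vecs: "lepoll rational_vecs (Fin (cprod I omega))"
proof (rule lepoll_trans[OF _ lepoll_Fin_mono[OF lepoll_prod[OF lepoll_refl lepoll_Rat]]])
  define g where "g x = coll {z. z <: cprod I Rat & (\<exists>i q. z = pair i q & ap x i \<noteq> real_code 0 &
      ap x i = rat_real q)}" for x
  have graph: "is_set {z. z <: cprod I Rat & (\<exists>i q. z = pair i q & ap x i \<noteq> real_code 0 &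
      ap x i = rat_real q)}" for x by (rule sep) (intro dpi)
  have g: "pair i q <: g x <-> i <: I & q <: Rat & ap x i \<noteq> real_code 0 & ap x i = rat_real q" "z <: g x ==>
      \<exists>i q. z = pair i q" for z i q x
    unfolding g_def mem_coll[OF graph] by auto
  have rat_real_inj: "q = r" if "q <: Rat" "r <: Rat" "rat_real q = rat_real r" for q r
    using that rat_Reals real_code_inj unfolding mem_Rat by (auto simp: rat_real_code)
  show "lepoll rational_vecs (Fin (cprod I Rat))"
  proof (rule lepollI)
    show "dt UNIV (%e. g (e 0))" unfolding g_def by (rule dt_coll_lift1[OF graph]) (intro dpi)+
    fix x assume x: "x <: rational_vecs"
    have "inj_on pfst (ext (g x))"
    proof (rule inj_onI)
      fix z z' assume z: "z \<in> ext (g x)" "z' \<in> ext (g x)" and eq: "pfst z = pfst z'"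
      obtain i q j r where "z = pair i q" "z' = pair j r" using g(2) z by (metis mem_ext)
      thus "z = z'" using z eq g(1) rat_real_inj by auto
    qed
    moreover have "pfst ` ext (g x) <= {i. i <: I & ap x i \<noteq> real_code 0}" using g by fastforce
    ultimately have "finite (ext (g x))" using x inj_on_finite unfolding mem_rational_vecs by blast
    moreover have "ext (g x) <= ext (cprod I Rat)" unfolding g_def by (auto simp: mem_coll[OF graph])
    ultimately show "g x <: Fin (cprod I Rat)" by (simp add: mem_Fin)
  next
    have zero: "ap y i = ap x i" if "x <: rational_vecs" "g x = g y" "i <: I" "ap x i \<noteq> real_code 0" for x y i
      using that g(1)[of i _ x] g(1)[of i _ y] unfolding mem_rational_vecs by metis
    show "inj_on g (ext rational_vecs)"
    proof (rule inj_onI)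
      fix x y assume "x \<in> ext rational_vecs" "y \<in> ext rational_vecs" "g x = g y"
      moreover from this have "ap x i = ap y i" if "i <: I" for i using zero[of x y i] zero[of y x i] that by force
      ultimately show "x = y" using fn_eqI[OF rational_vecD(2) rational_vecD(2)] by simp
    qed
  qed
qed

lemma lepoll_unit_vecs: "lepoll I rational_vecs"
proof (rule lepoll_rel[of "%i y. \<forall>j. j <: I --> ap y j = (if j = i then real_code 1 else real_code 0)"])
  fix i assume i: "i <: I"
  obtain y where y: "y <: rational_vecs" "\<And>j. j <: I ==> entry y j = (if j \<in> {i} then of_rat 1 else 0)"
    using ex_rational_vec[of "{i}" "%_. 1"] i by auto
  hence "ap y j = (if j = i then real_code 1 else real_code 0)" if "j <: I" for j
    using entry(1)[OF rational_vecD(2) that] that by simp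
  thus "\<exists>y. y <: rational_vecs & (\<forall>j. j <: I -->
      ap y j = (if j = i then real_code 1 else real_code 0))" using y(1) by blast
next
  fix i y z assume "y <: rational_vecs" "z <: rational_vecs" "\<forall>j. j <: I -->
      ap y j = (if j = i then real_code 1 else real_code 0)"
    "\<forall>j. j <: I --> ap z j = (if j = i then real_code 1 else real_code 0)"
  thus "y = z" using fn_eqI[OF rational_vecD(2) rational_vecD(2)] by simp
next
  have "real_code 1 \<noteq> real_code 0" using real_code_inj[OF Reals_const(2, 1)] by simp
  thus "i = i'" if "i <: I" "\<forall>j. j <: I --> ap y j = (if j = i then real_code 1 else real_code 0)"
    "\<forall>j. j <: I --> ap y j = (if j = i' then real_code 1 else real_code 0)" for i i' y using that by metis
qed (intro dpi)

text \<open>A point of a dense set close to a unit vector exceeds one half in exactly one coordinate.\<close>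

lemma lepoll_dense:
  assumes d: "dense_in (space a) d" and l: "ordinal l" "lepoll d l"
  shows "lepoll I l"
proof -
  obtain g where g: "inj_fn g d l" using l(2) by (rule lepollE)
  define near where "near i y <-> rat_code (1 / 2) <: ap y i & (\<forall>j. j <: I & j \<noteq> i -->
      \<not> rat_code (1 / 2) <: ap y j)" for i y
  have ex_near: "\<exists>y. y <: d & near i y" if i: "i <: I" for i
  proof -
    note u = unit_vec(1)[OF i, of a]
    obtain y where y: "y <: d" "nrm (norm_fn a) (unit_vec i \<ominus>\<^bsub>V\<^esub> y) < 1 / 2"
      using d[unfolded dense_in_def space_parts, THEN conjunct2, THEN bspec, of "unit_vec i", THEN spec, of "1 / 2"] u
        by (auto simp: space_vec)
    have yE: "y <: E" using d y(1) unfolding dense_in_def space_vec by auto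
    have close: "\<bar>entry (unit_vec i) j - entry y j\<bar> < 1 / 2" if "j <: I" for j
      using graph_norm_coord[OF graph_norm_diff(1)[OF bounded_fnD(2)[OF u] bounded_fnD(2)[OF yE]], of j] y(2) that
      unfolding space_minus(3)[OF u yE] by simp
    have half: "rat_code (1 / 2) <: ap y j <-> 1 / 2 < entry y j" if "j <: I" for j
      using entry[OF bounded_fnD(1)[OF yE] that] rat_mem_real[OF is_real_code, of "entry y j" "1 / 2"]
        by (simp add: of_rat_divide)
    have "1 / 2 < entry y i" using close[OF i] unit_vec(2)[OF i i] by (simp add: abs_if split: if_splits)
    moreover have "\<not> 1 / 2 < entry y j" if "j <: I" "j \<noteq> i" for j
      using close[OF that(1)] unit_vec(2)[OF i that(1)] that(2) by simp
    ultimately show ?thesis unfolding near_def using half i y(1) by blast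
  qed
  show ?thesis
  proof (rule lepoll_least[of "%i b. \<exists>y. y <: d & ap g y = b & near i y", OF _ l(1)])
    show "dp UNIV (%e. \<exists>y. y <: d & ap g y = e 1 & near (e 0) y)" unfolding near_def by (intro dpi)
    show "\<exists>b. b <: l & (\<exists>y. y <: d & ap g y = b & near i y)" if "i <: I" for i
      using ex_near[OF that] inj_fnD(3)[OF g] by blast
    show "i = j" if "i <: I" "j <: I" "\<exists>y. y <: d & ap g y = b & near i y" "\<exists>y. y <: d & ap g y = b &
        near j y" for i j b
      using that inj_fnD(4)[OF g] unfolding near_def by metis
  qed
qed

theorem space_density:
  assumes k: "cardinal k" "lepoll k I" "lepoll (Fin (cprod I omega)) k"
  shows "has_density (space a) k"
  unfolding has_density_def
proof (intro conjI allI impI notI)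
  show "\<exists>d. dense_in (space a) d & equinum d k"
    using rational_vecs_dense lepoll_trans[OF lepoll_rational_vecs k(3)] lepoll_trans[OF k(2) lepoll_unit_vecs]
      equinum_iff by blast
next
  fix d l assume d: "dense_in (space a) d & l <: k" and eq: "equinum d l"
  have "ordinal l" using k(1) d ordinal_mem unfolding cardinal_def by blast
  hence "lepoll k l" using lepoll_dense d equinum_lepoll[OF eq] lepoll_trans[OF k(2)] by blast
  thus False using cardinal_not_lepoll[OF k(1)] d by blast
qed

end

primrec unit_sum :: "(nat => 'v) => nat => 'v" where
  "unit_sum g 0 = vec_zero" | "unit_sum g (Suc n) = vec_add (unit_sum g n) (unit_vec (g n))"

lemma unit_sum:
  assumes "g ` {..<n} <= ext I" "inj_on g {..<n}"
  shows "unit_sum g n <: bounded_fns a & (\<forall>i. i <: I -->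
      entry (unit_sum g n) i = (if i \<in> g ` {..<n} then 1 else 0))"
  using assms
proof (induction n)
  case (Suc n)
  hence IH: "unit_sum g n <: bounded_fns a" "\<And>i. i <: I ==>
      entry (unit_sum g n) i = (if i \<in> g ` {..<n} then 1 else 0)"
    and n: "g n <: I" "g n \<notin> g ` {..<n}" by (auto simp: lessThan_Suc)
  thus ?case using vec_add[OF IH(1) unit_vec(1)[OF n(1)]] unit_vec(2)[OF n(1)] by (auto simp: lessThan_Suc)
qed (simp add: vec_zero)

lemma gnorm_unit_sum:
  assumes "g ` {..<n} <= ext I" "inj_on g {..<n}"
  shows "gnorm a (unit_sum g n) = fin_norm (Q a) (g ` {..<n}) (%i. 1)"
proof -
  have "gnorm a (unit_sum g n) = graph_norm (Q a) (ext I) (%i. if i \<in> g ` {..<n} then 1 else 0)"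
    using unit_sum[OF assms, of a] by (intro gnorm_cong) blast
  also have "... = fin_norm (Q a) (g ` {..<n}) (%i. if i \<in> g ` {..<n} then 1 else 0)"
    by (rule graph_norm_fin(2)) (use assms(1) in auto)
  also have "... = fin_norm (Q a) (g ` {..<n}) (%i. 1)" by (rule fin_norm_cong) simp
  finally show ?thesis .
qed

lemma gnorm_eq:
  assumes "space a = space b" "x <: bounded_fns a"
  shows "gnorm a x = gnorm b x"
  using assms norm_fn(2) unfolding space_def by (metis pair_inject)

lemma is_set_family: "is_set {z. \<exists>a. a <: D & z = space a}"
proof -
  let ?A = "funs I reals"
  let ?T = "cprod (cprod (powset ?A) (powset (cprod (cprod ?A ?A) ?A))) (cprod (powset (cprod (cprod reals ?A) ?A))
      (powset (cprod ?A reals)))"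
  have bounded: "x <: ?A" if "x <: bounded_fns a" for x a using bounded_fnD(1)[OF that] by simp
  have "space a <: ?T" for a
  proof -
    have "ext (add_fn a) <= ext (cprod (cprod (bounded_fns a) (bounded_fns a)) (bounded_fns a))"
      "ext (scale_fn a) <= ext (cprod (cprod reals (bounded_fns a)) (bounded_fns a))"
      "ext (norm_fn a) <= ext (cprod (bounded_fns a) reals)"
      using fn_mem_pow add_fn(1) scale_fn(1) norm_fn(1) mem_powset by blast+
    thus ?thesis unfolding space_def using bounded by (simp del: mem_funs add: subset_iff) (metis mem_cprod)
  qed
  hence "{z. \<exists>a. a <: D & z = space a} = {z. z <: ?T & (\<exists>a. a <: D & z = space a)}" by auto
  thus ?thesis using sep[of "%z. \<exists>a. a <: D & z = space a" ?T]
    by (simp del: mem_funs) (rule meta_mp, assumption, intro dpi dt_space)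
qed

lemma equinum_family:
  assumes "\<And>a b. a <: D ==> b <: D ==> space a = space b ==> a = b"
  shows "equinum (coll {z. \<exists>a. a <: D & z = space a}) D"
  by (rule equinum_rel[of "%z a. z = space a"])
    (use assms in \<open>auto simp: mem_coll[OF is_set_family] intro!: dpi dt_space\<close>)

end

section \<open>The family of spaces\<close>

context cohen_model
begin

definition joined :: "'w => 'w => 'w => 'w => bool" where
  "joined c a x y <-> (\<exists>n. memW n W.omega & \<not> (memW n x <-> memW n y) & (\<forall>k. memW k n -->
      (memW k x <-> memW k y)) & memW (W.pair a n) c)"
lemma dp_joined: "W.dt C t ==> W.dt C u ==> W.dt C v ==> W.dt C w ==> W.dp C (%e. joined (t e) (u e) (v e) (w e))"
  by (rule W.dp_lift4[where Q = joined]) (unfold joined_def, intro dpi)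

definition first_diff :: "'v => 'v => nat => bool" where
  "first_diff x y n <-> \<not> (num n <: x <-> num n <: y) & (\<forall>k<n. num k <: x <-> num k <: y)"
lemma first_diff_ex:
  assumes "x <: powset omega" "y <: powset omega" "x \<noteq> y"
  shows "\<exists>n. first_diff x y n"
proof -
  obtain z where "\<not> (z <: x <-> z <: y)" using assms(3) set_eqI by blast
  then obtain n where "\<not> (num n <: x <-> num n <: y)" using assms(1, 2) mem_omega[of z] by (auto simp: subset_iff)
  thus ?thesis using exists_least_iff[of "%n. \<not> (num n <: x <-> num n <: y)"] unfolding first_diff_def by blast
qed

lemma first_diff_unique: "first_diff x y n ==> first_diff x y k ==> n = k" unfolding first_diff_def
  by (metis linorder_neqE_nat)

lemma joined_first_diff:
  assumes "first_diff x y n"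
  shows "joined c a (emb x) (emb y) <-> memW (W.pair a (W.num n)) c"
proof -
  have num_emb: "memW (W.num k) (emb z) <-> num k <: z" for k z by (simp only: emb_num[symmetric] emb_mem)
  have below: "(\<forall>k. memW k (W.num n) --> R k) <-> (\<forall>k<n. R (W.num k))" for n R
    unfolding W.mem_num by blast
  have omega: "(\<exists>n. memW n W.omega & R n) <-> (\<exists>n. R (W.num n))" for R unfolding W.mem_omega by blast
  have "joined c a (emb x) (emb y) <-> (\<exists>k. first_diff x y k & memW (W.pair a (W.num k)) c)"
    unfolding joined_def below omega num_emb first_diff_def by (simp only: conj_assoc)
  thus ?thesis using assms first_diff_unique by blast
qed

abbreviation "indices \<equiv> emb (powset omega)"

end

sublocale cohen_model \<subseteq> B: graph_spaces memW "emb (powset omega)" "joined cohen_reals"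
  by unfold_locales (intro dp_joined dpi)

context cohen_model
begin

theorem space_density: "W.has_density (B.space a) W.aleph1"
  unfolding aleph1_W
proof (rule B.space_density[OF cardinal_aleph1_W])
  show "W.lepoll (emb aleph1) indices" by (rule emb_lepoll[OF equinum_lepoll2[OF equinum_pow_omega]])
  let ?b = "cprod (powset omega) omega"
  have "lepoll ?b aleph1" by (rule lepoll_aleph1_omega[OF equinum_lepoll[OF equinum_pow_omega]])
  hence "W.lepoll (emb (Fin ?b)) (emb aleph1)" using lepoll_Fin_mono Fin_aleph1 lepoll_trans emb_lepoll by blast
  moreover have "W.ext (W.Fin (emb ?b)) <= W.ext (emb (Fin ?b))"
  proof
    fix y assume "y \<in> W.ext (W.Fin (emb ?b))"
    hence "W.ext y <= W.ext (emb ?b)" "finite (W.ext y)" by (simp_all add: W.mem_Fin)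
    then obtain z where "y = emb z" "ext z <= ext ?b" "finite (ext z)" using emb_sub emb_finite by metis
    thus "y \<in> W.ext (emb (Fin ?b))" by (simp add: mem_Fin)
  qed
  ultimately show "W.lepoll (W.Fin (W.cprod indices W.omega)) (emb aleph1)"
    unfolding emb_omega[symmetric] emb_cprod using W.lepoll_subset W.lepoll_trans by blast
qed

lemma space_inj:
  assumes ab: "al <: dl" "be <: dl" and eq: "B.space (emb al) = B.space (emb be)"
  shows "al = be"
proof (rule ccontr)
  assume "al \<noteq> be"
  then obtain n where n: "memW (W.pair (emb al) (W.num n)) cohen_reals"
    "\<not> memW (W.pair (emb be) (W.num n)) cohen_reals" using bits_differ ab by blast
  define y where "y = coll {num n}"
  have mem_y: "z <: y <-> z = num n" for z unfolding y_def by (rule mem_coll_sing)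
  have diff: "first_diff empty y n" "first_diff y empty n" unfolding first_diff_def
    by (simp_all add: mem_y del: num.simps)
  have ne: "emb empty \<noteq> emb y" using mem_y[of "num n"] mem_empty[of "num n"] emb_inj by metis
  define g where "g l = (if l = 0 then emb empty else emb y)" for l :: nat
  have image: "g ` {..<2} = {emb empty, emb y}" unfolding g_def by (auto simp: image_iff less_2_cases_iff)
  have g: "g ` {..<2} <= W.ext indices" "inj_on g {..<2}"
    unfolding image using ne mem_y by (auto simp: g_def inj_on_def less_2_cases_iff split: if_splits)
  have norm: "B.gnorm a (B.unit_sum g 2) = fin_norm (joined cohen_reals a) {emb empty, emb y} (%i. 1)" for a
    using B.gnorm_unit_sum[OF g] unfolding image .
  have card: "card {emb empty, emb y} = 2" using ne by simp
  have "sqrt 2 <= B.gnorm (emb al) (B.unit_sum g 2)"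
    using fin_norm_clique[of "{emb empty, emb y}" "joined cohen_reals (emb al)"] n(1)
    unfolding norm card by (simp add: pairwise_insert joined_first_diff[OF diff(1)] joined_first_diff[OF diff(2)])
  also have "... = B.gnorm (emb be) (B.unit_sum g 2)" using B.gnorm_eq[OF eq] B.unit_sum[OF g] by blast
  also have "... <= sqrt (sqrt 2)"
    using fin_norm_anticlique[of "{emb empty, emb y}" "joined cohen_reals (emb be)"] n(2)
    unfolding norm card by (simp add: pairwise_insert joined_first_diff[OF diff(1)] joined_first_diff[OF diff(2)])
  also have "... < sqrt 2" using sqrt2_less_2 by (rule real_sqrt_less_mono)
  finally show False by simp
qed

definition Fam :: 'w where "Fam = W.coll {z. \<exists>a. memW a (emb dl) & z = B.space a}"
lemma mem_Fam: "memW z Fam <-> (\<exists>al. al <: dl & z = B.space (emb al))"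
  unfolding Fam_def by (subst W.mem_coll[OF B.is_set_family]) (auto simp: mem_emb)
lemma equinum_Fam: "W.equinum Fam W.aleph2"
  unfolding Fam_def aleph2_W by (rule B.equinum_family) (use space_inj in \<open>auto simp: mem_emb\<close>)

section \<open>Separating cliques from anticliques\<close>

definition separated :: "'w => 'w => 'w => 'w => ('w => bool) => ('w => bool) => bool" where
  "separated c a I k Q Q' <-> (\<forall>f. W.inj_fn f k I --> (pairwise (joined c a) (W.ap f ` W.ext k) --> Q f) &
  (pairwise (%x y. \<not> joined c a x y) (W.ap f ` W.ext k) --> Q' f))"

definition separates :: "'w => 'w => 'w => 'w => 'w => 'w => 'w => bool" where
  "separates j S c a I k w <-> W.fn j I w &
  separated c a I k (%f. \<forall>t. W.fn t k w & (\<forall>l. memW l k --> W.ap t l = W.ap j (W.ap f l)) --> memW t S)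
  (%f. \<forall>t. W.fn t k w & (\<forall>l. memW l k --> W.ap t l = W.ap j (W.ap f l)) --> \<not> memW t S)"

lemma dp_separates: "W.dp {} (%e. separates (e 0) (e 1) (e 2) (e 3) (e 4) (e 5) (e 6))"
  unfolding separates_def separated_def pairwise_image by (unfold pairwise_def Ball_def W.mem_ext, intro dpi dp_joined)

lemma decided_below:
  assumes B: "lepoll B aleph1"
  obtains be where "be <: dl" "\<And>b q c. b <: B ==> decides q b ta c ==>
  \<exists>e r c'. decides e b ta c' & leq r q & leq r e & (\<forall>al k. al <: dl & \<not> al <: be -->
      bits e (al, k) = None)"
proof -
  let ?D = "%b q. decides q b ta True \<or> decides q b ta False"
  obtain U where U: "lepoll U (cprod (cprod B omega) omega)" "\<And>u. u <: U ==> \<exists>b q. u = pair b q & b <: B &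
      q \<in> conds & ?D b q"
    "\<And>b q. b <: B ==> q \<in> conds ==> ?D b q ==> \<exists>e r. pair b e <: U & leq r q & leq r e"
    by (rule predense_cover[of ?D B]) (intro dpi, rule that)
  let ?occurs = "%u xi. \<exists>b e z. u = pair b e & has_bit e xi z"
  obtain C where C: "\<And>xi. xi <: C <-> xi <: dl & (\<exists>u. u <: U & ?occurs u xi)"
    by (rule sepE, erule that, intro dpi)
  have "lepoll C (cprod U omega)"
  proof (rule finite_cover[of ?occurs])
    show "\<exists>u. u <: U & ?occurs u xi" if "xi <: C" for xi using that C by blast
    fix u assume "u <: U"
    then obtain b e where u: "u = pair b e" "e \<in> conds" using U(2) by blast
    have "{xi. xi <: C & ?occurs u xi} <= fst ` dom (bits e)" using u C has_bit_cond_map[OF u(2)]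
      by (force simp: image_iff)
    thus "finite {xi. xi <: C & ?occurs u xi}" using dom_cond_map(1)[OF u(2)] finite_surj by blast
  qed (intro dpi)
  moreover have "lepoll (cprod U omega) aleph1"
    using lepoll_aleph1_omega lepoll_trans[OF U(1) lepoll_aleph1_omega2[OF B]] by blast
  ultimately have "lepoll C aleph1" using lepoll_trans by blast
  moreover have "ext C <= ext dl" using C by auto
  ultimately obtain be where be: "be <: dl" "ext C <= ext be" using bounded_dl by blast
  have "bits e (al, k) = None" if U_e: "pair b e <: U" and al: "al <: dl" "\<not> al <: be" for b e al k
  proof (rule ccontr)
    assume "bits e (al, k) \<noteq> None"
    moreover have "e \<in> conds" using U(2)[OF U_e] by auto
    ultimately obtain z where "has_bit e al z" using has_bit_pair al(1) by (metis not_None_eq)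
    hence "al <: C" using C U_e al(1) by blast
    thus False using be(2) al(2) by auto
  qed
  moreover have "\<exists>c'. decides e b ta c'" if "pair b e <: U" for b e using U(2)[OF that] by auto
  moreover have "\<exists>e r. pair b e <: U & leq r q & leq r e" if "b <: B" "decides q b ta c" for b q c
    using U(3)[OF that(1), of q] that(2) decides_iff by (cases c) auto
  ultimately show ?thesis using that[OF be(1)] by meson
qed

lemma lepoll_funs_num: "lepoll (funs (num K) aleph1) aleph1"
proof -
  have "y <: Fin (cprod omega aleph1)" if "y <: funs (num K) aleph1" for y
  proof -
    have y: "fn y (num K) aleph1" using that by simp
    have "ext y <= ext (cprod (num K) aleph1)" using fn_mem_pow[OF y] by simp
    also have "... <= ext (cprod omega aleph1)" using mem_num[of _ K] by (auto simp: mem_cprod)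
    finally have "ext y <= ext (cprod omega aleph1)" .
    moreover have "ext y <= (%l. pair l (ap y l)) ` ext (num K)"
      using y func_ap[of y "num K"] unfolding fn_ap func_on_def by (fastforce simp: image_iff)
    hence "finite (ext y)" by (rule finite_subset) (simp add: ext_num)
    ultimately show ?thesis by (simp add: mem_Fin)
  qed
  hence "lepoll (funs (num K) aleph1) (Fin (cprod omega aleph1))" by (intro lepoll_subset) auto
  moreover have "lepoll (cprod omega aleph1) aleph1"
    using lepoll_prod[OF omega_lepoll_aleph1 lepoll_refl] aleph1_square lepoll_trans by blast
  ultimately show ?thesis using lepoll_Fin_mono Fin_aleph1 lepoll_trans by blast
qed

lemma uniform_decisions:
  assumes al: "al <: dl" and j: "W.fn (val tj) (emb A) (emb B)" and p0: "p0 \<in> G" and A: "\<not> lepoll A omega"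
  obtains X n M p ga where "infinite X" "X <= ext A" "\<And>x. x \<in> X ==>
      leq (p x) p0 & decides (p x) (pair x (ga x)) tj True & ga x <: B"
  "\<And>x. x \<in> X ==> card (dom (bits (p x))) <= n & (\<forall>k b. bits (p x) (al, k) = Some b --> k < M)"
proof -
  define R where "R z x <-> (\<exists>n M p y. z = pair n M & y <: B & leq p p0 & size_le dl p n &
      (\<forall>u. has_bit p al u --> (\<exists>k b. u = pair k b & k <: M)) & decides p (pair x y) tj True)" for z x
  have small: "(\<forall>u. has_bit p al u --> (\<exists>k b. u = pair k b & k <: num M)) <->
      (\<forall>k b. bits p (al, k) = Some b --> k < M)" if p: "p \<in> conds" for p M
    unfolding has_bit_cond_map[OF p al] by (metis num_mem pair_inject)
  have "\<exists>z. z <: cprod omega omega & R z x" if x: "x <: A" for x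
  proof -
    have func: "W.func_on (val tj) (emb A)" and "memW (W.ap (val tj) (emb x)) (emb B)" using j x
      unfolding W.fn_ap by simp_all
    then obtain y where y: "y <: B" "W.ap (val tj) (emb x) = emb y" using mem_emb by metis
    hence "memW (emb (pair x y)) (val tj)" unfolding emb_pair using W.func_ap[OF func, of "emb x"] x by simp
    then obtain p where p: "p \<in> G" "leq p p0" "decides p (pair x y) tj True" using decides_below[OF p0] by blast
    have p_PP: "p \<in> conds" using p(1) G_P by blast
    obtain M where "\<forall>k\<in>snd ` dom (bits p). k < M" using dom_cond_map(1)[OF p_PP] finite_nat_set_iff_bounded
      by blast
    hence "\<forall>k b. bits p (al, k) = Some b --> k < M" by force
    hence "R (pair (num (card (dom (bits p)))) (num M)) x" unfolding R_def
      using small[OF p_PP] size_le_num[OF p_PP] p y(1) by blast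
    thus ?thesis by (intro exI[of _ "pair (num (card (dom (bits p)))) (num M)"]) simp
  qed
  moreover have "dp UNIV (%e. R (e 0) (e 1))" unfolding R_def by (intro dpi)
  ultimately have "\<exists>z. z <: cprod omega omega & infinite {x. x <: A & R z x}"
    using finite_cover[of R A "cprod omega omega"] A omega_cube lepoll_trans by blast
  then obtain n M where inf: "infinite {x. x <: A & R (pair (num n) (num M)) x}" by (auto simp: mem_cprod mem_omega)
  have "\<exists>p y. leq p p0 & decides p (pair x y) tj True & y <: B & card (dom (bits p)) <= n &
      (\<forall>k b. bits p (al, k) = Some b --> k < M)"
    if Rx: "R (pair (num n) (num M)) x" for x
  proof -
    obtain p y where p: "y <: B" "leq p p0" "size_le dl p (num n)" "decides p (pair x y) tj True"
      "\<forall>u. has_bit p al u --> (\<exists>k b. u = pair k b & k <: num M)" using Rx unfolding R_def by auto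
    hence "p \<in> conds" using decides_iff by blast
    thus ?thesis using p small size_le_num by blast
  qed
  then obtain p ga where "\<And>x. R (pair (num n) (num M)) x ==>
      leq (p x) p0 & decides (p x) (pair x (ga x)) tj True & ga x <: B &
      card (dom (bits (p x))) <= n & (\<forall>k b. bits (p x) (al, k) = Some b --> k < M)" by metis
  thus ?thesis by (intro that[OF inf, of p ga n M]) auto
qed

lemma finite_first_diffs:
  assumes "finite Y"
  shows "finite (\<Union>x\<in>Y. \<Union>y\<in>Y. {k. first_diff x y k})"
proof -
  have "{k. first_diff x y k} <= {THE k. first_diff x y k}" for x y using first_diff_unique
    by (auto intro: the_equality[symmetric])
  hence "finite {k. first_diff x y k}" for x y by (rule finite_subset) simp
  thus ?thesis using assms by blast
qed

lemma ex_set_bits: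
  assumes r: "r \<in> conds" and al: "al <: dl" and D: "finite D"
  obtains q where "q \<in> conds" "bits q = (%z. if z \<in> {al} \<times> D then Some b else bits r z)"
proof -
  let ?g = "%z. if z \<in> {al} \<times> D then Some b else bits r z"
  have dom: "dom ?g <= {al} \<times> D \<union> dom (bits r)" by (auto split: if_splits)
  have "\<exists>q\<in>conds. bits q = ?g"
  proof (rule ex_cond_map)
    show "finite (dom ?g)" by (rule finite_subset[OF dom]) (use D dom_cond_map(1)[OF r] in simp)
    show "dom ?g <= ext dl \<times> UNIV" by (rule subset_trans[OF dom]) (use al dom_cond_map(2)[OF r] in auto)
  qed
  thus thesis using that by blast
qed

text \<open>Elements that agree below \<open>M\<close> have their first differences where a common extension is still undecided.\<close>

lemma compatible_tuple:
  assumes al: "al <: dl" and X: "infinite X" "X <= ext (powset omega)" and K: "0 < K"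
  and p: "\<And>x. x \<in> X ==> p x \<in> conds & card (dom (bits (p x))) <= n &
      (\<forall>k b. bits (p x) (al, k) = Some b --> k < M)"
  obtains Y q where "Y <= X" "finite Y" "card Y = K" "\<And>b x. x \<in> Y ==> leq (q b) (p x)"
  "\<And>b x y k. x \<in> Y ==> y \<in> Y ==> first_diff x y k ==> bits (q b) (al, k) = Some b"
  "\<And>b c xi k. xi \<noteq> al ==> bits (q b) (xi, k) = bits (q c) (xi, k)"
proof -
  define low where "low x = {k. k < M & num k <: x}" for x
  have "finite (low ` X)" by (rule finite_subset[of _ "Pow {..<M}"]) (auto simp: low_def)
  then obtain x0 where x0: "infinite {x \<in> X. low x = low x0}" using pigeonhole_infinite[of X low] X(1) by blast
  have "\<exists>Y\<subseteq>{x \<in> X. low x = low x0}. finite Y & card Y = Suc (K - 1) &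
      (\<forall>x\<in>Y. \<forall>y\<in>Y. agree (bits (p x)) (bits (p y)))"
    by (rule infinite_compatible[OF x0, of _ n]) (use p dom_cond_map(1) in auto)
  then obtain Y where Y: "Y <= X" "\<And>x. x \<in> Y ==> low x = low x0" "finite Y" "card Y = K"
    "\<forall>x\<in>Y. \<forall>y\<in>Y. agree (bits (p x)) (bits (p y))"
    using K by auto
  have "\<exists>r\<in>conds. (\<forall>s\<in>p ` Y. bits s \<subseteq>\<^sub>m bits r) &
      dom (bits r) = (\<Union>s\<in>p ` Y. dom (bits s))"
    by (rule ex_union) (use Y p in auto)
  then obtain r where r: "r \<in> conds" "\<And>x. x \<in> Y ==> bits (p x) \<subseteq>\<^sub>m bits r"
    "dom (bits r) = (\<Union>x\<in>Y. dom (bits (p x)))" by auto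
  define De where "De = (\<Union>x\<in>Y. \<Union>y\<in>Y. {k. first_diff x y k})"
  have "bits r (al, k) = None" if k: "k \<in> De" for k
  proof (rule ccontr)
    assume "bits r (al, k) \<noteq> None"
    then obtain x where "x \<in> Y" "(al, k) \<in> dom (bits (p x))" using r(3) by blast
    hence "k < M" using p Y(1) by blast
    moreover obtain x y where "x \<in> Y" "y \<in> Y" "first_diff x y k" using k unfolding De_def by blast
    ultimately show False using Y(2)[of x] Y(2)[of y] unfolding low_def first_diff_def by blast
  qed
  hence free: "bits r z = None" if "z \<in> {al} \<times> De" for z using that by auto
  define g where "g b = (%z. if z \<in> {al} \<times> De then Some b else bits r z)" for b
  have "\<exists>q. q \<in> conds & bits q = g b" for b
    unfolding g_def by (rule ex_set_bits[OF r(1) al finite_first_diffs[OF Y(3)], folded De_def]) blast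
  then obtain q where q: "\<And>b. q b \<in> conds" "\<And>b. bits (q b) = g b" by metis
  have r_le: "bits r \<subseteq>\<^sub>m bits (q b)" for b unfolding map_le_def q(2) g_def using free by (metis domIff)
  have "leq (q b) (p x)" if "x \<in> Y" for b x
    unfolding cond_le_iff using q(1) p Y(1) that map_le_trans[OF r(2)[OF that] r_le] by blast
  moreover have "bits (q b) (al, k) = Some b" if "x \<in> Y" "y \<in> Y" "first_diff x y k" for b x y k
    unfolding q(2) g_def De_def using that by auto
  moreover have "bits (q b) (xi, k) = bits (q c) (xi, k)" if "xi \<noteq> al" for b c xi k unfolding q(2) g_def
    using that by simp
  ultimately show ?thesis by (rule that[OF Y(1, 3, 4)])
qed

lemma separates_value:
  assumes sep: "separates j S c (emb al) indices (W.num K) (emb aleph1)"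
  and f: "inj_fn f (num K) (powset omega)" and t: "fn t (num K) aleph1"
  and tj: "\<And>x. x <: num K ==> memW (emb (pair (ap f x) (ap t x))) j"
  and bits: "\<And>x y k. x <: num K ==> y <: num K ==> first_diff (ap f x) (ap f y) k ==>
      memW (W.pair (emb al) (W.num k)) c <-> b"
  shows "memW (emb t) S <-> b"
proof -
  note f_fn = inj_fnD(2)[OF f]
  have f_W: "W.inj_fn (emb f) (W.num K) indices" using emb_inj_fn[OF f] unfolding emb_num .
  have t_W: "W.fn (emb t) (W.num K) (emb aleph1)" using emb_fn[OF t] unfolding emb_num .
  have mem_K: "\<exists>x. x <: num K & l = emb x" if "memW l (W.num K)" for l using that mem_emb[of l "num K"]
    unfolding emb_num by blast
  have "W.ap (emb t) l = W.ap j (W.ap (emb f) l)" if "memW l (W.num K)" for l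
  proof -
    obtain x where x: "x <: num K" "l = emb x" using mem_K \<open>memW l (W.num K)\<close> by blast
    have "W.func_on j indices" using sep unfolding separates_def W.fn_ap by blast
    hence "W.ap j (emb (ap f x)) = emb (ap t x)"
      using W.func_ap[of j indices "emb (ap f x)" "emb (ap t x)"] tj[OF x(1)] inj_fnD(3)[OF f x(1)]
        unfolding emb_pair by simp
    thus ?thesis unfolding x(2) using emb_ap[OF f_fn x(1)] emb_ap[of t "num K" x] t x(1) by (simp add: fn_ap)
  qed
  note S_value = sep[unfolded separates_def separated_def, THEN conjunct2, THEN spec, THEN mp, OF f_W]
  have "joined c (emb al) u v <-> b" if uv: "u \<in> W.ap (emb f) ` W.ext (W.num K)"
    "v \<in> W.ap (emb f) ` W.ext (W.num K)" "u \<noteq> v" for u v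
  proof -
    obtain l l' where "u = W.ap (emb f) l" "v = W.ap (emb f) l'" "memW l (W.num K)" "memW l' (W.num K)"
      using uv(1, 2) by auto
    then obtain x y where xy: "x <: num K" "u = emb (ap f x)" "y <: num K" "v = emb (ap f y)"
      using mem_K emb_ap[OF f_fn] by metis
    then obtain k where "first_diff (ap f x) (ap f y) k"
      using first_diff_ex[OF inj_fnD(3)[OF f] inj_fnD(3)[OF f]] uv(3) by metis
    thus ?thesis using joined_first_diff bits xy by metis
  qed
  hence "b ==> pairwise (joined c (emb al)) (W.ap (emb f) ` W.ext (W.num K))"
    "\<not> b ==> pairwise (%u v. \<not> joined c (emb al) u v) (W.ap (emb f) ` W.ext (W.num K))"
      unfolding pairwise_def by blast+
  thus ?thesis using S_value t_W \<open>\<And>l. memW l (W.num K) ==> W.ap (emb t) l = W.ap j (W.ap (emb f) l)\<close>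
    by blast
qed

lemma separates_forced:
  assumes "separates j S cohen_reals (emb al) indices (W.num K) (emb aleph1)" and S: "S = val tS"
  obtains p0 tj where "p0 \<in> G" "j = val tj" "\<And>H v. generic H v ==> p0 \<in> H ==>
  separates (v tj) (v tS) (v cohen_name) (emb al) indices (W.num K) (emb aleph1)"
proof -
  obtain tj where tj: "j = val tj" using val_surj by blast
  define e where "e = env_list [tj, tS, cohen_name, ck al, ck (powset omega), ck (num K), ck aleph1]"
  have env: "separates (v (e 0)) (v (e 1)) (v (e 2)) (v (e 3)) (v (e 4)) (v (e 5)) (v (e 6)) <->
      separates (v tj) (v tS) (v cohen_name) (emb al) indices (W.num K) (emb aleph1)" if "generic H v" for H v
    unfolding e_def by (simp add: numeral_eq_Suc val_ck[OF that] emb_num del: num.simps W.num.simps)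
  have "\<exists>p\<in>G. forced (%e. separates (e 0) (e 1) (e 2) (e 3) (e 4) (e 5) (e 6)) p e"
    by (rule forced_truth[OF dp_separates generic_self]) (use assms(1) env[OF generic_self] in
      \<open>simp add: tj S cohen_reals_def\<close>)
  thus ?thesis using that[OF _ tj] forcedD env by blast
qed

lemma ex_tuple:
  assumes Y: "finite Y" "Y <= ext A"
  obtains f where "inj_fn f (num (card Y)) A" "ap f ` ext (num (card Y)) = Y"
proof -
  obtain g where g: "bij_betw g {..<card Y} Y" using ex_bij_betw_nat_finite[OF Y(1)] by (auto simp: atLeast0LessThan)
  define f where "f = lam (num (card Y)) (%x. g (num_val x))"
  have g_Y: "g l \<in> Y" if "l < card Y" for l using g that unfolding bij_betw_def by auto
  have g_A: "g (num_val x) <: A" if "x <: num (card Y)" for x using that subsetD[OF Y(2) g_Y] by (auto simp: mem_num)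
  have fin: "finite (ext (num (card Y)))" by (simp add: ext_num)
  have f: "fn f (num (card Y)) A" unfolding f_def by (rule fn_finite(1)[OF fin g_A])
  have ap_f: "ap f (num l) = g l" if "l < card Y" for l
    unfolding f_def using fn_finite(2)[OF fin, of "%x. g (num_val x)" A "num l"] g_A that by (simp add: num_mem)
  have "inj_fn f (num (card Y)) A"
    unfolding inj_fn_def mem_num using f ap_f bij_betw_imp_inj_on[OF g] by (auto simp: inj_on_def)
  moreover have "ap f ` ext (num (card Y)) = g ` {..<card Y}" unfolding ext_num using ap_f by force
  ultimately show thesis using that bij_betw_imp_surj_on[OF g] by metis
qed

lemma decides_unique:
  assumes "decides q b ta c" "decides q b ta c'"
  shows "c = c'"
proof -
  have "q \<in> conds" using assms(1) decides_iff by blast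
  then obtain H v where "generic H v" "q \<in> H" using ex_generic_above by blast
  thus ?thesis using assms unfolding decides_iff by blast
qed

lemma undecided_tuple:
  assumes K: "0 < K" and al: "al <: dl" and S: "S = val tS"
  and sep: "separates j S cohen_reals (emb al) indices (W.num K) (emb aleph1)"
  obtains t q where "fn t (num K) aleph1" "\<And>b. decides (q b) t tS b" "\<And>b c xi k. xi \<noteq> al ==>
      bits (q b) (xi, k) = bits (q c) (xi, k)"
proof -
  obtain p0 tj where p0: "p0 \<in> G" "j = val tj" and forced_sep: "\<And>H v. generic H v ==> p0 \<in> H ==>
      separates (v tj) (v tS) (v cohen_name) (emb al) indices (W.num K) (emb aleph1)" using separates_forced[OF sep S]
        by metis
  have "W.fn (val tj) indices (emb aleph1)" using sep unfolding separates_def p0(2) by blast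
  then obtain X n M p ga where X: "infinite X" "X <= ext (powset omega)"
    and p: "\<And>x. x \<in> X ==> leq (p x) p0 & decides (p x) (pair x (ga x)) tj True & ga x <: aleph1"
    "\<And>x. x \<in> X ==> card (dom (bits (p x))) <= n & (\<forall>k b. bits (p x) (al, k) = Some b --> k < M)"
    using uniform_decisions[OF al _ p0(1) not_lepoll_powset] by metis
  have small: "p x \<in> conds & card (dom (bits (p x))) <= n & (\<forall>k b. bits (p x) (al, k) = Some b --> k < M)"
    if "x \<in> X" for x
    using p[OF that] le_in(1) by blast
  obtain Y q where Y: "Y <= X" "finite Y" "card Y = K" and q: "\<And>b x. x \<in> Y ==> leq (q b) (p x)"
    "\<And>b x y k. x \<in> Y ==> y \<in> Y ==> first_diff x y k ==> bits (q b) (al, k) = Some b"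
    "\<And>b c xi k. xi \<noteq> al ==> bits (q b) (xi, k) = bits (q c) (xi, k)"
    by (rule compatible_tuple[OF al X K small]) (assumption, rule that)
  obtain f where f: "inj_fn f (num K) (powset omega)" "ap f ` ext (num K) = Y"
    using ex_tuple[OF Y(2), of "powset omega"] Y X(2) by (metis subset_trans)
  hence f_Y: "ap f x \<in> Y" if "x <: num K" for x using that by auto
  define t where "t = lam (num K) (%x. ga (ap f x))"
  have ga: "ga (ap f x) <: aleph1" if "x <: num K" for x using p(1) f_Y[OF that] Y(1) by blast
  have t: "fn t (num K) aleph1" "\<And>x. x <: num K ==> ap t x = ga (ap f x)"
    unfolding t_def by (rule fn_finite(1)[OF _ ga], simp add: ext_num, assumption, rule fn_finite(2)[OF _ ga], simp
      add: ext_num)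
  have "decides (q b) t tS b" for b
    unfolding decides_iff
  proof (intro conjI allI impI)
    obtain x where x: "x \<in> Y" using K Y(3) by fastforce
    show "q b \<in> conds" using q(1)[OF x] le_in(1) by blast
    fix H v assume "generic H v & q b \<in> H"
    hence H: "generic H v" "q b \<in> H" by simp_all
    have p_H: "p x \<in> H" if "x \<in> Y" for x using generic_facts(2)[OF H q(1)[OF that]] .
    hence "p0 \<in> H" using generic_facts(2)[OF H(1)] p(1) x Y(1) by blast
    moreover have "memW (emb (pair (ap f x) (ap t x))) (v tj)" if "x <: num K" for x
      using p(1)[of "ap f x"] p_H H(1) f_Y[OF that] Y(1) unfolding decides_iff t(2)[OF that] by blast
    ultimately show "memW (emb t) (v tS) <-> b"
      using separates_value[OF forced_sep[OF H(1)] f(1) t(1), of b] bit_decided[OF H q(2)] f_Y by blast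
  qed
  thus ?thesis using that[of t q] t(1) q(3) by blast
qed

text \<open>A condition without information on the real \<open>al\<close> cannot decide whether the image of a tuple lies in \<open>S\<close>.\<close>

theorem separates_bounded:
  assumes K: "0 < K"
  obtains be where "be <: dl" "\<And>al j. al <: dl ==> \<not> al <: be ==>
      \<not> separates j S cohen_reals (emb al) indices (W.num K) (emb aleph1)"
proof -
  obtain tS where tS: "S = val tS" using val_surj by blast
  obtain be where be: "be <: dl" "\<And>t q c. t <: funs (num K) aleph1 ==> decides q t tS c ==>
      \<exists>e r c'. decides e t tS c' & leq r q & leq r e & (\<forall>al k. al <: dl & \<not> al <: be -->
          bits e (al, k) = None)"
    using decided_below[OF lepoll_funs_num] by metis
  have False if al: "al <: dl" "\<not> al <: be" and sep:
    "separates j S cohen_reals (emb al) indices (W.num K) (emb aleph1)" for al j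
  proof -
    obtain t q where t: "fn t (num K) aleph1" and t_decided: "\<And>b. decides (q b) t tS b"
      and q: "\<And>b c xi k. xi \<noteq> al ==> bits (q b) (xi, k) = bits (q c) (xi, k)"
        by (rule undecided_tuple[OF K al(1) tS sep that])
    obtain e r c where e: "decides e t tS c" "leq r (q True)" "leq r e" "\<And>k. bits e (al, k) = None"
      using be(2)[of t] t_decided t al by (metis mem_funs)
    hence c: c using decides_unique decides_mono t_decided by blast
    have maps: "bits (q True) \<subseteq>\<^sub>m bits r" "bits e \<subseteq>\<^sub>m bits r" using e(2, 3)
      unfolding cond_le_iff by blast+
    have "agree (bits e) (bits (q False))" unfolding agree_def
    proof (intro allI impI)
      fix z b d assume z: "bits e z = Some b" "bits (q False) z = Some d"
      hence "bits (q True) z = Some d" using e(4) q by (cases z) (metis option.distinct(1))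
      thus "b = d" using maps z(1) unfolding map_le_def by (metis domI option.inject)
    qed
    moreover have "e \<in> conds" "q False \<in> conds" using e(1) t_decided decides_iff by blast+
    ultimately obtain s where "leq s e" "leq s (q False)" using ex_common by blast
    thus False using decides_unique decides_mono t_decided e(1) c by blast
  qed
  thus ?thesis using that be(1) by blast
qed

end

section \<open>No small universal family\<close>

context zermelo
begin

definition vec_sum :: "'v => 'v => ('v => 'v) => 'v => 'v"
  where "vec_sum P z h n = nat_rec z (%l v. ap P (pair v (h l))) n"
lemma dt_vec_sum [dpi]:
  assumes "dt UNIV P" "dt UNIV z" "dt UNIV (%e. h (%n. e (Suc n)) (e 0))" "dt UNIV n"
  shows "dt UNIV (%e. vec_sum (P e) (z e) (h e) (n e))"
proof -
  have "dt UNIV (%e. h (%n. e (Suc (Suc n))) (e 0))"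
    using dt_reindex[OF assms(3), of "%n. case n of 0 => 0 | Suc k => Suc (Suc k)"] by simp
  moreover have "dt UNIV (%e. P (%n. e (Suc (Suc n))))" by (rule dt_reindex[OF assms(1)])
  ultimately show ?thesis unfolding vec_sum_def by (intro dpi assms(2, 4))
qed

lemma vec_sum_num: "vec_sum P z h (num 0) = z"
  "vec_sum P z h (num (Suc n)) = ap P (pair (vec_sum P z h (num n)) (h (num n)))"
  unfolding vec_sum_def nat_rec_num by simp_all

lemma card_tuple:
  assumes f: "inj_fn f (num n) A"
  shows "finite (ap f ` ext (num n)) & card (ap f ` ext (num n)) = n"
proof -
  have "inj_on (ap f) (ext (num n))" using inj_fnD(4)[OF f] by (auto intro: inj_onI)
  moreover have "card (ext (num n)) = n" unfolding ext_num using card_image[of num "{..<n}"] inj_num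
    by (simp add: inj_on_def)
  ultimately show ?thesis using card_image by (fastforce simp: ext_num)
qed

end

locale banach_space = zermelo mem for mem :: "'v => 'v => bool" (infix \<open><:\<close> 50) +
  fixes Y :: 'v assumes Y: "banach Y"
begin

abbreviation "A \<equiv> points Y"
abbreviation "P \<equiv> plus_of Y"
abbreviation "S \<equiv> scale_of Y"
abbreviation "V \<equiv> vec Y"
abbreviation "N \<equiv> nrm (norm_of Y)"
abbreviation "Y_sum h n \<equiv> vec_sum P \<zero>\<^bsub>V\<^esub> h (num n)"

lemma Y_pair: "Y = pair (pair A P) (pair S (norm_of Y))" using Y
  unfolding banach_def by blast
lemma Y_norm: "is_norm Y (norm_of Y)" using Y
  unfolding banach_def by blast
lemma Y_fn: "fn P (cprod A A) A" "fn S (cprod reals A) A" using Y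
  unfolding banach_def vector_space_def by blast+

sublocale M: module scalars V using Y unfolding banach_def vector_space_def by blast

lemma mem_carrier: "x \<in> carrier V <-> x <: A" by (simp add: vec_def)
lemma scalars_simps: "r \<in> carrier scalars <-> r \<in> Reals_in" "r \<oplus>\<^bsub>scalars\<^esub> s = r + s"
  "\<one>\<^bsub>scalars\<^esub> = 1" "\<zero>\<^bsub>scalars\<^esub> = 0"
  by (simp_all add: scalars_def)
lemma ap_plus: "x <: A ==> y <: A ==> ap P (pair x y) = x \<oplus>\<^bsub>V\<^esub> y"
  using ap_eq[of P "cprod A A" "pair x y"] Y_fn(1) unfolding fn_def by (simp add: vec_def)
lemma zero_unique:
  assumes z: "z <: A" "ap P (pair z z) = z"
  shows "z = \<zero>\<^bsub>V\<^esub>"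
  using z M.add.l_cancel_one[of z z] ap_plus[OF z(1, 1)] by (simp add: mem_carrier)

lemma smult_minus_one:
  assumes y: "y <: A"
  shows "(- 1) \<odot>\<^bsub>V\<^esub> y = \<ominus>\<^bsub>V\<^esub> y"
proof -
  have yV: "y \<in> carrier V" using y by (simp add: mem_carrier)
  have m1: "- 1 \<in> Reals_in" using Reals_minus[OF Reals_const(2)] by simp
  have "(- 1) \<odot>\<^bsub>V\<^esub> y \<oplus>\<^bsub>V\<^esub> 1 \<odot>\<^bsub>V\<^esub> y =
      (- 1 + 1) \<odot>\<^bsub>V\<^esub> y"
    using M.smult_l_distr[of "- 1" 1 y] yV m1 Reals_const(2) by (simp add: scalars_simps)
  hence "(- 1) \<odot>\<^bsub>V\<^esub> y \<oplus>\<^bsub>V\<^esub> y = \<zero>\<^bsub>V\<^esub>"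
    using M.smult_one[OF yV] M.smult_l_null[OF yV] by (simp add: scalars_simps)
  moreover have "(- 1) \<odot>\<^bsub>V\<^esub> y \<in> carrier V" using M.smult_closed[of "- 1" y] yV m1
    by (simp add: scalars_simps)
  ultimately show ?thesis using M.minus_equality yV by metis
qed

lemma ap_minus:
  assumes "x <: A" "y <: A"
  shows "ap P (pair x (ap S (pair (real_code (- 1)) y))) = x \<ominus>\<^bsub>V\<^esub> y"
proof -
  have "- 1 \<in> Reals_in" using Reals_minus[OF Reals_const(2)] by simp
  hence "ap S (pair (real_code (- 1)) y) = \<ominus>\<^bsub>V\<^esub> y"
    using ap_eq[of S "cprod reals A" "pair (real_code (- 1)) y"] Y_fn(2) assms(2) smult_minus_one[OF assms(2)]
      unfolding fn_def by (simp add: vec_def)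
  moreover have "\<ominus>\<^bsub>V\<^esub> y <: A" using M.a_inv_closed[of y] assms(2) by (simp add: mem_carrier)
  ultimately show ?thesis using ap_plus[OF assms(1)] by (simp add: a_minus_def)
qed

lemma minus_A: "x <: A ==> y <: A ==> x \<ominus>\<^bsub>V\<^esub> y <: A" using M.minus_closed[of x y]
  by (simp add: mem_carrier)

lemma mem_ap_norm:
  assumes "x <: A"
  shows "rat_code q <: ap (norm_of Y) x <-> of_rat q < N x"
proof -
  have "fn (norm_of Y) A reals" using Y_norm unfolding is_norm_def by blast
  hence "ap (norm_of Y) x = app (norm_of Y) x" "real_cut (app (norm_of Y) x)"
    using ap_eq[of "norm_of Y" A x] assms unfolding fn_def by (auto simp flip: mem_reals)
  thus ?thesis using rat_mem_real real_cut_val unfolding nrm_def by metis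
qed

lemma norm_triangle: "x <: A ==> y <: A ==> N (x \<oplus>\<^bsub>V\<^esub> y) <= N x + N y"
  using Y_norm unfolding is_norm_def by (simp add: mem_carrier)
lemma norm_scale: "x <: A ==> r \<in> Reals_in ==> N (r \<odot>\<^bsub>V\<^esub> x) = \<bar>r\<bar> * N x"
  using Y_norm unfolding is_norm_def by (simp add: mem_carrier)

lemma norm_diff:
  assumes "x <: A" "y <: A"
  shows "\<bar>N x - N y\<bar> <= N (x \<ominus>\<^bsub>V\<^esub> y)"
proof -
  have le: "N u <= N (u \<ominus>\<^bsub>V\<^esub> w) + N w" if "u <: A" "w <: A" for u w
  proof -
    have "(u \<ominus>\<^bsub>V\<^esub> w) \<oplus>\<^bsub>V\<^esub> w = u" using that unfolding mem_carrier[symmetric]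
      by (simp add: a_minus_def M.a_assoc M.l_neg)
    thus ?thesis using norm_triangle[OF minus_A[OF that] that(2)] by simp
  qed
  have "y \<ominus>\<^bsub>V\<^esub> x = (- 1) \<odot>\<^bsub>V\<^esub> (x \<ominus>\<^bsub>V\<^esub> y)"
    unfolding smult_minus_one[OF minus_A[OF assms]] using assms unfolding mem_carrier[symmetric]
      by (simp add: a_minus_def M.minus_add M.a_ac)
  hence "N (y \<ominus>\<^bsub>V\<^esub> x) = N (x \<ominus>\<^bsub>V\<^esub> y)"
    using norm_scale[OF minus_A[OF assms], of "- 1"] Reals_minus[OF Reals_const(2)] by simp
  thus ?thesis using le[OF assms] le[OF assms(2, 1)] by linarith
qed

lemma Y_sum_closed: "(\<And>l. l < n ==> h (num l) <: A) ==> Y_sum h n <: A"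
proof (induction n)
  case 0 thus ?case unfolding vec_sum_num by (simp flip: mem_carrier)
next
  case (Suc n) thus ?case unfolding vec_sum_num using M.a_closed by (simp add: ap_plus flip: mem_carrier)
qed

lemma norm_Y_sum_diff:
  assumes "\<And>l. l < n ==> h (num l) <: A & h' (num l) <: A & N (h (num l) \<ominus>\<^bsub>V\<^esub> h' (num l)) <=
      d"
  shows "N (Y_sum h n \<ominus>\<^bsub>V\<^esub> Y_sum h' n) <= real n * d"
  using assms
proof (induction n)
  case 0
  have "\<zero>\<^bsub>V\<^esub> \<ominus>\<^bsub>V\<^esub> \<zero>\<^bsub>V\<^esub> =
      0 \<odot>\<^bsub>V\<^esub> \<zero>\<^bsub>V\<^esub>" using M.smult_l_null[of "\<zero>\<^bsub>V\<^esub>"]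
    by (simp add: a_minus_def scalars_simps)
  thus ?case unfolding vec_sum_num using norm_scale[of "\<zero>\<^bsub>V\<^esub>" 0] Reals_const(1)
    by (simp flip: mem_carrier)
next
  case (Suc n)
  let ?a = "Y_sum h n" and ?a' = "Y_sum h' n" and ?b = "h (num n)" and ?b' = "h' (num n)"
  have A: "?a <: A" "?a' <: A" "?b <: A" "?b' <: A" using Suc.prems Y_sum_closed[of n] by simp_all
  have "(?a \<oplus>\<^bsub>V\<^esub> ?b) \<ominus>\<^bsub>V\<^esub> (?a' \<oplus>\<^bsub>V\<^esub> ?b') =
      (?a \<ominus>\<^bsub>V\<^esub> ?a') \<oplus>\<^bsub>V\<^esub> (?b \<ominus>\<^bsub>V\<^esub> ?b')"
    using A unfolding mem_carrier[symmetric] by (simp add: a_minus_def M.minus_add M.a_ac)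
  hence "N ((?a \<oplus>\<^bsub>V\<^esub> ?b) \<ominus>\<^bsub>V\<^esub> (?a' \<oplus>\<^bsub>V\<^esub> ?b')) <=
      N (?a \<ominus>\<^bsub>V\<^esub> ?a') + N (?b \<ominus>\<^bsub>V\<^esub> ?b')"
    using norm_triangle[OF minus_A[OF A(1, 2)] minus_A[OF A(3, 4)]] by simp
  also have "... <= real n * d + d" using Suc by (intro add_mono) simp_all
  finally show ?case unfolding vec_sum_num using ap_plus A by (simp add: algebra_simps)
qed

lemma ex_approximation:
  assumes l: "ordinal l" and u: "fn u l A" "\<And>x e. x <: A ==> 0 < e ==> \<exists>b. b <: l &
      N (x \<ominus>\<^bsub>V\<^esub> ap u b) < e"
  and j: "fn j I A" and e: "0 < e"
  obtains j' where "fn j' I l" "\<And>i. i <: I ==> N (ap j i \<ominus>\<^bsub>V\<^esub> ap u (ap j' i)) <= of_rat e"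
proof -
  let ?near = "%i b. b <: l &
      \<not> rat_code e <: ap (norm_of Y) (ap P (pair (ap j i) (ap S (pair (real_code (- 1)) (ap u b)))))"
  have A: "i <: I ==> ap j i <: A" "b <: l ==> ap u b <: A" for i b using j u(1) unfolding fn_ap by blast+
  have near: "?near i b <-> b <: l & N (ap j i \<ominus>\<^bsub>V\<^esub> ap u b) <= of_rat e" if "i <: I" for i b
    using A that by (auto simp: ap_minus mem_ap_norm minus_A)
  have "0 < (of_rat e :: real)" using e by simp
  hence "\<exists>b. b <: l & ?near i b" if "i <: I" for i
    unfolding near[OF that] using u(2)[OF A(1)[OF that]] by (meson less_imp_le)
  then obtain j' where "fn j' I l" "\<And>i. i <: I ==> ?near i (ap j' i)"
    by (rule_tac fn_least[of ?near l I, OF _ l]) (intro dpi, blast+)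
  thus thesis using that near by blast
qed

definition level_set :: "'v => 'v => nat => rat => 'v" where
  "level_set u l n q = coll {t. t <: funs (num n) l & rat_code q <: ap (norm_of Y) (Y_sum (%x. ap u (ap t x)) n)}"
lemma mem_level_set:
  assumes u: "fn u l A"
  shows "t <: level_set u l n q <-> fn t (num n) l & of_rat q < N (Y_sum (%x. ap u (ap t x)) n)"
proof -
  have "Y_sum (%x. ap u (ap t x)) n <: A" if "fn t (num n) l" using that u
    unfolding fn_ap by (intro Y_sum_closed) (simp add: num_mem)
  moreover have "is_set {t. t <: funs (num n) l & rat_code q <: ap (norm_of Y) (Y_sum (%x. ap u (ap t x)) n)}"
    by (rule sep) (intro dpi)
  ultimately show ?thesis unfolding level_set_def by (auto simp: mem_coll mem_ap_norm)
qed

lemma dense_enumeration: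
  assumes "has_density Y k"
  obtains u where "fn u k A" "\<And>x e. x <: A ==> 0 < e ==> \<exists>b. b <: k &
      N (x \<ominus>\<^bsub>V\<^esub> ap u b) < e"
proof -
  obtain d where d: "dense_in Y d" "equinum d k" using assms unfolding has_density_def by blast
  obtain F where F: "inj_fn F d k" "\<And>b. b <: k ==> \<exists>x. x <: d & ap F x = b" using equinumE[OF d(2)]
    by metis
  obtain u where u: "fn u k d" "\<And>b. b <: k ==> ap u b <: d & ap F (ap u b) = b"
    by (rule fn_rel[of "%b x. x <: d & ap F x = b" k d]) (intro dpi, use F(2) inj_fnD(4)[OF F(1)] that in auto)
  have dA: "x <: A" if "x <: d" for x using d(1) that unfolding dense_in_def by (auto simp flip: mem_carrier)
  have "\<exists>b. b <: k & N (x \<ominus>\<^bsub>V\<^esub> ap u b) < e" if x: "x <: A" "0 < e" for x e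
  proof -
    obtain y where y: "y <: d" "N (x \<ominus>\<^bsub>V\<^esub> y) < e" using d(1) x mem_carrier mem_ext
      unfolding dense_in_def by metis
    hence "ap u (ap F y) = y" using u(2) inj_fnD(3, 4)[OF F(1)] by metis
    thus ?thesis using y inj_fnD(3)[OF F(1)] by metis
  qed
  moreover have "fn u k A" using u dA unfolding fn_ap by blast
  ultimately show thesis using that by blast
qed

end

lemma ex_gap:
  assumes c: "0 < (c::real)"
  obtains K :: nat and r r' :: rat where "0 < K" "r' < r" "of_rat r < 1 / c * sqrt (real K)"
    "c * sqrt (sqrt (real K)) < of_rat r'"
proof -
  obtain C :: nat where C: "c\<^sup>2 < real C" using reals_Archimedean2 by blast
  hence C0: "0 < C" using zero_le_power2[of c] by (metis of_nat_0_less_iff order.strict_trans1)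
  have roots: "sqrt (real (C ^ 4)) = (real C)\<^sup>2" "sqrt ((real C)\<^sup>2) = real C"
    by (simp_all add: real_sqrt_unique flip: power_mult)
  have "c * (c * real C) < real C * real C" using C C0 by (simp add: power2_eq_square mult.assoc[symmetric])
  hence "c * real C < 1 / c * (real C)\<^sup>2" using c by (simp add: field_simps power2_eq_square)
  then obtain r r' where "c * real C < of_rat r'" "of_rat r' < (of_rat r :: real)" "of_rat r < 1 / c * (real C)\<^sup>2"
    using of_rat_dense by metis
  thus thesis using that[of "C ^ 4" r' r] C0 unfolding roots by (simp add: of_rat_less)
qed

context cohen_model
begin

definition represents :: "'w => 'w => bool" where
  "represents p a <-> (\<exists>A P S N k q q' z j. p =
      W.pair (W.pair (W.pair A P) (W.pair S N)) (W.pair k (W.pair q q')) &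
  k \<noteq> W.empty & W.rat_less q' q & memW z A & W.ap P (W.pair z z) = z & W.fn j indices A &
      separated cohen_reals a indices k
  (%f. memW q (W.ap N (W.vec_sum P z (%l. W.ap j (W.ap f l)) k)))
      (%f. \<not> memW q' (W.ap N (W.vec_sum P z (%l. W.ap j (W.ap f l)) k))))"
lemma dp_represents: "W.dp UNIV (%e. represents (e 0) (e 1))"
  unfolding represents_def separated_def pairwise_image by (unfold pairwise_def Ball_def W.mem_ext, intro dpi dp_joined)

lemma separated_cong: "(\<And>f. W.inj_fn f k I ==> Q f = R f) ==> (\<And>f. W.inj_fn f k I ==> Q' f = R' f) ==>
  separated c a I k Q Q' = separated c a I k R R'"
  unfolding separated_def by auto

lemma separated_mono: "separated c a I k Q Q' ==> (\<And>f. W.inj_fn f k I ==> Q f ==> R f) ==>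
    (\<And>f. W.inj_fn f k I ==> Q' f ==> R' f) ==>
  separated c a I k R R'"
  unfolding separated_def by blast

context
  fixes Y :: 'w assumes Y: "W.banach Y"
begin

interpretation y: banach_space memW Y by unfold_locales (rule Y)

abbreviation "image_norm j f K \<equiv> y.N (y.Y_sum (%l. W.ap j (W.ap f l)) K)"

lemma represents_iff: "represents (W.pair Y (W.pair (W.num K) (W.pair (W.rat_code r) (W.rat_code r')))) a <->
    0 < K & r' < r &
  (\<exists>j. W.fn j indices y.A & separated cohen_reals a indices (W.num K) (%f. of_rat r < image_norm j f K)
  (%f. \<not> of_rat r' < image_norm j f K))"
proof -
  have closed: "memW (y.Y_sum (%l. W.ap j (W.ap f l)) K) y.A" if "W.fn j indices y.A" "W.inj_fn f (W.num K) indices"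
    for j f
    by (rule y.Y_sum_closed) (use that(1) W.inj_fnD(3)[OF that(2)] in \<open>simp add: W.fn_ap W.num_mem\<close>)
  have zero: "memW z y.A & W.ap y.P (W.pair z z) = z <-> z = \<zero>\<^bsub>y.V\<^esub>" for z
    using y.zero_unique y.ap_plus[of "\<zero>\<^bsub>y.V\<^esub>" "\<zero>\<^bsub>y.V\<^esub>"]
      by (auto simp flip: y.mem_carrier)
  have K: "W.num K \<noteq> W.empty <-> 0 < K" by (cases K) simp_all
  have parts: "Y = W.pair (W.pair A P) (W.pair S N) <-> A = y.A & P = y.P & S = y.S & N = W.norm_of Y" for A P S N
    using y.Y_pair by (metis W.pair_inject)
  have "represents (W.pair Y (W.pair (W.num K) (W.pair (W.rat_code r) (W.rat_code r')))) a <->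
      W.num K \<noteq> W.empty & W.rat_less (W.rat_code r') (W.rat_code r) &
          (\<exists>z j. (memW z y.A & W.ap y.P (W.pair z z) = z) & W.fn j indices y.A &
      separated cohen_reals a indices (W.num K)
          (%f. memW (W.rat_code r) (W.ap (W.norm_of Y) (W.vec_sum y.P z (%l. W.ap j (W.ap f l)) (W.num K))))
      (%f. \<not> memW (W.rat_code r') (W.ap (W.norm_of Y) (W.vec_sum y.P z (%l. W.ap j (W.ap f l)) (W.num K)))))"
    unfolding represents_def W.pair_inject parts by blast
  also have "... <-> 0 < K & r' < r & (\<exists>j. W.fn j indices y.A &
      separated cohen_reals a indices (W.num K)
          (%f. memW (W.rat_code r) (W.ap (W.norm_of Y) (y.Y_sum (%l. W.ap j (W.ap f l)) K)))
      (%f. \<not> memW (W.rat_code r') (W.ap (W.norm_of Y) (y.Y_sum (%l. W.ap j (W.ap f l)) K))))"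
    unfolding zero K W.rat_less_iff by blast
  also have "... <-> 0 < K & r' < r & (\<exists>j. W.fn j indices y.A & separated cohen_reals a indices (W.num K)
      (%f. of_rat r < image_norm j f K) (%f. \<not> of_rat r' < image_norm j f K))"
    by (intro conj_cong refl ex_cong1 separated_cong arg_cong[where f = Not] y.mem_ap_norm closed)
  finally show ?thesis .
qed

lemma linear_unit_sum:
  assumes T: "W.fn T (B.bounded_fns a) y.A"
  and add: "\<forall>x\<in>carrier (W.vec (B.space a)). \<forall>y\<in>carrier (W.vec (B.space a)).
  W.app T (x \<oplus>\<^bsub>W.vec (B.space a)\<^esub> y) = W.app T x \<oplus>\<^bsub>y.V\<^esub> W.app T y"
  and h: "\<And>l. l < n ==> h (W.num l) = W.app T (B.unit_vec (g l))" and g: "g ` {..<n} <= W.ext indices"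
    "inj_on g {..<n}"
  shows "y.Y_sum h n = W.app T (B.unit_sum g n)"
  using h g
proof (induction n)
  case 0
  have T_A: "W.app T B.vec_zero \<in> carrier y.V" using T B.vec_zero(1) unfolding W.fn_def y.mem_carrier by blast
  have zero: "B.vec_zero \<in> carrier (W.vec (B.space a))" by (simp add: B.space_vec B.vec_zero(1))
  have "B.vec_zero \<oplus>\<^bsub>W.vec (B.space a)\<^esub> B.vec_zero = B.vec_zero"
    using abelian_monoid.l_zero[OF abelian_group.axioms(1)[OF B.space_abelian] zero] by (simp add: B.space_vec(4))
  hence "W.app T B.vec_zero \<oplus>\<^bsub>y.V\<^esub> W.app T B.vec_zero = W.app T B.vec_zero" using add zero by metis
  hence "W.app T B.vec_zero = \<zero>\<^bsub>y.V\<^esub>" using y.M.add.l_cancel_one[OF T_A T_A] by simp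
  thus ?case by (simp add: W.vec_sum_num del: W.num.simps)
next
  case (Suc n)
  have n: "g ` {..<n} <= W.ext indices" "inj_on g {..<n}" "memW (g n) indices"
    using Suc.prems(2, 3) by (auto simp: lessThan_Suc)
  have sum: "memW (B.unit_sum g n) (B.bounded_fns a)" "memW (B.unit_vec (g n)) (B.bounded_fns a)"
    using B.unit_sum[OF n(1, 2)] B.unit_vec(1)[OF n(3)] by blast+
  have "W.app T (B.unit_sum g (Suc n)) =
      W.app T (B.unit_sum g n) \<oplus>\<^bsub>y.V\<^esub> W.app T (B.unit_vec (g n))"
    using add sum by (simp add: B.space_vec)
  moreover have "y.Y_sum h n = W.app T (B.unit_sum g n)" using Suc.IH Suc.prems(1) n by simp
  ultimately show ?case using Suc.prems(1)[of n] T sum y.ap_plus unfolding W.vec_sum_num W.fn_def by simp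
qed

lemma embedding_norms:
  assumes T: "W.fn T (B.bounded_fns a) y.A"
  and add: "\<forall>x\<in>carrier (W.vec (B.space a)). \<forall>y\<in>carrier (W.vec (B.space a)).
  W.app T (x \<oplus>\<^bsub>W.vec (B.space a)\<^esub> y) = W.app T x \<oplus>\<^bsub>y.V\<^esub> W.app T y"
  and c: "\<forall>x\<in>carrier (W.vec (B.space a)). 1 / c * W.nrm (B.norm_fn a) x <= y.N (W.app T x) &
      y.N (W.app T x) <= c * W.nrm (B.norm_fn a) x"
  and j: "\<And>i. memW i indices ==> W.ap j i = W.app T (B.unit_vec i)" and f: "W.inj_fn f (W.num K) indices"
  shows "1 / c * fin_norm (joined cohen_reals a) (W.ap f ` W.ext (W.num K)) (%i. 1) <= image_norm j f K &
  image_norm j f K <= c * fin_norm (joined cohen_reals a) (W.ap f ` W.ext (W.num K)) (%i. 1)"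
proof -
  define g where "g l = W.ap f (W.num l)" for l
  have image: "W.ap f ` W.ext (W.num K) = g ` {..<K}" unfolding g_def W.ext_num by (simp add: image_image)
  have g_II: "memW (g l) indices" if "l < K" for l using W.inj_fnD(3)[OF f] that
    unfolding g_def by (simp add: W.num_mem)
  hence g: "g ` {..<K} <= W.ext indices" by auto
  have g_inj: "inj_on g {..<K}" unfolding inj_on_def g_def using W.inj_fnD(4)[OF f]
    by (metis W.num_inj W.num_mem lessThan_iff)
  have sum: "y.Y_sum (%l. W.ap j (W.ap f l)) K = W.app T (B.unit_sum g K)"
    by (rule linear_unit_sum[OF T add _ g g_inj]) (use j g_II in \<open>simp add: g_def\<close>)
  have "memW (B.unit_sum g K) (B.bounded_fns a)" using B.unit_sum[OF g g_inj] by blast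
  hence "1 / c * B.gnorm a (B.unit_sum g K) <= y.N (W.app T (B.unit_sum g K)) &
      y.N (W.app T (B.unit_sum g K)) <= c * B.gnorm a (B.unit_sum g K)"
    using c B.norm_fn(2) by (simp add: B.space_vec(1))
  thus ?thesis unfolding sum image B.gnorm_unit_sum[OF g g_inj] .
qed

lemma embeds_represents:
  assumes "W.embeds (B.space a) Y"
  obtains K r r' where "represents (W.pair Y (W.pair (W.num K) (W.pair (W.rat_code r) (W.rat_code r')))) a"
proof -
  let ?X = "W.vec (B.space a)"
  obtain T c where T: "W.fn T (B.bounded_fns a) y.A"
    and add: "\<forall>x\<in>carrier ?X. \<forall>y\<in>carrier ?X. W.app T (x \<oplus>\<^bsub>?X\<^esub> y) =
        W.app T x \<oplus>\<^bsub>y.V\<^esub> W.app T y"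
    and c: "0 < c" "\<forall>x\<in>carrier ?X. 1 / c * W.nrm (B.norm_fn a) x <= y.N (W.app T x) &
        y.N (W.app T x) <= c * W.nrm (B.norm_fn a) x"
    using assms unfolding W.embeds_def B.space_parts by blast
  obtain K r r' where K: "0 < K" "r' < r" "of_rat r < 1 / c * sqrt (real K)" "c * sqrt (sqrt (real K)) < of_rat r'"
    using ex_gap[OF c(1)] by metis
  define j where "j = W.lam indices (%i. W.ap T (B.unit_vec i))"
  have apT: "W.ap T x = W.app T x" "memW (W.app T x) y.A" if "memW x (B.bounded_fns a)" for x
    using T that W.ap_eq unfolding W.fn_def by blast+
  have dt: "W.dt UNIV (%e. W.ap T (B.unit_vec (e 0)))" by (intro dpi B.dt_unit_vec)
  have T_A: "memW (W.ap T (B.unit_vec i)) y.A" if "memW i indices" for i using apT[OF B.unit_vec(1)[OF that]] by simp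
  have j: "W.fn j indices y.A" "\<And>i. memW i indices ==> W.ap j i = W.app T (B.unit_vec i)"
    unfolding j_def using W.fn_lam[OF dt T_A] W.lam_fn(2)[OF dt T_A] apT(1)[OF B.unit_vec(1)] by simp_all
  have "separated cohen_reals a indices (W.num K) (%f. of_rat r < image_norm j f K)
      (%f. \<not> of_rat r' < image_norm j f K)"
    unfolding separated_def
  proof (intro allI impI conjI)
    fix f assume f: "W.inj_fn f (W.num K) indices"
    let ?F = "W.ap f ` W.ext (W.num K)" and ?sum = "image_norm j f K"
    let ?n = "fin_norm (joined cohen_reals a) ?F (%i. 1)"
    have n: "1 / c * ?n <= ?sum" "?sum <= c * ?n" using embedding_norms[OF T add c(2) j(2) f] by blast+
    have F: "finite ?F" "card ?F = K" using W.card_tuple[OF f] by blast+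
    show "of_rat r < ?sum" if "pairwise (joined cohen_reals a) ?F"
    proof -
      have "1 / c * sqrt (real K) <= 1 / c * ?n" using fin_norm_clique[OF F(1) that] F(2) c(1)
        by (intro mult_left_mono) simp_all
      thus ?thesis using K(3) n(1) by linarith
    qed
    show "\<not> of_rat r' < ?sum" if "pairwise (%x y. \<not> joined cohen_reals a x y) ?F"
    proof -
      have "c * ?n <= c * sqrt (sqrt (real K))" using fin_norm_anticlique[OF F(1) that] F(2) c(1)
        by (intro mult_left_mono) simp_all
      thus ?thesis using K(4) n(2) by linarith
    qed
  qed
  thus thesis using that represents_iff K(1, 2) j(1) by blast
qed

lemma separates_level_set:
  assumes u: "W.fn u (emb aleph1) y.A"
  "\<And>x e. memW x y.A ==> 0 < e ==> \<exists>b. memW b (emb aleph1) &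
      y.N (x \<ominus>\<^bsub>y.V\<^esub> W.ap u b) < e"
  and rep: "represents (W.pair Y (W.pair (W.num K) (W.pair (W.rat_code r) (W.rat_code r')))) a"
  shows "\<exists>j. separates j (y.level_set u (emb aleph1) K ((r + r') / 2)) cohen_reals a indices (W.num K)
      (emb aleph1)"
proof -
  have K: "0 < K" "r' < r" using rep represents_iff by blast+
  obtain j where j: "W.fn j indices y.A" and sep: "separated cohen_reals a indices (W.num K)
      (%f. of_rat r < image_norm j f K) (%f. \<not> of_rat r' < image_norm j f K)"
    using rep represents_iff by blast
  let ?j_norm = "%f. image_norm j f K" and ?u_norm = "%t. y.N (y.Y_sum (%l. W.ap u (W.ap t l)) K)"
  let ?S = "y.level_set u (emb aleph1) K ((r + r') / 2)"
  define e where "e = (r - r') / (4 * of_nat K)"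
  have "0 < e" unfolding e_def using K by simp
  then obtain j' where j': "W.fn j' indices (emb aleph1)" "\<And>i. memW i indices ==>
      y.N (W.ap j i \<ominus>\<^bsub>y.V\<^esub> W.ap u (W.ap j' i)) <= of_rat e"
    using y.ex_approximation[OF emb_ordinal[OF ordinal_aleph1] u j] by metis
  have e: "4 * (real K * of_rat e) = of_rat r - of_rat r'"
    unfolding e_def using K(1) by (simp add: of_rat_divide of_rat_diff of_rat_mult)
  have mid: "of_rat ((r + r') / 2) = (of_rat r + of_rat r') / (2::real)" by (simp add: of_rat_divide of_rat_add)
  have less: "of_rat r' < (of_rat r :: real)" using K(2) by (simp add: of_rat_less)
  have close: "\<bar>?j_norm f - ?u_norm t\<bar> <= real K * of_rat e"
    if f: "W.inj_fn f (W.num K) indices" and t: "W.fn t (W.num K) (emb aleph1) & (\<forall>l. memW l (W.num K) -->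
        W.ap t l = W.ap j' (W.ap f l))" for f t
  proof -
    have terms: "memW (W.ap j (W.ap f (W.num l))) y.A & memW (W.ap u (W.ap t (W.num l))) y.A &
        y.N (W.ap j (W.ap f (W.num l)) \<ominus>\<^bsub>y.V\<^esub> W.ap u (W.ap t (W.num l))) <= of_rat e" if "l < K"
          for l
      using that W.inj_fnD(3)[OF f] conjunct1[OF t] conjunct2[OF t] j u(1) j'(2)
        unfolding W.fn_ap by (simp add: W.num_mem)
    have "memW (y.Y_sum (%l. W.ap j (W.ap f l)) K) y.A" "memW (y.Y_sum (%l. W.ap u (W.ap t l)) K) y.A"
      using terms by (simp_all add: y.Y_sum_closed)
    from y.norm_diff[OF this] show ?thesis
      using y.norm_Y_sum_diff[of K "%l. W.ap j (W.ap f l)" "%l. W.ap u (W.ap t l)", OF terms] by linarith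
  qed
  have level: "of_rat r < ?j_norm f ==> memW t ?S"
    "\<not> of_rat r' < ?j_norm f ==> \<not> memW t ?S"
    if "W.inj_fn f (W.num K) indices" "W.fn t (W.num K) (emb aleph1) & (\<forall>l. memW l (W.num K) -->
        W.ap t l = W.ap j' (W.ap f l))" for f t
    unfolding y.mem_level_set[OF u(1)] mid using close[OF that] that(2) e less by (simp_all add: abs_le_iff)
  have "separates j' ?S cohen_reals a indices (W.num K) (emb aleph1)"
    unfolding separates_def
    by (rule conjI, rule j'(1), rule separated_mono[OF sep]) ((intro allI impI, rule level, assumption+)+)
  thus ?thesis by blast
qed

end

theorem no_universal:
  assumes H: "W.lepoll H (emb aleph1)" "\<And>Y. memW Y H ==> W.banach Y & W.has_density Y W.aleph1"
  and universal: "\<And>al. al <: dl ==> \<exists>Y. memW Y H & W.embeds (B.space (emb al)) Y"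
  shows False
proof -
  let ?L = "W.cprod H (W.cprod W.omega (W.cprod W.Rat W.Rat))"
  have "W.lepoll (W.cprod W.Rat W.Rat) W.omega"
    by (rule W.lepoll_trans[OF W.lepoll_prod[OF W.lepoll_Rat W.lepoll_Rat] W.lepoll_omega_square])
  hence "W.lepoll (W.cprod W.omega (W.cprod W.Rat W.Rat)) W.omega"
    by (rule W.lepoll_trans[OF W.lepoll_prod[OF W.lepoll_refl] W.lepoll_omega_square])
  hence "W.lepoll ?L (emb (cprod aleph1 omega))" unfolding emb_omega[symmetric] emb_cprod[symmetric]
    by (rule W.lepoll_prod[OF H(1)])
  hence L: "W.lepoll ?L (emb aleph1)" using emb_lepoll[OF aleph1_omega] W.lepoll_trans by blast
  have "\<exists>p. memW p ?L & represents p (emb al)" if al: "al <: dl" for al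
  proof -
    obtain Y where Y: "memW Y H" "W.banach Y" "W.embeds (B.space (emb al)) Y" using universal[OF al] H(2) by blast
    obtain K r r' where "represents (W.pair Y (W.pair (W.num K) (W.pair (W.rat_code r) (W.rat_code r')))) (emb al)"
      by (rule embeds_represents[OF Y(2, 3)])
    thus ?thesis using Y(1) W.mem_Rat W.num_omega by (metis W.pair_mem_cprod)
  qed
  then obtain p where p: "memW p ?L" "\<forall>be. be <: dl -->
      (\<exists>al. al <: dl & \<not> al <: be & represents p (emb al))"
    using unbounded_fiber[OF dp_represents L] by blast
  then obtain Y K r r' where Y: "memW Y H" and p_eq:
    "p = W.pair Y (W.pair (W.num K) (W.pair (W.rat_code r) (W.rat_code r')))"
    by (auto simp: W.mem_cprod W.mem_omega W.mem_Rat)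
  have banach: "W.banach Y" and density: "W.has_density Y (emb aleph1)" using H(2)[OF Y] aleph1_W by simp_all
  interpret y: banach_space memW Y by unfold_locales (rule banach)
  obtain u where u: "W.fn u (emb aleph1) y.A"
    "\<And>x e. memW x y.A ==> 0 < e ==> \<exists>b. memW b (emb aleph1) &
        y.N (x \<ominus>\<^bsub>y.V\<^esub> W.ap u b) < e"
    using y.dense_enumeration[OF density] by metis
  have "0 < K" using p(2) num_dl[of 0] represents_iff[OF banach] unfolding p_eq by blast
  then obtain be where be: "be <: dl" "\<And>al j. al <: dl ==> \<not> al <: be ==>
      \<not> separates j (y.level_set u (emb aleph1) K ((r + r') / 2)) cohen_reals (emb al) indices (W.num K)
          (emb aleph1)"
    using separates_bounded by metis
  obtain al where "al <: dl" "\<not> al <: be" "represents p (emb al)" using p(2) be(1) by blast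
  thus False using separates_level_set[OF banach u] be(2) unfolding p_eq by blast
qed

theorem no_small_universal_family:
  assumes "memW k W.aleph2" "W.equinum H k" "\<And>Y. memW Y H ==> W.banach Y & W.has_density Y W.aleph1"
  shows "\<exists>X. memW X Fam & \<not> (\<exists>Y. memW Y H & W.embeds X Y)"
proof -
  obtain ka where ka: "k = emb ka" "ka <: dl" using assms(1) unfolding aleph2_W mem_emb by blast
  have "W.lepoll H (emb aleph1)"
    using W.equinum_lepoll[OF assms(2)] emb_lepoll[OF dl_props(3)[OF ka(2)]] W.lepoll_trans unfolding ka(1) by blast
  thus ?thesis using no_universal assms(3) mem_Fam by metis
qed

end

theorem cohen_modelI:
  assumes "wfp mem" "set_struct.ZFC mem" "set_struct.GCH mem" "dl = set_struct.aleph2 mem"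
  "set_struct.fs_cohen_iteration mem dl P leP" "set_struct.generic_filter mem (P dl) (leP dl) G"
    "generic_extension mem G memW val"
  shows "cohen_model mem dl G memW val"
proof -
  interpret zfc mem by (rule zfcI[OF assms(1, 2)])
  have "ordinal aleph1" using csucc_props(1)[OF ordinal_omega] unfolding aleph1_def cardinal_def by blast
  hence "ordinal dl" using csucc_props(1) unfolding assms(4) aleph2_def cardinal_def by blast
  hence "P dl = Cond dl" "leP dl = cond_le dl" using iteration_eq[OF assms(5)] by simp_all
  thus ?thesis using assms(3, 4, 6, 7) by unfold_locales simp_all
qed

theorem theorem3p1:
  fixes memV :: "'v \<Rightarrow> 'v \<Rightarrow> bool"
    and P :: "'v \<Rightarrow> 'v set"
    and leP :: "'v \<Rightarrow> 'v \<Rightarrow> 'v \<Rightarrow> bool"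
    and G :: "'v set"
    and memW :: "'w \<Rightarrow> 'w \<Rightarrow> bool"
    and val :: "'v \<Rightarrow> 'w"
    and \<omega>\<^sub>2 :: 'v
  assumes "wfp memV"
    and "set_struct.ZFC memV"
    and "set_struct.GCH memV"
    and "\<omega>\<^sub>2 = set_struct.aleph2 memV"
    and "set_struct.fs_cohen_iteration memV \<omega>\<^sub>2 P leP"
    and "set_struct.generic_filter memV (P \<omega>\<^sub>2) (leP \<omega>\<^sub>2) G"
    and "generic_extension memV G memW val"
  shows "set_struct.equinum memW (set_struct.powset memW (set_struct.omega memW)) (set_struct.aleph2 memW) \<and>
    (\<exists>F. set_struct.equinum memW F (set_struct.aleph2 memW) \<and>
      (\<forall>X. memW X F \<longrightarrow> set_struct.banach memW X \<and> set_struct.UG memW X \<and>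
         set_struct.has_density memW X (set_struct.aleph1 memW)) \<and>
      \<not> (\<exists>H k. memW k (set_struct.aleph2 memW) \<and> set_struct.equinum memW H k \<and>
           (\<forall>Y. memW Y H \<longrightarrow> set_struct.banach memW Y \<and>
              set_struct.has_density memW Y (set_struct.aleph1 memW)) \<and>
           (\<forall>X. memW X F \<longrightarrow> (\<exists>Y. memW Y H \<and> set_struct.embeds memW X Y))))"
proof -
  interpret cohen_model memV "\<omega>\<^sub>2" G memW val by (rule cohen_modelI[OF assms])
  have "W.banach X & W.UG X & W.has_density X W.aleph1" if "memW X Fam" for X
    using that B.space_banach B.space_UG space_density unfolding mem_Fam by blast
  moreover have "\<not> (\<exists>H k. memW k W.aleph2 & W.equinum H k & (\<forall>Y. memW Y H -->
      W.banach Y & W.has_density Y W.aleph1) &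
      (\<forall>X. memW X Fam --> (\<exists>Y. memW Y H & W.embeds X Y)))"
    using no_small_universal_family by blast
  ultimately show ?thesis using continuum equinum_Fam by blast
qed

end
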